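(* Suppose that integers $m,n>6$ satisfy $m=n+p(n-4)+q(n-2)$ for some integers $p\ge1$, $q\ge0$. Let $G$ and $H$ be graph products of finite or cyclic groups with underlying graphs $C_m$ and $C_n$, respectively. If every vertex group of $G$ has smaller cardinality than every vertex group of $H$, then there is a quasiisometric embedding $G\to H$.
   Context: $C_k$ denotes the cycle graph with $k$ vertices. Given a simplicial graph $\Gamma$ and a group $G_v$ for each vertex $v$, the graph product with underlying graph $\Gamma$ and vertex groups $G_v$ is the quotient of the free product $\ast_v G_v$ by the relations $[g,h]=1$ for all $g\in G_v$, $h\in G_w$ whenever $vw$ is an edge of $\Gamma$. "Finite or cyclic" means that each vertex group is either finite or (possibly infinite) cyclic. Finitely generated groups are equipped with word metrics with respect to finite generating sets. A map $F:X\to Y$ of metric spaces is a quasiisometric embedding if there are constants $K\ge1$, $A\ge0$ with $\frac1K d(x,x')-A\le d(F(x),F(x'))\le K d(x,x')+A$ for all $x,x'\in X$ ($F$ need not be a homomorphism). *)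

theory Defs
  imports
    "HOL-Algebra.Elementary_Groups"
    "HOL-Algebra.Generated_Groups"
    "HOL-Analysis.Abstract_Metric_Spaces"
    "HOL-Library.Equipollence"
begin

subsection \<open>Free products\<close>

definition letters :: "'v set \<Rightarrow> ('v \<Rightarrow> ('a, 'b) monoid_scheme) \<Rightarrow> ('v \<times> 'a) set" where
  "letters V A = (SIGMA v:V. carrier (A v))"

text \<open>The congruence on words of letters that drops identity letters and multiplies adjacent
  letters of the same factor; its classes are the elements of the free product.\<close>

inductive free_prod_eq ::
  "'v set \<Rightarrow> ('v \<Rightarrow> ('a, 'b) monoid_scheme) \<Rightarrow> ('v \<times> 'a) list \<Rightarrow> ('v \<times> 'a) list \<Rightarrow> bool"
  for V A where
  refl: "ws \<in> lists (letters V A) \<Longrightarrow> free_prod_eq V A ws ws"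
| sym: "free_prod_eq V A ws ws' \<Longrightarrow> free_prod_eq V A ws' ws"
| trans: "free_prod_eq V A ws ws' \<Longrightarrow> free_prod_eq V A ws' ws'' \<Longrightarrow> free_prod_eq V A ws ws''"
| one: "us \<in> lists (letters V A) \<Longrightarrow> ws \<in> lists (letters V A) \<Longrightarrow> v \<in> V
    \<Longrightarrow> free_prod_eq V A (us @ (v, \<one>\<^bsub>A v\<^esub>) # ws) (us @ ws)"
| mult: "us \<in> lists (letters V A) \<Longrightarrow> ws \<in> lists (letters V A) \<Longrightarrow> v \<in> V
    \<Longrightarrow> g \<in> carrier (A v) \<Longrightarrow> h \<in> carrier (A v)
    \<Longrightarrow> free_prod_eq V A (us @ (v, g) # (v, h) # ws) (us @ (v, g \<otimes>\<^bsub>A v\<^esub> h) # ws)"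

definition free_prod_rel ::
  "'v set \<Rightarrow> ('v \<Rightarrow> ('a, 'b) monoid_scheme) \<Rightarrow> (('v \<times> 'a) list \<times> ('v \<times> 'a) list) set" where
  "free_prod_rel V A = {(ws, ws'). free_prod_eq V A ws ws'}"

definition free_product ::
  "'v set \<Rightarrow> ('v \<Rightarrow> ('a, 'b) monoid_scheme) \<Rightarrow> ('v \<times> 'a) list set monoid" where
  "free_product V A =
    \<lparr>carrier = lists (letters V A) // free_prod_rel V A,
     mult = (\<lambda>X Y. \<Union>x\<in>X. \<Union>y\<in>Y. free_prod_rel V A `` {x @ y}),
     one = free_prod_rel V A `` {[]}\<rparr>"

definition free_product_incl ::
  "'v set \<Rightarrow> ('v \<Rightarrow> ('a, 'b) monoid_scheme) \<Rightarrow> 'v \<Rightarrow> 'a \<Rightarrow> ('v \<times> 'a) list set" where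
  "free_product_incl V A v g = free_prod_rel V A `` {[(v, g)]}"


subsection \<open>Graph products\<close>

definition normal_closure :: "('a, 'b) monoid_scheme \<Rightarrow> 'a set \<Rightarrow> 'a set" where
  "normal_closure G S = \<Inter>{N. N \<lhd> G \<and> S \<subseteq> N}"

text \<open>A graph is given by its vertex set \<open>V\<close> and its set \<open>E\<close> of edges, an edge being the set of its
  two ends.\<close>

definition graph_product_relators ::
  "'v set \<Rightarrow> 'v set set \<Rightarrow> ('v \<Rightarrow> ('a, 'b) monoid_scheme) \<Rightarrow> ('v \<times> 'a) list set set" where
  "graph_product_relators V E A =
    {x \<otimes>\<^bsub>free_product V A\<^esub> y \<otimes>\<^bsub>free_product V A\<^esub> inv\<^bsub>free_product V A\<^esub> x
        \<otimes>\<^bsub>free_product V A\<^esub> inv\<^bsub>free_product V A\<^esub> y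
     | x y. \<exists>v\<in>V. \<exists>w\<in>V. {v, w} \<in> E
          \<and> x \<in> free_product_incl V A v ` carrier (A v)
          \<and> y \<in> free_product_incl V A w ` carrier (A w)}"

definition graph_product ::
  "'v set \<Rightarrow> 'v set set \<Rightarrow> ('v \<Rightarrow> ('a, 'b) monoid_scheme) \<Rightarrow> ('v \<times> 'a) list set set monoid" where
  "graph_product V E A =
    free_product V A Mod normal_closure (free_product V A) (graph_product_relators V E A)"

text \<open>The cycle graph on the vertices \<open>0, \<dots>, k - 1\<close> (a simple graph for \<open>k \<ge> 3\<close>).\<close>

definition cycle_vertices :: "nat \<Rightarrow> nat set" where
  "cycle_vertices k = {..<k}"

definition cycle_edges :: "nat \<Rightarrow> nat set set" where
  "cycle_edges k = {{i, Suc i mod k} | i. i < k}"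

definition finite_or_cyclic_group :: "('a, 'b) monoid_scheme \<Rightarrow> bool" where
  "finite_or_cyclic_group G \<longleftrightarrow> group G \<and> (finite (carrier G) \<or> cyclic_group G)"


subsection \<open>Word metrics and quasiisometric embeddings\<close>

definition finite_generating_set :: "('a, 'b) monoid_scheme \<Rightarrow> 'a set \<Rightarrow> bool" where
  "finite_generating_set G S \<longleftrightarrow> finite S \<and> S \<subseteq> carrier G \<and> generate G S = carrier G"

definition word_length :: "('a, 'b) monoid_scheme \<Rightarrow> 'a set \<Rightarrow> 'a \<Rightarrow> nat" where
  "word_length G S g =
    (LEAST k. \<exists>ws. ws \<in> lists (S \<union> m_inv G ` S) \<and> length ws = k
        \<and> foldr (\<otimes>\<^bsub>G\<^esub>) ws \<one>\<^bsub>G\<^esub> = g)"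

text \<open>The value 0 off the carrier only serves the symmetry requirement of
  \<^locale>\<open>Metric_space\<close>, which is not restricted to the carrier.\<close>

definition word_dist :: "('a, 'b) monoid_scheme \<Rightarrow> 'a set \<Rightarrow> 'a \<Rightarrow> 'a \<Rightarrow> real" where
  "word_dist G S x y =
    (if x \<in> carrier G \<and> y \<in> carrier G then real (word_length G S (inv\<^bsub>G\<^esub> x \<otimes>\<^bsub>G\<^esub> y)) else 0)"

definition word_metric :: "('a, 'b) monoid_scheme \<Rightarrow> 'a set \<Rightarrow> 'a metric" where
  "word_metric G S = metric (carrier G, word_dist G S)"

definition quasiisometric_embedding :: "'a metric \<Rightarrow> 'b metric \<Rightarrow> ('a \<Rightarrow> 'b) \<Rightarrow> bool" where
  "quasiisometric_embedding X Y F \<longleftrightarrow>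
    F \<in> mspace X \<rightarrow> mspace Y \<and>
    (\<exists>K A. K \<ge> 1 \<and> A \<ge> 0 \<and>
      (\<forall>x\<in>mspace X. \<forall>x'\<in>mspace X.
        (1 / K) * mdist X x x' - A \<le> mdist Y (F x) (F x') \<and>
        mdist Y (F x) (F x') \<le> K * mdist X x x' + A))"


subsection \<open>Well-definedness\<close>

context
  notes in_listsI [rule del] in_listsD [rule del]
begin

lemma free_prod_eq_lists:
  assumes A: "\<forall>v\<in>V. group (A v)" and eq: "free_prod_eq V A x y"
  shows "x \<in> lists (letters V A) \<and> y \<in> lists (letters V A)"
  using assms(2)
proof induction
  case (one us ws v)
  then show ?case using group.is_monoid[OF A[rule_format]] by (auto simp: letters_def)
next
  case (mult us ws v g h)
  then show ?case using monoid.m_closed[OF group.is_monoid[OF A[rule_format]]] by (auto simp: letters_def)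
qed auto

lemma equiv_free_prod_rel:
  assumes A: "\<forall>v\<in>V. group (A v)"
  shows "equiv (lists (letters V A)) (free_prod_rel V A)"
proof (rule equivI)
  show "free_prod_rel V A \<subseteq> lists (letters V A) \<times> lists (letters V A)"
    using free_prod_eq_lists[OF A] by (force simp: free_prod_rel_def)
  show "refl_on (lists (letters V A)) (free_prod_rel V A)"
    by (auto simp: refl_on_def free_prod_rel_def intro: free_prod_eq.refl)
  show "sym (free_prod_rel V A)"
    by (auto simp: sym_def free_prod_rel_def intro: free_prod_eq.sym)
  show "trans (free_prod_rel V A)"
    by (auto simp: trans_def free_prod_rel_def intro: free_prod_eq.trans)
qed

lemma free_prod_eq_append_left:
  assumes "free_prod_eq V A x y" "z \<in> lists (letters V A)"
  shows "free_prod_eq V A (z @ x) (z @ y)"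
  using assms(1)
proof induction
  case (one us ws v)
  then show ?case using free_prod_eq.one[of "z @ us" V A ws v] assms(2) by simp
next
  case (mult us ws v g h)
  then show ?case using free_prod_eq.mult[of "z @ us" V A ws v g h] assms(2) by simp
qed (use assms(2) in \<open>auto intro: free_prod_eq.refl free_prod_eq.sym free_prod_eq.trans\<close>)

lemma free_prod_eq_append_right:
  assumes "free_prod_eq V A x y" "z \<in> lists (letters V A)"
  shows "free_prod_eq V A (x @ z) (y @ z)"
  using assms(1)
proof induction
  case (one us ws v)
  then show ?case using free_prod_eq.one[of us V A "ws @ z" v] assms(2) by simp
next
  case (mult us ws v g h)
  then show ?case using free_prod_eq.mult[of us V A "ws @ z" v g h] assms(2) by simp
qed (use assms(2) in \<open>auto intro: free_prod_eq.refl free_prod_eq.sym free_prod_eq.trans\<close>)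

lemma free_product_mult_class:
  assumes A: "\<forall>v\<in>V. group (A v)" and "x \<in> lists (letters V A)" "y \<in> lists (letters V A)"
  shows "free_prod_rel V A `` {x} \<otimes>\<^bsub>free_product V A\<^esub> free_prod_rel V A `` {y}
    = free_prod_rel V A `` {x @ y}"
proof -
  have "congruent2 (free_prod_rel V A) (free_prod_rel V A) (\<lambda>x y. free_prod_rel V A `` {x @ y})"
  proof (rule congruent2I[OF equiv_free_prod_rel[OF A] equiv_free_prod_rel[OF A]])
    fix y z w
    assume w: "w \<in> lists (letters V A)" and yz: "(y, z) \<in> free_prod_rel V A"
    show "free_prod_rel V A `` {y @ w} = free_prod_rel V A `` {z @ w}"
      using equiv_class_eq[OF equiv_free_prod_rel[OF A]] yz free_prod_eq_append_right[OF _ w]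
      by (simp add: free_prod_rel_def)
    show "free_prod_rel V A `` {w @ y} = free_prod_rel V A `` {w @ z}"
      using equiv_class_eq[OF equiv_free_prod_rel[OF A]] yz free_prod_eq_append_left[OF _ w]
      by (simp add: free_prod_rel_def)
  qed
  from UN_equiv_class2[OF equiv_free_prod_rel[OF A] equiv_free_prod_rel[OF A] this assms(2,3)]
  show ?thesis by (simp add: free_product_def)
qed

lemma free_product_class_closed:
  "x \<in> lists (letters V A) \<Longrightarrow> free_prod_rel V A `` {x} \<in> carrier (free_product V A)"
  by (simp add: free_product_def quotientI)

lemma free_product_carrierE:
  assumes "X \<in> carrier (free_product V A)"
  obtains x where "x \<in> lists (letters V A)" "X = free_prod_rel V A `` {x}"
  using assms that by (auto simp: free_product_def elim!: quotientE)

lemma free_product_one: "\<one>\<^bsub>free_product V A\<^esub> = free_prod_rel V A `` {[]}"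
  by (simp add: free_product_def)

lemma free_prod_class_eqI:
  assumes A: "\<forall>v\<in>V. group (A v)" and eq: "free_prod_eq V A x y"
  shows "free_prod_rel V A `` {x} = free_prod_rel V A `` {y}"
  using equiv_class_eq[OF equiv_free_prod_rel[OF A]] eq by (simp add: free_prod_rel_def)

lemma group_free_product:
  assumes A: "\<forall>v\<in>V. group (A v)"
  shows "group (free_product V A)"
proof (rule groupI)
  let ?L = "lists (letters V A)"
  show "\<one>\<^bsub>free_product V A\<^esub> \<in> carrier (free_product V A)"
    by (simp add: free_product_one free_product_class_closed)
  show "X \<otimes>\<^bsub>free_product V A\<^esub> Y \<in> carrier (free_product V A)"
    if "X \<in> carrier (free_product V A)" "Y \<in> carrier (free_product V A)" for X Y
    using that by (auto elim!: free_product_carrierE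
        simp: free_product_mult_class[OF A] free_product_class_closed)
  show "X \<otimes>\<^bsub>free_product V A\<^esub> Y \<otimes>\<^bsub>free_product V A\<^esub> Z
      = X \<otimes>\<^bsub>free_product V A\<^esub> (Y \<otimes>\<^bsub>free_product V A\<^esub> Z)"
    if "X \<in> carrier (free_product V A)" "Y \<in> carrier (free_product V A)"
      "Z \<in> carrier (free_product V A)" for X Y Z
    using that by (auto elim!: free_product_carrierE simp: free_product_mult_class[OF A])
  show "\<one>\<^bsub>free_product V A\<^esub> \<otimes>\<^bsub>free_product V A\<^esub> X = X"
    if "X \<in> carrier (free_product V A)" for X
    using that by (auto elim!: free_product_carrierE
        simp: free_product_mult_class[OF A] free_product_one)
  have inv: "\<exists>y\<in>?L. free_prod_eq V A (y @ x) []" if "x \<in> ?L" for x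
    using that
  proof (induction x rule: list.induct)
    case Nil
    then show ?case using free_prod_eq.refl[of "[]" V A] by (intro bexI[of _ "[]"]) auto
  next
    case (Cons l x)
    obtain v g where l: "l = (v, g)" by force
    have v: "v \<in> V" and g: "g \<in> carrier (A v)" and x: "x \<in> ?L"
      using Cons.prems by (auto simp: l letters_def)
    interpret Av: group "A v" using A v by blast
    obtain y where y: "y \<in> ?L" "free_prod_eq V A (y @ x) []" using Cons.IH x by blast
    let ?y = "y @ [(v, inv\<^bsub>A v\<^esub> g)]"
    have "free_prod_eq V A (y @ (v, inv\<^bsub>A v\<^esub> g) # (v, g) # x) (y @ (v, inv\<^bsub>A v\<^esub> g \<otimes>\<^bsub>A v\<^esub> g) # x)"
      using y x v g by (intro free_prod_eq.mult) auto
    moreover have "free_prod_eq V A (y @ (v, \<one>\<^bsub>A v\<^esub>) # x) (y @ x)"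
      using y x v by (intro free_prod_eq.one) auto
    ultimately have "free_prod_eq V A (?y @ l # x) []"
      using y g by (auto simp: l intro: free_prod_eq.trans)
    then show ?case using y v g by (intro bexI[of _ ?y]) (auto simp: letters_def)
  qed
  show "\<exists>Y\<in>carrier (free_product V A). Y \<otimes>\<^bsub>free_product V A\<^esub> X = \<one>\<^bsub>free_product V A\<^esub>"
    if X: "X \<in> carrier (free_product V A)" for X
  proof -
    obtain x where x: "x \<in> ?L" "X = free_prod_rel V A `` {x}"
      using free_product_carrierE[OF X] by blast
    obtain y where y: "y \<in> ?L" "free_prod_eq V A (y @ x) []" using inv x by blast
    then show ?thesis
      using x free_prod_class_eqI[OF A y(2)]
      by (intro bexI[of _ "free_prod_rel V A `` {y}"])
        (auto simp: free_product_mult_class[OF A] free_product_one free_product_class_closed)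
  qed
qed

lemma free_product_incl_hom:
  assumes A: "\<forall>v\<in>V. group (A v)" and v: "v \<in> V"
  shows "free_product_incl V A v \<in> hom (A v) (free_product V A)"
proof (rule homI)
  show "free_product_incl V A v g \<in> carrier (free_product V A)" if "g \<in> carrier (A v)" for g
    using that v by (auto simp: free_product_incl_def letters_def intro: free_product_class_closed)
  show "free_product_incl V A v (g \<otimes>\<^bsub>A v\<^esub> h)
      = free_product_incl V A v g \<otimes>\<^bsub>free_product V A\<^esub> free_product_incl V A v h"
    if "g \<in> carrier (A v)" "h \<in> carrier (A v)" for g h
    using that v free_prod_class_eqI[OF A free_prod_eq.mult[of "[]" V A "[]" v g h]]
    by (auto simp: free_product_incl_def free_product_mult_class[OF A] letters_def)
qed

lemma free_product_generated:
  assumes A: "\<forall>v\<in>V. group (A v)"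
  shows "generate (free_product V A) (\<Union>v\<in>V. free_product_incl V A v ` carrier (A v))
    = carrier (free_product V A)" (is "generate ?F ?S = _")
proof
  interpret F: group ?F using group_free_product[OF A] .
  show "generate ?F ?S \<subseteq> carrier ?F"
    using hom_in_carrier[OF free_product_incl_hom[OF A]] by (intro F.generate_incl) auto
  have "free_prod_rel V A `` {x} \<in> generate ?F ?S" if "x \<in> lists (letters V A)" for x
    using that
  proof (induction x rule: list.induct)
    case Nil
    then show ?case by (metis free_product_one generate.one)
  next
    case (Cons l x)
    obtain v g where l: "l = (v, g)" by force
    with Cons have "v \<in> V" "g \<in> carrier (A v)" by (auto simp: letters_def)
    then have "free_product_incl V A v g \<in> generate ?F ?S" by (auto intro: generate.incl)
    with Cons have "free_product_incl V A v g \<otimes>\<^bsub>?F\<^esub> free_prod_rel V A `` {x} \<in> generate ?F ?S"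
      by (auto intro: generate.eng)
    then show ?case
      using Cons.prems free_product_mult_class[OF A, of "[l]" x]
      by (simp add: free_product_incl_def l)
  qed
  then show "carrier ?F \<subseteq> generate ?F ?S" by (auto elim!: free_product_carrierE)
qed

end

lemma (in group) normal_normal_closure:
  assumes "S \<subseteq> carrier G"
  shows "normal_closure G S \<lhd> G"
proof -
  have ne: "carrier G \<in> {N. N \<lhd> G \<and> S \<subseteq> N}"
    using assms by (auto simp: normal_inv_iff subgroup_self)
  then have "subgroup (normal_closure G S) G"
    unfolding normal_closure_def
    by (intro subgroups_Inter) (auto simp: normal_inv_iff)
  then show ?thesis
    by (auto simp: normal_inv_iff normal_closure_def)
qed

lemma graph_product_relators_closed:
  assumes A: "\<forall>v\<in>V. group (A v)"
  shows "graph_product_relators V E A \<subseteq> carrier (free_product V A)"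
proof -
  interpret F: group "free_product V A" using group_free_product[OF A] .
  show ?thesis
    using hom_in_carrier[OF free_product_incl_hom[OF A]]
    by (fastforce simp: graph_product_relators_def)
qed

lemma group_graph_product:
  assumes A: "\<forall>v\<in>V. group (A v)"
  shows "group (graph_product V E A)"
  unfolding graph_product_def
  by (intro normal.factorgroup_is_group group.normal_normal_closure group_free_product
      graph_product_relators_closed A)

lemma (in group) foldr_mult_closed:
  "ws \<in> lists (carrier G) \<Longrightarrow> foldr (\<otimes>) ws \<one> \<in> carrier G"
  by (induction ws) auto

lemma (in group) foldr_mult_append:
  "us \<in> lists (carrier G) \<Longrightarrow> ws \<in> lists (carrier G)
    \<Longrightarrow> foldr (\<otimes>) (us @ ws) \<one> = foldr (\<otimes>) us \<one> \<otimes> foldr (\<otimes>) ws \<one>"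
  by (induction us) (auto simp: foldr_mult_closed m_assoc simp del: foldr_append simp: foldr_append[symmetric])

lemma (in group) generate_word:
  assumes S: "S \<subseteq> carrier G" and g: "g \<in> generate G S"
  shows "\<exists>ws\<in>lists (S \<union> m_inv G ` S). foldr (\<otimes>) ws \<one> = g"
  using g
proof induction
  case one
  then show ?case by (intro bexI[of _ "[]"]) auto
next
  case (incl h)
  then show ?case using S by (intro bexI[of _ "[h]"]) auto
next
  case (inv h)
  then show ?case using S by (intro bexI[of _ "[inv h]"]) auto
next
  case (eng g h)
  then obtain us ws where uw: "us \<in> lists (S \<union> m_inv G ` S)" "foldr (\<otimes>) us \<one> = g"
    "ws \<in> lists (S \<union> m_inv G ` S)" "foldr (\<otimes>) ws \<one> = h" by blast
  moreover have "lists (S \<union> m_inv G ` S) \<subseteq> lists (carrier G)"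
    using S by (intro lists_mono) auto
  ultimately show ?case
    using foldr_mult_append[of us ws] by (intro bexI[of _ "us @ ws"]) auto
qed

lemma (in group) foldr_mult_inv:
  assumes S: "S \<subseteq> carrier G" and ws: "ws \<in> lists (S \<union> m_inv G ` S)"
  shows "\<exists>us\<in>lists (S \<union> m_inv G ` S). length us = length ws
    \<and> foldr (\<otimes>) us \<one> = inv (foldr (\<otimes>) ws \<one>)"
  using ws
proof (induction ws rule: list.induct)
  case Nil
  then show ?case by auto
next
  case (Cons a ws)
  then obtain us where us: "us \<in> lists (S \<union> m_inv G ` S)" "length us = length ws"
    "foldr (\<otimes>) us \<one> = inv (foldr (\<otimes>) ws \<one>)" by auto
  have sub: "lists (S \<union> m_inv G ` S) \<subseteq> lists (carrier G)"
    using S by (intro lists_mono) auto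
  have "a \<in> S \<union> m_inv G ` S" using Cons.prems by auto
  then have a: "a \<in> carrier G" "inv a \<in> S \<union> m_inv G ` S" using S by auto
  have w: "foldr (\<otimes>) ws \<one> \<in> carrier G"
    using Cons.prems sub by (intro foldr_mult_closed) auto
  have "foldr (\<otimes>) (us @ [inv a]) \<one> = foldr (\<otimes>) us \<one> \<otimes> foldr (\<otimes>) [inv a] \<one>"
    using us sub a by (intro foldr_mult_append) auto
  then show ?case
    using us a w by (intro bexI[of _ "us @ [inv a]"]) (auto simp: inv_mult_group)
qed

lemma (in group) word_length_le:
  "ws \<in> lists (S \<union> m_inv G ` S) \<Longrightarrow> word_length G S (foldr (\<otimes>) ws \<one>) \<le> length ws"
  unfolding word_length_def by (intro Least_le) blast

lemma (in group) word_length_attained: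
  assumes "S \<subseteq> carrier G" "g \<in> generate G S"
  obtains ws where "ws \<in> lists (S \<union> m_inv G ` S)" "length ws = word_length G S g"
    "foldr (\<otimes>) ws \<one> = g"
proof -
  have "\<exists>k ws. ws \<in> lists (S \<union> m_inv G ` S) \<and> length ws = k \<and> foldr (\<otimes>) ws \<one> = g"
    using generate_word[OF assms] by blast
  from LeastI_ex[OF this] show ?thesis
    using that unfolding word_length_def by blast
qed

lemma (in group) Metric_space_word_dist:
  assumes "S \<subseteq> carrier G" "generate G S = carrier G"
  shows "Metric_space (carrier G) (word_dist G S)"
proof
  note attained = word_length_attained[OF assms(1), unfolded assms(2)]
  show "0 \<le> word_dist G S x y" for x y by (simp add: word_dist_def)
  have inv_le: "word_length G S (inv g) \<le> word_length G S g" if "g \<in> carrier G" for g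
    by (metis attained[OF that] foldr_mult_inv[OF assms(1)] word_length_le)
  have "word_length G S (inv x \<otimes> y) \<le> word_length G S (inv y \<otimes> x)"
    if "x \<in> carrier G" "y \<in> carrier G" for x y
    using inv_le[of "inv y \<otimes> x"] that by (simp add: inv_mult_group)
  then show "word_dist G S x y = word_dist G S y x" for x y
    by (simp add: word_dist_def order_antisym)
  show "word_dist G S x y = 0 \<longleftrightarrow> x = y" if xy: "x \<in> carrier G" "y \<in> carrier G" for x y
  proof
    assume "word_dist G S x y = 0"
    then have "word_length G S (inv x \<otimes> y) = 0" using xy by (simp add: word_dist_def)
    moreover obtain ws where "length ws = word_length G S (inv x \<otimes> y)"
      "foldr (\<otimes>) ws \<one> = inv x \<otimes> y" using attained xy by (metis inv_closed m_closed)
    ultimately have "inv x \<otimes> y = \<one>" by simp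
    then show "x = y" using xy by (metis inv_equality inv_inv inv_closed)
  next
    assume "x = y"
    then show "word_dist G S x y = 0"
      using xy word_length_le[of "[]" S] by (simp add: word_dist_def)
  qed
  show "word_dist G S x z \<le> word_dist G S x y + word_dist G S y z"
    if xyz: "x \<in> carrier G" "y \<in> carrier G" "z \<in> carrier G" for x y z
  proof -
    obtain us where us: "us \<in> lists (S \<union> m_inv G ` S)"
      "length us = word_length G S (inv x \<otimes> y)" "foldr (\<otimes>) us \<one> = inv x \<otimes> y"
      using attained xyz by (metis inv_closed m_closed)
    obtain ws where ws: "ws \<in> lists (S \<union> m_inv G ` S)"
      "length ws = word_length G S (inv y \<otimes> z)" "foldr (\<otimes>) ws \<one> = inv y \<otimes> z"
      using attained xyz by (metis inv_closed m_closed)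
    have sub: "lists (S \<union> m_inv G ` S) \<subseteq> lists (carrier G)"
      using assms(1) by (intro lists_mono) auto
    have "inv x \<otimes> z = (inv x \<otimes> y) \<otimes> (inv y \<otimes> z)"
      using xyz by (metis inv_closed inv_solve_left m_assoc m_closed)
    also have "\<dots> = foldr (\<otimes>) (us @ ws) \<one>"
      using us ws sub foldr_mult_append[of us ws, symmetric] by (simp only: subset_iff)
    finally have "word_length G S (inv x \<otimes> z) \<le> length (us @ ws)"
      using us ws word_length_le[of "us @ ws" S] by auto
    then show ?thesis using us ws xyz by (simp add: word_dist_def)
  qed
qed

lemma (in group) mspace_word_metric:
  "finite_generating_set G S \<Longrightarrow> mspace (word_metric G S) = carrier G"
  by (simp add: word_metric_def finite_generating_set_def Metric_space_word_dist
      Metric_space.mspace_metric)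

lemma (in group) mdist_word_metric:
  "finite_generating_set G S \<Longrightarrow> mdist (word_metric G S) = word_dist G S"
  by (simp add: word_metric_def finite_generating_set_def Metric_space_word_dist
      Metric_space.mdist_metric)

lemma finite_or_cyclic_group_generating_set:
  assumes "finite_or_cyclic_group G"
  shows "\<exists>S. finite_generating_set G S"
proof -
  interpret group G using assms by (simp add: finite_or_cyclic_group_def)
  show ?thesis
  proof (cases "finite (carrier G)")
    case True
    then show ?thesis
      using generate_incl[of "carrier G"] generate.incl[of _ "carrier G" G]
      by (auto simp: finite_generating_set_def)
  next
    case False
    then obtain x where x: "x \<in> carrier G" "subgroup_generated G {x} = G"
      using assms by (auto simp: finite_or_cyclic_group_def cyclic_group_def)
    then have "generate G {x} = carrier G"
      by (metis carrier_subgroup_generated Int_insert_right_if1 Int_empty_right)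
    with x show ?thesis by (auto simp: finite_generating_set_def)
  qed
qed

lemma graph_product_generating_set:
  assumes V: "finite V" and A: "\<And>v. v \<in> V \<Longrightarrow> finite_or_cyclic_group (A v)"
  shows "\<exists>S. finite_generating_set (graph_product V E A) S"
proof -
  let ?F = "free_product V A"
  let ?N = "normal_closure ?F (graph_product_relators V E A)"
  have gA: "\<forall>v\<in>V. group (A v)" using A by (auto simp: finite_or_cyclic_group_def)
  interpret F: group ?F using group_free_product[OF gA] .
  interpret N: normal ?N ?F
    by (intro F.normal_normal_closure graph_product_relators_closed gA)
  interpret Q: group "graph_product V E A" using group_graph_product[OF gA] .
  obtain S where S: "\<And>v. v \<in> V \<Longrightarrow> finite_generating_set (A v) (S v)"
    using finite_or_cyclic_group_generating_set[OF A] by metis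
  let ?S = "\<Union>v\<in>V. free_product_incl V A v ` S v"
  have S_carr: "?S \<subseteq> carrier ?F"
  proof clarify
    fix v s assume "v \<in> V" "s \<in> S v"
    then show "free_product_incl V A v s \<in> carrier ?F"
      using S hom_in_carrier[OF free_product_incl_hom[OF gA]] unfolding finite_generating_set_def by blast
  qed
  have "free_product_incl V A v ` carrier (A v) \<subseteq> generate ?F ?S" if v: "v \<in> V" for v
  proof -
    interpret h: group_hom "A v" ?F "free_product_incl V A v"
      using v gA free_product_incl_hom[OF gA]
      by (simp add: group_hom_def group_hom_axioms_def F.group_axioms)
    have "free_product_incl V A v ` carrier (A v) = generate ?F (free_product_incl V A v ` S v)"
      using S[OF v] h.generate_img by (metis finite_generating_set_def)
    also have "\<dots> \<subseteq> generate ?F ?S" using v by (intro F.mono_generate) auto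
    finally show ?thesis .
  qed
  then have "generate ?F (\<Union>v\<in>V. free_product_incl V A v ` carrier (A v)) \<subseteq> generate ?F ?S"
    by (intro F.generate_subgroup_incl F.generate_is_subgroup S_carr) auto
  then have F_gen: "generate ?F ?S = carrier ?F"
    using F.generate_incl[OF S_carr] free_product_generated[OF gA] by auto
  let ?pi = "\<lambda>a. ?N #>\<^bsub>?F\<^esub> a"
  interpret pi: group_hom ?F "graph_product V E A" ?pi
    using N.r_coset_hom_Mod F.group_axioms Q.group_axioms
    by (simp add: group_hom_def group_hom_axioms_def graph_product_def)
  have "generate (graph_product V E A) (?pi ` ?S) = ?pi ` carrier ?F"
    using pi.generate_img[OF S_carr] F_gen by simp
  also have "\<dots> = carrier (graph_product V E A)"
    by (auto simp: graph_product_def carrier_FactGroup)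
  finally have "generate (graph_product V E A) (?pi ` ?S) = carrier (graph_product V E A)" .
  moreover have "finite (?pi ` ?S)" using V S by (auto simp: finite_generating_set_def)
  moreover have "?pi ` ?S \<subseteq> carrier (graph_product V E A)"
    using S_carr pi.hom_closed by blast
  ultimately show ?thesis unfolding finite_generating_set_def by blast
qed

end

theory Submission
  imports Defs
begin

text \<open>
  The group \<open>H\<close> acts on a complex of right-angled \<open>n\<close>-gons: the chambers are the elements of \<open>H\<close>, each
  chamber has one side for each vertex \<open>v\<close> of the cycle, and the side of type \<open>v\<close> of the chamber \<open>y\<close> is
  shared by the chambers \<open>y b\<close> with \<open>b \<in> B v\<close>. The wall through this side consists of the sides that
  continue it, and it divides the complex into one sector for each element of \<open>B v\<close>. The same holds for
  \<open>G\<close> with \<open>m\<close>-gons.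

  A chain of \<open>p + q + 1\<close> chambers of \<open>H\<close>, each one glued to the next along a side, is a polygon. Where
  two chambers are glued, the sides next to the glued one continue each other. The first gluing, and
  each gluing along a side that is separated by one side from the previous glued one, adds \<open>n - 4\<close>
  sides to the polygon, and its angles remain right. If
  consecutive glued sides are neighbours, three chambers meet in a corner with an angle of three right
  angles, and \<open>n - 2\<close> sides are added. With \<open>p\<close> gluings of the first kind and \<open>q\<close> of the
  second kind the polygon, called a blob, has \<open>m = n + p (n - 4) + q (n - 2)\<close> sides. Therefore \<open>G\<close> can be mapped
  to \<open>H\<close> by sending its chambers to blobs in such a way that chambers that share a side are
  sent to blobs that share the corresponding side. Since a vertex group of \<open>G\<close> is smaller than those of
  \<open>H\<close>, the blobs at a side can be put into different sectors, and the sector into which the chain itself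
  continues can be left free.

  The map is defined by recursion on reduced words (\<open>unfold_word\<close>). A state records how the
  sides of the present \<open>m\<close>-gon are matched with those of the present blob, and it is updated at every
  crossing (\<open>after\<close>) so that two crossings that commute lead to the same result (\<open>after_comm\<close>, \<open>cross_comm\<close>).
  Hence the map is defined on \<open>G\<close>. A letter multiplied on the right changes one syllable, which can be
  moved to the end of the word (\<open>right_letter\<close>), and so moves the image by a bounded distance.

  The lower bound counts walls of \<open>H\<close>. If a blob had no reflex corners, its sides would lie on different
  walls, the parts of the complex behind sides that are not neighbours would be disjoint, and
  each syllable of a word would contribute a wall. At a reflex corner the two sides lie on walls
  that cut through the blob itself. Only a part of a sector, the region behind the side, is then
  disjoint from the other ones (\<open>region_disjoint\<close>), and the image of a word is behind exactly the sides
  crossed by its first syllables (\<open>image_coords\<close>). A point in such a sector that is outside the region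
  has come around the corner. It is behind a single side of the next blob, in a sector that is not used
  by the map (\<open>bad_point\<close>), so that the next syllable has to contribute a wall. Thus
  at least every second syllable contributes one (\<open>sep_bound\<close>, \<open>sep_words\<close>).
\<close>

section \<open>Reduced words, heads and walls in graph products\<close>

(* Words are taken apart at their first letter and not elementwise. *)
declare in_listsI [rule del] in_listsD [rule del]

locale graph_words =
  fixes V :: "'v set" and E :: "'v set set" and A :: "'v \<Rightarrow> 'a monoid"
  assumes grp: "v \<in> V \<Longrightarrow> group (A v)"
    and simple: "{v} \<notin> E"
begin

definition adj :: "'v \<Rightarrow> 'v \<Rightarrow> bool" where
  "adj v w \<longleftrightarrow> {v, w} \<in> E"

lemma adj_sym: "adj v w \<longleftrightarrow> adj w v"
  by (simp add: adj_def insert_commute)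

lemma adj_symD [dest]: "adj v w \<Longrightarrow> adj w v"
  using adj_sym by blast

lemma adj_irrefl [simp]: "\<not> adj v v"
  using simple by (simp add: adj_def)

abbreviation "L \<equiv> letters V A"

lemma letters_iff [simp]: "(v, b) \<in> L \<longleftrightarrow> v \<in> V \<and> b \<in> carrier (A v)"
  by (auto simp: letters_def)

text \<open>The syllable of type \<open>v\<close> that can be shuffled to the front of a reduced word, or \<open>\<one>\<close>
  if there is none, and the word that remains when it is removed.\<close>

fun head :: "'v \<Rightarrow> ('v \<times> 'a) list \<Rightarrow> 'a" where
  "head v [] = \<one>\<^bsub>A v\<^esub>"
| "head v ((u, c) # ws) = (if u = v then c else if adj u v then head v ws else \<one>\<^bsub>A v\<^esub>)"

fun del :: "'v \<Rightarrow> ('v \<times> 'a) list \<Rightarrow> ('v \<times> 'a) list" where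
  "del v [] = []"
| "del v ((u, c) # ws) = (if u = v then ws else if adj u v then (u, c) # del v ws else (u, c) # ws)"

definition cons :: "'v \<Rightarrow> 'a \<Rightarrow> ('v \<times> 'a) list \<Rightarrow> ('v \<times> 'a) list" where
  "cons v b ws = (if b = \<one>\<^bsub>A v\<^esub> then ws else (v, b) # ws)"

text \<open>Left multiplication by a letter on reduced words. Up to shuffles of commuting syllables this
  is an action of the graph product, which makes reduced words a normal form.\<close>

definition act :: "'v \<Rightarrow> 'a \<Rightarrow> ('v \<times> 'a) list \<Rightarrow> ('v \<times> 'a) list" where
  "act v b ws = cons v (b \<otimes>\<^bsub>A v\<^esub> head v ws) (del v ws)"

fun red :: "('v \<times> 'a) list \<Rightarrow> bool" where
  "red [] = True"
| "red ((v, b) # ws) = (v \<in> V \<and> b \<in> carrier (A v) \<and> b \<noteq> \<one>\<^bsub>A v\<^esub> \<and> head v ws = \<one>\<^bsub>A v\<^esub> \<and> red ws)"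

inductive swap :: "('v \<times> 'a) list \<Rightarrow> ('v \<times> 'a) list \<Rightarrow> bool" where
  "adj u v \<Longrightarrow> swap ((u, a) # (v, b) # ws) ((v, b) # (u, a) # ws)"
| "swap ws ws' \<Longrightarrow> swap (l # ws) (l # ws')"

abbreviation eqv (infix "\<simeq>" 50) where "ws \<simeq> ws' \<equiv> swap\<^sup>*\<^sup>* ws ws'"

lemma swap_sym: "swap x y \<Longrightarrow> swap y x"
  by (induction rule: swap.induct) (auto intro: swap.intros)

lemma eqv_sym: "x \<simeq> y \<Longrightarrow> y \<simeq> x"
  by (metis swap_sym symp_def symp_rtranclp)

lemma eqv_Cons: "x \<simeq> y \<Longrightarrow> l # x \<simeq> l # y"
  by (induction rule: rtranclp_induct) (auto intro: swap.intros rtranclp.rtrancl_into_rtrancl)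

lemma swap_head: "swap x y \<Longrightarrow> head v x = head v y"
  by (induction rule: swap.induct) auto

lemma eqv_head: "x \<simeq> y \<Longrightarrow> head v x = head v y"
  by (induction rule: rtranclp_induct) (auto simp: swap_head)

lemma swap_del: "swap x y \<Longrightarrow> del v x = del v y \<or> swap (del v x) (del v y)"
proof (induction rule: swap.induct)
  case (2 ws ws' l)
  then show ?case by (cases l) (auto intro: swap.intros)
qed (auto intro: swap.intros)

lemma eqv_del: "x \<simeq> y \<Longrightarrow> del v x \<simeq> del v y"
proof (induction rule: rtranclp_induct)
  case (step y z)
  then show ?case using swap_del[of y z v] by (metis rtranclp.rtrancl_into_rtrancl)
qed auto

lemma swap_red: "swap x y \<Longrightarrow> red x \<Longrightarrow> red y"
  by (induction rule: swap.induct) (auto simp: swap_head split: if_splits)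

lemma eqv_red: "x \<simeq> y \<Longrightarrow> red x \<Longrightarrow> red y"
  by (induction rule: rtranclp_induct) (auto simp: swap_red)

lemma eqv_length: "x \<simeq> y \<Longrightarrow> length x = length y"
proof (induction rule: rtranclp_induct)
  case (step y z)
  have "length y = length z" using step(2) by (induction rule: swap.induct) auto
  with step show ?case by simp
qed auto

lemma red_letters: "red ws \<Longrightarrow> ws \<in> lists L"
  by (induction ws) auto

lemma head_closed: "v \<in> V \<Longrightarrow> ws \<in> lists L \<Longrightarrow> head v ws \<in> carrier (A v)"
proof (induction ws)
  case Nil
  then show ?case using grp[of v] by (simp add: group.is_monoid monoid.one_closed)
next
  case (Cons l ws)
  then show ?case using grp[of v] by (cases l) (auto simp: group.is_monoid monoid.one_closed)
qed

lemma red_head_closed: "v \<in> V \<Longrightarrow> red ws \<Longrightarrow> head v ws \<in> carrier (A v)"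
  using head_closed red_letters by blast

text \<open>Syllables at the front belong to a common clique. For the walls this means that the sectors of
  walls that do not cross are nested.\<close>

lemma head_exclusive: "head w ws \<noteq> \<one>\<^bsub>A w\<^esub> \<Longrightarrow> \<not> adj v w \<Longrightarrow> v \<noteq> w \<Longrightarrow> head v ws = \<one>\<^bsub>A v\<^esub>"
  by (induction ws) (auto split: if_splits)

lemma head_del_adj: "adj u v \<Longrightarrow> head u (del v ws) = head u ws"
  by (induction ws) (auto)

lemma head_del_same: "red ws \<Longrightarrow> head v (del v ws) = \<one>\<^bsub>A v\<^esub>"
  by (induction ws) auto

lemma red_del: "red ws \<Longrightarrow> red (del v ws)"
  by (induction ws) (auto simp: head_del_adj)

lemma del_no_head: "red ws \<Longrightarrow> head v ws = \<one>\<^bsub>A v\<^esub> \<Longrightarrow> del v ws = ws"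
  by (induction ws) auto

lemma del_comm: "adj u v \<Longrightarrow> del u (del v ws) = del v (del u ws)"
  by (induction ws) (auto)

lemma head_to_front: "head v ws \<noteq> \<one>\<^bsub>A v\<^esub> \<Longrightarrow> ws \<simeq> (v, head v ws) # del v ws"
proof (induction ws)
  case (Cons l ws)
  obtain u c where l: "l = (u, c)" by force
  show ?case
  proof (cases "u = v")
    case False
    then have a: "adj u v" "head v ws \<noteq> \<one>\<^bsub>A v\<^esub>" using Cons.prems l by (auto split: if_splits)
    have "l # ws \<simeq> l # (v, head v ws) # del v ws" using Cons.IH a by (intro eqv_Cons) auto
    also have "\<dots> \<simeq> (v, head v ws) # l # del v ws"
      using a swap.intros(1)[of u v c "head v ws" "del v ws"] l by auto
    finally show ?thesis using a False l by simp
  qed (simp add: l)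
qed simp

lemma head_cons: "head u (cons v b ws) = (if u = v then (if b = \<one>\<^bsub>A v\<^esub> then head v ws else b)
    else if b = \<one>\<^bsub>A v\<^esub> \<or> adj u v then head u ws else \<one>\<^bsub>A u\<^esub>)"
  by (auto simp: cons_def)

lemma head_act_same:
  assumes "red ws" "v \<in> V" "b \<in> carrier (A v)"
  shows "head v (act v b ws) = b \<otimes>\<^bsub>A v\<^esub> head v ws"
  using assms by (auto simp: act_def head_cons head_del_same)

lemma head_act_adj: "adj u v \<Longrightarrow> head u (act v b ws) = head u ws"
  by (auto simp: act_def head_cons head_del_adj)

lemma red_act: "red ws \<Longrightarrow> v \<in> V \<Longrightarrow> b \<in> carrier (A v) \<Longrightarrow> red (act v b ws)"
  using red_head_closed[of v ws] grp[of v]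
  by (auto simp: act_def cons_def red_del head_del_same group.is_monoid monoid.m_closed)

lemma eqv_act: "x \<simeq> y \<Longrightarrow> act v b x \<simeq> act v b y"
  using eqv_del[of x y v] eqv_head[of x y v] by (auto simp: act_def cons_def eqv_Cons)

lemma del_act: "red ws \<Longrightarrow> del v (act v b ws) = del v ws"
  by (auto simp: act_def cons_def del_no_head red_del head_del_same)

lemma act_act:
  assumes "red ws" "v \<in> V" "b \<in> carrier (A v)" "c \<in> carrier (A v)"
  shows "act v b (act v c ws) = act v (b \<otimes>\<^bsub>A v\<^esub> c) ws"
proof -
  interpret group "A v" using grp assms by blast
  show ?thesis using assms red_head_closed[of v ws]
    by (simp add: act_def[of v b] act_def[of v "b \<otimes>\<^bsub>A v\<^esub> c"] head_act_same del_act m_assoc)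
qed

lemma act_one:
  assumes "red ws" "v \<in> V"
  shows "act v \<one>\<^bsub>A v\<^esub> ws \<simeq> ws"
proof -
  interpret group "A v" using grp assms by blast
  show ?thesis
    using assms red_head_closed[of v ws] head_to_front[of v ws]
    by (cases "head v ws = \<one>\<^bsub>A v\<^esub>") (auto simp: act_def cons_def del_no_head intro: eqv_sym)
qed

lemma del_cons_adj: "adj u v \<Longrightarrow> del u (cons v b ws) = cons v b (del u ws)"
  by (auto simp: cons_def)

lemma cons_comm: "adj u v \<Longrightarrow> cons u a (cons v b ws) \<simeq> cons v b (cons u a ws)"
  using swap.intros(1)[of u v a b ws] by (auto simp: cons_def)

text \<open>The relators of the graph product act trivially, since commuting letters act by commuting
  operations up to a shuffle.\<close>

lemma act_comm:
  assumes "adj u v"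
  shows "act u a (act v b ws) \<simeq> act v b (act u a ws)"
proof -
  have vu: "adj v u" using assms adj_sym by blast
  have "act u a (act v b ws) = cons u (a \<otimes>\<^bsub>A u\<^esub> head u ws) (cons v (b \<otimes>\<^bsub>A v\<^esub> head v ws) (del u (del v ws)))"
    using vu assms by (simp add: act_def[of u a] head_act_adj) (simp add: act_def del_cons_adj)
  also have "\<dots> \<simeq> cons v (b \<otimes>\<^bsub>A v\<^esub> head v ws) (cons u (a \<otimes>\<^bsub>A u\<^esub> head u ws) (del u (del v ws)))"
    by (rule cons_comm[OF assms])
  also have "\<dots> = act v b (act u a ws)"
    using vu assms by (simp add: act_def[of v b] head_act_adj) (simp add: act_def del_cons_adj del_comm)
  finally show ?thesis .
qed

definition nf :: "('v \<times> 'a) list \<Rightarrow> ('v \<times> 'a) list" where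
  "nf ws = foldr (\<lambda>(v, b). act v b) ws []"

lemma nf_simps [simp]: "nf [] = []" "nf ((v, b) # ws) = act v b (nf ws)"
  by (auto simp: nf_def)

lemma red_nf: "ws \<in> lists L \<Longrightarrow> red (nf ws)"
  by (induction ws) (auto simp: red_act)

lemma nf_red: "red ws \<Longrightarrow> nf ws \<simeq> ws"
proof (induction ws)
  case (Cons l ws)
  obtain v b where l: "l = (v, b)" by force
  interpret group "A v" using grp Cons.prems l by auto
  have "head v (nf ws) = \<one>\<^bsub>A v\<^esub>" using Cons l eqv_head by fastforce
  moreover have "red (nf ws)" using Cons.prems red_nf red_letters l by auto
  ultimately have "nf (l # ws) = l # nf ws"
    using Cons.prems l by (auto simp: act_def cons_def del_no_head)
  with Cons l show ?case by (auto intro: eqv_Cons)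
qed simp

lemma nf_append_cong: "nf x \<simeq> nf y \<Longrightarrow> nf (us @ x) \<simeq> nf (us @ y)"
  by (induction us) (auto intro: eqv_act)

lemma free_prod_eq_nf:
  assumes "free_prod_eq V A x y" "z \<in> lists L"
  shows "nf (x @ z) \<simeq> nf (y @ z)"
  using assms(1)
proof induction
  case (sym ws ws')
  show ?case by (rule eqv_sym[OF sym.IH])
next
  case (trans ws ws' ws'')
  then show ?case by auto
next
  case (one us ws v)
  then have "nf ((v, \<one>\<^bsub>A v\<^esub>) # ws @ z) \<simeq> nf (ws @ z)" using assms(2) by (auto intro!: act_one red_nf)
  from nf_append_cong[OF this] show ?case by simp
next
  case (mult us ws v g h)
  then have "nf ((v, g) # (v, h) # ws @ z) = nf ((v, g \<otimes>\<^bsub>A v\<^esub> h) # ws @ z)"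
    using assms(2) by (auto simp: act_act red_nf)
  then show ?case by (metis (no_types, lifting) append.assoc append_Cons nf_append_cong rtranclp.rtrancl_refl)
qed auto

abbreviation "FP \<equiv> free_product V A"
abbreviation "R \<equiv> free_prod_rel V A"
abbreviation "GP \<equiv> graph_product V E A"
abbreviation "NC \<equiv> normal_closure FP (graph_product_relators V E A)"

lemma gA: "\<forall>v\<in>V. group (A v)" using grp by blast

sublocale F: group FP by (rule group_free_product[OF gA])
sublocale Q: group GP by (rule group_graph_product[OF gA])

lemma normal_NC: "normal NC FP"
  by (intro F.normal_normal_closure graph_product_relators_closed gA)

definition ev :: "('v \<times> 'a) list \<Rightarrow> ('v \<times> 'a) list set set" where
  "ev ws = NC #>\<^bsub>FP\<^esub> (R `` {ws})"

lemma proj_hom: "(\<lambda>a. NC #>\<^bsub>FP\<^esub> a) \<in> hom FP GP"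
  using normal.r_coset_hom_Mod[OF normal_NC] by (simp add: graph_product_def)

lemma ev_closed [simp]: "ws \<in> lists L \<Longrightarrow> ev ws \<in> carrier GP"
  unfolding ev_def using hom_in_carrier[OF proj_hom] free_product_class_closed by blast

lemma ev_append: "x \<in> lists L \<Longrightarrow> y \<in> lists L \<Longrightarrow> ev (x @ y) = ev x \<otimes>\<^bsub>GP\<^esub> ev y"
  using hom_mult[OF proj_hom, of "R `` {x}" "R `` {y}"] free_product_mult_class[OF gA, of x y]
    free_product_class_closed
  by (auto simp: ev_def)

lemma ev_Nil: "ev [] = \<one>\<^bsub>GP\<^esub>"
  using ev_append[of "[]" "[]"] by (metis Q.l_cancel_one' append_Nil ev_closed lists.Nil)

lemma ev_surj: "g \<in> carrier GP \<Longrightarrow> \<exists>ws\<in>lists L. g = ev ws"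
  unfolding ev_def graph_product_def carrier_FactGroup
  by (auto elim!: free_product_carrierE)

lemma free_prod_eq_ev: "free_prod_eq V A x y \<Longrightarrow> ev x = ev y"
  unfolding ev_def using free_prod_class_eqI[OF gA] by metis

lemma ev_one: "v \<in> V \<Longrightarrow> ev [(v, \<one>\<^bsub>A v\<^esub>)] = \<one>\<^bsub>GP\<^esub>"
  using free_prod_eq_ev[OF free_prod_eq.one[of "[]" V A "[]" v]] by (simp add: ev_Nil)

lemma ev_mult: "v \<in> V \<Longrightarrow> b \<in> carrier (A v) \<Longrightarrow> c \<in> carrier (A v) \<Longrightarrow>
    ev [(v, b)] \<otimes>\<^bsub>GP\<^esub> ev [(v, c)] = ev [(v, b \<otimes>\<^bsub>A v\<^esub> c)]"
  using free_prod_eq_ev[OF free_prod_eq.mult[of "[]" V A "[]" v b c]]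
  by (simp flip: ev_append)

lemma ev_comm:
  assumes "v \<in> V" "w \<in> V" "adj v w" "b \<in> carrier (A v)" "c \<in> carrier (A w)"
  shows "ev [(v, b)] \<otimes>\<^bsub>GP\<^esub> ev [(w, c)] = ev [(w, c)] \<otimes>\<^bsub>GP\<^esub> ev [(v, b)]"
proof -
  let ?x = "free_product_incl V A v b" and ?y = "free_product_incl V A w c"
  have x: "?x \<in> carrier FP" "?y \<in> carrier FP"
    using assms by (auto simp: free_product_incl_def free_product_class_closed)
  have "?x \<otimes>\<^bsub>FP\<^esub> ?y \<otimes>\<^bsub>FP\<^esub> inv\<^bsub>FP\<^esub> ?x \<otimes>\<^bsub>FP\<^esub> inv\<^bsub>FP\<^esub> ?y \<in> graph_product_relators V E A"
    using assms unfolding graph_product_relators_def adj_def by blast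
  then have "?x \<otimes>\<^bsub>FP\<^esub> ?y \<otimes>\<^bsub>FP\<^esub> inv\<^bsub>FP\<^esub> ?x \<otimes>\<^bsub>FP\<^esub> inv\<^bsub>FP\<^esub> ?y \<in> NC"
    by (auto simp: normal_closure_def)
  then have "NC #>\<^bsub>FP\<^esub> (?x \<otimes>\<^bsub>FP\<^esub> ?y \<otimes>\<^bsub>FP\<^esub> inv\<^bsub>FP\<^esub> ?x \<otimes>\<^bsub>FP\<^esub> inv\<^bsub>FP\<^esub> ?y) = NC"
    using normal_NC by (metis F.coset_join2 F.rcosI F.m_closed normal_imp_subgroup subgroup.mem_carrier)
  moreover have "(\<one>\<^bsub>GP\<^esub>) = NC" by (simp add: graph_product_def)
  interpret pi: group_hom FP GP "\<lambda>a. NC #>\<^bsub>FP\<^esub> a"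
    by unfold_locales (rule proj_hom)
  have e: "ev [(v, b)] = NC #>\<^bsub>FP\<^esub> ?x" "ev [(w, c)] = NC #>\<^bsub>FP\<^esub> ?y"
    by (auto simp: ev_def free_product_incl_def)
  have "ev [(v, b)] \<otimes>\<^bsub>GP\<^esub> ev [(w, c)] \<otimes>\<^bsub>GP\<^esub> inv\<^bsub>GP\<^esub> ev [(v, b)] \<otimes>\<^bsub>GP\<^esub> inv\<^bsub>GP\<^esub> ev [(w, c)] = \<one>\<^bsub>GP\<^esub>"
    using calculation \<open>\<one>\<^bsub>GP\<^esub> = NC\<close> x unfolding e by simp
  then show ?thesis
    using assms by (metis (no_types, lifting) Q.inv_closed Q.inv_solve_right' Q.l_one Q.m_closed Q.one_closed ev_closed letters_iff lists.simps)
qed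

definition triv :: "('v \<times> 'a) list \<Rightarrow> bool" where
  "triv x \<longleftrightarrow> x \<in> lists L \<and> (\<forall>w\<in>lists L. nf (x @ w) \<simeq> nf w)"

lemma triv_cong: "free_prod_eq V A x y \<Longrightarrow> triv x \<Longrightarrow> triv y"
  using free_prod_eq_lists[OF gA] eqv_sym[OF free_prod_eq_nf]
  unfolding triv_def by (blast intro: rtranclp_trans)

definition TN :: "('v \<times> 'a) list set set" where
  "TN = {R `` {x} | x. triv x}"

lemma class_eq: "x \<in> lists L \<Longrightarrow> y \<in> lists L \<Longrightarrow> R `` {x} = R `` {y} \<Longrightarrow> free_prod_eq V A x y"
  using eq_equiv_class_iff[OF equiv_free_prod_rel[OF gA]] by (simp add: free_prod_rel_def)

lemma TN_iff: "x \<in> lists L \<Longrightarrow> R `` {x} \<in> TN \<longleftrightarrow> triv x"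
proof
  assume x: "x \<in> lists L" and "R `` {x} \<in> TN"
  then obtain y where y: "triv y" "R `` {x} = R `` {y}" by (auto simp: TN_def)
  then have "free_prod_eq V A y x" using x by (intro class_eq) (auto simp: triv_def)
  with y show "triv x" using triv_cong by blast
qed (auto simp: TN_def)

lemma TN_carrier: "TN \<subseteq> carrier FP"
  by (auto simp: TN_def triv_def free_product_class_closed)

lemma class_inv:
  assumes "x \<in> lists L"
  obtains y where "y \<in> lists L" "R `` {y} = inv\<^bsub>FP\<^esub> (R `` {x})"
    "\<And>w. w \<in> lists L \<Longrightarrow> nf (y @ x @ w) \<simeq> nf w" "\<And>w. w \<in> lists L \<Longrightarrow> nf (x @ y @ w) \<simeq> nf w"
proof -
  have X: "R `` {x} \<in> carrier FP" using assms by (rule free_product_class_closed)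
  then obtain y where y: "y \<in> lists L" "R `` {y} = inv\<^bsub>FP\<^esub> (R `` {x})"
    by (metis F.inv_closed free_product_carrierE)
  have "R `` {y @ x} = R `` {[]}" "R `` {x @ y} = R `` {[]}"
    using free_product_mult_class[OF gA, of y x] free_product_mult_class[OF gA, of x y]
      F.l_inv[OF X] F.r_inv[OF X] y assms by (metis free_product_one)+
  then have "free_prod_eq V A (y @ x) []" "free_prod_eq V A (x @ y) []"
    using y assms by (auto intro!: class_eq)
  from this[THEN free_prod_eq_nf] show ?thesis using that[OF y] by simp
qed

lemma normal_TN: "TN \<lhd> FP"
proof -
  have "subgroup TN FP"
  proof (rule F.subgroupI[OF TN_carrier])
    have "triv []" by (simp add: triv_def)
    then show "TN \<noteq> {}" by (auto simp: TN_def)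
    show "inv\<^bsub>FP\<^esub> X \<in> TN" if X: "X \<in> TN" for X
    proof -
      obtain x where x: "X = R `` {x}" "triv x" using X by (auto simp: TN_def)
      then have xl: "x \<in> lists L" by (simp add: triv_def)
      obtain y where y: "y \<in> lists L" "R `` {y} = inv\<^bsub>FP\<^esub> X"
        "\<And>w. w \<in> lists L \<Longrightarrow> nf (y @ x @ w) \<simeq> nf w"
        using class_inv[OF xl] x(1) by metis
      have "nf (y @ w) \<simeq> nf w" if w: "w \<in> lists L" for w
        using y(3)[OF w] nf_append_cong[of w "x @ w" y] x(2) w unfolding triv_def
        by (meson eqv_sym rtranclp_trans)
      then have "triv y" using y(1) by (simp add: triv_def)
      then show ?thesis using TN_iff y by metis
    qed
    show "X \<otimes>\<^bsub>FP\<^esub> Y \<in> TN" if XY: "X \<in> TN" "Y \<in> TN" for X Y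
    proof -
      obtain x y where x: "X = R `` {x}" "triv x" "Y = R `` {y}" "triv y" using XY by (auto simp: TN_def)
      have "nf (x @ y @ w) \<simeq> nf w" if "w \<in> lists L" for w
        using x that unfolding triv_def by (meson append_in_lists_conv rtranclp_trans)
      then have "triv (x @ y)" using x by (simp add: triv_def)
      moreover have "X \<otimes>\<^bsub>FP\<^esub> Y = R `` {x @ y}"
        using x free_product_mult_class[OF gA, of x y] by (simp add: triv_def)
      ultimately show ?thesis by (auto simp: TN_def)
    qed
  qed
  moreover have "H \<otimes>\<^bsub>FP\<^esub> X \<otimes>\<^bsub>FP\<^esub> inv\<^bsub>FP\<^esub> H \<in> TN" if H: "H \<in> carrier FP" and X: "X \<in> TN" for H X
  proof -
    obtain x where x: "X = R `` {x}" "triv x" using X by (auto simp: TN_def)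
    then have xl: "x \<in> lists L" by (simp add: triv_def)
    obtain h where h: "h \<in> lists L" "H = R `` {h}" using free_product_carrierE[OF H] by blast
    obtain k where k: "k \<in> lists L" "R `` {k} = inv\<^bsub>FP\<^esub> H"
      "\<And>w. w \<in> lists L \<Longrightarrow> nf (h @ k @ w) \<simeq> nf w"
      using class_inv[OF h(1)] h(2) by metis
    have "nf (h @ x @ k @ w) \<simeq> nf w" if w: "w \<in> lists L" for w
    proof -
      have "nf (x @ k @ w) \<simeq> nf (k @ w)" using x(2) k(1) w by (simp add: triv_def)
      from nf_append_cong[OF this, of h] k(3)[OF w] show ?thesis by simp
    qed
    then have "triv (h @ x @ k)" using h k xl by (simp add: triv_def)
    moreover have "H \<otimes>\<^bsub>FP\<^esub> X \<otimes>\<^bsub>FP\<^esub> inv\<^bsub>FP\<^esub> H = R `` {h @ x @ k}"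
      using free_product_mult_class[OF gA, of h x] free_product_mult_class[OF gA, of "h @ x" k] h k xl x
      by simp
    ultimately show ?thesis by (auto simp: TN_def)
  qed
  ultimately show ?thesis by (auto simp: F.normal_inv_iff)
qed

lemma relators_TN: "graph_product_relators V E A \<subseteq> TN"
proof
  fix r assume "r \<in> graph_product_relators V E A"
  then obtain v w g h where r: "v \<in> V" "w \<in> V" "adj v w" "g \<in> carrier (A v)" "h \<in> carrier (A w)"
    "r = free_product_incl V A v g \<otimes>\<^bsub>FP\<^esub> free_product_incl V A w h
      \<otimes>\<^bsub>FP\<^esub> inv\<^bsub>FP\<^esub> (free_product_incl V A v g) \<otimes>\<^bsub>FP\<^esub> inv\<^bsub>FP\<^esub> (free_product_incl V A w h)"
    unfolding graph_product_relators_def adj_def by blast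
  let ?v = "[(v, g)]" and ?w = "[(w, h)]"
  have l: "?v \<in> lists L" "?w \<in> lists L" using r by auto
  obtain v' where v': "v' \<in> lists L" "R `` {v'} = inv\<^bsub>FP\<^esub> (R `` {?v})"
    "\<And>z. z \<in> lists L \<Longrightarrow> nf (?v @ v' @ z) \<simeq> nf z" using class_inv[OF l(1)] by metis
  obtain w' where w': "w' \<in> lists L" "R `` {w'} = inv\<^bsub>FP\<^esub> (R `` {?w})"
    "\<And>z. z \<in> lists L \<Longrightarrow> nf (?w @ w' @ z) \<simeq> nf z" using class_inv[OF l(2)] by metis
  have "nf (?v @ ?w @ v' @ w' @ z) \<simeq> nf z" if z: "z \<in> lists L" for z
  proof -
    have "nf (?v @ ?w @ v' @ w' @ z) \<simeq> nf (?w @ ?v @ v' @ w' @ z)"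
      using act_comm[OF r(3)] by simp
    moreover have "nf (?v @ v' @ w' @ z) \<simeq> nf (w' @ z)" using v'(3)[of "w' @ z"] w' z by simp
    then have "nf (?w @ ?v @ v' @ w' @ z) \<simeq> nf (?w @ w' @ z)" by (rule nf_append_cong)
    ultimately show ?thesis using w'(3)[OF z] by (meson rtranclp_trans)
  qed
  then have "triv (?v @ ?w @ v' @ w')" using l v' w' r by (simp add: triv_def)
  moreover have "r = R `` {?v @ ?w @ v' @ w'}"
    using free_product_mult_class[OF gA, of ?v ?w] free_product_mult_class[OF gA, of "?v @ ?w" v']
      free_product_mult_class[OF gA, of "?v @ ?w @ v'" w'] l v' w' r
    by (simp add: free_product_incl_def)
  ultimately show "r \<in> TN" by (auto simp: TN_def)
qed

lemma NC_TN: "NC \<subseteq> TN"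
  using normal_TN relators_TN by (auto simp: normal_closure_def)

text \<open>The normal form is an invariant of the element of the graph product: the elements of the free
  product that act trivially on normal forms form a normal subgroup containing the relators.\<close>

lemma ev_eq_nf:
  assumes x: "x \<in> lists L" and y: "y \<in> lists L" and eq: "ev x = ev y"
  shows "nf x \<simeq> nf y"
proof -
  have X: "R `` {x} \<in> carrier FP" "R `` {y} \<in> carrier FP"
    using x y free_product_class_closed by auto
  have "R `` {x} \<in> NC #>\<^bsub>FP\<^esub> R `` {x}"
    using F.rcos_self[OF X(1)] normal_imp_subgroup[OF normal_NC] by blast
  then have "R `` {x} \<in> NC #>\<^bsub>FP\<^esub> R `` {y}" using eq by (simp add: ev_def)
  then obtain Z where "Z \<in> NC" "R `` {x} = Z \<otimes>\<^bsub>FP\<^esub> R `` {y}"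
    by (auto simp: r_coset_def)
  then obtain z where z: "triv z" "R `` {x} = R `` {z} \<otimes>\<^bsub>FP\<^esub> R `` {y}"
    using NC_TN by (auto simp: TN_def)
  then have "R `` {x} = R `` {z @ y}"
    using free_product_mult_class[OF gA, of z y] y by (simp add: triv_def)
  then have "free_prod_eq V A x (z @ y)" using z x y by (intro class_eq) (auto simp: triv_def)
  then have "nf x \<simeq> nf (z @ y)" using free_prod_eq_nf[of x "z @ y" "[]"] by simp
  then show ?thesis using z y by (auto simp: triv_def intro: rtranclp_trans)
qed

lemma ev_act:
  assumes w: "red w" and v: "v \<in> V" "b \<in> carrier (A v)"
  shows "ev (act v b w) = ev ((v, b) # w)"
proof -
  interpret Av: group "A v" using grp v by blast
  have front: "ev w = ev ((v, head v w) # del v w)" if "red w" for w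
    using that
  proof (induction w)
    case Nil
    then show ?case using v ev_append[of "[(v, \<one>\<^bsub>A v\<^esub>)]" "[]"] by (simp add: ev_one ev_Nil)
  next
    case (Cons l w)
    obtain u c where l: "l = (u, c)" by force
    have wl: "w \<in> lists L" "del v w \<in> lists L" "u \<in> V" "c \<in> carrier (A u)"
      using Cons.prems l red_letters red_del by auto
    have hv: "head v w \<in> carrier (A v)" using Cons.prems l v red_head_closed by auto
    consider "u = v" | "u \<noteq> v" "adj u v" | "u \<noteq> v" "\<not> adj u v" by blast
    then show ?case
    proof cases
      case 2
      have "ev (l # w) = ev [(u, c)] \<otimes>\<^bsub>GP\<^esub> ev ((v, head v w) # del v w)"
        using Cons wl l ev_append[of "[l]" w] by simp
      also have "\<dots> = (ev [(u, c)] \<otimes>\<^bsub>GP\<^esub> ev [(v, head v w)]) \<otimes>\<^bsub>GP\<^esub> ev (del v w)"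
        using ev_append[of "[(v, head v w)]" "del v w"] wl hv v by (simp add: Q.m_assoc)
      also have "\<dots> = ev [(v, head v w)] \<otimes>\<^bsub>GP\<^esub> ev [(u, c)] \<otimes>\<^bsub>GP\<^esub> ev (del v w)"
        using ev_comm[of u v c "head v w"] 2 wl hv v by simp
      also have "\<dots> = ev ([(v, head v w)] @ [(u, c)] @ del v w)"
        using wl hv v by (simp add: ev_append Q.m_assoc del: append_Cons)
      finally show ?thesis using 2 l by simp
    next
      case 3
      then show ?thesis
        using v l wl ev_append[of "[(v, \<one>\<^bsub>A v\<^esub>)]" "l # w"] by (simp add: ev_one)
    qed (simp add: l)
  qed
  have dl: "del v w \<in> lists L" "w \<in> lists L" using w red_letters red_del by auto
  have hv: "head v w \<in> carrier (A v)" using w v red_head_closed by auto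
  have "ev ((v, b) # w) = ev [(v, b)] \<otimes>\<^bsub>GP\<^esub> (ev [(v, head v w)] \<otimes>\<^bsub>GP\<^esub> ev (del v w))"
    using ev_append[of "[(v, b)]" w] ev_append[of "[(v, head v w)]" "del v w"] front[OF w] v dl hv by simp
  also have "\<dots> = ev [(v, b \<otimes>\<^bsub>A v\<^esub> head v w)] \<otimes>\<^bsub>GP\<^esub> ev (del v w)"
    using v dl hv by (simp add: Q.m_assoc[symmetric] ev_mult)
  also have "\<dots> = ev ((v, b \<otimes>\<^bsub>A v\<^esub> head v w) # del v w)"
    using ev_append[of "[(v, b \<otimes>\<^bsub>A v\<^esub> head v w)]" "del v w"] v dl hv by simp
  also have "\<dots> = ev (act v b w)"
    using ev_append[of "[(v, \<one>\<^bsub>A v\<^esub>)]" "del v w"] v dl by (auto simp: act_def cons_def ev_one)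
  finally show ?thesis by simp
qed

lemma ev_nf: "w \<in> lists L \<Longrightarrow> ev (nf w) = ev w"
proof (induction w)
  case (Cons l w)
  then obtain v b where l: "l = (v, b)" "v \<in> V" "b \<in> carrier (A v)" by (cases l) auto
  have "red (nf w)" using Cons red_nf by auto
  then have "ev (nf (l # w)) = ev [l] \<otimes>\<^bsub>GP\<^esub> ev (nf w)"
    using l ev_append[of "[l]" "nf w"] red_letters by (simp add: ev_act)
  then show ?case using Cons l ev_append[of "[l]" w] by simp
qed simp

lemma red_rep: "g \<in> carrier GP \<Longrightarrow> \<exists>w. red w \<and> ev w = g"
  using ev_surj ev_nf red_nf by metis

text \<open>The head as a function on the group. The chamber \<open>x\<close> has one side of each type, and
  \<open>y \<mapsto> hd v (x\<inverse> y)\<close> tells apart the sectors of the wall through its side of type \<open>v\<close>.\<close>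

definition hd :: "'v \<Rightarrow> ('v \<times> 'a) list set set \<Rightarrow> 'a" where
  "hd v g = head v (nf (SOME w. w \<in> lists L \<and> ev w = g))"

lemma hd_ev: assumes "w \<in> lists L" shows "hd v (ev w) = head v (nf w)"
proof -
  define w' where "w' = (SOME w'. w' \<in> lists L \<and> ev w' = ev w)"
  have "w' \<in> lists L \<and> ev w' = ev w" unfolding w'_def by (rule someI[of _ w]) (use assms in auto)
  then have "nf w' \<simeq> nf w" using assms by (intro ev_eq_nf) auto
  then show ?thesis unfolding hd_def w'_def[symmetric] by (rule eqv_head)
qed

lemma hd_red: "red w \<Longrightarrow> hd v (ev w) = head v w"
  using hd_ev[of w v] eqv_head[OF nf_red, of w v] red_letters by metis

lemma hd_closed: "v \<in> V \<Longrightarrow> g \<in> carrier GP \<Longrightarrow> hd v g \<in> carrier (A v)"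
  by (metis red_rep hd_red red_head_closed)

lemma hd_one: "hd v \<one>\<^bsub>GP\<^esub> = \<one>\<^bsub>A v\<^esub>"
  using hd_red[of "[]" v] by (simp add: ev_Nil)

definition mv :: "'v \<Rightarrow> 'a \<Rightarrow> ('v \<times> 'a) list set set \<Rightarrow> ('v \<times> 'a) list set set" where
  "mv v b g = ev [(v, b)] \<otimes>\<^bsub>GP\<^esub> g"

lemma mv_ev: "w \<in> lists L \<Longrightarrow> v \<in> V \<Longrightarrow> b \<in> carrier (A v) \<Longrightarrow> mv v b (ev w) = ev ((v, b) # w)"
  using ev_append[of "[(v, b)]" w] by (simp add: mv_def)

lemma hd_mv_same: "v \<in> V \<Longrightarrow> b \<in> carrier (A v) \<Longrightarrow> g \<in> carrier GP \<Longrightarrow>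
    hd v (mv v b g) = b \<otimes>\<^bsub>A v\<^esub> hd v g"
  using ev_surj[of g] by (auto simp: mv_ev hd_ev red_nf head_act_same)

lemma hd_mv_adj: "adj u v \<Longrightarrow> v \<in> V \<Longrightarrow> b \<in> carrier (A v) \<Longrightarrow> g \<in> carrier GP \<Longrightarrow>
    hd u (mv v b g) = hd u g"
  using ev_surj[of g] by (auto simp: mv_ev hd_ev red_nf head_act_adj)

lemma hd_exclusive: "g \<in> carrier GP \<Longrightarrow> hd w g \<noteq> \<one>\<^bsub>A w\<^esub> \<Longrightarrow> \<not> adj v w \<Longrightarrow> v \<noteq> w \<Longrightarrow>
    hd v g = \<one>\<^bsub>A v\<^esub>"
  by (metis red_rep hd_red head_exclusive)

lemma nf_types: "fst ` set (nf w) \<subseteq> fst ` set w"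
proof (induction w)
  case (Cons l w)
  have "set (del u x) \<subseteq> set x" for u x by (induction x) (auto split: if_splits)
  then have "set (act u b x) \<subseteq> insert (u, b \<otimes>\<^bsub>A u\<^esub> head u x) (set x)" for u b x
    by (auto simp: act_def cons_def)
  then have "fst ` set (act u b x) \<subseteq> insert u (fst ` set x)" for u b x
    by (metis fst_conv image_insert image_mono)
  from this[of "fst l" "snd l" "nf w"] Cons show ?case by (cases l) auto
qed simp

lemma head_no_type: "v \<notin> fst ` set w \<Longrightarrow> head v w = \<one>\<^bsub>A v\<^esub>"
proof (induction w)
  case (Cons l w)
  then show ?case by (cases l) auto
qed simp

lemma hd_no_type: "w \<in> lists L \<Longrightarrow> v \<notin> fst ` set w \<Longrightarrow> hd v (ev w) = \<one>\<^bsub>A v\<^esub>"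
  using nf_types[of w] by (auto simp: hd_ev intro!: head_no_type)

text \<open>Multiplication by a letter on the right crosses a single wall. A change of the head of type
  \<open>v\<close> forces the letter to have type \<open>v\<close> and to commute with everything before it: otherwise
  some syllable of the word hides it from the front.\<close>

lemma head_change:
  assumes "red w" "j \<in> V" "c \<in> carrier (A j)" "v \<in> V" "hd v (ev (w @ [(j, c)])) \<noteq> hd v (ev w)"
  shows "v = j \<and> (\<forall>u\<in>fst ` set w. u = j \<or> adj u j)"
  using assms
proof (induction w arbitrary: v)
  case Nil
  then have "red [(j, c)]" by (cases "c = \<one>\<^bsub>A j\<^esub>") (auto simp: ev_one ev_Nil)
  then show ?case
    using Nil hd_red[of "[(j, c)]" v] hd_red[of "[]" v] by (auto simp: ev_one ev_Nil hd_one split: if_splits)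
next
  case (Cons l w)
  obtain t b where l: "l = (t, b)" by force
  have w: "red w" "w \<in> lists L" "t \<in> V" "b \<in> carrier (A t)" "b \<noteq> \<one>\<^bsub>A t\<^esub>" "head t w = \<one>\<^bsub>A t\<^esub>"
    using Cons.prems l red_letters by auto
  interpret At: group "A t" using grp w by blast
  have wc: "w @ [(j, c)] \<in> lists L" "ev (w @ [(j, c)]) \<in> carrier GP" "ev w \<in> carrier GP" using w Cons.prems by auto
  have e: "ev ((l # w) @ [(j, c)]) = mv t b (ev (w @ [(j, c)]))" "ev (l # w) = mv t b (ev w)"
    using w wc l by (auto simp: mv_ev)
  consider "t = v" | "t \<noteq> v" "adj t v" | "t \<noteq> v" "\<not> adj t v" by blast
  then show ?case
  proof cases
    case 1
    have "hd v (ev (w @ [(j, c)])) \<noteq> hd v (ev w)"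
      using Cons.prems(5) w wc 1 unfolding e by (auto simp: hd_mv_same)
    then show ?thesis using Cons.IH[of v] Cons.prems w 1 l by auto
  next
    case 2
    have "adj v t" using 2 by blast
    then have "hd v (ev (w @ [(j, c)])) \<noteq> hd v (ev w)"
      using Cons.prems(5) w wc 2 unfolding e by (auto simp: hd_mv_adj)
    then show ?thesis using Cons.IH[of v] Cons.prems w 2 l by auto
  next
    case 3
    have 1: "hd v (ev (l # w)) = \<one>\<^bsub>A v\<^esub>" using hd_red[OF Cons.prems(1), of v] l 3 by simp
    have "hd t (ev ((l # w) @ [(j, c)])) = \<one>\<^bsub>A t\<^esub>"
      using hd_exclusive[of "ev ((l # w) @ [(j, c)])" v t] 1 Cons.prems(5) 3 wc e w
      by (auto simp: mv_def)
    then have "b \<otimes>\<^bsub>A t\<^esub> hd t (ev (w @ [(j, c)])) = \<one>\<^bsub>A t\<^esub>" using e w wc by (simp add: hd_mv_same)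
    then have "hd t (ev (w @ [(j, c)])) \<noteq> hd t (ev w)"
      using hd_red[OF w(1), of t] w by auto
    then have t: "t = j" "\<forall>u\<in>fst ` set w. u = j \<or> adj u j"
      using Cons.IH[of t] Cons.prems w by auto
    have "v \<notin> fst ` set ((l # w) @ [(j, c)])" using t 3 l by auto
    then have "hd v (ev ((l # w) @ [(j, c)])) = \<one>\<^bsub>A v\<^esub>"
      using wc w l by (intro hd_no_type) auto
    with 1 Cons.prems(5) show ?thesis by simp
  qed
qed

lemma hd_star:
  assumes "w \<in> lists L" "\<forall>u\<in>fst ` set w. u = j \<or> adj u j" "j \<in> V" "z \<in> carrier GP"
  shows "hd j (ev w \<otimes>\<^bsub>GP\<^esub> z) = hd j (ev w) \<otimes>\<^bsub>A j\<^esub> hd j z"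
  using assms
proof (induction w rule: list.induct)
  case Nil
  interpret Aj: group "A j" using grp Nil by blast
  show ?case using Nil hd_closed by (simp add: ev_Nil hd_one)
next
  case (Cons l w)
  obtain t b where l: "l = (t, b)" by force
  interpret Aj: group "A j" using grp Cons by blast
  have w: "w \<in> lists L" "t \<in> V" "b \<in> carrier (A t)" "ev w \<in> carrier GP" "ev w \<otimes>\<^bsub>GP\<^esub> z \<in> carrier GP"
    using Cons.prems l by auto
  have e: "ev (l # w) = mv t b (ev w)" "ev (l # w) \<otimes>\<^bsub>GP\<^esub> z = mv t b (ev w \<otimes>\<^bsub>GP\<^esub> z)"
    using w l Cons.prems ev_append[of "[l]" w] by (auto simp: mv_def Q.m_assoc)
  have IH: "hd j (ev w \<otimes>\<^bsub>GP\<^esub> z) = hd j (ev w) \<otimes>\<^bsub>A j\<^esub> hd j z" using Cons by auto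
  have c: "hd j (ev w) \<in> carrier (A j)" "hd j z \<in> carrier (A j)" using hd_closed w Cons.prems by auto
  consider "t = j" | "adj j t" using Cons.prems l by auto
  then show ?case
    unfolding e(2) unfolding e(1) using w Cons.prems(3) IH c
    by cases (auto simp: hd_mv_same hd_mv_adj Aj.m_assoc)
qed

text \<open>A wall is encoded by the equivalence relation whose classes are its sectors, so that it does not
  depend on the chamber from which it is described.\<close>

definition wall :: "('v \<times> 'a) list set set \<Rightarrow> 'v \<Rightarrow> (('v \<times> 'a) list set set \<times> ('v \<times> 'a) list set set) set" where
  "wall x v = {(y, z). y \<in> carrier GP \<and> z \<in> carrier GP \<and>
     hd v (inv\<^bsub>GP\<^esub> x \<otimes>\<^bsub>GP\<^esub> y) = hd v (inv\<^bsub>GP\<^esub> x \<otimes>\<^bsub>GP\<^esub> z)}"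

definition walls :: "(('v \<times> 'a) list set set \<times> ('v \<times> 'a) list set set) set set" where
  "walls = {wall x v | x v. x \<in> carrier GP \<and> v \<in> V}"

text \<open>Two adjacent chambers are separated by one wall only, the one through their common side.
  Therefore the number of walls between two elements is a lower bound for their word distance.\<close>

lemma wall_crossed:
  assumes x: "x \<in> carrier GP" "v \<in> V" and y: "y \<in> carrier GP" and c: "j \<in> V" "c \<in> carrier (A j)"
    and sep: "(y, y \<otimes>\<^bsub>GP\<^esub> ev [(j, c)]) \<notin> wall x v"
  shows "wall x v = wall y j"
proof -
  let ?p = "inv\<^bsub>GP\<^esub> x \<otimes>\<^bsub>GP\<^esub> y"
  have p: "?p \<in> carrier GP" using x y by simp
  obtain w where w: "red w" "ev w = ?p" using red_rep[OF p] by blast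
  have wl: "w \<in> lists L" using w red_letters by blast
  have "ev (w @ [(j, c)]) = inv\<^bsub>GP\<^esub> x \<otimes>\<^bsub>GP\<^esub> (y \<otimes>\<^bsub>GP\<^esub> ev [(j, c)])"
    using ev_append[of w "[(j, c)]"] wl w x y c by (simp add: Q.m_assoc)
  then have "hd v (ev (w @ [(j, c)])) \<noteq> hd v (ev w)"
    using sep x y c w by (auto simp: wall_def)
  then have j: "v = j" "\<forall>u\<in>fst ` set w. u = j \<or> adj u j" using head_change[OF w(1) c x(2)] by auto
  interpret Aj: group "A j" using grp c by blast
  have "hd j (inv\<^bsub>GP\<^esub> x \<otimes>\<^bsub>GP\<^esub> z) = hd j ?p \<otimes>\<^bsub>A j\<^esub> hd j (inv\<^bsub>GP\<^esub> y \<otimes>\<^bsub>GP\<^esub> z)" if z: "z \<in> carrier GP" for z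
  proof -
    have "inv\<^bsub>GP\<^esub> x \<otimes>\<^bsub>GP\<^esub> z = ev w \<otimes>\<^bsub>GP\<^esub> (inv\<^bsub>GP\<^esub> y \<otimes>\<^bsub>GP\<^esub> z)"
    proof -
      have "y \<otimes>\<^bsub>GP\<^esub> (inv\<^bsub>GP\<^esub> y \<otimes>\<^bsub>GP\<^esub> z) = z"
        using y z Q.m_assoc[of y "inv\<^bsub>GP\<^esub> y" z] by simp
      then show ?thesis using x y z w Q.m_assoc[of "inv\<^bsub>GP\<^esub> x" y "inv\<^bsub>GP\<^esub> y \<otimes>\<^bsub>GP\<^esub> z"] by simp
    qed
    then show ?thesis using hd_star[OF wl j(2) c(1)] x y z w(2) by simp
  qed
  note eq = this
  have cl: "hd j ?p \<in> carrier (A j)" "hd j (inv\<^bsub>GP\<^esub> y \<otimes>\<^bsub>GP\<^esub> z) \<in> carrier (A j)" if "z \<in> carrier GP" for z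
    using that p y hd_closed[OF c(1)] by auto
  have "hd j (inv\<^bsub>GP\<^esub> x \<otimes>\<^bsub>GP\<^esub> z) = hd j (inv\<^bsub>GP\<^esub> x \<otimes>\<^bsub>GP\<^esub> z') \<longleftrightarrow>
      hd j (inv\<^bsub>GP\<^esub> y \<otimes>\<^bsub>GP\<^esub> z) = hd j (inv\<^bsub>GP\<^esub> y \<otimes>\<^bsub>GP\<^esub> z')"
    if "z \<in> carrier GP" "z' \<in> carrier GP" for z z'
    unfolding eq[OF that(1)] eq[OF that(2)] using cl that by simp
  then show ?thesis unfolding wall_def j(1) by blast
qed

definition separating where
  "separating y z = {W \<in> walls. (y, z) \<notin> W}"

lemma separating_word:
  assumes "w \<in> lists L" "y \<in> carrier GP"
  shows "finite (separating y (y \<otimes>\<^bsub>GP\<^esub> ev w)) \<and> card (separating y (y \<otimes>\<^bsub>GP\<^esub> ev w)) \<le> length w"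
  using assms
proof (induction w arbitrary: y rule: list.induct)
  case Nil
  then have "separating y (y \<otimes>\<^bsub>GP\<^esub> ev []) = {}"
    by (auto simp: separating_def walls_def wall_def ev_Nil)
  then show ?case by simp
next
  case (Cons l w)
  obtain j c where l: "l = (j, c)" by force
  have w: "w \<in> lists L" "j \<in> V" "c \<in> carrier (A j)" using Cons.prems l by auto
  let ?y = "y \<otimes>\<^bsub>GP\<^esub> ev [(j, c)]" and ?z = "y \<otimes>\<^bsub>GP\<^esub> ev (l # w)"
  have y': "?y \<in> carrier GP" using Cons.prems w by auto
  have z: "?z = ?y \<otimes>\<^bsub>GP\<^esub> ev w" using ev_append[of "[l]" w] l w Cons.prems by (simp add: Q.m_assoc)
  have IH: "finite (separating ?y ?z)" "card (separating ?y ?z) \<le> length w"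
    using Cons.IH[OF w(1) y'] z by auto
  have "separating y ?z \<subseteq> insert (wall y j) (separating ?y ?z)"
  proof
    fix W assume W: "W \<in> separating y ?z"
    then obtain x v where x: "x \<in> carrier GP" "v \<in> V" "W = wall x v"
      by (auto simp: separating_def walls_def)
    show "W \<in> insert (wall y j) (separating ?y ?z)"
    proof (cases "(y, ?y) \<in> W")
      case True
      then have "(?y, ?z) \<notin> W" using W x by (auto simp: separating_def wall_def)
      then show ?thesis using W by (auto simp: separating_def)
    next
      case False
      then show ?thesis using wall_crossed[OF x(1,2) _ w(2,3), of y] Cons.prems x(3) by simp
    qed
  qed
  then show ?case
    using IH card_mono[of "insert (wall y j) (separating ?y ?z)" "separating y ?z"]
    by (auto intro: finite_subset simp: card_insert_if split: if_splits)
qed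

end

section \<open>Types around a cycle and chains of chambers\<close>

text \<open>Types are vertices of the \<open>N\<close>-cycle, represented by arbitrary integers. Two types are equal,
  adjacent, or far from each other.\<close>

definition eqt :: "int \<Rightarrow> int \<Rightarrow> int \<Rightarrow> bool" where
  "eqt N v w \<longleftrightarrow> N dvd v - w"

definition adjt :: "int \<Rightarrow> int \<Rightarrow> int \<Rightarrow> bool" where
  "adjt N v w \<longleftrightarrow> N dvd v - w - 1 \<or> N dvd v - w + 1"

definition far :: "int \<Rightarrow> int \<Rightarrow> int \<Rightarrow> bool" where
  "far N v w \<longleftrightarrow> \<not> eqt N v w \<and> \<not> adjt N v w"

lemma not_dvd_small: "0 < k \<Longrightarrow> k < N \<Longrightarrow> \<not> N dvd (k::int)" "k < 0 \<Longrightarrow> - N < k \<Longrightarrow> \<not> N dvd k"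
  using zdvd_not_zless[of k N] zdvd_not_zless[of "-k" N] by auto

lemma eqt_refl [simp]: "eqt N v v"
  by (simp add: eqt_def)

lemma eqt_sym: "eqt N v w \<Longrightarrow> eqt N w v"
  unfolding eqt_def by (metis dvd_minus_iff minus_diff_eq)

lemma eqt_trans: "eqt N u v \<Longrightarrow> eqt N v w \<Longrightarrow> eqt N u w"
  unfolding eqt_def by (metis add_diff_eq diff_add_cancel dvd_add)

lemma adjt_sym: "adjt N v w \<Longrightarrow> adjt N w v"
  unfolding adjt_def
  by (metis add.commute diff_diff_eq2 dvd_minus_iff minus_diff_eq uminus_add_conv_diff diff_add_eq)

lemma far_sym: "far N v w \<Longrightarrow> far N w v"
  unfolding far_def using eqt_sym adjt_sym by blast

lemma eqt_iff_mod: "eqt N v w \<longleftrightarrow> v mod N = w mod N"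
  by (simp add: eqt_def mod_eq_dvd_iff)

lemma adjt_cong: "eqt N v v' \<Longrightarrow> eqt N w w' \<Longrightarrow> adjt N v w \<longleftrightarrow> adjt N v' w'"
proof -
  have *: "N dvd v - w + k \<longleftrightarrow> N dvd v' - w' + k" if "N dvd v - v'" "N dvd w - w'" for k
  proof -
    have "v - w + k = (v' - w' + k) + ((v - v') - (w - w'))" by simp
    moreover have "N dvd (v - v') - (w - w')" using that by (rule dvd_diff)
    ultimately show ?thesis using dvd_add_left_iff by metis
  qed
  assume "eqt N v v'" "eqt N w w'"
  then show ?thesis using *[of "-1"] *[of 1] by (simp add: adjt_def eqt_def)
qed

lemma eqt_cong: "eqt N v v' \<Longrightarrow> eqt N w w' \<Longrightarrow> eqt N v w \<longleftrightarrow> eqt N v' w'"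
  by (meson eqt_sym eqt_trans)

lemma far_cong: "eqt N v v' \<Longrightarrow> eqt N w w' \<Longrightarrow> far N v w \<longleftrightarrow> far N v' w'"
  unfolding far_def using adjt_cong eqt_cong by metis

lemma far_small:
  assumes "2 \<le> \<bar>v - w\<bar>" "\<bar>v - w\<bar> \<le> N - 2"
  shows "far N v w"
proof -
  have "\<not> N dvd v - w" "\<not> N dvd v - w - 1" "\<not> N dvd v - w + 1"
    using assms by (cases "v - w > 0"; intro not_dvd_small; linarith)+
  then show ?thesis by (simp add: far_def eqt_def adjt_def)
qed

lemma adjt_small: "\<bar>v - w\<bar> = 1 \<Longrightarrow> adjt N v w"
proof -
  assume "\<bar>v - w\<bar> = 1"
  then have "v - w - 1 = 0 \<or> v - w + 1 = 0" by linarith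
  then show ?thesis unfolding adjt_def by fastforce
qed

lemma eqt_minus: "eqt N (- v) (- w) \<longleftrightarrow> eqt N v w"
  unfolding eqt_def by (metis dvd_minus_iff minus_diff_minus)

lemma adjt_minus: "adjt N (- v) (- w) \<longleftrightarrow> adjt N v w"
proof -
  have "- v - - w - 1 = - (v - w + 1)" "- v - - w + 1 = - (v - w - 1)" by auto
  then show ?thesis unfolding adjt_def by (metis dvd_minus_iff)
qed

lemma far_minus: "far N (- v) (- w) \<longleftrightarrow> far N v w"
  by (simp add: far_def eqt_minus adjt_minus)

lemma cycle_adj:
  assumes "2 < M" "i < M" "j < M"
  shows "{i, j} \<in> cycle_edges M \<longleftrightarrow> adjt (int M) (int i) (int j)"
proof -
  have s: "int M dvd int (Suc i mod M) - int i - 1" for i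
    by (metis diff_diff_eq mod_eq_dvd_iff of_nat_Suc of_nat_mod mod_mod_trivial add.commute)
  have d: "int M dvd int i - int j \<longleftrightarrow> i = j" if "i < M" "j < M" for i j
    using that by (metis mod_eq_dvd_iff mod_less nat_int of_nat_mod)
  have S: "Suc i mod M = j \<longleftrightarrow> int M dvd int j - int i - 1" if "i < M" "j < M" for i j
  proof -
    have "Suc i mod M = j \<longleftrightarrow> int M dvd int (Suc i mod M) - int j" using that by (subst d) auto
    also have "int (Suc i mod M) - int j = (int (Suc i mod M) - int i - 1) - (int j - int i - 1)" by simp
    also have "int M dvd \<dots> \<longleftrightarrow> int M dvd int j - int i - 1" using s[of i] by (metis dvd_diff_right_iff dvd_diff_commute dvd_diff_left_iff)
    finally show ?thesis .
  qed
  have "{i, j} \<in> cycle_edges M \<longleftrightarrow> Suc i mod M = j \<or> Suc j mod M = i"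
    using assms by (auto simp: cycle_edges_def doubleton_eq_iff)
  also have "\<dots> \<longleftrightarrow> int M dvd int j - int i - 1 \<or> int M dvd int i - int j - 1" using S assms by simp
  also have "int M dvd int j - int i - 1 \<longleftrightarrow> int M dvd int i - int j + 1"
    by (metis (no_types, opaque_lifting) dvd_minus_iff minus_diff_eq diff_diff_eq add_diff_eq uminus_add_conv_diff diff_minus_eq_add)
  finally show ?thesis by (auto simp: adjt_def)
qed

text \<open>The part of the geometry of the graph product over the \<open>N\<close>-cycle that is needed below: a set
  of points, the action \<open>mv\<close> of the vertex groups on it and the heads \<open>hd\<close>. The setting is closed
  under rotations and reflections of the cycle, which saves many symmetric cases.\<close>

locale heads =
  fixes N :: int and Bt :: "int \<Rightarrow> 'b monoid" and Y :: "'y set"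
    and mv :: "int \<Rightarrow> 'b \<Rightarrow> 'y \<Rightarrow> 'y" and hd :: "int \<Rightarrow> 'y \<Rightarrow> 'b"
  assumes N: "N \<ge> 7"
    and grp: "group (Bt v)"
    and per: "eqt N v w \<Longrightarrow> Bt v = Bt w \<and> mv v = mv w \<and> hd v = hd w"
    and mv_closed [simp]: "b \<in> carrier (Bt v) \<Longrightarrow> y \<in> Y \<Longrightarrow> mv v b y \<in> Y"
    and mv_one: "y \<in> Y \<Longrightarrow> mv v \<one>\<^bsub>Bt v\<^esub> y = y"
    and mv_mult: "b \<in> carrier (Bt v) \<Longrightarrow> c \<in> carrier (Bt v) \<Longrightarrow> y \<in> Y \<Longrightarrow>
      mv v b (mv v c y) = mv v (b \<otimes>\<^bsub>Bt v\<^esub> c) y"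
    and mv_comm: "adjt N v w \<Longrightarrow> b \<in> carrier (Bt v) \<Longrightarrow> c \<in> carrier (Bt w) \<Longrightarrow> y \<in> Y \<Longrightarrow>
      mv v b (mv w c y) = mv w c (mv v b y)"
    and hd_closed [simp]: "y \<in> Y \<Longrightarrow> hd v y \<in> carrier (Bt v)"
    and hd_mv: "b \<in> carrier (Bt v) \<Longrightarrow> y \<in> Y \<Longrightarrow> hd v (mv v b y) = b \<otimes>\<^bsub>Bt v\<^esub> hd v y"
    and hd_adj: "adjt N v w \<Longrightarrow> b \<in> carrier (Bt w) \<Longrightarrow> y \<in> Y \<Longrightarrow> hd v (mv w b y) = hd v y"
    and hd_far: "far N v w \<Longrightarrow> y \<in> Y \<Longrightarrow> hd w y \<noteq> \<one>\<^bsub>Bt w\<^esub> \<Longrightarrow> hd v y = \<one>\<^bsub>Bt v\<^esub>"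
begin

lemma inv_cl [simp]: "b \<in> carrier (Bt v) \<Longrightarrow> inv\<^bsub>Bt v\<^esub> b \<in> carrier (Bt v)"
  using grp by (rule group.inv_closed)

lemma mult_cl [simp]: "b \<in> carrier (Bt v) \<Longrightarrow> c \<in> carrier (Bt v) \<Longrightarrow> b \<otimes>\<^bsub>Bt v\<^esub> c \<in> carrier (Bt v)"
  using grp by (simp add: group.is_monoid monoid.m_closed)

lemma one_cl [simp]: "\<one>\<^bsub>Bt v\<^esub> \<in> carrier (Bt v)"
  using grp by (simp add: group.is_monoid monoid.one_closed)

lemma inv_mult_eq: "b \<in> carrier (Bt v) \<Longrightarrow> c \<in> carrier (Bt v) \<Longrightarrow>
    inv\<^bsub>Bt v\<^esub> b \<otimes>\<^bsub>Bt v\<^esub> c = \<one>\<^bsub>Bt v\<^esub> \<longleftrightarrow> c = b"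
  using grp[of v] by (metis group.inv_solve_left group.l_inv group.is_monoid monoid.r_one one_cl)

lemma heads_minus: "heads N (\<lambda>v. Bt (- v)) Y (\<lambda>v. mv (- v)) (\<lambda>v. hd (- v))"
proof (rule heads.intro)
  show "eqt N v w \<Longrightarrow> Bt (- v) = Bt (- w) \<and> mv (- v) = mv (- w) \<and> hd (- v) = hd (- w)" for v w
    using per[of "- v" "- w"] by (simp add: eqt_minus)
  show "far N v w \<Longrightarrow> y \<in> Y \<Longrightarrow> hd (- w) y \<noteq> \<one>\<^bsub>Bt (- w)\<^esub> \<Longrightarrow> hd (- v) y = \<one>\<^bsub>Bt (- v)\<^esub>" for v w y
    using hd_far[of "- v" "- w"] by (simp add: far_minus)
  show "adjt N v w \<Longrightarrow> b \<in> carrier (Bt (- v)) \<Longrightarrow> c \<in> carrier (Bt (- w)) \<Longrightarrow> y \<in> Y \<Longrightarrow>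
      mv (- v) b (mv (- w) c y) = mv (- w) c (mv (- v) b y)" for v w b c y
    using mv_comm[of "- v" "- w"] by (simp add: adjt_minus)
qed (auto simp: N grp mv_one mv_mult hd_mv hd_adj adjt_minus)

lemma mv_inv1 [simp]: "b \<in> carrier (Bt v) \<Longrightarrow> y \<in> Y \<Longrightarrow> mv v b (mv v (inv\<^bsub>Bt v\<^esub> b) y) = y"
  using grp[of v] by (simp add: mv_mult mv_one group.r_inv)

lemma mv_inv2 [simp]: "b \<in> carrier (Bt v) \<Longrightarrow> y \<in> Y \<Longrightarrow> mv v (inv\<^bsub>Bt v\<^esub> b) (mv v b y) = y"
  using grp[of v] by (simp add: mv_mult mv_one group.l_inv)

lemma inv_eq_one: "b \<in> carrier (Bt v) \<Longrightarrow> inv\<^bsub>Bt v\<^esub> b = \<one>\<^bsub>Bt v\<^esub> \<longleftrightarrow> b = \<one>\<^bsub>Bt v\<^esub>"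
  using grp[of v] by (metis group.inv_inv group.is_monoid monoid.inv_one)

lemma inv_inv [simp]: "b \<in> carrier (Bt v) \<Longrightarrow> inv\<^bsub>Bt v\<^esub> (inv\<^bsub>Bt v\<^esub> b) = b"
  using grp[of v] by (simp add: group.inv_inv)

lemma heads_shift: "heads N (\<lambda>v. Bt (c + v)) Y (\<lambda>v. mv (c + v)) (\<lambda>v. hd (c + v))"
proof -
  have "eqt N (c + v) (c + w) = eqt N v w" "adjt N (c + v) (c + w) = adjt N v w" for v w
    by (auto simp: eqt_def adjt_def)
  moreover from this have "far N (c + v) (c + w) = far N v w" for v w by (simp add: far_def)
  ultimately show ?thesis
    using per hd_far[of "c + _" "c + _"]
    by (intro heads.intro) (auto simp: N grp mv_one mv_mult hd_mv hd_adj intro: mv_comm)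
qed

end

text \<open>A chain of chambers \<open>y\<^sub>0, \<dots>, y\<^sub>C\<close>, where \<open>y\<^sub>k\<^sub>+\<^sub>1 = y\<^sub>k (g k)\<close> lies across the side of type \<open>t k\<close> of
  \<open>y\<^sub>k\<close>. The point \<open>P k = y\<^sub>k\<inverse> y\<close> is a fixed point \<open>y\<close> as seen from the chamber \<open>y\<^sub>k\<close>. The jumps say that
  consecutive glued sides are neighbours or have one side between them.\<close>

locale chain_pts = heads +
  fixes C :: nat and t :: "nat \<Rightarrow> int" and g :: "nat \<Rightarrow> 'a" and P :: "nat \<Rightarrow> 'b"
  assumes g [simp]: "k < C \<Longrightarrow> g k \<in> carrier (Bt (t k))"
    and g_ne: "k < C \<Longrightarrow> g k \<noteq> \<one>\<^bsub>Bt (t k)\<^esub>"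
    and P [simp]: "k \<le> C \<Longrightarrow> P k \<in> Y"
    and P_Suc: "k < C \<Longrightarrow> P (Suc k) = mv (t k) (inv\<^bsub>Bt (t k)\<^esub> (g k)) (P k)"
    and jump: "Suc k < C \<Longrightarrow> t (Suc k) = t k + 1 \<or> t (Suc k) = t k + 2"
begin

abbreviation "one_at v \<equiv> \<one>\<^bsub>Bt v\<^esub>"

text \<open>The sector of the \<open>k\<close>-th glued wall that contains the point: it is \<open>\<one>\<close> on the side of
  the chamber \<open>k\<close>, \<open>g k\<close> on the side of the chamber \<open>k + 1\<close>, and anything else when the point branches
  off there.\<close>

definition a :: "nat \<Rightarrow> 'a" where "a k = hd (t k) (P k)"

lemma next_same: "k < C \<Longrightarrow> hd (t k) (P (Suc k)) = inv\<^bsub>Bt (t k)\<^esub> (g k) \<otimes>\<^bsub>Bt (t k)\<^esub> a k"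
  by (simp add: P_Suc hd_mv a_def)

lemma next_same_one: "k < C \<Longrightarrow> hd (t k) (P (Suc k)) = one_at (t k) \<longleftrightarrow> a k = g k"
  by (simp add: next_same inv_mult_eq a_def)

lemma next_adj: "k < C \<Longrightarrow> adjt N v (t k) \<Longrightarrow> hd v (P (Suc k)) = hd v (P k)"
  by (simp add: P_Suc hd_adj)

lemma before: "k < C \<Longrightarrow> a k \<noteq> g k \<Longrightarrow> far N v (t k) \<Longrightarrow> hd v (P (Suc k)) = one_at v"
  using hd_far[of v "t k" "P (Suc k)"] next_same_one[of k] by auto

lemma after: "k < C \<Longrightarrow> a k \<noteq> one_at (t k) \<Longrightarrow> far N v (t k) \<Longrightarrow> hd v (P k) = one_at v"
  using hd_far[of v "t k" "P k"] by (auto simp: a_def)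

lemma a_one_before: "k < C \<Longrightarrow> a k = one_at (t k) \<Longrightarrow> a k \<noteq> g k"
  using g_ne by metis

lemma before_jump2: "Suc k < C \<Longrightarrow> a k \<noteq> g k \<Longrightarrow> t (Suc k) = t k + 2 \<Longrightarrow> a (Suc k) = one_at (t (Suc k))"
  using before[of k "t (Suc k)"] far_small[of "t (Suc k)" "t k" N] N by (simp add: a_def)

lemma a_jump1: "Suc k < C \<Longrightarrow> t (Suc k) = t k + 1 \<Longrightarrow> a (Suc k) = hd (t (Suc k)) (P k)"
  using next_adj[of k "t (Suc k)"] adjt_small[of "t (Suc k)" "t k" N] by (simp add: a_def)

lemma before_jump1:
  assumes "Suc k < C" "a k \<noteq> g k" "t (Suc k) = t k + 1" "far N v (t k)"
  shows "hd v (P (Suc (Suc k))) = one_at v"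
proof -
  have "hd (t k) (P (Suc (Suc k))) = hd (t k) (P (Suc k))"
    using assms by (intro next_adj) (auto intro: adjt_small)
  then have "hd (t k) (P (Suc (Suc k))) \<noteq> one_at (t k)" using assms next_same_one[of k] by simp
  then show ?thesis using hd_far[OF assms(4), of "P (Suc (Suc k))"] assms(1) by simp
qed

lemma before2:
  assumes k: "Suc (Suc k) < C" "a k \<noteq> g k"
  shows "a (Suc (Suc k)) = one_at (t (Suc (Suc k)))"
proof -
  have k': "Suc k < C" "k < C" using k by auto
  from jump[OF k'(1)] show ?thesis
  proof
    assume 1: "t (Suc k) = t k + 1"
    have "hd (t (Suc (Suc k))) (P (Suc (Suc k))) = one_at (t (Suc (Suc k)))"
      using jump[OF k(1)] 1 N by (intro before_jump1[OF k'(1) k(2) 1] far_small) auto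
    then show ?thesis by (simp add: a_def)
  next
    assume 2: "t (Suc k) = t k + 2"
    have a1: "a (Suc k) = one_at (t (Suc k))" using before_jump2[OF k'(1) k(2) 2] .
    from jump[OF k(1)] show ?thesis
    proof
      assume "t (Suc (Suc k)) = t (Suc k) + 2"
      then show ?thesis using before_jump2[OF k(1)] a_one_before[OF k'(1) a1] by blast
    next
      assume 3: "t (Suc (Suc k)) = t (Suc k) + 1"
      have "hd (t (Suc (Suc k))) (P (Suc k)) = one_at (t (Suc (Suc k)))"
        using 2 3 N by (intro before[OF k'(2) k(2)] far_small) auto
      then show ?thesis using a_jump1[OF k(1) 3] by simp
    qed
  qed
qed

lemma before3:
  assumes k: "Suc (Suc (Suc k)) < C" "a k \<noteq> g k"
  shows "a (Suc (Suc (Suc k))) = one_at (t (Suc (Suc (Suc k))))"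
proof -
  have k': "Suc (Suc k) < C" "Suc k < C" "k < C" using k by auto
  from jump[OF k'(2)] show ?thesis
  proof
    assume 2: "t (Suc k) = t k + 2"
    have "a (Suc k) \<noteq> g (Suc k)" using a_one_before before_jump2[OF k'(2) k(2) 2] k'(2) by blast
    then show ?thesis by (rule before2[OF k(1)])
  next
    assume 1: "t (Suc k) = t k + 1"
    have a2: "a (Suc (Suc k)) \<noteq> g (Suc (Suc k))" using a_one_before before2[OF k'(1) k(2)] k'(1) by blast
    from jump[OF k(1)] show ?thesis
    proof
      assume "t (Suc (Suc (Suc k))) = t (Suc (Suc k)) + 2"
      then show ?thesis using before_jump2[OF k(1) a2] by blast
    next
      assume 3: "t (Suc (Suc (Suc k))) = t (Suc (Suc k)) + 1"
      have "hd (t (Suc (Suc (Suc k)))) (P (Suc (Suc k))) = one_at (t (Suc (Suc (Suc k))))"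
        using 1 3 jump[OF k'(1)] N by (intro before_jump1[OF k'(2) k(2) 1] far_small) auto
      then show ?thesis using a_jump1[OF k(1) 3] by simp
    qed
  qed
qed

text \<open>A point that does not pass through the \<open>k\<close>-th glued wall lies on the near side of all later
  ones from \<open>k + 2\<close> on. The wall \<open>k + 1\<close> is exempt because it crosses the wall \<open>k\<close> when the jump is \<open>1\<close>.\<close>

lemma before_chain:
  assumes "l < C" "k + 2 \<le> l" "a k \<noteq> g k"
  shows "a l = one_at (t l)"
  using assms
proof (induction "l - k" arbitrary: k rule: less_induct)
  case less
  consider "l = Suc (Suc k)" | "l = Suc (Suc (Suc k))" | "l \<ge> k + 4" using less.prems by linarith
  then show ?case
  proof cases
    case 3
    then have k: "Suc (Suc k) < C" using less.prems by simp
    have "a (Suc (Suc k)) \<noteq> g (Suc (Suc k))" using a_one_before[OF k] before2[OF k less.prems(3)] by blast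
    then show ?thesis using less.hyps[of "Suc (Suc k)"] less.prems 3 by auto
  qed (use before2 before3 less.prems in auto)
qed

text \<open>When the jump after \<open>k\<close> is \<open>1\<close>, the walls \<open>k\<close> and \<open>k + 1\<close> cross in a vertex around which the
  chambers \<open>k\<close>, \<open>k + 1\<close> and \<open>k + 2\<close> fill three quadrants: a reflex corner. The last side of chamber \<open>k\<close> at
  this corner lies on the wall \<open>k + 1\<close>, and so does the side glued between the two other chambers.
  A sector of this wall is thus behind the reflex side only in part. The definition singles out
  that part: it consists of the points outside the sector \<open>g k\<close> of the wall \<open>k\<close>, and of those which are
  also behind the side of type \<open>t k - 1\<close> of the chamber across the reflex side.\<close>

definition early :: "nat \<Rightarrow> bool" where
  "early k \<longleftrightarrow> Suc k < C \<and> t (Suc k) = t k + 1 \<and>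
     a (Suc k) \<noteq> one_at (t (Suc k)) \<and> a (Suc k) \<noteq> g (Suc k) \<and>
     (a k \<noteq> g k \<or> hd (t k - 1) (mv (t (Suc k)) (inv\<^bsub>Bt (t (Suc k))\<^esub> (a (Suc k))) (P (Suc k))) \<noteq> one_at (t k - 1))"

lemma early_next:
  assumes "early k" "eqt N v (t k + 2)"
  shows "hd v (P (Suc k)) = one_at v"
proof -
  have k: "Suc k < C" "k < C" "t (Suc k) = t k + 1" using assms by (auto simp: early_def)
  have "hd (t k + 2) (P (Suc k)) = one_at (t k + 2)"
  proof (cases "a k = g k")
    case True
    let ?y = "mv (t (Suc k)) (inv\<^bsub>Bt (t (Suc k))\<^esub> (a (Suc k))) (P (Suc k))"
    have y: "?y \<in> Y" "hd (t k - 1) ?y \<noteq> one_at (t k - 1)" using True assms(1) k by (auto simp: early_def a_def)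
    have "hd (t k + 2) ?y = one_at (t k + 2)"
      using N by (intro hd_far[OF _ y] far_small) auto
    moreover have "hd (t k + 2) ?y = hd (t k + 2) (P (Suc k))"
      using k by (intro hd_adj adjt_small) (auto simp: a_def)
    ultimately show ?thesis by simp
  next
    case False
    then show ?thesis using N k by (intro before far_small) auto
  qed
  then show ?thesis using per[OF assms(2)] by simp
qed

lemma early_chain:
  assumes "early k" "l < C" "k + 2 \<le> l"
  shows "a l = one_at (t l)"
proof (cases "l = Suc (Suc k)")
  case True
  have k: "Suc k < C" "t (Suc k) = t k + 1" "a (Suc k) \<noteq> g (Suc k)" using assms by (auto simp: early_def)
  from jump[of "Suc k"] True assms(2)
  consider "t l = t (Suc k) + 1" | "t l = t (Suc k) + 2" by auto
  then show ?thesis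
  proof cases
    case 1
    then have "t l = t k + 2" using k(2) by simp
    then have "hd (t l) (P (Suc k)) = one_at (t l)" using early_next[OF assms(1), of "t l"] by simp
    then show ?thesis using a_jump1[of "Suc k"] 1 True assms(2) by simp
  qed (use before_jump2[of "Suc k"] k True assms(2) in auto)
next
  case False
  then show ?thesis using before_chain[of l "Suc k"] assms by (auto simp: early_def)
qed

text \<open>The separation property on which everything rests: a point behind a side of one chamber is on
  the near side of each side of a later chamber, apart from glued sides, from sides that continue
  into the chamber before, and from late reflex sides. For a side far from the glued one this is
  nestedness of walls, for a reflex side it is what \<open>early\<close> was
  made for.\<close>

lemma behind_far:
  assumes kl: "k < l" "l \<le> C"
    and v0: "hd v\<^sub>0 (P k) \<noteq> one_at v\<^sub>0" "far N v\<^sub>0 (t k) \<or> early k"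
    and v: "far N v (t (l - 1))" "l < C \<Longrightarrow> \<not> eqt N v (t l)"
      "l = Suc (Suc k) \<Longrightarrow> t (Suc k) = t k + 1 \<Longrightarrow> \<not> eqt N v (t k)"
  shows "hd v (P l) = one_at v"
  using v0(2)
proof
  assume far0: "far N v\<^sub>0 (t k)"
  have k: "k < C" using kl by simp
  have ak: "a k = one_at (t k)"
    using hd_far[OF far_sym[OF far0] _ v0(1)] k by (simp add: a_def)
  then have ak': "a k \<noteq> g k" using a_one_before k by blast
  consider "l = Suc k" | "l = Suc (Suc k)" "t (Suc k) = t k + 2" | "l = Suc (Suc k)" "t (Suc k) = t k + 1" | "l \<ge> k + 3"
    using kl jump[of k] by fastforce
  then show ?thesis
  proof cases
    case 1
    then show ?thesis using before[OF k ak'] v(1) by simp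
  next
    case 2
    then have "a (Suc k) \<noteq> g (Suc k)" using before_jump2[OF _ ak'] a_one_before[of "Suc k"] kl by auto
    then show ?thesis using before[of "Suc k" v] v(1) kl 2 by simp
  next
    case 3
    have k1: "Suc k < C" using 3 kl by simp
    show ?thesis
    proof (cases "far N v (t k)")
      case True
      then show ?thesis using before_jump1[OF k1 ak' 3(2)] 3(1) by simp
    next
      case False
      have v1: "far N v (t k + 1)" using v(1) 3 by simp
      have "\<not> N dvd v - t k" using v(3) 3 by (simp add: eqt_def)
      moreover have "\<not> N dvd v - t k - 1" using v1 by (simp add: far_def eqt_def algebra_simps)
      ultimately have vk: "eqt N v (t k - 1)" using False by (simp add: far_def eqt_def adjt_def algebra_simps)
      then have adj: "adjt N v (t k)" using False v(3) 3 by (simp add: far_def)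
      let ?Q = "mv (t (Suc k)) (inv\<^bsub>Bt (t (Suc k))\<^esub> (g (Suc k))) (P k)"
      have Q: "?Q \<in> Y" using k1 by simp
      have "P l = mv (t k) (inv\<^bsub>Bt (t k)\<^esub> (g k)) ?Q"
        unfolding 3(1) P_Suc[OF k1] P_Suc[OF k] using k1 k
          inv_cl[OF g[OF k1]] inv_cl[OF g[OF k]] by (intro mv_comm adjt_small) (simp_all add: 3(2))
      then have "hd v (P l) = hd v ?Q" using adj Q k by (simp add: hd_adj)
      moreover have "hd v ?Q = one_at v"
      proof (cases "adjt N v\<^sub>0 (t (Suc k))")
        case True
        then have "N dvd v\<^sub>0 - t k - 2 \<or> N dvd v\<^sub>0 - t k"
          using 3 by (auto simp: adjt_def algebra_simps)
        then have "eqt N v\<^sub>0 (t k + 2)" using far0 by (auto simp: far_def eqt_def algebra_simps)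
        then have "far N v v\<^sub>0" using far_cong[OF vk] far_small[of "t k - 1" "t k + 2" N] N by simp
        moreover have "hd v\<^sub>0 ?Q = hd v\<^sub>0 (P k)" using True k1 by (simp add: hd_adj)
        ultimately show ?thesis using hd_far[of v v\<^sub>0 ?Q] Q v0(1) by simp
      next
        case False
        moreover have "\<not> eqt N v\<^sub>0 (t (Suc k))"
        proof -
          have "eqt N v\<^sub>0 (t (Suc k)) = (N dvd v\<^sub>0 - t k - 1)" by (simp add: eqt_def diff_diff_eq 3(2))
          then show ?thesis using far0 by (simp add: far_def adjt_def)
        qed
        ultimately have "far N v\<^sub>0 (t (Suc k))" by (simp add: far_def)
        then have "far N (t (Suc k)) v\<^sub>0" by (rule far_sym)
        then have "hd (t (Suc k)) (P k) = one_at (t (Suc k))" using hd_far[OF _ _ v0(1)] k by simp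
        then have "hd (t (Suc k)) ?Q = inv\<^bsub>Bt (t (Suc k))\<^esub> (g (Suc k)) \<otimes>\<^bsub>Bt (t (Suc k))\<^esub> one_at (t (Suc k))"
          using k1 by (simp add: hd_mv)
        then have "hd (t (Suc k)) ?Q \<noteq> one_at (t (Suc k))"
          using k1 g_ne[of "Suc k"] inv_mult_eq[of "g (Suc k)" "t (Suc k)" "one_at (t (Suc k))"] by auto
        then show ?thesis using hd_far[of v "t (Suc k)" ?Q] v(1) 3 Q by simp
      qed
      ultimately show ?thesis by simp
    qed
  next
    case 4
    then have "a (l - 1) = one_at (t (l - 1))" using kl by (intro before_chain[OF _ _ ak']) auto
    then have "a (l - 1) \<noteq> g (l - 1)" using a_one_before[of "l - 1"] kl by auto
    then show ?thesis using before[of "l - 1" v] v(1) kl by simp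
  qed
next
  assume e: "early k"
  then have k1: "Suc k < C" "t (Suc k) = t k + 1" "a (Suc k) \<noteq> one_at (t (Suc k))" "a (Suc k) \<noteq> g (Suc k)"
    by (auto simp: early_def)
  consider "l = Suc k" | "l = Suc (Suc k)" | "l \<ge> k + 3" using kl by linarith
  then show ?thesis
  proof cases
    case 1
    show ?thesis
    proof (cases "far N v (t (Suc k))")
      case True
      then show ?thesis using after[OF k1(1,3)] 1 by simp
    next
      case False
      have "\<not> N dvd v - t k" "\<not> N dvd v - t k - 1" using v 1 k1 by (auto simp: far_def eqt_def algebra_simps)
      then have "eqt N v (t k + 2)" using False k1(2) by (auto simp: far_def eqt_def adjt_def algebra_simps)
      then show ?thesis using early_next[OF e] 1 by simp
    qed
  next
    case 2
    then show ?thesis using before[OF k1(1,4)] v(1) by simp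
  next
    case 3
    then have "a (l - 1) = one_at (t (l - 1))" using kl by (intro early_chain[OF e]) auto
    then have "a (l - 1) \<noteq> g (l - 1)" using a_one_before[of "l - 1"] kl by auto
    then show ?thesis using before[of "l - 1" v] v(1) kl by simp
  qed
qed

lemma early_disjoint: "early k \<Longrightarrow> early k' \<Longrightarrow> k < k' \<Longrightarrow> False"
  using early_chain[of k "Suc k'"] by (auto simp: early_def)

text \<open>A chain read from its other end, with the cycle reflected, is again a chain. This turns
  statements about later chambers into statements about earlier ones, and \<open>early\<close> into the following
  notion.\<close>

lemma reverse: "chain_pts N (\<lambda>v. Bt (- v)) Y (\<lambda>v. mv (- v)) (\<lambda>v. hd (- v)) C
    (\<lambda>k. - t (C - 1 - k)) (\<lambda>k. inv\<^bsub>Bt (t (C - 1 - k))\<^esub> (g (C - 1 - k))) (\<lambda>k. P (C - k))"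
proof -
  interpret m: heads N "\<lambda>v. Bt (- v)" Y "\<lambda>v. mv (- v)" "\<lambda>v. hd (- v)" by (rule heads_minus)
  show ?thesis
  proof
    fix k assume k: "k < C"
    let ?k = "C - 1 - k"
    have k': "?k < C" "C - k = Suc ?k" using k by auto
    interpret B: group "Bt (t ?k)" by (rule grp)
    show "inv\<^bsub>Bt (t ?k)\<^esub> g ?k \<in> carrier (Bt (- (- t ?k)))" using k' by simp
    show "inv\<^bsub>Bt (t ?k)\<^esub> g ?k \<noteq> one_at (- (- t ?k))" using g_ne[OF k'(1)] inv_eq_one[OF g[OF k'(1)]] by simp
    have "mv (t ?k) (g ?k) (P (Suc ?k)) = P ?k"
      using k'(1) g[OF k'(1)] unfolding P_Suc[OF k'(1)] by (intro mv_inv1 P) auto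
    note eq = this
    have Sk: "C - Suc k = ?k" by simp
    show "P (C - Suc k) = mv (- (- t ?k)) (inv\<^bsub>Bt (- (- t ?k))\<^esub> (inv\<^bsub>Bt (t ?k)\<^esub> g ?k)) (P (C - k))"
      unfolding k'(2) minus_minus inv_inv[OF g[OF k'(1)]] Sk by (rule eq[symmetric])
  next
    fix k assume k: "Suc k < C"
    then have "C - 1 - k = Suc (C - 1 - Suc k)" "Suc (C - 1 - Suc k) < C" by auto
    then show "- t (C - 1 - Suc k) = - t (C - 1 - k) + 1 \<or> - t (C - 1 - Suc k) = - t (C - 1 - k) + 2"
      using jump[of "C - 1 - Suc k"] by auto
  qed auto
qed

definition late :: "nat \<Rightarrow> bool" where
  "late k \<longleftrightarrow> Suc k < C \<and> t (Suc k) = t k + 1 \<and>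
     a k \<noteq> one_at (t k) \<and> a k \<noteq> g k \<and>
     (a (Suc k) \<noteq> one_at (t (Suc k)) \<or> hd (t (Suc k) + 1)
       (mv (t k) (inv\<^bsub>Bt (t k)\<^esub> (hd (t k) (P (Suc k)))) (P (Suc k))) \<noteq> one_at (t (Suc k) + 1))"

context
begin

interpretation rv: chain_pts N "\<lambda>v. Bt (- v)" Y "\<lambda>v. mv (- v)" "\<lambda>v. hd (- v)" C
    "\<lambda>k. - t (C - 1 - k)" "\<lambda>k. inv\<^bsub>Bt (t (C - 1 - k))\<^esub> (g (C - 1 - k))" "\<lambda>k. P (C - k)"
  by (rule reverse)

lemma rv_a: assumes "k < C" shows "rv.a (C - 1 - k) = inv\<^bsub>Bt (t k)\<^esub> (g k) \<otimes>\<^bsub>Bt (t k)\<^esub> a k"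
proof -
  have "C - 1 - (C - 1 - k) = k" "C - (C - 1 - k) = Suc k" using assms by linarith+
  then show ?thesis using next_same[OF assms] unfolding rv.a_def by simp
qed

lemma inv_mult_eq2:
  assumes "b \<in> carrier (Bt v)" "c \<in> carrier (Bt v)"
  shows "inv\<^bsub>Bt v\<^esub> b \<otimes>\<^bsub>Bt v\<^esub> c = inv\<^bsub>Bt v\<^esub> b \<longleftrightarrow> c = one_at v"
proof -
  interpret B: group "Bt v" by (rule grp)
  show ?thesis using assms by simp
qed

lemma late_reverse:
  assumes k: "Suc k < C" shows "rv.early (C - 2 - k) \<longleftrightarrow> late k"
proof -
  have e: "C - 2 - k = C - 1 - Suc k" "Suc (C - 2 - k) = C - 1 - k" "C - 1 - (C - 1 - k) = k"
    "C - 1 - (C - 1 - Suc k) = Suc k" "C - (C - 1 - k) = Suc k" using k by auto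
  have a1: "rv.a (C - 1 - k) = hd (t k) (P (Suc k))" using rv_a[of k] next_same[of k] k by simp
  have a2: "rv.a (C - 1 - Suc k) = inv\<^bsub>Bt (t (Suc k))\<^esub> (g (Suc k)) \<otimes>\<^bsub>Bt (t (Suc k))\<^esub> a (Suc k)"
    using rv_a[of "Suc k"] k by simp
  have k': "k < C" using k by simp
  have "Suc (C - 2 - k) < C" using k by simp
  moreover have "rv.a (C - 1 - k) \<noteq> one_at (t k) \<longleftrightarrow> a k \<noteq> g k"
    using a1 next_same_one[OF k'] by simp
  moreover have "rv.a (C - 1 - k) \<noteq> inv\<^bsub>Bt (t k)\<^esub> (g k) \<longleftrightarrow> a k \<noteq> one_at (t k)"
    using a1 next_same[OF k'] k' by (simp add: inv_mult_eq2 a_def)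
  moreover have "rv.a (C - 1 - Suc k) \<noteq> inv\<^bsub>Bt (t (Suc k))\<^esub> (g (Suc k)) \<longleftrightarrow> a (Suc k) \<noteq> one_at (t (Suc k))"
    using a2 k by (simp add: inv_mult_eq2 a_def)
  moreover have "- (- t (Suc k) - 1) = t (Suc k) + 1" by simp
  ultimately show ?thesis
    unfolding rv.early_def late_def e(1) using e(2-5) k a1 unfolding e(1) by (auto simp: algebra_simps)
qed

lemma ahead_far:
  assumes kl: "l < k" "k \<le> C"
    and v0: "hd v\<^sub>0 (P k) \<noteq> one_at v\<^sub>0" "far N v\<^sub>0 (t (k - 1)) \<or> 2 \<le> k \<and> late (k - 2)"
    and v: "far N v (t l)" "0 < l \<Longrightarrow> \<not> eqt N v (t (l - 1))"
      "k = Suc (Suc l) \<Longrightarrow> t (Suc l) = t l + 1 \<Longrightarrow> \<not> eqt N v (t (Suc l))"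
  shows "hd v (P l) = one_at v"
proof -
  have e: "C - 1 - (C - k) = k - 1" "C - (C - k) = k" "C - 1 - (C - l - 1) = l" "C - (C - l) = l"
    "0 < l \<Longrightarrow> C - 1 - (C - l) = l - 1"
    using kl by auto
  have "hd (- (- v)) (P (C - (C - l))) = \<one>\<^bsub>Bt (- (- v))\<^esub>"
  proof (rule rv.behind_far[of "C - k" "C - l" "- v\<^sub>0"])
    show "C - k < C - l" "C - l \<le> C" using kl by auto
    show "hd (- (- v\<^sub>0)) (P (C - (C - k))) \<noteq> \<one>\<^bsub>Bt (- (- v\<^sub>0))\<^esub>" using v0 e by simp
    show "far N (- v\<^sub>0) (- t (C - 1 - (C - k))) \<or> rv.early (C - k)"
    proof (cases "far N v\<^sub>0 (t (k - 1))")
      case True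
      then show ?thesis using e by (simp add: far_minus)
    next
      case False
      then have "2 \<le> k" "late (k - 2)" using v0 by auto
      moreover have "C - 2 - (k - 2) = C - k" "Suc (k - 2) < C" using kl \<open>2 \<le> k\<close> by auto
      ultimately show ?thesis using late_reverse[of "k - 2"] by simp
    qed
    show "far N (- v) (- t (C - 1 - (C - l - 1)))" using e v by (simp add: far_minus)
    show "\<not> eqt N (- v) (- t (C - 1 - (C - l)))" if "C - l < C" using that e v kl by (simp add: eqt_minus)
    show "\<not> eqt N (- v) (- t (C - 1 - (C - k)))"
      if "C - l = Suc (Suc (C - k))" "- t (C - 1 - Suc (C - k)) = - t (C - 1 - (C - k)) + 1"
    proof -
      have "k = Suc (Suc l)" using that kl by simp
      moreover from this have "C - 1 - Suc (C - k) = l" "C - 1 - (C - k) = Suc l" using kl by auto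
      ultimately show ?thesis using that v(3) by (simp add: eqt_minus)
    qed
  qed
  then show ?thesis using e by simp
qed

lemma late_disjoint: "late k \<Longrightarrow> late k' \<Longrightarrow> k < k' \<Longrightarrow> False"
proof -
  assume l: "late k" "late k'" "k < k'"
  then have "Suc k' < C" by (simp add: late_def)
  with l(3) have "Suc k < C" "C - 2 - k' < C - 2 - k" by linarith+
  then show False
    using rv.early_disjoint[of "C - 2 - k'" "C - 2 - k"] late_reverse[of k] late_reverse[of k'] l \<open>Suc k' < C\<close> by blast
qed

end

text \<open>Regions behind reflex sides at different reflex corners do not meet: a point in one of them
  branches off from the chain at that corner.\<close>

lemma early_late_disjoint:
  assumes e: "early k" and l: "late k'" and ne: "k \<noteq> k'"
  shows False
proof -
  have k: "Suc k < C" "t (Suc k) = t k + 1" "a (Suc k) \<noteq> one_at (t (Suc k))" "a (Suc k) \<noteq> g (Suc k)" "k < C"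
    using e by (auto simp: early_def)
  have k': "Suc k' < C" "t (Suc k') = t k' + 1" "a k' \<noteq> one_at (t k')" "a k' \<noteq> g k'"
    using l by (auto simp: late_def)
  consider "k' < k" | "k' = Suc k" | "k' \<ge> k + 2" using ne by linarith
  then show False
  proof cases
    case 1
    then show ?thesis using before_chain[of "Suc k" k'] k k' by auto
  next
    case 3
    then show ?thesis using early_chain[OF e, of k'] k' by auto
  next
    case 2
    let ?y = "mv (t (Suc k)) (inv\<^bsub>Bt (t (Suc k))\<^esub> (a (Suc k))) (P (Suc k))"
    let ?y' = "mv (t (Suc k)) (inv\<^bsub>Bt (t (Suc k))\<^esub> (hd (t (Suc k)) (P (Suc (Suc k))))) (P (Suc (Suc k)))"
    interpret B: group "Bt (t (Suc k))" by (rule grp)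
    have ak: "a (Suc k) \<in> carrier (Bt (t (Suc k)))" using k by (simp add: a_def)
    have y: "?y \<in> Y" "?y = ?y'"
    proof -
      show "?y \<in> Y" using k ak by simp
      have "?y' = mv (t (Suc k)) (inv\<^bsub>Bt (t (Suc k))\<^esub> (inv\<^bsub>Bt (t (Suc k))\<^esub> (g (Suc k)) \<otimes>\<^bsub>Bt (t (Suc k))\<^esub> a (Suc k)) \<otimes>\<^bsub>Bt (t (Suc k))\<^esub>
          inv\<^bsub>Bt (t (Suc k))\<^esub> (g (Suc k))) (P (Suc k))"
        unfolding next_same[OF k(1)] unfolding P_Suc[OF k(1)] using k(1) ak by (intro mv_mult) auto
      also have "inv\<^bsub>Bt (t (Suc k))\<^esub> (inv\<^bsub>Bt (t (Suc k))\<^esub> (g (Suc k)) \<otimes>\<^bsub>Bt (t (Suc k))\<^esub> a (Suc k)) \<otimes>\<^bsub>Bt (t (Suc k))\<^esub>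
          inv\<^bsub>Bt (t (Suc k))\<^esub> (g (Suc k)) = inv\<^bsub>Bt (t (Suc k))\<^esub> (a (Suc k))"
        using g[OF k(1)] ak by (simp add: B.inv_mult_group B.m_assoc)
      finally show "?y = ?y'" by simp
    qed
    have "a (Suc (Suc k)) = one_at (t (Suc (Suc k)))" using early_chain[OF e] k' 2 by simp
    moreover have "t (Suc (Suc k)) + 1 = t k + 3" using 2 k(2) k'(2) by simp
    moreover have "a (Suc (Suc k)) = one_at (t (Suc (Suc k))) \<Longrightarrow>
        hd (t (Suc (Suc k)) + 1) ?y' \<noteq> one_at (t (Suc (Suc k)) + 1)"
      using l unfolding late_def 2 by blast
    ultimately have "hd (t k + 3) ?y \<noteq> one_at (t k + 3)" unfolding y(2) by metis
    note 3 = this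
    have "hd (t k - 1) ?y = one_at (t k - 1)" "hd (t k) ?y = one_at (t k)"
      using N by (auto intro!: hd_far[OF _ y(1) 3] far_small)
    moreover have "hd (t k) ?y = hd (t k) (P (Suc k))" using k ak by (intro hd_adj adjt_small) auto
    ultimately have "a k = g k" using next_same_one[OF k(5)] by simp
    then show ?thesis using e \<open>hd (t k - 1) ?y = one_at (t k - 1)\<close> by (simp add: early_def)
  qed
qed

lemma all_trivial:
  assumes "0 < C" "a 0 = one_at (t 0)" "Suc 0 < C \<Longrightarrow> t (Suc 0) = t 0 + 1 \<Longrightarrow> hd (t (Suc 0)) (P 0) = one_at (t (Suc 0))"
    "l < C"
  shows "a l = one_at (t l)"
proof -
  have a0: "a 0 \<noteq> g 0" using a_one_before assms by blast
  consider "l = 0" | "l = Suc 0" | "l \<ge> 0 + 2" by linarith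
  then show ?thesis
  proof cases
    case 2
    then show ?thesis using assms a_jump1[of 0] jump[of 0] before_jump2[OF _ a0] by auto
  qed (use before_chain[OF assms(4) _ a0] assms in auto)
qed

end

section \<open>The boundary of a blob\<close>

text \<open>The combinatorics of the union of a chain of \<open>N\<close>-gons whose gluings jump \<open>p - 1\<close> times by \<open>2\<close>
  and then \<open>q\<close> times by \<open>1\<close>. Its boundary is a polygon: where two chambers are glued, their sides next to
  the glued one continue each other and count as one side, except at reflex corners.\<close>

locale shape =
  fixes N :: int and p q :: nat
  assumes N: "N \<ge> 7" and p: "p \<ge> 1"
begin

definition C :: nat where "C = p + q"

definition t :: "nat \<Rightarrow> int" where "t k = (if k < p then 2 * int k else int p - 1 + int k)"

lemma C_pos: "0 < C" using p by (simp add: C_def)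

lemma t_0: "t 0 = 0" using p by (simp add: t_def)

lemma t_jump: "t (Suc k) = t k + 1 \<or> t (Suc k) = t k + 2"
  by (auto simp: t_def)

lemma t_diff: "k \<le> l \<Longrightarrow> t k + int (l - k) \<le> t l \<and> t l \<le> t k + 2 * int (l - k)"
proof (induction l)
  case (Suc l)
  then show ?case using t_jump[of l] by (cases "k = Suc l") (auto simp: Suc_diff_le)
qed simp

text \<open>The chamber \<open>k\<close> is entered through type \<open>tin k\<close> and left through type \<open>tout k\<close>; the
  values at the two ends of the chain are chosen so that the formulas below hold there as well.\<close>

definition tin :: "nat \<Rightarrow> int" where "tin k = (if k = 0 then 0 else t (k - 1))"
definition tout :: "nat \<Rightarrow> int" where "tout k = (if k < C then t k else t (C - 1))"

definition hf :: "nat \<Rightarrow> int" where "hf k = int (k div 2)"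

text \<open>The sides of the blob are numbered by integers modulo their number \<open>m\<close>. Starting from the
  common side of the chambers \<open>0\<close> and \<open>1\<close>, which gets the number \<open>0\<close>, the even chambers are met in the positive
  direction and the odd ones in the negative direction, and chamber \<open>k\<close> occupies the numbers whose
  absolute value is between \<open>S k\<close> and \<open>E k\<close>. The numbers \<open>Me\<close> and \<open>- Mo\<close> both denote the last side.\<close>

definition S :: "nat \<Rightarrow> int" where "S k = hf k * N - tin k"
definition E :: "nat \<Rightarrow> int" where "E k = (hf k + 1) * N - 2 - tout k"

definition sg :: "nat \<Rightarrow> int \<Rightarrow> int" where "sg k y = (if even k then y else - y)"

definition Me :: int where "Me = hf (C + 2) * N - 2 - t (C - 1)"
definition Mo :: int where "Mo = hf (C + 1) * N - 2 - t (C - 1)"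
definition m :: int where "m = Me + Mo"

lemma tin_out: "k \<le> C \<Longrightarrow> tin k \<le> tout k \<and> tout k \<le> tin k + 2"
  using t_jump[of "k - 1"] t_0 C_pos by (cases "k = 0"; cases "k < C") (auto simp: tin_def tout_def)

lemma SE: "k \<le> C \<Longrightarrow> S k + 3 \<le> E k \<and> E k \<le> S k + N - 2"
  using tin_out[of k] N by (simp add: S_def E_def algebra_simps)

lemma S_01: "S 0 = 0" "S (Suc 0) = 0"
  by (auto simp: S_def tin_def hf_def t_0)

lemma hf_add2: "hf (k + 2 * j) = hf k + int j"
  by (simp add: hf_def)

lemma step_S: "k + 2 \<le> C \<Longrightarrow> S (k + 2) = E k + 2 - (t (Suc k) - t k)"
  using hf_add2[of k 1] by (simp add: S_def E_def tin_def tout_def)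

lemma step_S_cases: "k + 2 \<le> C \<Longrightarrow> (S (k + 2) = E k \<and> t (Suc k) = t k + 2) \<or> (S (k + 2) = E k + 1 \<and> t (Suc k) = t k + 1)"
  using step_S[of k] t_jump[of k] by auto

lemma E_le_S:
  assumes "k + 2 * j \<le> C" "j \<ge> 2"
  shows "E k + 3 \<le> S (k + 2 * j)"
proof -
  have "t (k + 2 * j - 1) \<le> t k + 2 * int (2 * j - 1)"
    using t_diff[of k "k + 2 * j - 1"] assms by simp
  then have "t (k + 2 * j - 1) \<le> t k + 4 * int j - 2" using assms by (simp add: of_nat_diff)
  moreover have "(int j - 1) * 7 \<le> (int j - 1) * N" using N assms by (intro mult_left_mono) auto
  moreover have "S (k + 2 * j) = hf k * N + int j * N - t (k + 2 * j - 1)" "E k = hf k * N + N - 2 - t k"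
    using assms by (simp_all add: S_def E_def tin_def tout_def hf_add2 distrib_right)
  ultimately show ?thesis using assms(2) by (simp add: left_diff_distrib)
qed

lemma S_pos: assumes "2 \<le> k" "k \<le> C" shows "S k \<ge> 3"
proof -
  obtain j i where k: "k = i + 2 * j" "i < 2" "1 \<le> j" using assms
    by (metis One_nat_def Suc_leI add.commute div_greater_zero_iff mod_less_divisor mod_mult_div_eq pos2)
  have "t (k - 1) \<le> 2 * int (k - 1)" using t_diff[of 0 "k - 1"] t_0 by simp
  moreover have "int j * 7 \<le> int j * N" using N by (intro mult_left_mono) auto
  moreover have "hf k = int j" using k by (simp add: hf_def)
  ultimately have "S k \<ge> int j * 7 - 2 * int (k - 1)" using assms by (simp add: S_def tin_def)
  then show ?thesis using k by (auto simp: of_nat_diff)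
qed

lemma S_nonneg: "k \<le> C \<Longrightarrow> S k \<ge> 0"
  using S_pos[of k] S_01 by (cases "k \<ge> 2") (auto simp: less_2_cases_iff not_le)

lemma ends: "E C = (if even C then Me else Mo)" "E (C - 1) = (if even C then Mo else Me)"
proof -
  have "even C \<Longrightarrow> C \<ge> 2" using C_pos by (cases "C = 1") auto
  then show "E C = (if even C then Me else Mo)" "E (C - 1) = (if even C then Mo else Me)"
    using C_pos by (auto simp: E_def Me_def Mo_def tout_def hf_def elim!: evenE oddE)
qed

lemma last_end: "k \<le> C \<Longrightarrow> C \<le> Suc k \<Longrightarrow> E k = (if even k then Me else Mo)"
  using ends C_pos by (cases "k = C") (auto simp: le_Suc_eq)

lemma E_mono2: "k + 2 \<le> C \<Longrightarrow> E k + 3 \<le> E (k + 2)"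
  using step_S_cases[of k] SE[of "k + 2"] by auto

lemma E_le_end: "k \<le> C \<Longrightarrow> E k \<le> (if even k then Me else Mo)"
proof (induction "C - k" arbitrary: k rule: less_induct)
  case less
  show ?case
  proof (cases "C \<le> Suc k")
    case True
    then show ?thesis using last_end[of k] less.prems by simp
  next
    case False
    then have "E (k + 2) \<le> (if even (k + 2) then Me else Mo)" by (intro less.hyps) auto
    then show ?thesis using E_mono2[of k] False by (auto split: if_splits)
  qed
qed

lemma Me_Mo_pos: "Me \<ge> N - 2" "Mo \<ge> 3"
proof -
  have "E 0 = N - 2" using C_pos by (simp add: E_def hf_def tout_def t_0)
  then show "Me \<ge> N - 2" using E_le_end[of 0] by simp
  show "Mo \<ge> 3" using E_le_end[of 1] SE[of 1] S_01 C_pos by simp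
qed

lemma m_pos: "m > 6" using Me_Mo_pos N by (simp add: m_def)

text \<open>A gluing removes the two glued sides and merges the four sides next to them in pairs, so that
  an \<open>N\<close>-gon adds \<open>N - 4\<close> sides. At a reflex corner the glued side of the earlier chamber is part of a
  longer side that does not disappear, and there is only one pair to merge; this adds \<open>N - 2\<close> sides.\<close>

lemma m_eq: "m = N + int p * (N - 4) + int q * (N - 2)"
proof -
  have "t (C - 1) = 2 * (int p - 1) + int q" using p by (auto simp: t_def C_def of_nat_diff)
  moreover have "hf (C + 2) + hf (C + 1) = int C + 1" by (cases "even C") (auto simp: hf_def elim!: evenE oddE)
  ultimately have "m = (int C + 1) * N - 4 - 2 * (2 * (int p - 1) + int q)"
    by (simp add: m_def Me_def Mo_def flip: distrib_right)
  then show ?thesis by (simp add: C_def algebra_simps)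
qed

text \<open>The representative in \<open>(- Mo, Me]\<close> of a position modulo \<open>m\<close>.\<close>

definition norm :: "int \<Rightarrow> int" where "norm x = (x + Mo - 1) mod m + 1 - Mo"

text \<open>The type of a side. Because types decrease by one along both directions from position \<open>0\<close>, the
  type depends only on the absolute value.\<close>

definition T :: "int \<Rightarrow> int" where "T x = - 1 - \<bar>norm x\<bar>"

lemma norm_range: "- Mo < norm x" "norm x \<le> Me"
proof -
  have "(x + Mo - 1) mod m < m" "0 \<le> (x + Mo - 1) mod m" using m_pos by simp_all
  moreover have "m = Me + Mo" by (rule m_def)
  ultimately show "- Mo < norm x" "norm x \<le> Me" unfolding norm_def by linarith+
qed

lemma norm_cong: "m dvd x - norm x"
proof -
  have "x - norm x = (x + Mo - 1) - (x + Mo - 1) mod m" by (simp add: norm_def)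
  then show ?thesis by (simp add: minus_mod_eq_mult_div)
qed

lemma norm_eq: "m dvd x - x' \<Longrightarrow> norm x = norm x'"
proof -
  assume "m dvd x - x'"
  then have "(x + Mo - 1) mod m = (x' + Mo - 1) mod m" by (simp add: mod_eq_dvd_iff)
  then show ?thesis by (simp add: norm_def)
qed

lemma same_rep:
  assumes "m dvd y - y'" "- Mo \<le> y" "y \<le> Me" "- Mo \<le> y'" "y' \<le> Me"
  shows "y = y' \<or> (y = Me \<and> y' = - Mo) \<or> (y = - Mo \<and> y' = Me)"
proof -
  obtain c where c: "y - y' = m * c" using assms(1) by blast
  have "m = Me + Mo" by (rule m_def)
  then have "m * c \<le> m * 1" "m * (- 1) \<le> m * c" using assms c by linarith+
  moreover have "0 < m" using m_pos by simp
  ultimately have "c \<le> 1" "- 1 \<le> c" by (simp_all only: mult_le_cancel_left_pos)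
  then have "c = 0 \<or> c = 1 \<or> c = - 1" by auto
  then show ?thesis using c assms by (auto simp: m_def)
qed

lemma T_rep:
  assumes "m dvd x - y" "- Mo \<le> y" "y \<le> Me"
  shows "eqt N (T x) (- 1 - \<bar>y\<bar>)"
proof -
  have "m dvd norm x - y"
    using dvd_diff[OF assms(1) norm_cong[of x]] by (simp add: algebra_simps)
  then have "norm x = y \<or> (norm x = Me \<and> y = - Mo)" using same_rep[of "norm x" y] norm_range[of x] assms by auto
  then show ?thesis
  proof
    assume *: "norm x = Me \<and> y = - Mo"
    have "hf (C + 2) - hf (C + 1) = (if even C then 1 else 0)" by (auto simp: hf_def elim!: evenE oddE)
    then have "Me - Mo = (if even C then 1 else 0) * N" by (simp add: Me_def Mo_def flip: left_diff_distrib)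
    then have "N dvd Me - Mo" by simp
    then have "N dvd Mo - Me" by (metis dvd_minus_iff minus_diff_eq)
    moreover have "Me \<ge> 0" "Mo \<ge> 0" using Me_Mo_pos N by auto
    ultimately show ?thesis using * by (simp add: T_def eqt_def)
  qed (simp add: T_def)
qed

text \<open>The chambers that contain a side. Besides the long run of sides described by \<open>S\<close> and \<open>E\<close>, a
  chamber between two gluings with jump \<open>2\<close> contains the side between the two glued ones. This side
  has three chambers and belongs to the run of the chambers before and after it.\<close>

definition main :: "nat \<Rightarrow> int \<Rightarrow> bool" where
  "main k y \<longleftrightarrow> k \<le> C \<and> S k \<le> sg k y \<and> sg k y \<le> E k"

definition short :: "nat \<Rightarrow> int \<Rightarrow> bool" where
  "short k y \<longleftrightarrow> 0 < k \<and> k < C \<and> t k = t (k - 1) + 2 \<and> sg (k - 1) y = E (k - 1)"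

definition On :: "nat \<Rightarrow> int \<Rightarrow> bool" where
  "On k x \<longleftrightarrow> (\<exists>y. m dvd x - y \<and> (main k y \<or> short k y))"

text \<open>The two sides at the reflex corner of the chambers \<open>k\<close>, \<open>k + 1\<close>, \<open>k + 2\<close>, on the earliest and on
  the latest of these chambers.\<close>

definition isE :: "nat \<Rightarrow> int \<Rightarrow> bool" where
  "isE k x \<longleftrightarrow> Suc k < C \<and> t (Suc k) = t k + 1 \<and> (\<exists>y. m dvd x - y \<and> sg k y = E k)"

definition isL :: "nat \<Rightarrow> int \<Rightarrow> bool" where
  "isL k x \<longleftrightarrow> Suc k < C \<and> t (Suc k) = t k + 1 \<and> (\<exists>y. m dvd x - y \<and> sg k y = S (k + 2))"

lemma main_range: "main k y \<Longrightarrow> - Mo \<le> y \<and> y \<le> Me"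
  using E_le_end[of k] S_nonneg[of k] Me_Mo_pos N by (auto simp: main_def sg_def split: if_splits)

lemma main_abs: "main k y \<Longrightarrow> \<bar>y\<bar> = sg k y"
  using S_nonneg[of k] by (auto simp: main_def sg_def split: if_splits)

lemma short_main: "short k y \<Longrightarrow> main (k - 1) y \<and> main (k + 1) y"
  using step_S_cases[of "k - 1"] SE[of "k + 1"] SE[of "k - 1"]
  by (cases k) (auto simp: short_def main_def sg_def)

lemma short_iff: "0 < k \<Longrightarrow> k < C \<Longrightarrow> t k = t (k - 1) + 2 \<Longrightarrow> short k y \<longleftrightarrow> sg (k + 1) y = S (k + 1)"
  using step_S_cases[of "k - 1"] by (auto simp: short_def sg_def)

lemma On_range: "On k x \<Longrightarrow> k \<le> C"
  by (auto simp: On_def main_def short_def)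

lemma type_main:
  assumes "m dvd x - y" "main k y"
  shows "eqt N (T x) (tin k - 1 - (sg k y - S k))"
proof -
  have "eqt N (T x) (- 1 - sg k y)" using T_rep[OF assms(1)] main_range[OF assms(2)] main_abs[OF assms(2)] by simp
  moreover have "(tin k - 1 - (sg k y - S k)) - (- 1 - sg k y) = N * hf k" by (simp add: S_def)
  then have "eqt N (- 1 - sg k y) (tin k - 1 - (sg k y - S k))"
    unfolding eqt_def by (metis dvd_minus_iff dvd_triv_left minus_diff_eq)
  ultimately show ?thesis by (rule eqt_trans)
qed

lemma On_type:
  assumes "On k x"
  obtains y \<tau> where "m dvd x - y" "main k y" "\<tau> = tin k - 1 - (sg k y - S k)" "eqt N (T x) \<tau>"
      "tout k + 1 - N \<le> \<tau>" "\<tau> \<le> tin k - 1"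
  | y where "m dvd x - y" "short k y" "eqt N (T x) (t (k - 1) + 1)"
proof -
  obtain y where y: "m dvd x - y" "main k y \<or> short k y" using assms by (auto simp: On_def)
  show thesis
  proof (cases "main k y")
    case True
    have "sg k y - S k \<ge> 0" "sg k y \<le> E k" using True by (auto simp: main_def)
    moreover have "E k - S k = N - 2 - tout k + tin k" by (simp add: E_def S_def algebra_simps)
    ultimately show ?thesis using that(1)[OF y(1) True HOL.refl type_main[OF y(1) True]] by simp
  next
    case False
    then have s: "short k y" using y by simp
    then have mn: "main (k - 1) y" using short_main by blast
    have "k - 1 < C" "sg (k - 1) y = E (k - 1)" using s by (auto simp: short_def)
    then have "eqt N (T x) (tin (k - 1) - 1 - (E (k - 1) - S (k - 1)))" using type_main[OF y(1) mn] by simp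
    moreover have "tin (k - 1) - 1 - (E (k - 1) - S (k - 1)) = t (k - 1) + 1 - N"
      using \<open>k - 1 < C\<close> by (simp add: E_def S_def tout_def algebra_simps)
    moreover have "eqt N (t (k - 1) + 1 - N) (t (k - 1) + 1)" by (simp add: eqt_def)
    ultimately show ?thesis using that(2)[OF y(1) s] eqt_trans by metis
  qed
qed

lemma eqt_range: "eqt N u v \<Longrightarrow> eqt N u w \<Longrightarrow> \<bar>v - w\<bar> < N \<Longrightarrow> v = w"
proof -
  assume "eqt N u v" "eqt N u w" and r: "\<bar>v - w\<bar> < N"
  then have "N dvd v - w" using eqt_sym eqt_trans by (metis eqt_def)
  then show ?thesis using not_dvd_small[of "v - w" N] r by (cases "v - w > 0"; cases "v - w < 0") auto
qed

lemma adjt_range: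
  assumes "eqt N u v" "adjt N u w" "\<bar>v - w\<bar> < N"
  shows "v = w + 1 \<or> v = w - 1 \<or> v = w + 1 - N \<or> v = w - 1 + N"
proof -
  have N0: "0 < N" using N by simp
  have "adjt N v w" using adjt_cong[OF assms(1) eqt_refl] assms(2) by blast
  then consider "N dvd v - w - 1" | "N dvd v - w + 1" by (auto simp: adjt_def)
  then show ?thesis
  proof cases
    case 1
    then obtain c where c: "v - w - 1 = N * c" by blast
    have "N * c < N * 1" "N * (- 2) < N * c" using assms(3) c N by linarith+
    then have "c < 1" "- 2 < c" using N0 by (simp_all only: mult_less_cancel_left_pos)
    then have "c = 0 \<or> c = - 1" by auto
    then show ?thesis using c by auto
  next
    case 2
    then obtain c where c: "v - w + 1 = N * c" by blast
    have "N * c < N * 2" "N * (- 1) < N * c" using assms(3) c N by linarith+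
    then have "c < 2" "- 1 < c" using N0 by (simp_all only: mult_less_cancel_left_pos)
    then have "c = 0 \<or> c = 1" by auto
    then show ?thesis using c by auto
  qed
qed

lemma not_glue_out:
  assumes "On k x" "k < C" shows "\<not> eqt N (T x) (t k)"
  using assms(1)
proof (cases rule: On_type)
  case (1 y \<tau>)
  then have "\<tau> < t k" "\<bar>\<tau> - t k\<bar> < N" using tin_out[of k] assms by (auto simp: tout_def)
  then show ?thesis using eqt_range[OF 1(4), of "t k"] by auto
next
  case (2 y)
  then show ?thesis using eqt_range[of "T x" "t (k - 1) + 1" "t k"] N by (auto simp: short_def)
qed

lemma not_glue_in:
  assumes "On k x" "0 < k" shows "\<not> eqt N (T x) (t (k - 1))"
  using assms(1)
proof (cases rule: On_type)
  case (1 y \<tau>)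
  then have "\<tau> < t (k - 1)" "\<bar>\<tau> - t (k - 1)\<bar> < N"
    using tin_out[of k] assms(2) On_range[OF assms(1)] by (auto simp: tin_def)
  then show ?thesis using eqt_range[OF 1(4), of "t (k - 1)"] by auto
next
  case (2 y)
  then show ?thesis using eqt_range[of "T x" "t (k - 1) + 1" "t (k - 1)"] N by auto
qed

lemma On_zero: "m dvd x \<Longrightarrow> On 0 x \<and> On 1 x"
  using SE[of 0] SE[of 1] S_01 C_pos by (auto simp: On_def main_def sg_def intro!: exI[of _ 0])

lemma On_last:
  assumes "m dvd x - y" "k \<le> C" "C \<le> Suc k" "sg k y = E k"
  shows "On C x \<and> On (C - 1) x"
proof -
  have e: "E k = (if even k then Me else Mo)" using last_end assms by blast
  then have y: "y = Me \<or> y = - Mo" using assms(4) by (auto simp: sg_def split: if_splits)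
  have "m dvd x - Me \<and> m dvd x - (- Mo)"
  proof -
    have "x - (- Mo) = (x - Me) + m" by (simp add: m_def)
    then have "m dvd x - Me \<longleftrightarrow> m dvd x - (- Mo)" by (simp only: dvd_add_left_iff[OF dvd_refl])
    then show ?thesis using y assms(1) by auto
  qed
  moreover have "main C (if even C then Me else - Mo)" "main (C - 1) (if even C then - Mo else Me)"
    using ends SE[of C] SE[of "C - 1"] C_pos by (auto simp: main_def sg_def)
  ultimately show ?thesis unfolding On_def by (metis (full_types))
qed

text \<open>A side of chamber \<open>k\<close> next to a glued side continues into the chamber \<open>k + 1\<close>, unless it ends in a
  reflex corner.\<close>

lemma next_side:
  assumes On: "On k x" and k: "k < C" and a: "adjt N (T x) (t k)"
  shows "On (Suc k) x \<or> isE k x"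
  using On
proof (cases rule: On_type)
  case (1 y \<tau>)
  have "\<tau> < t k" "\<bar>\<tau> - t k\<bar> < N" using 1 tin_out[of k] k by (auto simp: tout_def)
  then have "\<tau> = t k - 1 \<or> \<tau> = t k + 1 - N" using adjt_range[OF 1(4) a] 1(5) k N by (auto simp: tout_def)
  then show ?thesis
  proof
    assume \<tau>: "\<tau> = t k - 1"
    then have "tin k = t k" "sg k y = S k" using 1 tin_out[of k] k by (auto simp: tout_def main_def)
    then have "k = 0" using t_jump[of "k - 1"] by (auto simp: tin_def split: if_splits)
    then have "y = 0" using \<open>sg k y = S k\<close> S_01 by (simp add: sg_def)
    then show ?thesis using On_zero[of x] 1 \<open>k = 0\<close> by simp
  next
    assume "\<tau> = t k + 1 - N"
    then have y: "sg k y = E k" using 1(3) k by (simp add: E_def S_def tout_def algebra_simps)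
    show ?thesis
    proof (cases "Suc k < C")
      case True
      show ?thesis
      proof (cases "t (Suc k) = t k + 1")
        case True
        then show ?thesis using y 1 \<open>Suc k < C\<close> by (auto simp: isE_def)
      next
        case False
        then have "short (Suc k) y" using True y t_jump[of k] by (auto simp: short_def)
        then show ?thesis using 1 by (auto simp: On_def)
      qed
    next
      case False
      then show ?thesis using On_last[OF 1(1), of k] y k by (metis Suc_lessI less_or_eq_imp_le order_refl)
    qed
  qed
next
  case (2 y)
  then show ?thesis using short_main[of k y] by (auto simp: On_def)
qed

lemma prev_side:
  assumes On: "On k x" and k: "0 < k" and a: "adjt N (T x) (t (k - 1))"
  shows "On (k - 1) x \<or> (2 \<le> k \<and> isL (k - 2) x)"
  using On
proof (cases rule: On_type)
  case (1 y \<tau>)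
  have kC: "k \<le> C" using On On_range by blast
  have tin: "tin k = t (k - 1)" using k by (simp add: tin_def)
  have "\<tau> < t (k - 1)" "\<bar>\<tau> - t (k - 1)\<bar> < N" using 1 tin_out[OF kC] tin by auto
  then have "\<tau> = t (k - 1) - 1 \<or> \<tau> = t (k - 1) + 1 - N"
    using adjt_range[OF 1(4) a] 1(5) tin_out[OF kC] tin N by auto
  then show ?thesis
  proof
    assume "\<tau> = t (k - 1) - 1"
    then have y: "sg k y = S k" using 1(3) tin by simp
    show ?thesis
    proof (cases "k = 1")
      case True
      then have "y = 0" using y S_01 by (simp add: sg_def)
      then show ?thesis using On_zero[of x] 1 True by simp
    next
      case False
      then obtain j where j: "k = j + 2" using k by (metis One_nat_def Suc_pred add_2_eq_Suc' neq0_conv)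
      have sgj: "sg j y = sg k y" using j by (simp add: sg_def)
      show ?thesis
      proof (cases "t (Suc j) = t j + 1")
        case True
        then show ?thesis using j y sgj 1 kC by (auto simp: isL_def)
      next
        case False
        then have "short (Suc j) y" using j y t_jump[of j] short_iff[of "Suc j" y] kC by auto
        then show ?thesis using 1 j by (auto simp: On_def)
      qed
    qed
  next
    assume \<tau>: "\<tau> = t (k - 1) + 1 - N"
    then have "tout k = t (k - 1)" using 1(5) tin_out[OF kC] tin by simp
    then have "k = C" using t_jump[of "k - 1"] kC k by (auto simp: tout_def split: if_splits)
    moreover have "sg k y = E k" using 1(3) \<tau> \<open>tout k = t (k - 1)\<close> tin by (simp add: E_def S_def algebra_simps)
    ultimately show ?thesis using On_last[OF 1(1), of k] by simp
  qed
next
  case (2 y)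
  then show ?thesis using short_main[of k y] by (auto simp: On_def)
qed

lemma isE_On: "isE k x \<Longrightarrow> On k x \<and> eqt N (T x) (t (Suc k))"
proof -
  assume e: "isE k x"
  then obtain y where y: "m dvd x - y" "sg k y = E k" and k: "Suc k < C" "t (Suc k) = t k + 1" by (auto simp: isE_def)
  have mn: "main k y" using y SE[of k] k by (auto simp: main_def)
  have "tin k - 1 - (sg k y - S k) = t (Suc k) - N" using y k by (simp add: E_def S_def tout_def algebra_simps)
  then have "eqt N (T x) (t (Suc k) - N)" using type_main[OF y(1) mn] by simp
  moreover have "eqt N (t (Suc k) - N) (t (Suc k))" by (simp add: eqt_def)
  ultimately show ?thesis using mn y eqt_trans by (auto simp: On_def)
qed

lemma isL_On: "isL k x \<Longrightarrow> On (k + 2) x \<and> eqt N (T x) (t k)"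
proof -
  assume e: "isL k x"
  then obtain y where y: "m dvd x - y" "sg k y = S (k + 2)" and k: "Suc k < C" "t (Suc k) = t k + 1" by (auto simp: isL_def)
  have sgk: "sg (k + 2) y = sg k y" by (simp add: sg_def)
  have mn: "main (k + 2) y" using y SE[of "k + 2"] k sgk by (auto simp: main_def)
  then show ?thesis using type_main[OF y(1) mn] y k sgk by (auto simp: On_def tin_def)
qed

lemma isE_iff: assumes "On k x" "eqt N (T x) (t (Suc k))" "Suc k < C" "t (Suc k) = t k + 1" shows "isE k x"
proof -
  have "adjt N (T x) (t k)" using adjt_cong[OF assms(2) eqt_refl, of "t k"] assms(4) adjt_small by simp
  moreover have "\<not> On (Suc k) x" using not_glue_out[of "Suc k" x] assms by blast
  moreover have "k < C" using assms(3) by simp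
  ultimately show ?thesis using next_side[OF assms(1)] by blast
qed

lemma isL_iff: assumes "On (k + 2) x" "eqt N (T x) (t k)" "Suc k < C" "t (Suc k) = t k + 1" shows "isL k x"
proof -
  have "adjt N (T x) (t (Suc k))" using adjt_cong[OF assms(2) eqt_refl, of "t (Suc k)"] assms(4) adjt_small by simp
  moreover have "\<not> On (Suc k) x" using not_glue_in[of "Suc k" x] assms by auto
  ultimately show ?thesis using prev_side[of "k + 2" x] assms by auto
qed

lemma main_main:
  assumes "main k y" "main l y" "k < l" "even (k + l)"
  shows "l = k + 2 \<and> sg k y = E k \<and> t (Suc k) = t k + 2"
proof -
  obtain j where j: "l = k + 2 * j" "j \<ge> 1"
    using assms(3,4) by (metis One_nat_def Suc_leI add.commute even_diff_nat even_two_times_div_two le_add_diff_inverse less_imp_le nat_0_less_mult_iff zero_less_diff dvd_mult_div_cancel even_add)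
  have sgl: "sg l y = sg k y" using j by (simp add: sg_def)
  have b: "S l \<le> sg k y" "sg k y \<le> E k" "l \<le> C" using assms sgl by (auto simp: main_def)
  have "j = 1" using E_le_S[of k j] j b by (cases "j \<ge> 2") auto
  then show ?thesis using step_S_cases[of k] b j by auto
qed

lemma rep_cases:
  assumes "m dvd x - y" "m dvd x - y'" "- Mo \<le> y" "y \<le> Me" "- Mo \<le> y'" "y' \<le> Me"
  shows "y = y' \<or> (y = Me \<and> y' = - Mo) \<or> (y = - Mo \<and> y' = Me)"
proof -
  have "m dvd y' - y" using dvd_diff[OF assms(1,2)] by simp
  then have "m dvd y - y'" by (metis dvd_minus_iff minus_diff_eq)
  then show ?thesis using same_rep assms by blast
qed

lemma main_end: "main k y \<Longrightarrow> y = Me \<or> y = - Mo \<Longrightarrow> C \<le> Suc k"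
proof (rule ccontr)
  assume mn: "main k y" "y = Me \<or> y = - Mo" and "\<not> C \<le> Suc k"
  then have "E k + 3 \<le> (if even k then Me else Mo)" using E_mono2[of k] E_le_end[of "k + 2"] by (auto split: if_splits)
  moreover have "sg k y \<le> E k" "sg k y \<ge> 0" using mn S_nonneg[of k] by (auto simp: main_def)
  ultimately show False using mn(2) Me_Mo_pos N by (auto simp: sg_def split: if_splits)
qed

lemma main_parity:
  assumes "m dvd x - y" "m dvd x - y'" "main k y" "main l y'" "k < l" "odd (k + l)"
  shows "l = Suc k"
proof -
  have r: "y = y' \<or> (y = Me \<and> y' = - Mo) \<or> (y = - Mo \<and> y' = Me)"
    using rep_cases[OF assms(1,2)] main_range assms by blast
  show ?thesis
  proof (cases "y = y'")
    case True
    have "sg k y \<ge> S k" "sg l y \<ge> S l" "k \<le> C" "l \<le> C" using assms True by (auto simp: main_def)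
    moreover have "sg l y = - sg k y" using assms(6) by (auto simp: sg_def)
    ultimately have "S k = 0" "S l = 0" using S_nonneg[of k] S_nonneg[of l] by auto
    then have "l < 2" using S_pos[of l] \<open>l \<le> C\<close> by (cases "l \<ge> 2") auto
    then show ?thesis using assms(5) by auto
  next
    case False
    then have "C \<le> Suc k" using main_end r assms(3) by blast
    moreover have "l \<le> C" using assms(4) by (simp add: main_def)
    ultimately show ?thesis using assms(5) by simp
  qed
qed

lemma short_unique:
  assumes "m dvd x - y" "short (Suc j) y" "On l x"
  shows "l = j \<or> l = Suc j \<or> l = j + 2"
proof -
  have mk: "main j y" "main (j + 2) y" using short_main[OF assms(2)] by auto
  have k: "Suc j < C" "sg j y = E j" using assms by (auto simp: short_def)
  have yr: "y \<noteq> Me" "y \<noteq> - Mo" using main_end[OF mk(1)] k by auto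
  have eq: "y' = y" if "m dvd x - y'" "- Mo \<le> y'" "y' \<le> Me" for y'
    using rep_cases[OF assms(1) that(1)] main_range[OF mk(1)] that yr by auto
  have y0: "sg j y \<ge> 3" using k SE[of j] S_nonneg[of j] by auto
  obtain y' where y': "m dvd x - y'" "main l y' \<or> short l y'" using assms(3) by (auto simp: On_def)
  then have "main l y' \<or> main (l - 1) y'" using short_main by blast
  then have "y' = y" using eq y'(1) main_range by blast
  have par: "even (i + j)" if "main i y" for i
  proof (rule ccontr)
    assume "odd (i + j)"
    then have "sg i y = - sg j y" by (auto simp: sg_def)
    then show False using that y0 S_nonneg[of i] by (auto simp: main_def)
  qed
  show ?thesis
  proof (cases "main l y")
    case True
    show ?thesis
    proof (rule ccontr)
      assume "\<not> ?thesis"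
      then consider "l < j" | "l > j + 2" by linarith
      then show False
      proof cases
        case 1
        then show ?thesis using main_main[OF True mk(2)] par[OF True] by auto
      next
        case 2
        then show ?thesis using main_main[OF mk(1) True] par[OF True] by (auto simp: add.commute)
      qed
    qed
  next
    case False
    then have s: "short l y" using y' \<open>y' = y\<close> by simp
    then obtain i where i: "l = Suc i" by (cases l) (auto simp: short_def)
    have ml: "main i y" "main (i + 2) y" using short_main[OF s] i by auto
    have ev: "even (j + (i + 2))" "even (i + (j + 2))" using par[OF ml(1)] by (auto simp: add.commute)
    have "\<not> j < i" using main_main[OF mk(1) ml(2) _ ev(1)] by auto
    moreover have "\<not> i < j" using main_main[OF ml(1) mk(2) _ ev(2)] by auto
    ultimately show ?thesis using i by simp
  qed
qed

text \<open>The runs of two chambers on the same arc of the boundary overlap in at most one side, which is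
  then the side between the two gluings of the chamber between them. Runs on different arcs meet
  only at the two ends of the chain.\<close>

lemma On_On:
  assumes "On k x" "On l x" "k < l"
  shows "l = Suc k \<or> (l = k + 2 \<and> On (Suc k) x)"
proof -
  obtain y where y: "m dvd x - y" "main k y \<or> short k y" using assms by (auto simp: On_def)
  obtain y' where y': "m dvd x - y'" "main l y' \<or> short l y'" using assms by (auto simp: On_def)
  consider "short k y" | "short l y'" | "main k y" "main l y'" using y y' by blast
  then show ?thesis
  proof cases
    case 1
    moreover obtain j where "k = Suc j" using 1 by (cases k) (auto simp: short_def)
    ultimately show ?thesis using short_unique[OF y(1) _ assms(2), of j] assms(3) by auto
  next
    case 2
    moreover obtain j where "l = Suc j" using 2 by (cases l) (auto simp: short_def)
    ultimately show ?thesis using short_unique[OF y'(1) _ assms(1), of j] assms(3) by auto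
  next
    case 3
    show ?thesis
    proof (cases "even (k + l)")
      case True
      have "y = y' \<or> C \<le> Suc k"
        using rep_cases[OF y(1) y'(1)] main_range main_end 3 by blast
      moreover have "l \<le> C" using 3 by (simp add: main_def)
      ultimately have "y = y'" using True assms(3) by (cases "l = Suc k") auto
      then have *: "l = k + 2" "sg k y = E k" "t (Suc k) = t k + 2" using main_main[OF 3(1) _ assms(3) True] 3(2) by auto
      then have "short (Suc k) y" using \<open>l \<le> C\<close> by (auto simp: short_def)
      then show ?thesis using * y by (auto simp: On_def)
    next
      case False
      then show ?thesis using main_parity[OF y(1) y'(1) 3 assms(3)] by simp
    qed
  qed
qed

lemma On_next_adj:
  assumes "On k x" "On (Suc k) x"
  shows "adjt N (T x) (t k)"
proof -
  have k: "k < C" using On_range[OF assms(2)] by simp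
  have short_adj: "adjt N (T x) (t k)" if "short k y" "eqt N (T x) (t (k - 1) + 1)" for y
  proof -
    have "t (k - 1) + 1 = t k - 1" using that by (simp add: short_def)
    then have "adjt N (t (k - 1) + 1) (t k)" by (simp add: adjt_small)
    then show ?thesis using adjt_cong[OF that(2) eqt_refl] by blast
  qed
  have short_adj': "adjt N (T x) (t k)" if "short (Suc k) y" "eqt N (T x) (t (Suc k - 1) + 1)" for y
    using that adjt_cong[OF that(2) eqt_refl, of "t k"] adjt_small[of "t k + 1" "t k"] by simp
  from assms(2) show ?thesis
  proof (cases rule: On_type)
    case (2 y)
    then show ?thesis using short_adj' by blast
  next
    case (1 y \<tau>)
    note y' = this
    from assms(1) show ?thesis
    proof (cases rule: On_type)
      case (2 y)
      then show ?thesis using short_adj by blast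
    next
      case (1 z \<sigma>)
      have r: "z = y \<or> C \<le> Suc k" using rep_cases[OF 1(1) y'(1)] main_range main_end 1(2) y'(2) by blast
      show ?thesis
      proof (cases "z = y")
        case True
        have "sg k y \<ge> 0" "sg (Suc k) y \<ge> 0" "sg (Suc k) y = - sg k y"
          using 1(2) y'(2) True S_nonneg[of k] S_nonneg[of "Suc k"] by (auto simp: main_def sg_def)
        then have 0: "sg k y = 0" by simp
        then have "S k = 0" using 1(2) True S_nonneg[of k] by (auto simp: main_def)
        moreover have "sg (Suc k) y = 0" "S (Suc k) = 0"
          using 0 y'(2) S_nonneg[of "Suc k"] \<open>sg (Suc k) y = - sg k y\<close> by (auto simp: main_def)
        ultimately have "k = 0" using S_pos[of "Suc k"] k by (cases k) auto
        then have "\<sigma> = t k - 1" using 1(3) 0 True t_0 by (simp add: tin_def S_01)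
        then show ?thesis using adjt_cong[OF 1(4) eqt_refl, of "t k"] by (simp add: adjt_small)
      next
        case False
        then have kC: "k = C - 1" using r k by simp
        have "z = Me \<or> z = - Mo" using False rep_cases[OF 1(1) y'(1)] main_range 1(2) y'(2) by blast
        moreover have "E k = (if even k then Me else Mo)" using last_end[of k] k kC by simp
        moreover have "0 \<le> sg k z" using 1(2) S_nonneg[of k] by (auto simp: main_def)
        ultimately have "sg k z = E k" using Me_Mo_pos N by (auto simp: sg_def split: if_splits)
        then have "\<sigma> = t k + 1 - N" using 1(3) k by (simp add: E_def S_def tout_def algebra_simps)
        then have "adjt N \<sigma> (t k)" by (simp add: adjt_def)
        then show ?thesis using adjt_cong[OF 1(4) eqt_refl, of "t k"] by simp
      qed
    qed
  qed
qed

lemma isE_unique: "isE j x \<Longrightarrow> On k x \<Longrightarrow> k = j"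
proof (rule ccontr)
  assume e: "isE j x" and k: "On k x" "k \<noteq> j"
  have j: "On j x" "eqt N (T x) (t (Suc j))" "Suc j < C" "t (Suc j) = t j + 1"
    using isE_On[OF e] e by (auto simp: isE_def)
  have nS: "\<not> On (Suc j) x" using not_glue_out[of "Suc j" x] j by blast
  then have "\<not> j < k" using On_On[OF j(1) k(1)] k(1) by auto
  then have "k < j" using k(2) by simp
  then have o: "On (j - 1) x" "0 < j" using On_On[OF k(1) j(1)] k(1) by auto
  have "adjt N (T x) (t (j - 1))" using On_next_adj[of "j - 1" x] o j by simp
  moreover have "t j \<le> t (j - 1) + 2" "t (j - 1) + 1 \<le> t j" using t_jump[of "j - 1"] o by auto
  ultimately show False
    using adjt_range[OF j(2), of "t (j - 1)"] j(4) N by auto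
qed

lemma isL_unique: "isL j x \<Longrightarrow> On k x \<Longrightarrow> k = j + 2"
proof (rule ccontr)
  assume e: "isL j x" and k: "On k x" "k \<noteq> j + 2"
  have j: "On (j + 2) x" "eqt N (T x) (t j)" "Suc j < C" "t (Suc j) = t j + 1"
    using isL_On[OF e] e by (auto simp: isL_def)
  have nS: "\<not> On (Suc j) x" using not_glue_out[of "Suc j" x] not_glue_in[of "Suc j" x] j by auto
  then have "\<not> k < j + 2" using On_On[OF k(1) j(1)] k(1) by auto
  then have "j + 2 < k" using k(2) by simp
  then have o: "On (j + 3) x" using On_On[OF j(1) k(1)] k(1) by (auto simp: numeral_3_eq_3)
  have "adjt N (T x) (t (j + 2))" using On_next_adj[of "j + 2" x] o j by (simp add: numeral_3_eq_3)
  moreover have "t (j + 2) \<le> t j + 3" "t j + 2 \<le> t (j + 2)" using t_jump[of "Suc j"] j(4) by auto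
  ultimately show False
    using adjt_range[OF j(2), of "t (j + 2)"] N by auto
qed

abbreviation padj :: "int \<Rightarrow> int \<Rightarrow> bool" where
  "padj \<equiv> adjt m"

lemma type_inj:
  assumes "On k x" "On k x'" "eqt N (T x) (T x')"
  shows "m dvd x - x'"
  using assms(1)
proof (cases rule: On_type)
  case (2 y)
  note s = this
  from assms(2) show ?thesis
  proof (cases rule: On_type)
    case (2 y')
    then have "y = y'" using s by (auto simp: short_def sg_def split: if_splits)
    then show ?thesis using dvd_diff[OF s(1) 2(1)] by simp
  next
    case (1 y' \<tau>)
    have k: "0 < k" "k < C" "t k = t (k - 1) + 2" using s by (auto simp: short_def)
    have "eqt N (T x) \<tau>" using assms(3) 1(4) eqt_trans by blast
    then have "\<tau> = t (k - 1) + 1"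
      using eqt_range[OF _ s(3)] 1(5,6) k tin_out[of k] N by (auto simp: tout_def tin_def)
    then show ?thesis using 1(6) k by (simp add: tin_def)
  qed
next
  case (1 y \<tau>)
  note y = this
  from assms(2) show ?thesis
  proof (cases rule: On_type)
    case (2 y')
    have k: "0 < k" "k < C" "t k = t (k - 1) + 2" using 2 by (auto simp: short_def)
    have "eqt N (T x') \<tau>" using assms(3) y(4) eqt_trans eqt_sym by blast
    then have "\<tau> = t (k - 1) + 1"
      using eqt_range[OF _ 2(3)] y(5,6) k tin_out[of k] N by (auto simp: tout_def tin_def)
    then show ?thesis using y(6) k by (simp add: tin_def)
  next
    case (1 y' \<tau>')
    have "eqt N (T x) \<tau>'" using assms(3) 1(4) eqt_trans by blast
    then have "\<tau> = \<tau>'" using eqt_range[OF y(4)] y(5,6) 1(5,6) tin_out[OF On_range[OF assms(1)]] N by auto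
    then have "sg k y = sg k y'" using y(3) 1(3) by simp
    then have "y = y'" by (auto simp: sg_def split: if_splits)
    then show ?thesis using dvd_diff[OF y(1) 1(1)] by simp
  qed
qed

lemma type_adj:
  assumes "On k x" "On k x'" "adjt N (T x) (T x')"
  shows "padj x x'"
  using assms(1)
proof (cases rule: On_type)
  case (2 y)
  have k: "0 < k" "k < C" "t k = t (k - 1) + 2" using 2 by (auto simp: short_def)
  have "adjt N (T x') (t (k - 1) + 1)"
    using adjt_cong[OF 2(3) eqt_refl, of "T x'"] assms(3) adjt_sym by blast
  then have "N dvd T x' - t k \<or> N dvd T x' - t (k - 1)"
    using k(3) by (auto simp: adjt_def algebra_simps)
  then show ?thesis using not_glue_out[OF assms(2) k(2)] not_glue_in[OF assms(2) k(1)] by (auto simp: eqt_def)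
next
  case (1 y \<tau>)
  note y = this
  from assms(2) show ?thesis
  proof (cases rule: On_type)
    case (2 y')
    have k: "0 < k" "k < C" "t k = t (k - 1) + 2" using 2 by (auto simp: short_def)
    have "adjt N (T x) (t (k - 1) + 1)"
      using adjt_cong[OF eqt_refl 2(3), of "T x"] assms(3) by blast
    then have "N dvd T x - t k \<or> N dvd T x - t (k - 1)"
      using k(3) by (auto simp: adjt_def algebra_simps)
    then show ?thesis using not_glue_out[OF assms(1) k(2)] not_glue_in[OF assms(1) k(1)] by (auto simp: eqt_def)
  next
    case (1 y' \<tau>')
    have "adjt N (T x) \<tau>'" using adjt_cong[OF eqt_refl 1(4), of "T x"] assms(3) by blast
    then have "\<tau> = \<tau>' + 1 \<or> \<tau> = \<tau>' - 1"
      using adjt_range[OF y(4), of \<tau>'] y(5,6) 1(5,6) tin_out[OF On_range[OF assms(1)]] N by auto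
    then have "sg k y = sg k y' + 1 \<or> sg k y = sg k y' - 1" using y(3) 1(3) by auto
    then have "y = y' + 1 \<or> y = y' - 1" by (auto simp: sg_def split: if_splits)
    moreover have "m dvd (x - x') - (y - y')" using dvd_diff[OF y(1) 1(1)] by (simp add: algebra_simps)
    ultimately show ?thesis by (auto simp: adjt_def algebra_simps)
  qed
qed

lemma arc_chamber:
  fixes e :: nat
  assumes "0 \<le> d" "d \<le> (if even e then Me else Mo)" "e \<le> 1"
  obtains k where "k \<le> C" "even k = even e" "S k \<le> d" "d \<le> E k \<or> k + 2 \<le> C \<and> d = E k" "d \<le> E k"
    "k + 2 \<le> C \<Longrightarrow> d < S (k + 2)"
proof -
  let ?P = "\<lambda>k. k \<le> C \<and> even k = even e \<and> S k \<le> d"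
  have "e = 0 \<or> e = 1" using assms(3) by auto
  then have e: "?P e" using assms(1) S_01 C_pos by auto
  define k where "k = (GREATEST k. ?P k)"
  have Pk: "?P k" unfolding k_def by (rule GreatestI_nat[of ?P e C]) (use e in auto)
  have n: "k + 2 \<le> C \<Longrightarrow> d < S (k + 2)"
  proof (rule ccontr)
    assume "k + 2 \<le> C" "\<not> d < S (k + 2)"
    then have "?P (k + 2)" using Pk by auto
    then have "k + 2 \<le> k" unfolding k_def by (rule Greatest_le_nat[of ?P _ C]) auto
    then show False by simp
  qed
  have "d \<le> E k"
  proof (cases "k + 2 \<le> C")
    case True
    then show ?thesis using n step_S_cases[of k] by auto
  next
    case False
    then show ?thesis using last_end[of k] Pk assms(2) by auto
  qed
  then show thesis using that Pk n by blast
qed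

lemma On_exists: "\<exists>k. On k x"
proof (cases "norm x \<ge> 0")
  case True
  then obtain k where "k \<le> C" "even k" "S k \<le> norm x" "norm x \<le> E k"
    using arc_chamber[of "norm x" 0] norm_range[of x] by auto
  then have "main k (norm x)" by (auto simp: main_def sg_def)
  then show ?thesis using norm_cong[of x] by (auto simp: On_def)
next
  case False
  then obtain k where "k \<le> C" "odd k" "S k \<le> - norm x" "- norm x \<le> E k"
    using arc_chamber[of "- norm x" 1] norm_range[of x] by auto
  then have "main k (norm x)" by (auto simp: main_def sg_def)
  then show ?thesis using norm_cong[of x] by (auto simp: On_def)
qed

text \<open>Consecutive positions meet in a corner of a common chamber or in a reflex corner. The chamber is
  the last one of the right parity that starts at or before the position.\<close>

lemma corner:
  assumes xx: "m dvd x' - x - 1"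
  shows "(\<exists>k. On k x \<and> On k x' \<and> adjt N (T x) (T x')) \<or> (\<exists>k. isE k x \<and> isL k x') \<or> (\<exists>k. isL k x \<and> isE k x')"
proof -
  define y where "y = (if norm x = Me then - Mo else norm x)"
  have y: "m dvd x - y" "- Mo \<le> y" "y < Me"
  proof -
    show "- Mo \<le> y" "y < Me" using norm_range[of x] Me_Mo_pos N by (auto simp: y_def)
    have "x - (- Mo) = (x - Me) + m" by (simp add: m_def)
    then have "norm x = Me \<Longrightarrow> m dvd x - (- Mo)" using norm_cong[of x] by (metis dvd_add dvd_refl)
    then show "m dvd x - y" using norm_cong[of x] by (auto simp: y_def)
  qed
  have y': "m dvd x' - (y + 1)" using dvd_add[OF xx y(1)] by (simp add: algebra_simps)
  have share: ?thesis if "main k y" "main k (y + 1)" for k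
  proof -
    have "eqt N (T x) (- 1 - \<bar>y\<bar>)" "eqt N (T x') (- 1 - \<bar>y + 1\<bar>)"
      using T_rep[OF y(1)] T_rep[OF y'] y by auto
    moreover have "adjt N (- 1 - \<bar>y\<bar>) (- 1 - \<bar>y + 1\<bar>)"
      by (rule adjt_small) auto
    ultimately have "adjt N (T x) (T x')" using adjt_cong by blast
    then show ?thesis using that y(1) y' by (auto simp: On_def)
  qed
  show ?thesis
  proof (cases "y \<ge> 0")
    case True
    obtain k where k: "k \<le> C" "even k" "S k \<le> y" "y \<le> E k" "k + 2 \<le> C \<Longrightarrow> y < S (k + 2)"
      using arc_chamber[of y 0] True y by auto
    show ?thesis
    proof (cases "y + 1 \<le> E k")
      case True
      then show ?thesis using k by (intro share[of k]) (auto simp: main_def sg_def)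
    next
      case False
      then have e: "y = E k" using k by simp
      then have kC: "k + 2 \<le> C" using last_end[of k] k y by (cases "C \<le> Suc k") auto
      then have "S (k + 2) = E k + 1" "t (Suc k) = t k + 1" using step_S_cases[of k] k e by auto
      moreover have "sg k y = E k" "sg k (y + 1) = E k + 1" using k e by (auto simp: sg_def)
      ultimately have "isE k x \<and> isL k x'" using kC y(1) y' unfolding isE_def isL_def by auto
      then show ?thesis by blast
    qed
  next
    case False
    obtain k where k: "k \<le> C" "odd k" "S k \<le> - y - 1" "- y - 1 \<le> E k" "k + 2 \<le> C \<Longrightarrow> - y - 1 < S (k + 2)"
      using arc_chamber[of "- y - 1" 1] False y by auto
    show ?thesis
    proof (cases "- y \<le> E k")
      case True
      then show ?thesis using k by (intro share[of k]) (auto simp: main_def sg_def)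
    next
      case False
      then have e: "- (y + 1) = E k" using k by simp
      then have kC: "k + 2 \<le> C" using last_end[of k] k y by (cases "C \<le> Suc k") auto
      then have "S (k + 2) = - y" "t (Suc k) = t k + 1" using step_S_cases[of k] k e by auto
      moreover have "sg k y = - y" "sg k (y + 1) = E k" using k e by (auto simp: sg_def)
      ultimately have "isL k x \<and> isE k x'" using kC y(1) y' unfolding isE_def isL_def by auto
      then show ?thesis by blast
    qed
  qed
qed

text \<open>Away from its two ends, the run of the chamber \<open>0\<close> consists of \<open>N - 3\<close> sides of this chamber alone.
  A crossing that starts a new blob places the crossed side there, at position \<open>2\<close> or \<open>3\<close>, so that its
  neighbours are also ordinary sides.\<close>

lemma first_chamber:
  assumes "0 < x" "x < N - 2"
  shows "On k x \<longleftrightarrow> k = 0" and "T x = - 1 - x"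
proof -
  have xr: "- Mo < x" "x < Me" using assms Me_Mo_pos N by auto
  have "On 0 x" using assms SE[of 0] S_01 C_pos by (auto simp: On_def main_def sg_def E_def hf_def tout_def t_0 intro!: exI[of _ x])
  moreover have "k = 0" if On: "On k x"
  proof (rule ccontr)
    assume "k \<noteq> 0"
    obtain y where y: "m dvd x - y" "main k y \<or> short k y" using On by (auto simp: On_def)
    then have "main k y \<or> main (k - 1) y" using short_main by blast
    then have "- Mo \<le> y" "y \<le> Me" using main_range by blast+
    then have "y = x" using rep_cases[of x y x] y(1) xr by auto
    have E0: "E 0 = N - 2" using C_pos by (simp add: E_def hf_def tout_def t_0)
    have 1: "k' = 0" if mn: "main k' x" for k'
    proof (rule ccontr)
      assume k': "k' \<noteq> 0"
      have ev: "even k'" using mn assms S_nonneg[of k'] by (auto simp: main_def sg_def split: if_splits)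
      have "main 0 x" using assms E0 C_pos S_01 by (simp add: main_def sg_def)
      then show False using main_main[OF _ mn] k' ev E0 assms by (auto simp: sg_def)
    qed
    then have "\<not> main k x" using \<open>k \<noteq> 0\<close> by blast
    then have s: "short k x" using y(2) \<open>y = x\<close> by simp
    then have "k - 1 = 0" "k + 1 = 0" using 1 short_main by blast+
    then show False by simp
  qed
  ultimately show "On k x \<longleftrightarrow> k = 0" by blast
  have "norm x = x" using rep_cases[of x "norm x" x] norm_cong[of x] norm_range[of x] xr by auto
  then show "T x = - 1 - x" using assms by (simp add: T_def)
qed

text \<open>Clean sides are those away from the reflex corners, and long sides are those that are shared
  by several chambers.\<close>

definition clean :: "int \<Rightarrow> bool" where
  "clean x \<longleftrightarrow> (\<forall>k. \<not> isE k x \<and> \<not> isL k x)"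

definition long :: "int \<Rightarrow> bool" where
  "long x \<longleftrightarrow> (\<exists>k. On k x \<and> On (Suc k) x)"

lemma cong:
  assumes "m dvd x - x'"
  shows "On k x = On k x'" "T x = T x'" "isE k x = isE k x'" "isL k x = isL k x'" "clean x = clean x'" "long x = long x'"
proof -
  have d: "m dvd x - y \<longleftrightarrow> m dvd x' - y" for y
    using assms by (metis diff_add_cancel dvd_diff_commute add_diff_eq dvd_add_right_iff)
  show o: "On k x = On k x'" for k by (simp add: On_def d)
  show "T x = T x'" using norm_eq[OF assms] by (simp add: T_def)
  show e: "isE k x = isE k x'" "isL k x = isL k x'" for k by (simp_all add: isE_def isL_def d)
  show "clean x = clean x'" "long x = long x'" by (simp_all add: clean_def long_def e o)
qed

lemma padj_corner:
  assumes "padj x x'"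
  shows "(\<exists>k. On k x \<and> On k x' \<and> adjt N (T x) (T x')) \<or> (\<exists>k. isE k x \<and> isL k x') \<or> (\<exists>k. isL k x \<and> isE k x')"
proof -
  have "x - x' + 1 = - (x' - x - 1)" by simp
  then have "m dvd x - x' - 1 \<or> m dvd x' - x - 1" using assms unfolding adjt_def by (metis dvd_minus_iff)
  then consider "m dvd x - x' - 1" | "m dvd x' - x - 1" by blast
  then show ?thesis using corner[of x x'] corner[of x' x] adjt_sym by cases blast+
qed

lemma adjt_not_eqt: "adjt N v w \<Longrightarrow> \<not> eqt N v w"
proof
  assume "adjt N v w" "eqt N v w"
  then have "N dvd (v - w) - (v - w - 1) \<or> N dvd (v - w + 1) - (v - w)"
    unfolding adjt_def eqt_def by (meson dvd_diff)
  then show False using N by auto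
qed

lemma E_L_aux: "isE k x \<Longrightarrow> isL j x \<Longrightarrow> False"
proof -
  assume e: "isE k x" and l: "isL j x"
  have k: "k = j + 2" using isE_unique[OF e, of "j + 2"] isL_On[OF l] by simp
  have j: "Suc k < C" "t (Suc k) = t k + 1" "t (Suc j) = t j + 1" using e l by (auto simp: isE_def isL_def)
  have "t k = t (Suc j) + 1 \<or> t k = t (Suc j) + 2" using t_jump[of "Suc j"] k by simp
  then show False
    using eqt_range[of "T x" "t (Suc k)" "t j"] isE_On[OF e] isL_On[OF l] j N by auto
qed

lemma E_E_nbr: "isE k x \<Longrightarrow> isE j x' \<Longrightarrow> padj x x' \<Longrightarrow> False"
proof -
  assume e: "isE k x" "isE j x'" and "padj x x'"
  from padj_corner[OF this(3)] show False
  proof (elim disjE exE conjE)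
    fix i assume "On i x" "On i x'" "adjt N (T x) (T x')"
    then have "i = k" "i = j" using isE_unique e by auto
    then have "eqt N (T x) (T x')" using isE_On[OF e(1)] isE_On[OF e(2)] eqt_sym eqt_trans by blast
    then show ?thesis using adjt_not_eqt \<open>adjt N (T x) (T x')\<close> by blast
  next
    fix i assume "isL i x'"
    then show ?thesis using E_L_aux[OF e(2)] by blast
  next
    fix i assume "isL i x"
    then show ?thesis using E_L_aux[OF e(1)] by blast
  qed
qed

lemma L_L_nbr: "isL k x \<Longrightarrow> isL j x' \<Longrightarrow> padj x x' \<Longrightarrow> False"
proof -
  assume e: "isL k x" "isL j x'" and "padj x x'"
  from padj_corner[OF this(3)] show False
  proof (elim disjE exE conjE)
    fix i assume "On i x" "On i x'" "adjt N (T x) (T x')"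
    then have "i = k + 2" "i = j + 2" using isL_unique e by auto
    then have "eqt N (T x) (t k)" "eqt N (T x') (t k)" using isL_On[OF e(1)] isL_On[OF e(2)] by simp_all
    then have "eqt N (T x) (T x')" using eqt_sym eqt_trans by blast
    then show ?thesis using adjt_not_eqt \<open>adjt N (T x) (T x')\<close> by blast
  qed (use E_L_aux e in blast)+
qed

lemma E_L_nbr: "isE k x \<Longrightarrow> isL j x' \<Longrightarrow> padj x x' \<Longrightarrow> j = k"
proof -
  assume e: "isE k x" "isL j x'" and "padj x x'"
  from padj_corner[OF this(3)] show ?thesis
  proof (elim disjE exE conjE)
    fix i assume a: "On i x" "On i x'" "adjt N (T x) (T x')"
    then have i: "i = k" "k = j + 2" using isE_unique[OF e(1)] isL_unique[OF e(2)] by auto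
    have j: "t (Suc k) = t k + 1" "t (Suc j) = t j + 1" using e by (auto simp: isE_def isL_def)
    have "t k = t (Suc j) + 1 \<or> t k = t (Suc j) + 2" using t_jump[of "Suc j"] i by simp
    moreover have "adjt N (t (Suc k)) (t j)" using adjt_cong isE_On[OF e(1)] isL_On[OF e(2)] a(3) by blast
    ultimately show ?thesis using adjt_range[of "t (Suc k)" "t (Suc k)" "t j"] j N by auto
  next
    fix i assume "isE i x" "isL i x'"
    then show ?thesis using isE_unique[OF e(1)] isE_On isL_unique[OF e(2)] isL_On by fastforce
  qed (use E_L_aux e in blast)+
qed

lemma E_nbr:
  assumes e: "isE k x" and a: "padj x x'" and l: "\<not> isL k x'"
  shows "On k x'" "adjt N (T x) (T x')" "eqt N (T x') (t k + 2)" "clean x'"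
proof -
  have k: "Suc k < C" "t (Suc k) = t k + 1" using e by (auto simp: isE_def)
  have nl: "\<not> isL j x'" for j using E_L_nbr[OF e _ a] l by blast
  from padj_corner[OF a] have "\<exists>i. On i x \<and> On i x' \<and> adjt N (T x) (T x')" using nl E_L_aux[OF e] by blast
  then show o: "On k x'" and ad: "adjt N (T x) (T x')" using isE_unique[OF e] by auto
  have "adjt N (T x') (t k + 1)"
    using adjt_cong[OF eqt_refl[of N "T x'"] conjunct2[OF isE_On[OF e]]] adjt_sym[OF ad] k(2) by simp
  then have "N dvd T x' - t k - 2 \<or> N dvd T x' - t k" by (auto simp: adjt_def algebra_simps)
  then show "eqt N (T x') (t k + 2)" using not_glue_out[OF o] k by (auto simp: eqt_def algebra_simps)
  show "clean x'" unfolding clean_def using nl E_E_nbr[OF e _ a] by blast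
qed

lemma L_nbr:
  assumes e: "isL k x" and a: "padj x x'" and l: "\<not> isE k x'"
  shows "On (k + 2) x'" "adjt N (T x) (T x')" "eqt N (T x') (t k - 1)" "clean x'"
proof -
  have k: "Suc k < C" "t (Suc k) = t k + 1" using e by (auto simp: isL_def)
  have nl: "\<not> isE j x'" for j using E_L_nbr[OF _ e adjt_sym[OF a]] l by blast
  from padj_corner[OF a] have "\<exists>i. On i x \<and> On i x' \<and> adjt N (T x) (T x')" using nl E_L_aux[OF _ e] by blast
  then show o: "On (k + 2) x'" and ad: "adjt N (T x) (T x')" using isL_unique[OF e] by auto
  have "adjt N (T x') (t k)"
    using adjt_cong[OF eqt_refl[of N "T x'"] conjunct2[OF isL_On[OF e]]] adjt_sym[OF ad] by simp
  then have "N dvd T x' - t k - 1 \<or> N dvd T x' - t k + 1" by (auto simp: adjt_def)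
  moreover have "\<not> eqt N (T x') (t (Suc k))" using not_glue_in[OF o] by simp
  ultimately show "eqt N (T x') (t k - 1)" using k by (auto simp: eqt_def algebra_simps)
  show "clean x'" unfolding clean_def using nl L_L_nbr[OF e _ a] by blast
qed

lemma long_clean: "long x \<Longrightarrow> clean x"
  unfolding long_def clean_def using isE_unique isL_unique by (metis n_not_Suc_n)

lemma long_glue:
  assumes "long x" "On j x"
  shows "(j < C \<and> adjt N (T x) (t j)) \<or> (0 < j \<and> adjt N (T x) (t (j - 1)))"
proof -
  obtain k where k: "On k x" "On (Suc k) x" using assms by (auto simp: long_def)
  consider "j = k" | "j = Suc k" | "j < k" | "j > Suc k" by linarith
  then show ?thesis
  proof cases
    case 1
    then show ?thesis using On_next_adj[OF k] On_range[OF k(2)] by auto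
  next
    case 2
    then show ?thesis using On_next_adj[OF k] by auto
  next
    case 3
    then have "On (Suc j) x" using On_On[OF assms(2) k(1)] k(1) by auto
    then show ?thesis using On_next_adj[OF assms(2)] On_range by fastforce
  next
    case 4
    then have "On (j - 1) x" "0 < j" using On_On[OF k(2) assms(2)] k(2) by auto
    then show ?thesis using On_next_adj[of "j - 1" x] assms(2) by auto
  qed
qed

lemma near_types:
  assumes "eqt N u v" "adjt N u w \<or> adjt N u w'" "\<And>c. c \<in> {w, w'} \<Longrightarrow> 2 \<le> \<bar>v - c\<bar> \<and> \<bar>v - c\<bar> \<le> N - 2"
  shows False
proof -
  have "far N u w" "far N u w'"
    using assms(3) far_cong[OF assms(1) eqt_refl] far_small[of v _ N] by blast+
  then show False using assms(2) by (simp add: far_def)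
qed

text \<open>The neighbours of long sides are ordinary sides, because \<open>N \<ge> 7\<close> leaves enough room
  between two gluings on the same chamber.\<close>

lemma long_nbr:
  assumes "long x" "padj x x'"
  shows "clean x' \<and> \<not> long x'"
proof -
  have c: "clean x" by (rule long_clean[OF assms(1)])
  obtain j where j: "On j x" "On j x'" "adjt N (T x) (T x')"
    using padj_corner[OF assms(2)] c by (auto simp: clean_def)
  note g = long_glue[OF assms(1) j(1)]
  have 1: "\<not> isE i x'" for i
  proof
    assume e: "isE i x'"
    then have i: "i = j" using isE_unique[OF e j(2)] by simp
    have x: "eqt N (T x) (t j + 2)" using E_nbr(3)[OF e adjt_sym[OF assms(2)]] c i by (auto simp: clean_def)
    have "t j = t (j - 1) + 1 \<or> t j = t (j - 1) + 2" if "0 < j" using t_jump[of "j - 1"] that by simp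
    then show False
      using g near_types[OF x, of "t j" "t j"] near_types[OF x, of "t (j - 1)" "t (j - 1)"] N by fastforce
  qed
  have 2: "\<not> isL i x'" for i
  proof
    assume e: "isL i x'"
    then have i: "j = i + 2" using isL_unique[OF e j(2)] by simp
    have x: "eqt N (T x) (t i - 1)" using L_nbr(3)[OF e adjt_sym[OF assms(2)]] c i by (auto simp: clean_def)
    have "t (j - 1) = t i + 1" "t j = t (Suc i) + 1 \<or> t j = t (Suc i) + 2" "t (Suc i) = t i + 1"
      using e i t_jump[of "Suc i"] by (auto simp: isL_def)
    then show False
      using g near_types[OF x, of "t j" "t j"] near_types[OF x, of "t (j - 1)" "t (j - 1)"] N by fastforce
  qed
  have 3: "\<not> long x'"
  proof
    assume "long x'"
    note g' = long_glue[OF this j(2)]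
    have pick: "\<exists>a. eqt N (T z) a \<and> (j < C \<and> (a = t j + 1 \<or> a = t j - 1) \<or>
        0 < j \<and> (a = t (j - 1) + 1 \<or> a = t (j - 1) - 1))"
      if "(j < C \<and> adjt N (T z) (t j)) \<or> (0 < j \<and> adjt N (T z) (t (j - 1)))" for z
    proof -
      have "\<exists>a. eqt N u a \<and> (a = v + 1 \<or> a = v - 1)" if "adjt N u v" for u v
        using that unfolding adjt_def eqt_def by (metis diff_diff_eq diff_diff_eq2 diff_add_eq)
      then show ?thesis using that by meson
    qed
    obtain a where a: "eqt N (T x) a" "j < C \<and> (a = t j + 1 \<or> a = t j - 1) \<or>
        0 < j \<and> (a = t (j - 1) + 1 \<or> a = t (j - 1) - 1)" using pick[OF g] by blast
    obtain b where b: "eqt N (T x') b" "j < C \<and> (b = t j + 1 \<or> b = t j - 1) \<or>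
        0 < j \<and> (b = t (j - 1) + 1 \<or> b = t (j - 1) - 1)" using pick[OF g'] by blast
    have na: "j < C \<Longrightarrow> a \<noteq> t j" "0 < j \<Longrightarrow> a \<noteq> t (j - 1)"
      using not_glue_out[OF j(1)] not_glue_in[OF j(1)] a(1) by auto
    have nb: "j < C \<Longrightarrow> b \<noteq> t j" "0 < j \<Longrightarrow> b \<noteq> t (j - 1)"
      using not_glue_out[OF j(2)] not_glue_in[OF j(2)] b(1) by auto
    have J: "0 < j \<Longrightarrow> t j = t (j - 1) + 1 \<or> t j = t (j - 1) + 2" using t_jump[of "j - 1"] by simp
    have r: "\<bar>a - b\<bar> \<le> 4" using a(2) b(2) J by auto
    have "adjt N a b" using adjt_cong[OF a(1) b(1)] j(3) by simp
    then have "a = b + 1 \<or> a = b - 1" using adjt_range[of a a b] r N by auto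
    then show False using a(2) b(2) na nb J by (elim disjE conjE; force)
  qed
  show ?thesis using 1 2 3 by (auto simp: clean_def)
qed

lemma long_nbr2:
  assumes "long x" "padj x x'" "padj x' x''"
  shows "\<not> isL k x''"
proof
  assume l: "isL k x''"
  have c: "clean x" "clean x'" "\<not> long x'" using long_clean long_nbr assms by blast+
  obtain j where j: "On j x" "On j x'" "adjt N (T x) (T x')"
    using padj_corner[OF assms(2)] c by (auto simp: clean_def)
  have x': "On (k + 2) x'" "eqt N (T x') (t k - 1)"
    using L_nbr[OF l adjt_sym[OF assms(3)]] c by (auto simp: clean_def)
  have "j = k + 2"
  proof (rule ccontr)
    assume ne: "j \<noteq> k + 2"
    have "long x'" if "On i x'" "On i' x'" "i < i'" for i i'
      using On_On[OF that] that by (auto simp: long_def)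
    then show False using ne j(2) x'(1) c(3) by (metis nat_neq_iff)
  qed
  then have o: "On (k + 2) x" using j by simp
  have k: "Suc k < C" "t (Suc k) = t k + 1" using l by (auto simp: isL_def)
  have "adjt N (T x) (t k - 1)" using adjt_cong[OF eqt_refl x'(2)] j(3) by blast
  then have "N dvd T x - t k \<or> N dvd T x - (t k - 2)" by (auto simp: adjt_def algebra_simps)
  moreover have "\<not> eqt N (T x) (t k)" using isL_iff[OF o _ k] c by (auto simp: clean_def)
  ultimately have x: "eqt N (T x) (t k - 2)" by (auto simp: eqt_def)
  have "t (k + 2) = t (Suc k) + 1 \<or> t (k + 2) = t (Suc k) + 2" using t_jump[of "Suc k"] by simp
  then show False using long_glue[OF assms(1) o] k(2) N
      near_types[OF x, of "t (k + 2)" "t (k + 2)"] near_types[OF x, of "t (Suc k)" "t (Suc k)"] by fastforce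
qed

lemma first_clean: assumes "0 < x" "x < N - 2" shows "clean x" "\<not> long x"
proof -
  note f = first_chamber[OF assms]
  have "\<not> isE k x" for k
  proof
    assume e: "isE k x"
    then have "k = 0" "eqt N (T x) (t 1)" using isE_On[OF e] f(1)[of k] by auto
    then have "N dvd - 2 - x" using e f(2) t_0 by (simp add: isE_def eqt_def)
    then show False using not_dvd_small(2)[of "- 2 - x" N] assms by simp
  qed
  moreover have "\<not> isL k x" for k using isL_On[of k x] f(1)[of "k + 2"] by auto
  ultimately show "clean x" by (simp add: clean_def)
  show "\<not> long x" using f(1) by (auto simp: long_def)
qed

lemma first_not_L: assumes "0 \<le> x" "x \<le> N - 2" shows "\<not> isL k x"
proof
  assume "isL k x"
  moreover have "On 0 x" using assms SE[of 0] S_01 C_pos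
    by (auto simp: On_def main_def sg_def E_def hf_def tout_def t_0 intro!: exI[of _ x])
  ultimately show False using isL_unique[of k x 0] by simp
qed

end

section \<open>Blobs of chambers\<close>

text \<open>A blob is the union of the chain \<open>y\<^sub>k\<^sub>+\<^sub>1 = y\<^sub>k f\<close>, where \<open>f = f (t k)\<close> is a fixed nontrivial element of
  each vertex group and \<open>y\<^sub>0 = \<one>\<close>.\<close>

locale blob = shape N p q + heads N Bt Y mv hd
  for N :: int and p q :: nat and Bt :: "int \<Rightarrow> 'b monoid" and Y :: "'y set"
    and mv :: "int \<Rightarrow> 'b \<Rightarrow> 'y \<Rightarrow> 'y" and hd :: "int \<Rightarrow> 'y \<Rightarrow> 'b" +
  fixes f :: "int \<Rightarrow> 'b"
  assumes f_closed [simp]: "f v \<in> carrier (Bt v)"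
    and f_ne: "f v \<noteq> \<one>\<^bsub>Bt v\<^esub>"
    and f_per: "eqt N v w \<Longrightarrow> f v = f w"
begin

abbreviation one_t where "one_t v \<equiv> \<one>\<^bsub>Bt v\<^esub>"
abbreviation inv_t where "inv_t v b \<equiv> inv\<^bsub>Bt v\<^esub> b"

lemma Bt_cong: "eqt N v w \<Longrightarrow> Bt v = Bt w" using per by blast
lemma mv_cong: "eqt N v w \<Longrightarrow> mv v = mv w" using per by blast
lemma hd_cong: "eqt N v w \<Longrightarrow> hd v = hd w" using per by blast

text \<open>A point as seen from chamber \<open>k\<close> of the blob, and the inverse change of viewpoint.\<close>

primrec pt :: "nat \<Rightarrow> 'y \<Rightarrow> 'y" where
  "pt 0 y = y"
| "pt (Suc k) y = mv (t k) (inv_t (t k) (f (t k))) (pt k y)"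

primrec upt :: "nat \<Rightarrow> 'y \<Rightarrow> 'y" where
  "upt 0 y = y"
| "upt (Suc k) y = upt k (mv (t k) (f (t k)) y)"

lemma pt_closed [simp]: "y \<in> Y \<Longrightarrow> pt k y \<in> Y"
  by (induction k) auto

lemma upt_closed [simp]: "y \<in> Y \<Longrightarrow> upt k y \<in> Y"
  by (induction k arbitrary: y) auto

lemma pt_upt [simp]: "y \<in> Y \<Longrightarrow> pt k (upt k y) = y"
  by (induction k arbitrary: y) auto

lemma upt_pt [simp]: "y \<in> Y \<Longrightarrow> upt k (pt k y) = y"
  by (induction k arbitrary: y) auto

lemma chain: "y \<in> Y \<Longrightarrow> chain_pts N Bt Y mv hd C t (\<lambda>k. f (t k)) (\<lambda>k. pt k y)"
  by unfold_locales (auto simp: f_ne t_jump)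

lemmas pt_Suc = pt.simps(2)
declare pt.simps(2) [simp del] upt.simps(2) [simp del]

definition chamber_of :: "int \<Rightarrow> nat" where "chamber_of x = (SOME k. On k x)"

lemma chamber_of: "On (chamber_of x) x"
  unfolding chamber_of_def using On_exists someI_ex by metis

text \<open>The sector of a point at the wall through the side \<open>x\<close>. By the next lemmas any chamber of a
  long side gives the same value.\<close>

definition coord :: "int \<Rightarrow> 'y \<Rightarrow> 'b" where "coord x y = hd (T x) (pt (chamber_of x) y)"

lemma coord_closed [simp]: "y \<in> Y \<Longrightarrow> coord x y \<in> carrier (Bt (T x))"
  by (simp add: coord_def)

lemma coord_next:
  assumes "On k x" "On (Suc k) x" "y \<in> Y"
  shows "hd (T x) (pt (Suc k) y) = hd (T x) (pt k y)"
  using On_next_adj[OF assms(1,2)] assms(3) by (simp add: hd_adj pt_Suc)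

lemma coord_eq: assumes "On k x" "y \<in> Y" shows "coord x y = hd (T x) (pt k y)"
proof -
  have *: "hd (T x) (pt l y) = hd (T x) (pt k y)" if "On k x" "On l x" "k < l" for k l
    using On_On[OF that] that coord_next[OF that(1) _ assms(2)] coord_next[of "Suc k" x y] assms(2) by auto
  consider "k < chamber_of x" | "k = chamber_of x" | "chamber_of x < k" by linarith
  then show ?thesis using *[of k "chamber_of x"] *[of "chamber_of x" k] chamber_of[of x] assms(1) by cases (auto simp: coord_def)
qed

definition early where "early k y = chain_pts.early Bt mv hd C t (\<lambda>k. f (t k)) (\<lambda>k. pt k y) k"
definition late where "late k y = chain_pts.late Bt mv hd C t (\<lambda>k. f (t k)) (\<lambda>k. pt k y) k"

text \<open>The points behind the side \<open>x\<close> in its sector \<open>b\<close>. For a side at a reflex corner a sector of its wall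
  is larger than the part behind the side.\<close>

definition region :: "int \<Rightarrow> 'b \<Rightarrow> 'y \<Rightarrow> bool" where
  "region x b y \<longleftrightarrow> coord x y = b \<and> (\<forall>k. isE k x \<longrightarrow> early k y) \<and> (\<forall>k. isL k x \<longrightarrow> late k y)"

lemma region_clean: "clean x \<Longrightarrow> region x b y \<longleftrightarrow> coord x y = b"
  by (simp add: region_def clean_def)

context
  fixes y assumes y: "y \<in> Y"
begin

interpretation ch: chain_pts N Bt Y mv hd C t "\<lambda>k. f (t k)" "\<lambda>k. pt k y"
  by (rule chain[OF y])

lemma coord_E: "isE k x \<Longrightarrow> coord x y = hd (t (Suc k)) (pt k y) \<and> coord x y = ch.a (Suc k)"
proof -
  assume e: "isE k x"
  then have k: "Suc k < C" "t (Suc k) = t k + 1" by (auto simp: isE_def)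
  have "coord x y = hd (t (Suc k)) (pt k y)"
    using coord_eq[OF conjunct1[OF isE_On[OF e]] y] hd_cong[OF conjunct2[OF isE_On[OF e]]] by simp
  then show ?thesis using ch.a_jump1[OF k] by simp
qed

lemma coord_L: "isL k x \<Longrightarrow> coord x y = hd (t k) (pt (k + 2) y) \<and> coord x y = hd (t k) (pt (Suc k) y)"
proof -
  assume e: "isL k x"
  then have k: "Suc k < C" "t (Suc k) = t k + 1" by (auto simp: isL_def)
  have "coord x y = hd (t k) (pt (k + 2) y)"
    using coord_eq[OF conjunct1[OF isL_On[OF e]] y] hd_cong[OF conjunct2[OF isL_On[OF e]]] by simp
  then show ?thesis using ch.next_adj[OF k(1), of "t k"] adjt_small[of "t k" "t (Suc k)" N] k(2) by simp
qed

lemma region_coord_ne: "region x b y \<Longrightarrow> b \<noteq> one_t (T x) \<Longrightarrow> On k x \<Longrightarrow> hd (T x) (pt k y) \<noteq> one_t (T x)"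
  using coord_eq y by (simp add: region_def)

text \<open>Behind a side, the coordinates at all clean sides other than its neighbours are trivial. If the
  two sides have a chamber in common this holds since their types are far from each other; otherwise
  the chain between the nearest chambers of the two sides separates them.\<close>

lemma region_far_clean:
  assumes r: "region x b y" "b \<noteq> one_t (T x)" and c: "clean x'" and ne: "\<not> padj x x'" "\<not> m dvd x - x'"
  shows "coord x' y = one_t (T x')"
proof (cases "\<exists>k. On k x \<and> On k x'")
  case True
  then obtain k where k: "On k x" "On k x'" by blast
  have "\<not> eqt N (T x) (T x')" "\<not> adjt N (T x) (T x')"
    using type_inj[OF k] type_adj[OF k] ne by blast+
  then have "far N (T x') (T x)" by (intro far_sym[OF iffD2[OF far_def]] conjI)
  then have "hd (T x') (pt k y) = one_t (T x')"
    by (rule hd_far) (use region_coord_ne[OF r k(1)] y in auto)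
  then show ?thesis using coord_eq[OF k(2) y] by simp
next
  case False
  obtain k0 where k0: "On k0 x" using On_exists by blast
  obtain l0 where l0: "On l0 x'" using On_exists by blast
  have bnd: "k < C" if "k < l" "On l z" for k l z using that On_range by fastforce
  show ?thesis
  proof (cases "k0 < l0")
    case True
    \<comment> \<open>The last chamber of \<open>x\<close> and the first one of \<open>x'\<close>.\<close>
    define k where "k = (GREATEST k. On k x)"
    define l where "l = (LEAST l. On l x')"
    have k: "On k x" unfolding k_def by (rule GreatestI_nat[of _ k0 C]) (use k0 On_range in auto)
    have kmax: "On k' x \<Longrightarrow> k' \<le> k" for k' unfolding k_def by (rule Greatest_le_nat[of _ _ C]) (auto simp: On_range)
    have l: "On l x'" unfolding l_def by (rule LeastI[of _ l0]) (rule l0)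
    have lmin: "On l' x' \<Longrightarrow> l \<le> l'" for l' unfolding l_def by (rule Least_le)
    have "l \<le> l0" "k0 \<le> k" using kmax lmin k0 l0 by auto
    have kl: "k < l"
    proof (rule ccontr)
      assume "\<not> k < l"
      then have "l < k" using False k l by (cases "k = l") auto
      have ii: "On j z" if "On i z" "On i' z" "i \<le> j" "j \<le> i'" for i i' j z
      proof (cases "i = j \<or> j = i'")
        case False
        then have "i < i'" "j = Suc i" using On_On[OF that(1,2)] that by auto
        then show ?thesis using On_On[OF that(1,2)] False that by auto
      qed (use that in auto)
      show False
      proof (cases "l \<le> k0")
        case True
        then have "On k0 x'" using ii[OF l l0] \<open>k0 < l0\<close> by simp
        then show False using \<open>\<not> (\<exists>k. On k x \<and> On k x')\<close> k0 by blast
      next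
        case False
        then have "On l x" using ii[OF k0 k] \<open>l < k\<close> by simp
        then show False using \<open>\<not> (\<exists>k. On k x \<and> On k x')\<close> l by blast
      qed
    qed
    have lC: "l \<le> C" using On_range[OF l] .
    have "hd (T x') (pt l y) = one_t (T x')"
    proof (rule ch.behind_far[OF kl lC])
      show "hd (T x) (pt k y) \<noteq> one_t (T x)" by (rule region_coord_ne[OF r k])
      have kC: "k < C" using kl lC by simp
      show "far N (T x) (t k) \<or> ch.early k"
      proof (cases "adjt N (T x) (t k)")
        case True
        then have "isE k x" using next_side[OF k kC] kmax[of "Suc k"] by auto
        then show ?thesis using r by (simp add: region_def early_def)
      next
        case False
        then show ?thesis using not_glue_out[OF k kC] by (simp add: far_def)
      qed
      show "far N (T x') (t (l - 1))"
      proof -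
        have "\<not> On (l - 1) x'" using lmin[of "l - 1"] kl by auto
        then have "\<not> adjt N (T x') (t (l - 1))" using prev_side[OF l] c kl by (auto simp: clean_def)
        then show ?thesis using not_glue_in[OF l] kl by (simp add: far_def)
      qed
      show "l < C \<Longrightarrow> \<not> eqt N (T x') (t l)" using not_glue_out[OF l] .
      show "\<not> eqt N (T x') (t k)" if "l = Suc (Suc k)" "t (Suc k) = t k + 1"
        using isL_iff[of k x'] l that c lC by (auto simp: clean_def)
    qed
    then show ?thesis using coord_eq[OF l y] by simp
  next
    case 2: False
    define k where "k = (LEAST k. On k x)"
    define l where "l = (GREATEST l. On l x')"
    have l: "On l x'" unfolding l_def by (rule GreatestI_nat[of _ l0 C]) (use l0 On_range in auto)
    have lmax: "On l' x' \<Longrightarrow> l' \<le> l" for l' unfolding l_def by (rule Greatest_le_nat[of _ _ C]) (auto simp: On_range)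
    have k: "On k x" unfolding k_def by (rule LeastI[of _ k0]) (rule k0)
    have kmin: "On k' x \<Longrightarrow> k \<le> k'" for k' unfolding k_def by (rule Least_le)
    have "l0 \<noteq> k0" using False k0 l0 by blast
    then have "l0 < k0" using 2 by simp
    have kl: "l < k"
    proof (rule ccontr)
      assume "\<not> l < k"
      then have "k < l" using False k l by (cases "k = l") auto
      have ii: "On j z" if "On i z" "On i' z" "i \<le> j" "j \<le> i'" for i i' j z
      proof (cases "i = j \<or> j = i'")
        case False
        then have "i < i'" "j = Suc i" using On_On[OF that(1,2)] that by auto
        then show ?thesis using On_On[OF that(1,2)] False that by auto
      qed (use that in auto)
      show False
      proof (cases "k \<le> l0")
        case True
        then have "On l0 x" using ii[OF k k0] \<open>l0 < k0\<close> by simp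
        then show False using \<open>\<not> (\<exists>k. On k x \<and> On k x')\<close> l0 by blast
      next
        case False
        then have "On k x'" using ii[OF l0 l] \<open>k < l\<close> by simp
        then show False using \<open>\<not> (\<exists>k. On k x \<and> On k x')\<close> k by blast
      qed
    qed
    have kC: "k \<le> C" using On_range[OF k] .
    have "hd (T x') (pt l y) = one_t (T x')"
    proof (rule ch.ahead_far[OF kl kC])
      show "hd (T x) (pt k y) \<noteq> one_t (T x)" by (rule region_coord_ne[OF r k])
      show "far N (T x) (t (k - 1)) \<or> 2 \<le> k \<and> ch.late (k - 2)"
      proof (cases "adjt N (T x) (t (k - 1))")
        case True
        have "\<not> On (k - 1) x" using kmin[of "k - 1"] kl by auto
        then have "2 \<le> k" "isL (k - 2) x" using prev_side[OF k _ True] kl by auto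
        then show ?thesis using r by (simp add: region_def late_def)
      next
        case False
        then show ?thesis using not_glue_in[OF k] kl by (simp add: far_def)
      qed
      have lC: "l < C" using kl kC by simp
      show "far N (T x') (t l)"
      proof -
        have "\<not> On (Suc l) x'" using lmax[of "Suc l"] by auto
        then have "\<not> adjt N (T x') (t l)" using next_side[OF l lC] c by (auto simp: clean_def)
        then show ?thesis using not_glue_out[OF l lC] by (simp add: far_def)
      qed
      show "0 < l \<Longrightarrow> \<not> eqt N (T x') (t (l - 1))" using not_glue_in[OF l] .
      show "\<not> eqt N (T x') (t (Suc l))" if "k = Suc (Suc l)" "t (Suc l) = t l + 1"
        using isE_iff[OF l] that c kC by (auto simp: clean_def)
    qed
    then show ?thesis using coord_eq[OF l y] by simp
  qed
qed

text \<open>Behind different sides that are not neighbours there are different points. Only two sides at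
  different reflex corners are not covered by the previous lemma.\<close>

lemma region_disjoint:
  assumes r: "region x b y" "b \<noteq> one_t (T x)" and r': "region x' b' y" "b' \<noteq> one_t (T x')"
    and ne: "\<not> padj x x'" "\<not> m dvd x - x'"
  shows False
proof -
  have ne': "\<not> padj x' x" "\<not> m dvd x' - x" using ne adjt_sym by (blast, metis dvd_diff_commute)
  consider "clean x'" | "clean x" | "\<not> clean x" "\<not> clean x'" by blast
  then show False
  proof cases
    case 1
    then show ?thesis using region_far_clean[OF r 1 ne] r' by (simp add: region_def)
  next
    case 2
    then show ?thesis using region_far_clean[OF r' 2 ne'] r by (simp add: region_def)
  next
    case 3
    have E: "ch.early k" if "isE k z" "region z c y" for k z c using that by (simp add: region_def early_def)
    have L: "ch.late k" if "isL k z" "region z c y" for k z c using that by (simp add: region_def late_def)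
    have EE: "m dvd z - z'" if "isE k z" "isE k z'" for k z z'
      using isE_On[OF that(1)] isE_On[OF that(2)] type_inj[of k z z'] eqt_sym eqt_trans by blast
    have LL: "m dvd z - z'" if "isL k z" "isL k z'" for k z z'
      using isL_On[OF that(1)] isL_On[OF that(2)] type_inj[of "k + 2" z z'] eqt_sym eqt_trans by blast
    have EL: "padj z z'" if e: "isE k z" and l: "isL k z'" for k z z'
    proof -
      obtain u where u: "m dvd z - u" "sg k u = E k" "Suc k < C" "t (Suc k) = t k + 1"
        using e by (auto simp: isE_def)
      obtain u' where u': "m dvd z' - u'" "sg k u' = S (k + 2)"
        using l by (auto simp: isL_def)
      then have "sg k u' = sg k u + 1" using u step_S_cases[of k] by auto
      then have "u' = u + 1 \<or> u' = u - 1" by (auto simp: sg_def split: if_splits)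
      moreover have "m dvd (z - z') - (u - u')" using dvd_diff[OF u(1) u'(1)] by (simp add: algebra_simps)
      moreover have "(z - z') - (u - (u + 1)) = z - z' + 1" "(z - z') - (u - (u - 1)) = z - z' - 1" by simp_all
      ultimately show ?thesis unfolding adjt_def by metis
    qed
    obtain k k' where "isE k x \<or> isL k x" "isE k' x' \<or> isL k' x'" using 3 by (auto simp: clean_def)
    then consider "isE k x" "isE k' x'" | "isE k x" "isL k' x'" | "isL k x" "isE k' x'" | "isL k x" "isL k' x'" by blast
    then show ?thesis
    proof cases
      case 1
      have "k \<noteq> k'" using EE 1 ne by blast
      then show ?thesis
        using ch.early_disjoint[OF E[OF 1(1) r(1)] E[OF 1(2) r'(1)]] ch.early_disjoint[OF E[OF 1(2) r'(1)] E[OF 1(1) r(1)]]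
        by linarith
    next
      case 2
      then have "k \<noteq> k'" using EL ne by blast
      then show ?thesis using ch.early_late_disjoint[OF E[OF 2(1) r(1)] L[OF 2(2) r'(1)]] by blast
    next
      case 3
      then have "k' \<noteq> k" using EL ne' by blast
      then show ?thesis using ch.early_late_disjoint[OF E[OF 3(2) r'(1)] L[OF 3(1) r(1)]] by blast
    next
      case 4
      have "k \<noteq> k'" using LL 4 ne by blast
      then show ?thesis
        using ch.late_disjoint[OF L[OF 4(1) r(1)] L[OF 4(2) r'(1)]] ch.late_disjoint[OF L[OF 4(2) r'(1)] L[OF 4(1) r(1)]]
        by linarith
    qed
  qed
qed

text \<open>A point on the near side of the first gluing is on the near side of all further ones, hence of all
  sides away from the first chamber. The wall of a late side at a reflex corner is also the first glued wall there, and the late side lies beyond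
  it; thus the coordinate of such a point is \<open>f\<inverse>\<close> there instead of \<open>\<one>\<close>.\<close>

lemma trivial_coord:
  assumes "hd (t 0) y = one_t (t 0)" "hd 1 y = one_t 1" and x: "\<not> On 0 x"
  shows "(\<forall>k. \<not> isL k x) \<Longrightarrow> coord x y = one_t (T x)"
    and "isL k x \<Longrightarrow> coord x y = inv_t (T x) (f (T x))"
proof -
  have a: "ch.a l = one_t (t l)" if "l < C" for l
  proof (rule ch.all_trivial[OF C_pos _ _ that])
    show "ch.a 0 = one_t (t 0)" using assms(1) by (simp add: ch.a_def)
    show "hd (t (Suc 0)) (pt 0 y) = one_t (t (Suc 0))" if "t (Suc 0) = t 0 + 1"
      using assms(2) that t_0 by simp
  qed
  define k where "k = (LEAST k. On k x)"
  have k: "On k x" unfolding k_def by (rule LeastI_ex) (rule On_exists)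
  have kmin: "On k' x \<Longrightarrow> k \<le> k'" for k' unfolding k_def by (rule Least_le)
  have k0: "0 < k" using k x by (cases k) auto
  have kC: "k \<le> C" using On_range[OF k] .
  have n: "\<not> On (k - 1) x" using kmin[of "k - 1"] k0 by auto
  show "coord x y = one_t (T x)" if nl: "\<forall>k. \<not> isL k x"
  proof -
    have "far N (T x) (t (k - 1))"
      using prev_side[OF k k0] n nl not_glue_in[OF k k0] by (auto simp: far_def)
    moreover have "k - 1 < C" using k0 kC by simp
    moreover have "ch.a (k - 1) \<noteq> f (t (k - 1))" using a[of "k - 1"] f_ne[of "t (k - 1)"] k0 kC by auto
    ultimately have "hd (T x) (pt (Suc (k - 1)) y) = one_t (T x)" using ch.before[of "k - 1" "T x"] by simp
    then show ?thesis using coord_eq[OF k y] k0 by simp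
  qed
  show "coord x y = inv_t (T x) (f (T x))" if l: "isL k x" for k
  proof -
    have kC: "k < C" using l by (auto simp: isL_def)
    have e: "eqt N (T x) (t k)" using isL_On[OF l] by simp
    have "coord x y = hd (t k) (pt (Suc k) y)" by (rule conjunct2[OF coord_L[OF l]])
    also have "\<dots> = inv_t (t k) (f (t k))"
    proof -
      interpret B: group "Bt (t k)" by (rule grp)
      show ?thesis using ch.next_same[OF kC] a[OF kC] by simp
    qed
    finally show ?thesis using Bt_cong[OF e] f_per[OF e] by simp
  qed
qed

end

end

context shape
begin

lemma isE_partner: assumes "isE k x" shows "isL k (x + 1) \<or> isL k (x - 1)"
proof -
  obtain y where y: "m dvd x - y" "sg k y = E k" "Suc k < C" "t (Suc k) = t k + 1"
    using assms by (auto simp: isE_def)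
  then have S: "S (k + 2) = E k + 1" using step_S_cases[of k] by auto
  have "m dvd (x + 1) - (y + 1)" "m dvd (x - 1) - (y - 1)" using y(1) by simp_all
  moreover have "sg k (y + 1) = S (k + 2) \<or> sg k (y - 1) = S (k + 2)" using y S by (auto simp: sg_def)
  ultimately show ?thesis using y unfolding isL_def by blast
qed

lemma isL_partner: assumes "isL k x" shows "isE k (x + 1) \<or> isE k (x - 1)"
proof -
  obtain y where y: "m dvd x - y" "sg k y = S (k + 2)" "Suc k < C" "t (Suc k) = t k + 1"
    using assms by (auto simp: isL_def)
  then have S: "S (k + 2) = E k + 1" using step_S_cases[of k] by auto
  have "m dvd (x + 1) - (y + 1)" "m dvd (x - 1) - (y - 1)" using y(1) by simp_all
  moreover have "sg k (y + 1) = E k \<or> sg k (y - 1) = E k" using y S by (auto simp: sg_def)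
  ultimately show ?thesis using y unfolding isE_def by blast
qed

text \<open>At a reflex corner, the sides have the types of the two gluings, in reverse order.\<close>

lemma E_L_types: "isE k x \<Longrightarrow> isL k x' \<Longrightarrow> adjt N (T x) (T x')"
proof -
  assume e: "isE k x" and l: "isL k x'"
  have "adjt N (t (Suc k)) (t k)" using e by (intro adjt_small) (simp add: isE_def)
  then show ?thesis using adjt_cong[OF conjunct2[OF isE_On[OF e]] conjunct2[OF isL_On[OF l]]] by simp
qed

lemma padj_types: "padj x x' \<Longrightarrow> adjt N (T x) (T x')"
  using padj_corner[of x x'] E_L_types adjt_sym by blast

lemma not_long: "\<not> long x \<Longrightarrow> On k x \<Longrightarrow> On l x \<Longrightarrow> k = l"
proof (rule ccontr)
  assume "\<not> long x" and o: "On k x" "On l x" and ne: "k \<noteq> l"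
  have "long x" if "On i x" "On i' x" "i < i'" for i i'
    using On_On[OF that] that by (auto simp: long_def)
  then show False using o ne \<open>\<not> long x\<close> by (metis nat_neq_iff)
qed

lemma padj_plus: "padj (x + 1) x" "padj (x - 1) x"
  by (simp_all add: adjt_def)

lemma adjt_opposite:
  assumes "adjt N u v" "adjt N w v" "\<not> eqt N u w"
  shows "eqt N (u - v) (v - w)"
proof -
  have "N dvd u - w" if "N dvd u - v - c" "N dvd w - v - c" for c
    using dvd_diff[OF that] by simp
  from this[of 1] this[of "- 1"] assms(3)
  have ne: "\<not> (N dvd u - v - 1 \<and> N dvd w - v - 1)" "\<not> (N dvd u - v + 1 \<and> N dvd w - v + 1)"
    by (auto simp: eqt_def)
  have "(u - v) - (v - w) = (u - v - 1) + (w - v + 1)" "(u - v) - (v - w) = (u - v + 1) + (w - v - 1)" by auto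
  then show ?thesis using ne assms(1,2) unfolding adjt_def eqt_def by (metis dvd_add)
qed

text \<open>Around a side that is not long the types change by the same amount on both sides. This allows
  to place it, together with both neighbours, into a run of sides of a single chamber. At a side
  that is shared by two chambers the types of its two neighbours agree instead.\<close>

lemma nonlong_types:
  assumes "\<not> long x"
  shows "eqt N (T (x + 1) - T x) (T x - T (x - 1))"
proof (rule adjt_opposite)
  show "adjt N (T (x + 1)) (T x)" "adjt N (T (x - 1)) (T x)" by (rule padj_types, rule padj_plus)+
  show "\<not> eqt N (T (x + 1)) (T (x - 1))"
  proof
    assume eq: "eqt N (T (x + 1)) (T (x - 1))"
    have ne: "\<not> m dvd (x + 1) - (x - 1)" using not_dvd_small(1)[of 2 m] m_pos by simp
    consider k where "isE k x" | k where "isL k x" | "clean x" by (auto simp: clean_def)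
    then show False
    proof cases
      case 1
      have 3: "\<not> eqt N (t k) (t k + 2)" using not_dvd_small(2)[of "- 2" N] N by (simp add: eqt_def)
      have E: "eqt N (T x') (t k + 2)" if "padj x' x" "\<not> isL k x'" for x'
        using E_nbr(3)[OF 1 adjt_sym[OF that(1)] that(2)] .
      have L: "eqt N (T x') (t k)" if "isL k x'" for x' using isL_On[OF that] by simp
      have "isL k (x + 1) \<noteq> isL k (x - 1)"
      proof
        assume b: "isL k (x + 1) = isL k (x - 1)"
        then have "isL k (x + 1)" "isL k (x - 1)" using isE_partner[OF 1] by auto
        then show False using type_inj[of "k + 2"] isL_On eq ne by blast
      qed
      then consider "isL k (x + 1)" "\<not> isL k (x - 1)" | "isL k (x - 1)" "\<not> isL k (x + 1)" by blast
      then have "eqt N (t k) (t k + 2)"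
      proof cases
        case 1
        then show ?thesis using eqt_cong[OF L[of "x + 1"] E[OF padj_plus(2)]] eq by blast
      next
        case 2
        then show ?thesis using eqt_cong[OF L[of "x - 1"] E[OF padj_plus(1)]] eqt_sym[OF eq] by blast
      qed
      then show False using 3 by blast
    next
      case 2
      have 3: "\<not> eqt N (t (Suc k)) (t k - 1)"
        using not_dvd_small(1)[of 2 N] N 2 by (simp add: eqt_def isL_def)
      have E: "eqt N (T x') (t k - 1)" if "padj x' x" "\<not> isE k x'" for x'
        using L_nbr(3)[OF 2 adjt_sym[OF that(1)] that(2)] .
      have L: "eqt N (T x') (t (Suc k))" if "isE k x'" for x' using isE_On[OF that] by simp
      have "isE k (x + 1) \<noteq> isE k (x - 1)"
      proof
        assume b: "isE k (x + 1) = isE k (x - 1)"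
        then have "isE k (x + 1)" "isE k (x - 1)" using isL_partner[OF 2] by auto
        then show False using type_inj[of k] isE_On eq ne by blast
      qed
      then consider "isE k (x + 1)" "\<not> isE k (x - 1)" | "isE k (x - 1)" "\<not> isE k (x + 1)" by blast
      then have "eqt N (t (Suc k)) (t k - 1)"
      proof cases
        case 1
        then show ?thesis using eqt_cong[OF L[of "x + 1"] E[OF padj_plus(2)]] eq by blast
      next
        case 2
        then show ?thesis using eqt_cong[OF L[of "x - 1"] E[OF padj_plus(1)]] eqt_sym[OF eq] by blast
      qed
      then show False using 3 by blast
    next
      case 3
      obtain k where k: "On k (x + 1)" "On k x"
        using padj_corner[OF padj_plus(1)[of x]] 3 by (auto simp: clean_def)
      obtain l where l: "On l (x - 1)" "On l x"
        using padj_corner[OF padj_plus(2)[of x]] 3 by (auto simp: clean_def)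
      have "k = l" using not_long[OF assms k(2) l(2)] .
      then show False using type_inj[OF k(1)] l(1) eq ne by blast
    qed
  qed
qed

end

context blob
begin

lemma upt_Suc: "upt (Suc k) y = upt k (mv (t k) (f (t k)) y)"
  by (rule upt.simps(2))

lemma pt_mv_next:
  assumes "On k x" "On (Suc k) x" "y \<in> Y" "b \<in> carrier (Bt (T x))"
  shows "upt (Suc k) (mv (T x) b (pt (Suc k) y)) = upt k (mv (T x) b (pt k y))"
proof -
  have a: "adjt N (T x) (t k)" using On_next_adj[OF assms(1,2)] .
  have "mv (T x) b (pt (Suc k) y) = mv (t k) (inv_t (t k) (f (t k))) (mv (T x) b (pt k y))"
    using assms a by (simp add: pt_Suc mv_comm)
  then show ?thesis using assms by (simp add: upt_Suc)
qed

text \<open>Crossing a long side leads to the same element from each of its chambers, because the side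
  commutes with the gluings between these chambers.\<close>

lemma upt_mv_pt:
  assumes "On k x" "On l x" "y \<in> Y" "b \<in> carrier (Bt (T x))"
  shows "upt k (mv (T x) b (pt k y)) = upt l (mv (T x) b (pt l y))"
proof -
  have *: "upt k (mv (T x) b (pt k y)) = upt l (mv (T x) b (pt l y))" if "On k x" "On l x" "k < l" for k l
    using On_On[OF that]
  proof
    assume "l = Suc k"
    then show ?thesis using pt_mv_next[OF that(1) _ assms(3,4)] that(2) by simp
  next
    assume l: "l = k + 2 \<and> On (Suc k) x"
    then have "On (Suc (Suc k)) x" using that(2) by simp
    from pt_mv_next[OF that(1) conjunct2[OF l] assms(3,4)] pt_mv_next[OF conjunct2[OF l] this assms(3,4)] l
    show ?thesis by simp
  qed
  show ?thesis
  proof (cases k l rule: linorder_cases)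
    case greater
    then show ?thesis using *[OF assms(2,1)] by simp
  qed (use *[OF assms(1,2)] in simp_all)
qed

lemma pt_mv:
  assumes "On k x" "On l x" "y \<in> Y" "b \<in> carrier (Bt (T x))"
  shows "pt l (upt k (mv (T x) b (pt k y))) = mv (T x) b (pt l y)"
  using upt_mv_pt[OF assms] assms by simp

lemma f_mult_inv [simp]: "b \<in> carrier (Bt v) \<Longrightarrow> f v \<otimes>\<^bsub>Bt v\<^esub> (inv_t v (f v) \<otimes>\<^bsub>Bt v\<^esub> b) = b"
proof -
  interpret B: group "Bt v" by (rule grp)
  show "b \<in> carrier (Bt v) \<Longrightarrow> ?thesis" by (simp add: B.m_assoc[symmetric])
qed

lemma inv_mult_f [simp]: "b \<in> carrier (Bt v) \<Longrightarrow> inv_t v (f v) \<otimes>\<^bsub>Bt v\<^esub> (f v \<otimes>\<^bsub>Bt v\<^esub> b) = b"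
proof -
  interpret B: group "Bt v" by (rule grp)
  show "b \<in> carrier (Bt v) \<Longrightarrow> ?thesis" by (simp add: B.m_assoc[symmetric])
qed

text \<open>At a reflex corner the two walls cross, and the coordinates of the two sides differ by the
  gluing element from the heads as seen from the other chamber at the corner.\<close>

lemma corner_coords:
  assumes e: "isE k x" and l: "isL k x'" and y: "y \<in> Y"
  shows "coord x y = hd (T x) (pt k y)" "coord x' y = inv_t (T x') (f (T x')) \<otimes>\<^bsub>Bt (T x')\<^esub> hd (T x') (pt k y)"
    "coord x' y = hd (T x') (pt (k + 2) y)" "hd (T x) (pt (k + 2) y) = inv_t (T x) (f (T x)) \<otimes>\<^bsub>Bt (T x)\<^esub> coord x y"
proof -
  interpret ch: chain_pts N Bt Y mv hd C t "\<lambda>k. f (t k)" "\<lambda>k. pt k y" by (rule chain[OF y])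
  have k: "Suc k < C" "k < C" using e by (auto simp: isE_def)
  have x: "eqt N (T x) (t (Suc k))" "eqt N (T x') (t k)" using isE_On[OF e] isL_On[OF l] by auto
  note c = per[OF x(1)] per[OF x(2)] f_per[OF x(1)] f_per[OF x(2)]
  show "coord x y = hd (T x) (pt k y)" using coord_E[OF y e] c by simp
  show "coord x' y = inv_t (T x') (f (T x')) \<otimes>\<^bsub>Bt (T x')\<^esub> hd (T x') (pt k y)"
    using conjunct2[OF coord_L[OF y l]] ch.next_same[OF k(2)] c by (simp add: ch.a_def)
  show "coord x' y = hd (T x') (pt (k + 2) y)" using coord_L[OF y l] c by simp
  show "hd (T x) (pt (k + 2) y) = inv_t (T x) (f (T x)) \<otimes>\<^bsub>Bt (T x)\<^esub> coord x y"
    using conjunct2[OF coord_E[OF y e]] ch.next_same[OF k(1)] c by simp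
qed

lemma early_I:
  assumes e: "isE k x" and y: "y \<in> Y" and b: "coord x y \<noteq> one_t (T x)" "coord x y \<noteq> f (T x)"
    and h: "hd (t k) (pt k y) \<noteq> f (t k)"
  shows "early k y"
proof -
  interpret ch: chain_pts N Bt Y mv hd C t "\<lambda>k. f (t k)" "\<lambda>k. pt k y" by (rule chain[OF y])
  have x: "eqt N (T x) (t (Suc k))" using isE_On[OF e] by auto
  show ?thesis
    using e coord_E[OF y e] b h per[OF x] f_per[OF x] unfolding early_def ch.early_def by (auto simp: isE_def ch.a_def)
qed

lemma late_I:
  assumes l: "isL k x" and y: "y \<in> Y" and b: "coord x y \<noteq> one_t (T x)" "coord x y \<noteq> inv_t (T x) (f (T x))"
    and h: "hd (t (Suc k)) (pt (k + 2) y) \<noteq> inv_t (t (Suc k)) (f (t (Suc k)))"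
  shows "late k y"
proof -
  interpret ch: chain_pts N Bt Y mv hd C t "\<lambda>k. f (t k)" "\<lambda>k. pt k y" by (rule chain[OF y])
  have k: "Suc k < C" "k < C" "t (Suc k) = t k + 1" using l by (auto simp: isL_def)
  have x: "eqt N (T x) (t k)" using isL_On[OF l] by auto
  have c: "coord x y = inv_t (t k) (f (t k)) \<otimes>\<^bsub>Bt (t k)\<^esub> ch.a k"
    using conjunct2[OF coord_L[OF y l]] ch.next_same[OF k(2)] by simp
  have "ch.a k \<noteq> one_t (t k)" using b(2) c per[OF x] f_per[OF x] k by (auto simp: ch.inv_mult_eq2)
  moreover have "ch.a k \<noteq> f (t k)" using b(1) c per[OF x] by (auto simp: inv_mult_eq)
  moreover have "ch.a (Suc k) \<noteq> one_t (t (Suc k))" using h ch.next_same[OF k(1)] by (auto simp: ch.inv_mult_eq2)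
  ultimately show ?thesis using k unfolding late_def ch.late_def by simp
qed

text \<open>The other neighbour of a reflex side is far from the wall through which the reflex corner would
  be reached, so a point behind that neighbour is on the near side of the corner. This gives the
  condition in \<open>early_I\<close>.\<close>

lemma early_nbr:
  assumes e: "isE k x" and a: "padj x x'" "\<not> isL k x'" and y: "y \<in> Y"
    and r: "coord x' y \<noteq> one_t (T x')"
  shows "hd (t k) (pt k y) \<noteq> f (t k)"
proof -
  have x': "On k x'" "eqt N (T x') (t k + 2)" using E_nbr[OF e a] by auto
  have "far N (t k) (T x')" using far_cong[OF eqt_refl x'(2)] far_small[of "t k" "t k + 2" N] N by simp
  then have "hd (t k) (pt k y) = one_t (t k)"
    using hd_far[of "t k" "T x'" "pt k y"] r coord_eq[OF x'(1) y] y by simp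
  then show ?thesis using f_ne[of "t k"] by simp
qed

lemma late_nbr:
  assumes l: "isL k x" and a: "padj x x'" "\<not> isE k x'" and y: "y \<in> Y"
    and r: "coord x' y \<noteq> one_t (T x')"
  shows "hd (t (Suc k)) (pt (k + 2) y) \<noteq> inv_t (t (Suc k)) (f (t (Suc k)))"
proof -
  have x': "On (k + 2) x'" "eqt N (T x') (t k - 1)" using L_nbr[OF l a] by auto
  have "t (Suc k) = t k + 1" using l by (simp add: isL_def)
  then have "far N (t (Suc k)) (T x')" using far_cong[OF eqt_refl x'(2)] far_small[of "t (Suc k)" "t k - 1" N] N by simp
  then have "hd (t (Suc k)) (pt (k + 2) y) = one_t (t (Suc k))"
    using hd_far[of "t (Suc k)" "T x'" "pt (k + 2) y"] r coord_eq[OF x'(1) y] y by simp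
  then show ?thesis using f_ne[of "t (Suc k)"] inv_eq_one[OF f_closed, of "t (Suc k)"] by simp
qed

text \<open>A point whose coordinate at a reflex side is that of a sector but which is not in the region
  behind it has entered the sector around the corner. Once the side is crossed, the only side
  of the chamber which such a point is behind is the other one at the corner.\<close>

lemma not_early:
  assumes e: "isE k x" and y: "y \<in> Y" and b: "coord x y \<noteq> one_t (T x)" "coord x y \<noteq> f (T x)"
    and n: "\<not> early k y" and z: "z = mv (T x) (inv_t (T x) (coord x y)) (pt k y)"
  shows "hd (t k) z = f (t k)" "\<And>v. \<not> eqt N v (t k) \<Longrightarrow> hd v z = one_t v"
proof -
  interpret ch: chain_pts N Bt Y mv hd C t "\<lambda>k. f (t k)" "\<lambda>k. pt k y" by (rule chain[OF y])
  have k: "Suc k < C" "k < C" "t (Suc k) = t k + 1" using e by (auto simp: isE_def)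
  have x: "eqt N (T x) (t (Suc k))" using isE_On[OF e] by auto
  have cE: "coord x y = hd (t (Suc k)) (pt k y)" "coord x y = ch.a (Suc k)" using coord_E[OF y e] by auto
  let ?b = "inv_t (t (Suc k)) (ch.a (Suc k))"
  have b_cl: "?b \<in> carrier (Bt (t (Suc k)))" using y by (simp add: ch.a_def)
  have z': "z = mv (t (Suc k)) ?b (pt k y)" using z cE(2) per[OF x] by simp
  have zY: "z \<in> Y" using z' y b_cl by simp
  have adj: "adjt N (t k) (t (Suc k))" "adjt N (t (Suc k)) (t k)" using k by (auto intro: adjt_small)
  have "ch.a (Suc k) \<noteq> one_t (t (Suc k))" "ch.a (Suc k) \<noteq> f (t (Suc k))"
    using b cE per[OF x] f_per[OF x] by auto
  then have ne: "ch.a k = f (t k)" "hd (t k - 1) (mv (t (Suc k)) ?b (pt (Suc k) y)) = one_t (t k - 1)"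
    using n k unfolding early_def ch.early_def by auto
  show h: "hd (t k) z = f (t k)" unfolding z' using adj y b_cl ne(1) by (simp add: hd_adj ch.a_def)
  show "hd v z = one_t v" if v: "\<not> eqt N v (t k)" for v
  proof (cases "adjt N v (t k)")
    case False
    then have "far N v (t k)" using v by (simp add: far_def)
    then show ?thesis using hd_far[OF _ zY] h f_ne[of "t k"] by simp
  next
    case True
    then have "eqt N v (t (Suc k)) \<or> eqt N v (t k - 1)"
      using k(3) by (auto simp: adjt_def eqt_def algebra_simps)
    then show ?thesis
    proof
      assume v: "eqt N v (t (Suc k))"
      interpret B: group "Bt (t (Suc k))" by (rule grp)
      have "hd (t (Suc k)) z = one_t (t (Suc k))" unfolding z' using y b_cl cE by (simp add: hd_mv ch.a_def)
      then show ?thesis using per[OF v] by simp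
    next
      assume v: "eqt N v (t k - 1)"
      have "mv (t (Suc k)) ?b (pt (Suc k) y) = mv (t k) (inv_t (t k) (f (t k))) z"
        unfolding z' pt_Suc using adj y b_cl by (simp add: mv_comm)
      then have "hd (t k - 1) z = one_t (t k - 1)" using ne(2) zY by (simp add: hd_adj adjt_small)
      then show ?thesis using per[OF v] by simp
    qed
  qed
qed

lemma not_late:
  assumes l: "isL k x" and y: "y \<in> Y" and b: "coord x y \<noteq> one_t (T x)" "coord x y \<noteq> inv_t (T x) (f (T x))"
    and n: "\<not> late k y" and z: "z = mv (T x) (inv_t (T x) (coord x y)) (pt (k + 2) y)"
  shows "hd (t (Suc k)) z = inv_t (t (Suc k)) (f (t (Suc k)))" "\<And>v. \<not> eqt N v (t (Suc k)) \<Longrightarrow> hd v z = one_t v"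
proof -
  interpret ch: chain_pts N Bt Y mv hd C t "\<lambda>k. f (t k)" "\<lambda>k. pt k y" by (rule chain[OF y])
  have k: "Suc k < C" "k < C" "t (Suc k) = t k + 1" using l by (auto simp: isL_def)
  have x: "eqt N (T x) (t k)" using isL_On[OF l] by auto
  have cL: "coord x y = hd (t k) (pt (k + 2) y)" "coord x y = hd (t k) (pt (Suc k) y)" using coord_L[OF y l] by auto
  let ?b = "inv_t (t k) (hd (t k) (pt (Suc k) y))"
  have b_cl: "?b \<in> carrier (Bt (t k))" using y by simp
  have z': "z = mv (t k) ?b (pt (k + 2) y)" using z cL(2) per[OF x] by simp
  have zY: "z \<in> Y" using z' y b_cl by simp
  have adj: "adjt N (t k) (t (Suc k))" "adjt N (t (Suc k)) (t k)" using k by (auto intro: adjt_small)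
  have c: "coord x y = inv_t (t k) (f (t k)) \<otimes>\<^bsub>Bt (t k)\<^esub> ch.a k" using cL(2) ch.next_same[OF k(2)] by simp
  have "ch.a k \<noteq> one_t (t k)" using b(2) c per[OF x] f_per[OF x] k by (auto simp: ch.inv_mult_eq2)
  moreover have "ch.a k \<noteq> f (t k)" using b(1) c per[OF x] by (auto simp: inv_mult_eq)
  ultimately have ne: "ch.a (Suc k) = one_t (t (Suc k))"
      "hd (t (Suc k) + 1) (mv (t k) ?b (pt (Suc k) y)) = one_t (t (Suc k) + 1)"
    using n k unfolding late_def ch.late_def by auto
  have pt2: "pt (k + 2) y = mv (t (Suc k)) (inv_t (t (Suc k)) (f (t (Suc k)))) (pt (Suc k) y)"
    by (simp add: pt_Suc)
  interpret B: group "Bt (t (Suc k))" by (rule grp)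
  have "hd (t (Suc k)) z = hd (t (Suc k)) (pt (k + 2) y)" unfolding z' using adj y b_cl by (simp add: hd_adj)
  then show h: "hd (t (Suc k)) z = inv_t (t (Suc k)) (f (t (Suc k)))"
    using ne(1) y unfolding pt2 by (simp add: hd_mv ch.a_def)
  show "hd v z = one_t v" if v: "\<not> eqt N v (t (Suc k))" for v
  proof (cases "adjt N v (t (Suc k))")
    case False
    then have "far N v (t (Suc k))" using v by (simp add: far_def)
    then show ?thesis using hd_far[OF _ zY] h f_ne[of "t (Suc k)"] inv_eq_one[OF f_closed, of "t (Suc k)"] by simp
  next
    case True
    then have "eqt N v (t k) \<or> eqt N v (t (Suc k) + 1)"
      using k(3) by (auto simp: adjt_def eqt_def algebra_simps)
    then show ?thesis
    proof
      assume v: "eqt N v (t k)"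
      interpret B': group "Bt (t k)" by (rule grp)
      have "hd (t k) z = one_t (t k)" unfolding z' using y b_cl cL by (simp add: hd_mv)
      then show ?thesis using per[OF v] by simp
    next
      assume v: "eqt N v (t (Suc k) + 1)"
      let ?w = "mv (t k) ?b (pt (Suc k) y)"
      have "z = mv (t (Suc k)) (inv_t (t (Suc k)) (f (t (Suc k)))) ?w"
        unfolding z' pt2 using adj y b_cl by (simp add: mv_comm)
      then have "hd (t (Suc k) + 1) z = one_t (t (Suc k) + 1)" using ne(2) y b_cl by (simp add: hd_adj adjt_small)
      then show ?thesis using per[OF v] by simp
    qed
  qed
qed

text \<open>Both sides at a reflex corner can be crossed in either order. One order starts from chamber \<open>k\<close>
  and the other from chamber \<open>k + 2\<close>, which differs from it by the two gluing elements; these are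
  absorbed when the letters of the second order are multiplied by \<open>f\<inverse>\<close>.\<close>

lemma reflex_square:
  assumes e: "isE k x" and l: "isL k x'" and y: "y \<in> Y"
    and b: "b \<in> carrier (Bt (T x))" and c: "c \<in> carrier (Bt (T x'))"
  shows "upt k (mv (T x) b (mv (T x') c y)) =
    upt (k + 2) (mv (T x') (inv_t (T x') (f (T x')) \<otimes>\<^bsub>Bt (T x')\<^esub> c)
      (mv (T x) (inv_t (T x) (f (T x)) \<otimes>\<^bsub>Bt (T x)\<^esub> b) y))"
proof -
  have x: "eqt N (T x) (t (Suc k))" "eqt N (T x') (t k)" using isE_On[OF e] isL_On[OF l] by auto
  have adj: "adjt N (T x) (T x')" "adjt N (T x') (T x)" using E_L_types[OF e l] adjt_sym by blast+
  have "upt (k + 2) w = upt k (mv (T x') (f (T x')) (mv (T x) (f (T x)) w))" for w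
    using per[OF x(1)] per[OF x(2)] f_per[OF x(1)] f_per[OF x(2)] by (simp add: upt_Suc)
  moreover have "mv (T x) (f (T x)) (mv (T x') (inv_t (T x') (f (T x')) \<otimes>\<^bsub>Bt (T x')\<^esub> c)
      (mv (T x) (inv_t (T x) (f (T x)) \<otimes>\<^bsub>Bt (T x)\<^esub> b) y)) =
      mv (T x') (inv_t (T x') (f (T x')) \<otimes>\<^bsub>Bt (T x')\<^esub> c) (mv (T x) b y)"
    using b c y adj by (simp add: mv_comm[of "T x" "T x'"] mv_mult)
  ultimately show ?thesis using b c y adj by (simp add: mv_comm[of "T x" "T x'"] mv_mult)
qed

end

section \<open>States and crossings\<close>

text \<open>A state describes how the next blob is placed. The sides \<open>descents\<close> are those which the last
  syllables have crossed, so that no further syllable of this type may follow. The side \<open>j\<close> of an \<open>m\<close>-gon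
  is at position \<open>j + offset\<close>, and the types of the blob are labelled by \<open>v \<mapsto> origin + orientation * v\<close>.
  A side in \<open>phase\<close> is crossed with elements that are multiplied by \<open>f\<inverse>\<close>.\<close>

record state =
  descents :: "nat set"
  offset :: int
  origin :: int
  orientation :: int
  phase :: "nat set"

text \<open>The injections \<open>rho i v\<close> choose sectors of a wall of type \<open>v\<close> for the elements of the vertex group
  \<open>A i\<close>. The sector of the gluing element \<open>f v\<close> is avoided, since it belongs to the blob itself.\<close>

locale blob_map = gw: graph_words "{..<M}" "cycle_edges M" A + blob N p q Bt Y mv hd f
  for M :: nat and A :: "nat \<Rightarrow> 'a monoid"
    and N :: int and p q :: nat and Bt :: "int \<Rightarrow> 'b monoid" and Y :: "'y set"
    and mv :: "int \<Rightarrow> 'b \<Rightarrow> 'y \<Rightarrow> 'y" and hd :: "int \<Rightarrow> 'y \<Rightarrow> 'b" and f :: "int \<Rightarrow> 'b" +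
  fixes rho :: "nat \<Rightarrow> int \<Rightarrow> 'a \<Rightarrow> 'b" and base :: 'y
  assumes M: "int M = m"
    and rho_closed [simp]: "i < M \<Longrightarrow> s \<in> carrier (A i) \<Longrightarrow> rho i v s \<in> carrier (Bt v)"
    and rho_inj: "i < M \<Longrightarrow> s \<in> carrier (A i) \<Longrightarrow> s' \<in> carrier (A i) \<Longrightarrow> rho i v s = rho i v s' \<Longrightarrow> s = s'"
    and rho_one: "i < M \<Longrightarrow> rho i v \<one>\<^bsub>A i\<^esub> = \<one>\<^bsub>Bt v\<^esub>"
    and rho_f: "i < M \<Longrightarrow> s \<in> carrier (A i) \<Longrightarrow> rho i v s \<noteq> f v"
    and rho_per: "eqt N v w \<Longrightarrow> rho i v = rho i w"
    and base [simp]: "base \<in> Y" "hd v base = \<one>\<^bsub>Bt v\<^esub>"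
begin

abbreviation adj where "adj \<equiv> gw.adj"

lemma M_large: "M > 6" using M m_pos by linarith

definition succ where "succ i = Suc i mod M"
definition pred where "pred i = (if i = 0 then M - 1 else i - 1)"

lemma succ_less [simp]: "succ i < M" using M_large by (simp add: succ_def)

lemma pred_less [simp]: "i < M \<Longrightarrow> pred i < M" by (auto simp: pred_def)

lemma succ_pred [simp]: "i < M \<Longrightarrow> succ (pred i) = i"
  using M_large by (auto simp: succ_def pred_def)

lemma pred_succ [simp]: "i < M \<Longrightarrow> pred (succ i) = i"
  using M_large by (auto simp: succ_def pred_def mod_Suc)

lemma dvd_eq: "i < M \<Longrightarrow> j < M \<Longrightarrow> m dvd int i - int j \<longleftrightarrow> i = j"
  using zdvd_not_zless[of "int i - int j" m] zdvd_not_zless[of "int j - int i" m] M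
  by (cases i j rule: linorder_cases) (auto simp: dvd_diff_commute)

lemma succ_dvd: "i < M \<Longrightarrow> m dvd int (succ i) - int i - 1"
proof (cases "Suc i = M")
  case True
  then have "int (succ i) - int i - 1 = - m" using M by (simp add: succ_def)
  then show ?thesis by simp
qed (auto simp: succ_def)

lemma pred_dvd: "i < M \<Longrightarrow> m dvd int (pred i) - int i + 1"
  using M_large M by (auto simp: pred_def of_nat_diff)

lemma adj_iff: "i < M \<Longrightarrow> j < M \<Longrightarrow> adj i j \<longleftrightarrow> j = succ i \<or> i = succ j"
  by (auto simp: gw.adj_def) (auto simp: cycle_edges_def succ_def[symmetric] doubleton_eq_iff)

lemma adj_cases: "i < M \<Longrightarrow> j < M \<Longrightarrow> adj i j \<longleftrightarrow> j = succ i \<or> j = pred i"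
  using adj_iff succ_pred pred_succ by metis

lemma adj_padj: assumes "i < M" "j < M" shows "adj i j \<longleftrightarrow> adjt m (int i) (int j)"
  using cycle_adj[of M i j] assms M M_large by (simp add: gw.adj_def)

definition pos where "pos \<sigma> j = int j + offset \<sigma>"
definition label where "label \<sigma> v = origin \<sigma> + orientation \<sigma> * v"
definition type_at where "type_at \<sigma> j = label \<sigma> (T (pos \<sigma> j))"

text \<open>The sector in which the words with first syllable \<open>(i, s)\<close> are placed. The shift in phase is
  needed at late reflex sides, for which the sector \<open>f\<inverse>\<close> is the one of the blob; it is carried along
  after a crossing at a reflex corner.\<close>

definition sector where
  "sector \<sigma> i s = (if s = \<one>\<^bsub>A i\<^esub> then one_t (type_at \<sigma> i)
     else if i \<in> phase \<sigma> then inv_t (type_at \<sigma> i) (f (type_at \<sigma> i)) \<otimes>\<^bsub>Bt (type_at \<sigma> i)\<^esub> rho i (type_at \<sigma> i) s else rho i (type_at \<sigma> i) s)"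

abbreviation "Bs \<sigma> \<equiv> \<lambda>v. Bt (label \<sigma> v)"
abbreviation "ms \<sigma> \<equiv> \<lambda>v. mv (label \<sigma> v)"
abbreviation "hs \<sigma> \<equiv> \<lambda>v. hd (label \<sigma> v)"
abbreviation "fs \<sigma> \<equiv> \<lambda>v. f (label \<sigma> v)"

definition coord_at where "coord_at \<sigma> j = blob.coord N p q (Bs \<sigma>) (ms \<sigma>) (hs \<sigma>) (fs \<sigma>) (pos \<sigma> j)"
definition region_at where "region_at \<sigma> j = blob.region N p q (Bs \<sigma>) (ms \<sigma>) (hs \<sigma>) (fs \<sigma>) (pos \<sigma> j)"
definition view where "view \<sigma> = blob.pt p (Bs \<sigma>) (ms \<sigma>) (fs \<sigma>)"
definition unview where "unview \<sigma> = blob.upt p (ms \<sigma>) (fs \<sigma>)"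

text \<open>The move to the next blob, as a left multiplication. At a long side the next blob is the image of
  the present one under a conjugate of the letter, so that all positions stay the same. At other sides
  the chamber across the side becomes the first chamber of the next blob.\<close>

definition cross where
  "cross \<sigma> i s y = unview \<sigma> (chamber_of (pos \<sigma> i)) (mv (type_at \<sigma> i) (sector \<sigma> i s)
     (if long (pos \<sigma> i) then view \<sigma> (chamber_of (pos \<sigma> i)) y else y))"

definition uncross where
  "uncross \<sigma> i s y = (let z = mv (type_at \<sigma> i) (inv_t (type_at \<sigma> i) (sector \<sigma> i s)) (view \<sigma> (chamber_of (pos \<sigma> i)) y)
     in if long (pos \<sigma> i) then unview \<sigma> (chamber_of (pos \<sigma> i)) z else z)"

text \<open>The side that is placed at position \<open>2\<close>: when the predecessor of the crossed side is a descent, it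
  was crossed immediately before by a commuting syllable, and both orders have to lead to the same
  placement.\<close>

definition first_of where "first_of \<sigma> i = (if pred i \<in> descents \<sigma> then pred i else i)"
definition turn where "turn \<sigma> l = (if N dvd type_at \<sigma> l - label \<sigma> (T (pos \<sigma> l + 1)) - 1 then 1 else - 1 :: int)"

definition offset_after where
  "offset_after \<sigma> i = (if long (pos \<sigma> i) then offset \<sigma> else 2 - int (first_of \<sigma> i))"

text \<open>The state after a crossing. The next blob is placed so that the crossed side and its neighbours
  keep their types; the number \<open>3\<close> comes from the type \<open>- 3\<close> of the position \<open>2\<close>. A neighbour
  changes its phase exactly if it forms a reflex corner with the crossed side; for sides that are not
  neighbours the phase is dictated by the position.\<close>

definition after where
  "after \<sigma> i = \<lparr> descents = insert i {d \<in> descents \<sigma>. adj d i},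
     offset = offset_after \<sigma> i,
     origin = (if long (pos \<sigma> i) then origin \<sigma> else (type_at \<sigma> (first_of \<sigma> i) + 3 * turn \<sigma> (first_of \<sigma> i)) mod N),
     orientation = (if long (pos \<sigma> i) then orientation \<sigma> else turn \<sigma> (first_of \<sigma> i)),
     phase = {j. j < M \<and> (if adj i j then (j \<in> phase \<sigma>) \<noteq> (\<not> clean (pos \<sigma> i) \<and> \<not> clean (pos \<sigma> j))
       else j \<noteq> i \<and> (\<exists>k. isL k (int j + offset_after \<sigma> i)))} \<rparr>"

lemma pos_after: "pos (after \<sigma> i) j = (if long (pos \<sigma> i) then pos \<sigma> j else pos \<sigma> j - pos \<sigma> (first_of \<sigma> i) + 2)"
  by (simp add: pos_def after_def offset_after_def)

lemma label_after_long: "long (pos \<sigma> i) \<Longrightarrow> label (after \<sigma> i) = label \<sigma>"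
  by (auto simp: label_def after_def)

lemma phase_after: "j \<in> phase (after \<sigma> i) \<longleftrightarrow> j < M \<and> (if adj i j then (j \<in> phase \<sigma>) \<noteq> (\<not> clean (pos \<sigma> i) \<and> \<not> clean (pos \<sigma> j))
       else j \<noteq> i \<and> (\<exists>k. isL k (pos (after \<sigma> i) j)))"
  by (simp add: after_def pos_def)

lemma descents_after: "descents (after \<sigma> i) = insert i {d \<in> descents \<sigma>. adj d i}"
  by (simp add: after_def)

definition good where "good \<sigma> \<longleftrightarrow> orientation \<sigma> = 1 \<or> orientation \<sigma> = - 1"

text \<open>The invariant of states: descents that have just been crossed are in the middle of the run of
  the first chamber or on a long side, and the phase of a reflex side is the one of its kind.\<close>

definition Inv where
  "Inv \<sigma> \<longleftrightarrow> good \<sigma> \<and> descents \<sigma> \<subseteq> {..<M} \<and>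
     (descents \<sigma> = {} \<or> (\<exists>d. descents \<sigma> = {d} \<and> (m dvd pos \<sigma> d - 2 \<or> long (pos \<sigma> d))) \<or>
       (\<exists>d e. descents \<sigma> = {d, e} \<and> m dvd pos \<sigma> d - 2 \<and> m dvd pos \<sigma> e - 3)) \<and>
     (\<forall>j<M. (\<forall>k. isE k (pos \<sigma> j) \<longrightarrow> j \<notin> phase \<sigma>) \<and> (\<forall>k. isL k (pos \<sigma> j) \<longrightarrow> j \<in> phase \<sigma>))"

text \<open>Relabelling by a rotation or a reflection of the cycle of types gives a blob again, so that all
  facts about blobs are available for each state.\<close>

lemma blob_label: assumes "good \<sigma>" shows "blob N p (Bs \<sigma>) Y (ms \<sigma>) (hs \<sigma>) (fs \<sigma>)"
proof -
  interpret h: heads N "\<lambda>v. Bt (origin \<sigma> + v)" Y "\<lambda>v. mv (origin \<sigma> + v)" "\<lambda>v. hd (origin \<sigma> + v)"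
    by (rule heads_shift)
  have "heads N (Bs \<sigma>) Y (ms \<sigma>) (hs \<sigma>)"
    using assms h.heads_minus h.heads_axioms by (auto simp: good_def label_def)
  moreover have "eqt N (label \<sigma> v) (label \<sigma> w)" if "eqt N v w" for v w
    using assms that by (auto simp: good_def label_def eqt_def dvd_diff_commute)
  ultimately show ?thesis
    using f_per by (intro blob.intro blob_axioms.intro shape_axioms) (auto simp: f_ne)
qed

lemma pos_diff: "pos \<sigma> i - pos \<sigma> j = int i - int j"
  by (simp add: pos_def)

lemma pos_eq: "i < M \<Longrightarrow> j < M \<Longrightarrow> m dvd pos \<sigma> i - pos \<sigma> j \<longleftrightarrow> i = j"
  by (simp add: pos_diff dvd_eq)

lemma pos_adj: "i < M \<Longrightarrow> j < M \<Longrightarrow> padj (pos \<sigma> i) (pos \<sigma> j) \<longleftrightarrow> adj i j"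
  by (simp add: adj_padj adjt_def pos_diff)

lemma pos_succ: "i < M \<Longrightarrow> m dvd pos \<sigma> (succ i) - (pos \<sigma> i + 1)"
  using succ_dvd[of i] by (simp add: pos_def algebra_simps)

lemma pos_pred: "i < M \<Longrightarrow> m dvd pos \<sigma> (pred i) - (pos \<sigma> i - 1)"
  using pred_dvd[of i] by (simp add: pos_def algebra_simps)

lemma near_first:
  assumes "m dvd x - c" "c = 1 \<or> c = 2 \<or> c = 3 \<or> c = 4"
  shows "clean x" "\<not> long x" "On k x \<longleftrightarrow> k = 0" "T x = - 1 - c" "chamber_of x = 0"
proof -
  have c: "0 < c" "c < N - 2" using assms(2) N by auto
  show "clean x" "\<not> long x" "On k x \<longleftrightarrow> k = 0" "T x = - 1 - c" for k
    using cong[OF assms(1)] first_clean[OF c] first_chamber[OF c] by auto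
  then show "chamber_of x = 0" using chamber_of[of x] by blast
qed

lemma adj_pos:
  assumes "i < M" "j < M" "adj i j" "m dvd pos \<sigma> i - c"
  shows "m dvd pos \<sigma> j - (c + 1) \<or> m dvd pos \<sigma> j - (c - 1)"
proof -
  have "padj (pos \<sigma> j) (pos \<sigma> i)" using pos_adj[of j i] assms gw.adj_sym by blast
  then show ?thesis
    using dvd_add[OF assms(4), of "pos \<sigma> j - pos \<sigma> i - 1"] dvd_add[OF assms(4), of "pos \<sigma> j - pos \<sigma> i + 1"]
    by (auto simp: adjt_def algebra_simps)
qed

lemma D_facts:
  assumes "Inv \<sigma>" "d \<in> descents \<sigma>"
  shows "d < M" "clean (pos \<sigma> d)" "j < M \<Longrightarrow> adj d j \<Longrightarrow> clean (pos \<sigma> j) \<and> \<not> long (pos \<sigma> j)"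
proof -
  show d: "d < M" using assms by (auto simp: Inv_def)
  have c: "long (pos \<sigma> d) \<or> m dvd pos \<sigma> d - 2 \<or> m dvd pos \<sigma> d - 3"
    using assms by (auto simp: Inv_def)
  then show "clean (pos \<sigma> d)" using long_clean near_first(1) by blast
  show "clean (pos \<sigma> j) \<and> \<not> long (pos \<sigma> j)" if j: "j < M" "adj d j"
    using c
  proof (elim disjE)
    assume "long (pos \<sigma> d)"
    then show ?thesis using long_nbr pos_adj[OF d j(1), of \<sigma>] j by blast
  next
    assume "m dvd pos \<sigma> d - 2"
    then have "m dvd pos \<sigma> j - 3 \<or> m dvd pos \<sigma> j - 1" using adj_pos[OF d j] by fastforce
    then show ?thesis using near_first(1,2) by blast
  next
    assume "m dvd pos \<sigma> d - 3"
    then have "m dvd pos \<sigma> j - 4 \<or> m dvd pos \<sigma> j - 2" using adj_pos[OF d j] by fastforce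
    then show ?thesis using near_first(1,2) by blast
  qed
qed

lemma D_clique:
  assumes "Inv \<sigma>" "d \<in> descents \<sigma>" "e \<in> descents \<sigma>" "d \<noteq> e"
  shows "adj d e"
proof -
  have "adj d' e'" if "m dvd pos \<sigma> d' - 2" "m dvd pos \<sigma> e' - 3" "d' < M" "e' < M" for d' e'
  proof -
    have "m dvd pos \<sigma> d' - pos \<sigma> e' + 1" using dvd_diff[OF that(1,2)] by (simp add: algebra_simps)
    then show ?thesis using pos_adj[OF that(3,4), of \<sigma>] by (simp add: adjt_def)
  qed
  then show ?thesis using assms gw.adj_sym[of d e] by (auto simp: Inv_def)
qed

lemma near_adj: "i < M \<Longrightarrow> j < M \<Longrightarrow> adj i j \<Longrightarrow> \<exists>x. m dvd int i - int j - x \<and> (x = 1 \<or> x = - 1)"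
  using adj_padj[of i j] unfolding adjt_def by (metis diff_minus_eq_add)

lemma no_triangle: "i < M \<Longrightarrow> j < M \<Longrightarrow> d < M \<Longrightarrow> adj i j \<Longrightarrow> adj d i \<Longrightarrow> adj d j \<Longrightarrow> False"
proof -
  assume a: "i < M" "j < M" "d < M" "adj i j" "adj d i" "adj d j"
  have "m dvd c \<Longrightarrow> - 7 < c \<Longrightarrow> c < 7 \<Longrightarrow> c = 0" for c
    using not_dvd_small[of c m] m_pos by (cases "0 < c"; cases "c < 0") auto
  note small = this
  obtain x where x: "m dvd int i - int j - x" "x = 1 \<or> x = - 1" using near_adj[of i j] a by blast
  obtain y where y: "m dvd int d - int i - y" "y = 1 \<or> y = - 1" using near_adj[of d i] a by blast
  obtain z where z: "m dvd int d - int j - z" "z = 1 \<or> z = - 1" using near_adj[of d j] a by blast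
  have "m dvd x + y - z" using dvd_diff[OF z(1) dvd_add[OF x(1) y(1)]] by (simp add: algebra_simps)
  then show False using small[of "x + y - z"] x(2) y(2) z(2) by auto
qed

lemma phase_E: "Inv \<sigma> \<Longrightarrow> j < M \<Longrightarrow> isE k (pos \<sigma> j) \<Longrightarrow> j \<notin> phase \<sigma>"
  and phase_L: "Inv \<sigma> \<Longrightarrow> j < M \<Longrightarrow> isL k (pos \<sigma> j) \<Longrightarrow> j \<in> phase \<sigma>"
  by (auto simp: Inv_def)

lemma Inv_good [simp]: "Inv \<sigma> \<Longrightarrow> good \<sigma>" by (simp add: Inv_def)

lemma turn_cases: "turn \<sigma> l = 1 \<or> turn \<sigma> l = - 1" by (simp add: turn_def)

lemma good_after [simp]: "good \<sigma> \<Longrightarrow> good (after \<sigma> i)"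
  using turn_cases by (auto simp: good_def after_def)

text \<open>The choice of the position \<open>2\<close> leaves room on both sides: the crossed side is at \<open>2\<close> or \<open>3\<close> and its
  neighbours are between \<open>1\<close> and \<open>4\<close>.\<close>

lemma new_pos:
  assumes "Inv \<sigma>" "i < M" "i \<notin> descents \<sigma>" "\<not> long (pos \<sigma> i)"
  shows "pred i \<in> descents \<sigma> \<Longrightarrow> m dvd pos (after \<sigma> i) i - 3" "pred i \<notin> descents \<sigma> \<Longrightarrow> pos (after \<sigma> i) i = 2"
  using assms pos_succ[of "pred i" \<sigma>] by (auto simp: pos_after first_of_def algebra_simps)

lemma new_pos_nbr:
  assumes "Inv \<sigma>" "i < M" "i \<notin> descents \<sigma>" "\<not> long (pos \<sigma> i)" "j < M" "j = i \<or> adj i j"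
  obtains c where "m dvd pos (after \<sigma> i) j - c" "c = 1 \<or> c = 2 \<or> c = 3 \<or> c = 4"
proof -
  obtain c where c: "m dvd pos (after \<sigma> i) i - c" "c = 2 \<or> c = 3"
    using new_pos[OF assms(1-4)] by (metis diff_self dvd_0_right)
  show ?thesis
  proof (cases "j = i")
    case True
    then show ?thesis using c that by blast
  next
    case False
    then have "m dvd pos (after \<sigma> i) j - (c + 1) \<or> m dvd pos (after \<sigma> i) j - (c - 1)"
      using adj_pos[OF assms(2,5) _ c(1)] assms(6) by blast
    then show ?thesis using that[of "c + 1"] that[of "c - 1"] c(2) by auto
  qed
qed

text \<open>The orientation of the next blob is chosen so that the positions \<open>2\<close> and \<open>3\<close> get the types of \<open>x\<close>
  and \<open>x + 1\<close>. Next to a side that is not long, the types of further neighbours agree automatically.\<close>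

lemma relabel:
  assumes g: "good \<sigma>" and a: "a' = (label \<sigma> (T x) + 3 * e) mod N"
    and e: "e = (if N dvd label \<sigma> (T x) - label \<sigma> (T (x + 1)) - 1 then 1 else - 1)"
  shows "eqt N (a' - 3 * e) (label \<sigma> (T x))" "eqt N (a' - 4 * e) (label \<sigma> (T (x + 1)))"
    "\<not> long x \<Longrightarrow> eqt N (a' - 2 * e) (label \<sigma> (T (x - 1)))"
    "\<not> long (x + 1) \<Longrightarrow> eqt N (a' - 5 * e) (label \<sigma> (T (x + 2)))"
proof -
  let ?l = "\<lambda>c. label \<sigma> (T (x + c))"
  have a0: "N dvd a' - (?l 0 + 3 * e)" using a by (simp add: mod_eq_dvd_iff[symmetric])
  then show "eqt N (a' - 3 * e) (label \<sigma> (T x))" by (simp add: eqt_def algebra_simps)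
  have "adjt N (?l 1) (?l 0)"
    using padj_types[OF padj_plus(1)[of x]] g adjt_minus[of N "T (x + 1)" "T x"]
    by (auto simp: good_def label_def adjt_def)
  then have e1: "N dvd ?l 0 - ?l 1 - e"
    unfolding e adjt_def by (auto simp: dvd_diff_commute algebra_simps)
  then show "eqt N (a' - 4 * e) (label \<sigma> (T (x + 1)))"
    using dvd_add[OF a0 e1] by (simp add: eqt_def algebra_simps)
  have lin: "N dvd ?l (c + 1) - ?l c - (?l c - ?l (c - 1))" if "\<not> long (x + c)" for c
  proof -
    have "N dvd T (x + c + 1) - T (x + c) - (T (x + c) - T (x + c - 1))"
      using nonlong_types[OF that] by (simp add: eqt_def)
    then have "N dvd orientation \<sigma> * (T (x + c + 1) - T (x + c) - (T (x + c) - T (x + c - 1)))" by simp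
    then show ?thesis by (simp add: label_def algebra_simps)
  qed
  show "eqt N (a' - 2 * e) (label \<sigma> (T (x - 1)))" if "\<not> long x"
  proof -
    have "N dvd ?l 1 - ?l 0 - (?l 0 - ?l (- 1))" using lin[of 0] that by simp
    moreover have "a' - 2 * e - ?l (- 1) = (a' - (?l 0 + 3 * e)) + (- (?l 0 - ?l 1 - e)) + (- (?l 1 - ?l 0 - (?l 0 - ?l (- 1)))) "
      by simp
    ultimately show ?thesis using a0 e1 unfolding eqt_def by (metis dvd_add dvd_minus_iff uminus_add_conv_diff add_uminus_conv_diff)
  qed
  show "eqt N (a' - 5 * e) (label \<sigma> (T (x + 2)))" if "\<not> long (x + 1)"
  proof -
    have "N dvd ?l 2 - ?l 1 - (?l 1 - ?l 0)" using lin[of 1] that by simp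
    moreover have "a' - 5 * e - ?l 2 = (a' - (?l 0 + 3 * e)) + (?l 0 - ?l 1 - e) + (?l 0 - ?l 1 - e) + (- (?l 2 - ?l 1 - (?l 1 - ?l 0)))"
      by simp
    ultimately show ?thesis using a0 e1 unfolding eqt_def by (metis dvd_add dvd_minus_iff)
  qed
qed

text \<open>Kept types make the coordinates before and after a crossing comparable. For a new blob this is
  how its position and orientation were chosen.\<close>

lemma type_at_after:
  assumes I: "Inv \<sigma>" "i < M" "i \<notin> descents \<sigma>" and j: "j < M" "j = i \<or> adj i j"
  shows "eqt N (type_at (after \<sigma> i) j) (type_at \<sigma> j)"
proof (cases "long (pos \<sigma> i)")
  case True
  then show ?thesis by (simp add: type_at_def label_after_long pos_after)
next
  case False
  let ?x = "pos \<sigma> (first_of \<sigma> i)" and ?e = "turn \<sigma> (first_of \<sigma> i)" and ?a = "origin (after \<sigma> i)"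
  have R: "eqt N (?a - 3 * ?e) (label \<sigma> (T ?x))" "eqt N (?a - 4 * ?e) (label \<sigma> (T (?x + 1)))"
    "\<not> long ?x \<Longrightarrow> eqt N (?a - 2 * ?e) (label \<sigma> (T (?x - 1)))"
    "\<not> long (?x + 1) \<Longrightarrow> eqt N (?a - 5 * ?e) (label \<sigma> (T (?x + 2)))"
    using relabel[of \<sigma> ?a ?x ?e] I False by (auto simp: after_def turn_def type_at_def)
  have new: "eqt N (type_at (after \<sigma> i) j) (type_at \<sigma> j)"
    if c: "m dvd pos (after \<sigma> i) j - c" "c = 1 \<or> c = 2 \<or> c = 3 \<or> c = 4" and l: "eqt N (?a - (1 + c) * ?e) (label \<sigma> (T (?x + (c - 2))))" for c
  proof -
    have 1: "type_at (after \<sigma> i) j = ?a - (1 + c) * ?e"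
      using near_first(4)[OF c] False by (simp add: type_at_def label_def) (simp add: after_def algebra_simps)
    have "m dvd pos \<sigma> j - (?x + (c - 2))" using c(1) False by (simp add: pos_after algebra_simps)
    then have "type_at \<sigma> j = label \<sigma> (T (?x + (c - 2)))" unfolding type_at_def using cong(2) by metis
    then show ?thesis using 1 l by simp
  qed
  show ?thesis
  proof (cases "pred i \<in> descents \<sigma>")
    case True
    have p: "m dvd pos (after \<sigma> i) i - 3" by (rule new_pos(1)[OF I False True])
    have "m dvd pos \<sigma> i - (?x + 1)" using pos_succ[of "pred i" \<sigma>] I True by (simp add: first_of_def)
    then have nl: "\<not> long (?x + 1)" using False cong(6) by blast
    consider "j = i" | "m dvd pos (after \<sigma> i) j - 4" | "m dvd pos (after \<sigma> i) j - 2"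
      using adj_pos[OF I(2) j(1) _ p] j(2) by auto
    then show ?thesis using new[of 3] new[of 4] new[of 2] p R(1,2) R(4)[OF nl] by cases auto
  next
    case 2: False
    then have p: "pos (after \<sigma> i) i = 2" by (rule new_pos(2)[OF I False])
    have nl: "\<not> long ?x" using False 2 by (simp add: first_of_def)
    consider "j = i" | "m dvd pos (after \<sigma> i) j - 3" | "m dvd pos (after \<sigma> i) j - 1"
      using adj_pos[OF I(2) j(1), of "after \<sigma> i" 2] j(2) p by auto
    then show ?thesis using new[of 3] new[of 1] new[of 2] p R(1,2) R(3)[OF nl] by cases auto
  qed
qed

lemma clean_after:
  assumes I: "Inv \<sigma>" "i < M" "i \<notin> descents \<sigma>" and j: "j < M"
  shows "adj i j \<Longrightarrow> clean (pos (after \<sigma> i) j) \<and> \<not> long (pos (after \<sigma> i) j)" "clean (pos (after \<sigma> i) i)"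
proof -
  show "clean (pos (after \<sigma> i) j) \<and> \<not> long (pos (after \<sigma> i) j)" if a: "adj i j"
  proof (cases "long (pos \<sigma> i)")
    case True
    then show ?thesis using long_nbr[OF True] pos_adj[OF I(2) j, of \<sigma>] a by (simp add: pos_after)
  next
    case False
    obtain c where "m dvd pos (after \<sigma> i) j - c" "c = 1 \<or> c = 2 \<or> c = 3 \<or> c = 4"
      using new_pos_nbr[OF I False j] a by blast
    then show ?thesis using near_first(1,2) by blast
  qed
  show "clean (pos (after \<sigma> i) i)"
  proof (cases "long (pos \<sigma> i)")
    case True
    then show ?thesis using long_clean by (simp add: pos_after)
  next
    case False
    obtain c where "m dvd pos (after \<sigma> i) i - c" "c = 1 \<or> c = 2 \<or> c = 3 \<or> c = 4"
      using new_pos_nbr[OF I False I(2)] by blast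
    then show ?thesis using near_first(1) by blast
  qed
qed

lemma D_nbr_unique: "Inv \<sigma> \<Longrightarrow> i < M \<Longrightarrow> d \<in> descents \<sigma> \<Longrightarrow> e \<in> descents \<sigma> \<Longrightarrow> adj d i \<Longrightarrow> adj e i \<Longrightarrow> d = e"
  using D_clique[of \<sigma> d e] no_triangle[of e i d] D_facts(1)[of \<sigma>] by blast

lemma Inv_after:
  assumes I: "Inv \<sigma>" "i < M" "i \<notin> descents \<sigma>"
  shows "Inv (after \<sigma> i)"
proof -
  let ?s = "after \<sigma> i"
  have D: "descents ?s = {} \<or> (\<exists>d. descents ?s = {d} \<and> (m dvd pos ?s d - 2 \<or> long (pos ?s d))) \<or>
       (\<exists>d e. descents ?s = {d, e} \<and> m dvd pos ?s d - 2 \<and> m dvd pos ?s e - 3)"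
  proof (cases "\<exists>d\<in>descents \<sigma>. adj d i")
    case False
    then have 1: "descents ?s = {i}" by (auto simp: descents_after)
    have "adj (pred i) i" using adj_iff[of "pred i" i] I(2) by simp
    then have "pred i \<notin> descents \<sigma>" using False by blast
    then have "long (pos ?s i) \<or> m dvd pos ?s i - 2" using new_pos(2)[OF I] by (auto simp: pos_after)
    then show ?thesis using 1 by blast
  next
    case True
    then obtain d where d: "d \<in> descents \<sigma>" "adj d i" by blast
    have nl: "\<not> long (pos \<sigma> i)" using D_facts(3)[OF I(1) d(1) I(2) d(2)] by blast
    have dM: "d < M" using D_facts(1)[OF I(1) d(1)] .
    have "e = d" if "e \<in> descents \<sigma>" "adj e i" for e
      using D_nbr_unique[OF I(1,2) that(1) d(1) that(2) d(2)] .
    then have "{e \<in> descents \<sigma>. adj e i} = {d}" using d by blast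
    then have 2: "descents ?s = {d, i}" unfolding descents_after by blast
    show ?thesis
    proof (cases "pred i \<in> descents \<sigma>")
      case True
      have "adj (pred i) i" using adj_iff[of "pred i" i] I(2) by simp
      then have d': "d = pred i" using D_nbr_unique[OF I(1,2) d(1) True d(2)] by blast
      have "pos ?s d = 2" using d' True nl by (simp add: pos_after first_of_def)
      then have "m dvd pos ?s d - 2" by simp
      then show ?thesis using 2 new_pos(1)[OF I nl True] by blast
    next
      case False
      have "adj i d" using d(2) gw.adj_sym by blast
      then have "d = succ i" using adj_cases[of i d] d False dM I(2) by metis
      then have "m dvd pos ?s d - 3" using pos_succ[OF I(2), of ?s] new_pos(2)[OF I nl False] by simp
      moreover have "m dvd pos ?s i - 2" using new_pos(2)[OF I nl False] by simp
      moreover have "descents ?s = {i, d}" using 2 by blast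
      ultimately show ?thesis by blast
    qed
  qed
  have "(\<forall>k. isE k (pos ?s j) \<longrightarrow> j \<notin> phase ?s) \<and> (\<forall>k. isL k (pos ?s j) \<longrightarrow> j \<in> phase ?s)" if j: "j < M" for j
  proof (cases "j = i \<or> adj i j")
    case True
    then have "clean (pos ?s j)" using clean_after[OF I j] by blast
    then show ?thesis by (simp add: clean_def)
  next
    case False
    then show ?thesis using j E_L_aux by (auto simp: phase_after)
  qed
  then show ?thesis using D I by (auto simp: Inv_def descents_after)
qed

end

context shape
begin

lemma unclean_pair:
  assumes "padj x x'" "\<not> clean x" "\<not> clean x'"
  obtains k where "isE k x" "isL k x'" | k where "isL k x" "isE k x'"
proof -
  consider k where "isE k x" | k where "isL k x" using assms(2) by (auto simp: clean_def)
  then show ?thesis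
  proof cases
    case 1
    then show ?thesis using E_nbr(4)[OF 1 assms(1)] assms(3) that(1) by blast
  next
    case 2
    then show ?thesis using L_nbr(4)[OF 2 assms(1)] assms(3) that(2) by blast
  qed
qed

lemma common_chamber:
  assumes "padj x x'" "clean x \<or> clean x'"
  obtains k where "On k x" "On k x'" "adjt N (T x) (T x')"
  using padj_corner[OF assms(1)] assms(2) unfolding clean_def by blast

lemma E_unclean: "isE k x \<Longrightarrow> \<not> clean x" and L_unclean: "isL k x \<Longrightarrow> \<not> clean x"
  by (auto simp: clean_def)

end

context blob_map
begin

lemma coord_at_closed [simp]: "good \<sigma> \<Longrightarrow> y \<in> Y \<Longrightarrow> coord_at \<sigma> j y \<in> carrier (Bt (type_at \<sigma> j))"
proof -
  assume g: "good \<sigma>" and y: "y \<in> Y"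
  interpret b: blob N p q "Bs \<sigma>" Y "ms \<sigma>" "hs \<sigma>" "fs \<sigma>" by (rule blob_label[OF g])
  show ?thesis using b.coord_closed[OF y] by (simp add: coord_at_def type_at_def)
qed

lemma coord_at_On: "good \<sigma> \<Longrightarrow> y \<in> Y \<Longrightarrow> On k (pos \<sigma> j) \<Longrightarrow> coord_at \<sigma> j y = hd (type_at \<sigma> j) (view \<sigma> k y)"
proof -
  assume g: "good \<sigma>" and y: "y \<in> Y" and k: "On k (pos \<sigma> j)"
  interpret b: blob N p q "Bs \<sigma>" Y "ms \<sigma>" "hs \<sigma>" "fs \<sigma>" by (rule blob_label[OF g])
  show ?thesis using b.coord_eq[OF k y] by (simp add: coord_at_def type_at_def view_def)
qed

lemma
  assumes g: "good \<sigma>" and y: "y \<in> Y"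
  shows view_closed [simp]: "view \<sigma> k y \<in> Y" and unview_closed [simp]: "unview \<sigma> k y \<in> Y"
    and view_unview [simp]: "view \<sigma> k (unview \<sigma> k y) = y" and unview_view [simp]: "unview \<sigma> k (view \<sigma> k y) = y"
    and view_0: "view \<sigma> 0 y = y" and unview_0: "unview \<sigma> 0 y = y"
proof -
  interpret b: blob N p q "Bs \<sigma>" Y "ms \<sigma>" "hs \<sigma>" "fs \<sigma>" by (rule blob_label[OF g])
  show "view \<sigma> k y \<in> Y" "unview \<sigma> k y \<in> Y" "view \<sigma> k (unview \<sigma> k y) = y" "unview \<sigma> k (view \<sigma> k y) = y"
    "view \<sigma> 0 y = y" "unview \<sigma> 0 y = y"
    using y by (simp_all add: view_def unview_def)
qed

lemma sector_closed [simp]: "i < M \<Longrightarrow> s \<in> carrier (A i) \<Longrightarrow> sector \<sigma> i s \<in> carrier (Bt (type_at \<sigma> i))"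
  by (simp add: sector_def)

lemma sector_one: "sector \<sigma> i \<one>\<^bsub>A i\<^esub> = one_t (type_at \<sigma> i)"
  by (simp add: sector_def)

lemma sector_eq:
  assumes "eqt N (type_at \<sigma> i) (type_at \<tau> i)" "i \<in> phase \<sigma> \<longleftrightarrow> i \<in> phase \<tau>"
  shows "sector \<sigma> i s = sector \<tau> i s"
  using Bt_cong[OF assms(1)] f_per[OF assms(1)] rho_per[OF assms(1)] assms(2) by (simp add: sector_def)

lemma sector_flip:
  assumes "eqt N (type_at \<sigma> i) (type_at \<tau> i)" "i \<in> phase \<sigma>" "i \<notin> phase \<tau>" "s \<noteq> \<one>\<^bsub>A i\<^esub>"
  shows "sector \<sigma> i s = inv_t (type_at \<sigma> i) (f (type_at \<sigma> i)) \<otimes>\<^bsub>Bt (type_at \<sigma> i)\<^esub> sector \<tau> i s"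
  using Bt_cong[OF assms(1)] f_per[OF assms(1)] rho_per[OF assms(1)] assms(2-) by (simp add: sector_def)

lemma sector_not_one:
  assumes "i < M" "s \<in> carrier (A i)" "s \<noteq> \<one>\<^bsub>A i\<^esub>"
  shows "sector \<sigma> i s \<noteq> one_t (type_at \<sigma> i)"
proof -
  interpret Ai: group "A i" using gw.grp assms by auto
  have "rho i (type_at \<sigma> i) s \<noteq> one_t (type_at \<sigma> i)"
    using rho_inj[OF assms(1,2), of "\<one>\<^bsub>A i\<^esub>" "type_at \<sigma> i"] rho_one[OF assms(1)] assms by auto
  moreover have "rho i (type_at \<sigma> i) s \<noteq> f (type_at \<sigma> i)" using rho_f assms by blast
  ultimately show ?thesis
    using assms by (simp add: sector_def inv_mult_eq)
qed

lemma inv_cancel: "b \<in> carrier (Bt v) \<Longrightarrow> c \<in> carrier (Bt v) \<Longrightarrow> d \<in> carrier (Bt v) \<Longrightarrow>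
    b \<otimes>\<^bsub>Bt v\<^esub> c = b \<otimes>\<^bsub>Bt v\<^esub> d \<longleftrightarrow> c = d"
proof -
  interpret B: group "Bt v" by (rule grp)
  show "b \<in> carrier (Bt v) \<Longrightarrow> c \<in> carrier (Bt v) \<Longrightarrow> d \<in> carrier (Bt v) \<Longrightarrow> ?thesis" by simp
qed

lemma sector_inj:
  assumes "i < M" "s \<in> carrier (A i)" "s' \<in> carrier (A i)" "sector \<sigma> i s = sector \<sigma> i s'"
  shows "s = s'"
proof -
  consider "s = \<one>\<^bsub>A i\<^esub>" | "s' = \<one>\<^bsub>A i\<^esub>" | "s \<noteq> \<one>\<^bsub>A i\<^esub>" "s' \<noteq> \<one>\<^bsub>A i\<^esub>" by blast
  then show ?thesis
  proof cases
    case 3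
    then have "rho i (type_at \<sigma> i) s = rho i (type_at \<sigma> i) s'"
      using assms by (simp add: sector_def inv_cancel split: if_splits)
    then show ?thesis using rho_inj assms by blast
  qed (use sector_not_one[OF assms(1,2), of \<sigma>] sector_not_one[OF assms(1,3), of \<sigma>] sector_one[of \<sigma> i] assms(4) in metis)+
qed

lemma sector_not_f: "i < M \<Longrightarrow> s \<in> carrier (A i) \<Longrightarrow> i \<notin> phase \<sigma> \<Longrightarrow> sector \<sigma> i s \<noteq> f (type_at \<sigma> i)"
  using rho_f[of i s "type_at \<sigma> i"] f_ne[of "type_at \<sigma> i"] by (auto simp: sector_def)

lemma sector_not_inv_f:
  assumes "i < M" "s \<in> carrier (A i)" "i \<in> phase \<sigma>"
  shows "sector \<sigma> i s \<noteq> inv_t (type_at \<sigma> i) (f (type_at \<sigma> i))"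
proof -
  interpret B: group "Bt (type_at \<sigma> i)" by (rule grp)
  show ?thesis
  proof (cases "s = \<one>\<^bsub>A i\<^esub>")
    case True
    then show ?thesis using inv_eq_one[OF f_closed, of "type_at \<sigma> i"] f_ne[of "type_at \<sigma> i"] sector_one by metis
  next
    case False
    interpret Ai: group "A i" using gw.grp assms by auto
    have "rho i (type_at \<sigma> i) s \<noteq> one_t (type_at \<sigma> i)"
      using rho_inj[OF assms(1,2), of "\<one>\<^bsub>A i\<^esub>" "type_at \<sigma> i"] rho_one[OF assms(1)] False by auto
    then show ?thesis using False assms by (simp add: sector_def)
  qed
qed

lemma cross_closed [simp]: "good \<sigma> \<Longrightarrow> i < M \<Longrightarrow> s \<in> carrier (A i) \<Longrightarrow> y \<in> Y \<Longrightarrow> cross \<sigma> i s y \<in> Y"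
  by (simp add: cross_def)

lemma uncross_closed [simp]: "good \<sigma> \<Longrightarrow> i < M \<Longrightarrow> s \<in> carrier (A i) \<Longrightarrow> y \<in> Y \<Longrightarrow> uncross \<sigma> i s y \<in> Y"
  by (simp add: uncross_def Let_def)

lemma cross_uncross [simp]: "good \<sigma> \<Longrightarrow> i < M \<Longrightarrow> s \<in> carrier (A i) \<Longrightarrow> y \<in> Y \<Longrightarrow> cross \<sigma> i s (uncross \<sigma> i s y) = y"
  by (simp add: cross_def uncross_def Let_def)

lemma uncross_cross [simp]: "good \<sigma> \<Longrightarrow> i < M \<Longrightarrow> s \<in> carrier (A i) \<Longrightarrow> y \<in> Y \<Longrightarrow> uncross \<sigma> i s (cross \<sigma> i s y) = y"
  by (simp add: cross_def uncross_def Let_def)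

text \<open>After a crossing that starts a new blob, the crossed side and its neighbours belong to the first
  chamber only, so that their coordinates are heads of the point itself.\<close>

lemma coord_at_new:
  assumes I: "Inv \<sigma>" "i < M" "i \<notin> descents \<sigma>" and nl: "\<not> long (pos \<sigma> i)" and j: "j < M" "j = i \<or> adj i j" and y: "y \<in> Y"
  shows "coord_at (after \<sigma> i) j y = hd (type_at \<sigma> j) y"
proof -
  obtain c where c: "m dvd pos (after \<sigma> i) j - c" "c = 1 \<or> c = 2 \<or> c = 3 \<or> c = 4"
    using new_pos_nbr[OF I nl j] by blast
  have "On 0 (pos (after \<sigma> i) j)" using near_first(3)[OF c] by blast
  then have "coord_at (after \<sigma> i) j y = hd (type_at (after \<sigma> i) j) y"
    using coord_at_On[of "after \<sigma> i" y 0 j] I y by (simp add: view_0)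
  then show ?thesis using hd_cong[OF type_at_after[OF I j]] by simp
qed

context
  fixes \<sigma> i s y
  assumes I: "Inv \<sigma>" "i < M" "i \<notin> descents \<sigma>" and s: "s \<in> carrier (A i)" and y: "y \<in> Y"
begin

lemma cross_self: "coord_at \<sigma> i (cross \<sigma> i s y) = sector \<sigma> i s \<otimes>\<^bsub>Bt (type_at \<sigma> i)\<^esub> coord_at (after \<sigma> i) i y"
proof -
  have g: "good \<sigma>" using I by simp
  have k: "On (chamber_of (pos \<sigma> i)) (pos \<sigma> i)" by (rule chamber_of)
  show ?thesis
  proof (cases "long (pos \<sigma> i)")
    case True
    have "coord_at (after \<sigma> i) i y = coord_at \<sigma> i y" using True by (simp add: coord_at_def label_after_long pos_after)
    then show ?thesis
      using coord_at_On[OF g _ k, of y] coord_at_On[OF g _ k, of "cross \<sigma> i s y"] True g y s I(2)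
      by (simp add: cross_def hd_mv)
  next
    case False
    have "coord_at (after \<sigma> i) i y = hd (type_at \<sigma> i) y" using coord_at_new[OF I False I(2) _ y] by simp
    then show ?thesis
      using coord_at_On[OF g _ k, of "cross \<sigma> i s y"] False g y s I(2)
      by (simp add: cross_def hd_mv)
  qed
qed

text \<open>The crossed letter commutes with the type of a neighbouring side in a common chamber, so that it
  does not change the coordinate. At a reflex corner there is no common chamber, and the next two lemmas
  show that the coordinate is shifted by the gluing element.\<close>

lemma cross_adj:
  assumes j: "j < M" "adj i j" and c: "clean (pos \<sigma> i) \<or> clean (pos \<sigma> j)"
  shows "coord_at \<sigma> j (cross \<sigma> i s y) = coord_at (after \<sigma> i) j y"
proof -
  have g: "good \<sigma>" using I by simp
  interpret b: blob N p q "Bs \<sigma>" Y "ms \<sigma>" "hs \<sigma>" "fs \<sigma>" by (rule blob_label[OF g])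
  have pa: "padj (pos \<sigma> i) (pos \<sigma> j)" using pos_adj[OF I(2) j(1), of \<sigma>] j by blast
  obtain l where l: "On l (pos \<sigma> i)" "On l (pos \<sigma> j)" "adjt N (T (pos \<sigma> i)) (T (pos \<sigma> j))"
    using common_chamber[OF pa c] .
  have a: "adjt N (T (pos \<sigma> j)) (T (pos \<sigma> i))" using l(3) adjt_sym by blast
  have k: "On (chamber_of (pos \<sigma> i)) (pos \<sigma> i)" by (rule chamber_of)
  have kY: "cross \<sigma> i s y \<in> Y" using g I s y by simp
  have r: "sector \<sigma> i s \<in> carrier (Bt (label \<sigma> (T (pos \<sigma> i))))" using I s sector_closed[of i s \<sigma>] by (simp add: type_at_def)
  show ?thesis
  proof (cases "long (pos \<sigma> i)")
    case True
    have "coord_at (after \<sigma> i) j y = coord_at \<sigma> j y" using True by (simp add: coord_at_def label_after_long pos_after)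
    also have "\<dots> = hd (type_at \<sigma> j) (view \<sigma> l y)" using coord_at_On[OF g y l(2)] .
    also have "\<dots> = hd (type_at \<sigma> j) (mv (type_at \<sigma> i) (sector \<sigma> i s) (view \<sigma> l y))"
      using b.hd_adj[OF a r, of "view \<sigma> l y"] g y by (simp add: type_at_def)
    also have "mv (type_at \<sigma> i) (sector \<sigma> i s) (view \<sigma> l y) = view \<sigma> l (cross \<sigma> i s y)"
      using b.pt_mv[OF k l(1) y r] True by (simp add: cross_def view_def unview_def type_at_def)
    also have "hd (type_at \<sigma> j) (view \<sigma> l (cross \<sigma> i s y)) = coord_at \<sigma> j (cross \<sigma> i s y)" using coord_at_On[OF g kY l(2)] by simp
    finally show ?thesis by simp
  next
    case False
    then have kl: "chamber_of (pos \<sigma> i) = l" using not_long k l(1) by blast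
    have "coord_at (after \<sigma> i) j y = hd (type_at \<sigma> j) y" using coord_at_new[OF I False j(1) _ y] j by simp
    also have "\<dots> = hd (type_at \<sigma> j) (mv (type_at \<sigma> i) (sector \<sigma> i s) y)"
      using b.hd_adj[OF a r, of y] y by (simp add: type_at_def)
    also have "mv (type_at \<sigma> i) (sector \<sigma> i s) y = view \<sigma> l (cross \<sigma> i s y)"
      using False kl g y r by (simp add: cross_def type_at_def)
    also have "hd (type_at \<sigma> j) (view \<sigma> l (cross \<sigma> i s y)) = coord_at \<sigma> j (cross \<sigma> i s y)" using coord_at_On[OF g kY l(2)] by simp
    finally show ?thesis by simp
  qed
qed

lemma cross_EL:
  assumes j: "j < M" "adj i j" and e: "isE k (pos \<sigma> i)" "isL k (pos \<sigma> j)"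
  shows "coord_at \<sigma> j (cross \<sigma> i s y) = inv_t (type_at \<sigma> j) (f (type_at \<sigma> j)) \<otimes>\<^bsub>Bt (type_at \<sigma> j)\<^esub> coord_at (after \<sigma> i) j y"
proof -
  have g: "good \<sigma>" using I by simp
  interpret b: blob N p q "Bs \<sigma>" Y "ms \<sigma>" "hs \<sigma>" "fs \<sigma>" by (rule blob_label[OF g])
  have nl: "\<not> long (pos \<sigma> i)" using e(1) long_clean E_unclean by blast
  have k: "chamber_of (pos \<sigma> i) = k" using isE_unique[OF e(1) chamber_of] .
  have a: "adjt N (T (pos \<sigma> j)) (T (pos \<sigma> i))" using E_L_types[OF e] adjt_sym by blast
  have r: "sector \<sigma> i s \<in> carrier (Bt (label \<sigma> (T (pos \<sigma> i))))" using I s sector_closed[of i s \<sigma>] by (simp add: type_at_def)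
  have "view \<sigma> k (cross \<sigma> i s y) = mv (type_at \<sigma> i) (sector \<sigma> i s) y" using nl k g y r by (simp add: cross_def type_at_def)
  then have "hd (type_at \<sigma> j) (view \<sigma> k (cross \<sigma> i s y)) = hd (type_at \<sigma> j) y"
    using b.hd_adj[OF a r, of y] y by (simp add: type_at_def)
  moreover have "coord_at (after \<sigma> i) j y = hd (type_at \<sigma> j) y" using coord_at_new[OF I nl j(1) _ y] j by simp
  ultimately show ?thesis
    using b.corner_coords(2)[OF e, of "cross \<sigma> i s y"] g y I s by (simp add: coord_at_def type_at_def view_def)
qed

lemma cross_LE:
  assumes j: "j < M" "adj i j" and e: "isL k (pos \<sigma> i)" "isE k (pos \<sigma> j)"
  shows "coord_at \<sigma> j (cross \<sigma> i s y) = f (type_at \<sigma> j) \<otimes>\<^bsub>Bt (type_at \<sigma> j)\<^esub> coord_at (after \<sigma> i) j y"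
proof -
  have g: "good \<sigma>" using I by simp
  interpret b: blob N p q "Bs \<sigma>" Y "ms \<sigma>" "hs \<sigma>" "fs \<sigma>" by (rule blob_label[OF g])
  have nl: "\<not> long (pos \<sigma> i)" using e(1) long_clean L_unclean by blast
  have k: "chamber_of (pos \<sigma> i) = k + 2" using isL_unique[OF e(1) chamber_of] .
  have a: "adjt N (T (pos \<sigma> j)) (T (pos \<sigma> i))" using E_L_types[OF e(2,1)] .
  have r: "sector \<sigma> i s \<in> carrier (Bt (label \<sigma> (T (pos \<sigma> i))))" using I s sector_closed[of i s \<sigma>] by (simp add: type_at_def)
  have "view \<sigma> (k + 2) (cross \<sigma> i s y) = mv (type_at \<sigma> i) (sector \<sigma> i s) y"
    using nl g y r unfolding cross_def k by (simp add: type_at_def del: add_2_eq_Suc')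
  then have "hd (type_at \<sigma> j) (view \<sigma> (k + 2) (cross \<sigma> i s y)) = hd (type_at \<sigma> j) y"
    using b.hd_adj[OF a r, of y] y by (simp add: type_at_def)
  moreover have "coord_at (after \<sigma> i) j y = hd (type_at \<sigma> j) y" using coord_at_new[OF I nl j(1) _ y] j by simp
  moreover have "cross \<sigma> i s y \<in> Y" using g y I s by simp
  ultimately show ?thesis
    using b.corner_coords(4)[OF e(2,1), of "cross \<sigma> i s y"] coord_at_closed[OF g, of "cross \<sigma> i s y" j]
    by (simp add: coord_at_def type_at_def view_def)
qed

text \<open>The phase is made so that the shifts at reflex corners cancel: the elements of \<open>A j\<close> select the same
  sector of the wall before and after the crossing of a neighbour.\<close>

lemma cross_sector:
  assumes j: "j < M" "adj i j" and h: "h \<in> carrier (A j)" "h \<noteq> \<one>\<^bsub>A j\<^esub>"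
  shows "coord_at \<sigma> j (cross \<sigma> i s y) = sector \<sigma> j h \<longleftrightarrow> coord_at (after \<sigma> i) j y = sector (after \<sigma> i) j h"
proof (cases "clean (pos \<sigma> i) \<or> clean (pos \<sigma> j)")
  case True
  have "j \<in> phase \<sigma> \<longleftrightarrow> j \<in> phase (after \<sigma> i)" using True j by (auto simp: phase_after)
  then show ?thesis
    using cross_adj[OF j True] sector_eq[OF type_at_after[OF I j(1)], of h] j(2) by simp
next
  case False
  have pa: "padj (pos \<sigma> i) (pos \<sigma> j)" using pos_adj[OF I(2) j(1), of \<sigma>] j by blast
  have fl: "j \<in> phase (after \<sigma> i) \<longleftrightarrow> j \<notin> phase \<sigma>" using False j by (simp add: phase_after)
  have e: "eqt N (type_at (after \<sigma> i) j) (type_at \<sigma> j)" using type_at_after[OF I j(1)] j(2) by blast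
  note cg = Bt_cong[OF e] f_per[OF e]
  have cl: "coord_at (after \<sigma> i) j y \<in> carrier (Bt (type_at \<sigma> j))" "sector (after \<sigma> i) j h \<in> carrier (Bt (type_at \<sigma> j))"
    using coord_at_closed[of "after \<sigma> i" y j] sector_closed[OF j(1) h(1), of "after \<sigma> i"] I y cg by auto
  show ?thesis
  proof (cases rule: unclean_pair[OF pa])
    case (3 k)
    have w: "j \<in> phase \<sigma>" "j \<notin> phase (after \<sigma> i)" using phase_L[OF I(1) j(1) 3(2)] fl by auto
    show ?thesis
      using cross_EL[OF j 3] sector_flip[OF eqt_sym[OF e] w h(2)] cl by (simp add: inv_cancel)
  next
    case (4 k)
    have w: "j \<notin> phase \<sigma>" "j \<in> phase (after \<sigma> i)" using phase_E[OF I(1) j(1) 4(2)] fl by auto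
    have "f (type_at \<sigma> j) \<otimes>\<^bsub>Bt (type_at \<sigma> j)\<^esub> sector (after \<sigma> i) j h = sector \<sigma> j h"
      using sector_flip[OF e w(2,1) h(2)] sector_closed[OF j(1) h(1), of \<sigma>] cg by simp
    then show ?thesis using cross_LE[OF j 4] cl inv_cancel[OF f_closed[of "type_at \<sigma> j"] cl] by simp
  qed (use False in auto)
qed

end

text \<open>The state after the crossing of the sides \<open>l\<close> and \<open>l + 1\<close> in one of the two orders. The placement
  depends only on the types of these two sides.\<close>

definition corner_state where
  "corner_state \<sigma> l = \<lparr> descents = {l, succ l}, offset = 2 - int l, origin = (type_at \<sigma> l + 3 * turn \<sigma> l) mod N, orientation = turn \<sigma> l,
     phase = {x. x < M \<and> (\<exists>k. isL k (int x + 2 - int l))} \<rparr>"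

lemma turn_alt: "l < M \<Longrightarrow> turn \<sigma> l = (if N dvd type_at \<sigma> l - type_at \<sigma> (succ l) - 1 then 1 else - 1)"
  using cong(2)[OF pos_succ[of l \<sigma>]] by (simp add: turn_def type_at_def)

lemma turn_cong:
  assumes "l < M" "eqt N (type_at \<sigma> l) (type_at \<tau> l)" "eqt N (type_at \<sigma> (succ l)) (type_at \<tau> (succ l))"
  shows "turn \<sigma> l = turn \<tau> l"
proof -
  have "N dvd (type_at \<sigma> l - type_at \<tau> l) - (type_at \<sigma> (succ l) - type_at \<tau> (succ l))"
    using dvd_diff[OF assms(2,3)[unfolded eqt_def]] .
  moreover have "type_at \<sigma> l - type_at \<sigma> (succ l) - 1 = (type_at \<tau> l - type_at \<tau> (succ l) - 1) + ((type_at \<sigma> l - type_at \<tau> l) - (type_at \<sigma> (succ l) - type_at \<tau> (succ l)))"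
    by simp
  ultimately have "N dvd type_at \<sigma> l - type_at \<sigma> (succ l) - 1 \<longleftrightarrow> N dvd type_at \<tau> l - type_at \<tau> (succ l) - 1"
    by (metis dvd_add_left_iff)
  then show ?thesis using assms(1) by (simp add: turn_alt)
qed

lemma adj_adj_L:
  assumes I: "Inv \<sigma>" "i < M" "i \<notin> descents \<sigma>" and j: "j < M" "adj i j" and x: "x < M" "adj j x"
  shows "\<not> isL k (pos (after \<sigma> i) x)"
proof (cases "long (pos \<sigma> i)")
  case True
  then show ?thesis
    using long_nbr2[OF True, of "pos \<sigma> j" "pos \<sigma> x"] pos_adj[OF I(2) j(1), of \<sigma>] pos_adj[OF j(1) x(1), of \<sigma>] j x
    by (simp add: pos_after)
next
  case False
  have "\<exists>c. m dvd pos (after \<sigma> i) i - c \<and> (c = 2 \<or> c = 3)"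
    using new_pos[OF I False] by (metis diff_self dvd_0_right)
  then obtain c where c: "m dvd pos (after \<sigma> i) i - c" "c = 2 \<or> c = 3" by blast
  obtain d where d: "m dvd pos (after \<sigma> i) j - d" "d = 1 \<or> d = 2 \<or> d = 3 \<or> d = 4"
    using adj_pos[OF I(2) j c(1)] c(2) by fastforce
  obtain e where e: "m dvd pos (after \<sigma> i) x - e" "0 \<le> e" "e \<le> 5"
    using adj_pos[OF j(1) x d(1)] d(2) by fastforce
  have "\<not> isL k e" using first_not_L[of e k] e(2,3) N by simp
  then show ?thesis using cong(4)[OF e(1)] by simp
qed

text \<open>The second crossing always starts a new blob, since neighbours of the first side are not long
  any more. The phases agree with those of the positions also for the outer neighbours of the two
  sides, by the following reason: they are not neighbours of the first crossed side and cannot be late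
  reflex sides by the previous lemma.\<close>

lemma after_after:
  assumes I: "Inv \<sigma>" "i < M" "i \<notin> descents \<sigma>" and j: "j < M" "adj i j" "j \<notin> descents \<sigma>"
  shows "after (after \<sigma> i) j = corner_state \<sigma> (if j = succ i then i else j)"
proof -
  let ?s = "after \<sigma> i" and ?l = "if j = succ i then i else j"
  have I': "Inv ?s" by (rule Inv_after[OF I])
  have ij: "i \<noteq> j" using j(2) by auto
  have j': "j \<notin> descents ?s" using j ij by (auto simp: descents_after)
  have nl: "\<not> long (pos ?s j)" using clean_after(1)[OF I j(1,2)] by blast
  have l: "?l < M" using I j by simp
  have sl: "{i, j} = {?l, succ ?l}" using adj_iff[OF I(2) j(1)] j(2) by auto
  have first_of: "first_of ?s j = ?l"
  proof (cases "j = succ i")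
    case True
    then show ?thesis using I(2) by (simp add: first_of_def descents_after)
  next
    case False
    have "pred j \<noteq> i" using False succ_pred[OF j(1)] by metis
    moreover have "pred j \<notin> descents \<sigma> \<or> \<not> adj (pred j) i"
      using no_triangle[OF I(2) j(1) pred_less[OF j(1)] j(2)] adj_iff[of "pred j" j] j(1) succ_pred[OF j(1)] pred_less[OF j(1)] by metis
    ultimately have "pred j \<notin> descents ?s" unfolding descents_after by blast
    then show ?thesis using False by (simp add: first_of_def)
  qed
  have type_at_eq: "eqt N (type_at ?s x) (type_at \<sigma> x)" if "x \<in> {i, j}" for x
    using that type_at_after[OF I] I j by blast
  have t: "eqt N (type_at ?s ?l) (type_at \<sigma> ?l)" "eqt N (type_at ?s (succ ?l)) (type_at \<sigma> (succ ?l))"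
    using type_at_eq sl by blast+
  have o: "turn ?s ?l = turn \<sigma> ?l" by (rule turn_cong[OF l t])
  have "N dvd (type_at ?s ?l + 3 * turn \<sigma> ?l) - (type_at \<sigma> ?l + 3 * turn \<sigma> ?l)" using t(1) by (simp add: eqt_def)
  then have a: "(type_at ?s ?l + 3 * turn \<sigma> ?l) mod N = (type_at \<sigma> ?l + 3 * turn \<sigma> ?l) mod N"
    by (simp add: mod_eq_dvd_iff)
  have D: "insert j {d \<in> descents ?s. adj d j} = {?l, succ ?l}"
  proof -
    have "d \<notin> descents \<sigma>" if "adj d i" "adj d j" for d
      using no_triangle[OF I(2) j(1) _ j(2) that] D_facts(1)[OF I(1), of d] by blast
    then have "{d \<in> insert i {d \<in> descents \<sigma>. adj d i}. adj d j} = {i}" using j(2) by blast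
    then have "{d \<in> descents ?s. adj d j} = {i}" by (simp only: descents_after)
    then have "insert j {d \<in> descents ?s. adj d j} = {i, j}" by (simp only: insert_commute)
    then show ?thesis by (rule HOL.trans[OF _ sl])
  qed
  have psc: "pos (after ?s j) x = int x + 2 - int ?l" for x
    using nl first_of by (simp add: pos_after pos_diff) 
  have dc: "offset_after ?s j = 2 - int ?l" using nl first_of by (simp add: offset_after_def)
  have w: "phase (after ?s j) = {x. x < M \<and> (\<exists>k. isL k (int x + 2 - int ?l))}"
  proof -
    have "x \<in> phase (after ?s j) \<longleftrightarrow> (\<exists>k. isL k (pos (after ?s j) x))" if x: "x < M" for x
    proof (cases "adj j x \<or> x = j")
      case True
      have "\<not> isL k (pos (after ?s j) x)" for k
        using clean_after[OF I' j(1) j' x] True L_unclean by blast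
      moreover have "x \<notin> phase (after ?s j)"
      proof (cases "x = j")
        case False
        have "clean (pos ?s j)" using clean_after(1)[OF I j(1,2)] by blast
        then have "x \<in> phase (after ?s j) \<longleftrightarrow> x \<in> phase ?s" using x True False by (simp add: phase_after[of _ ?s])
        also have "\<dots> \<longleftrightarrow> False"
        proof (cases "x = i")
          case True
          then show ?thesis by (simp add: phase_after)
        next
          case False
          have "\<not> adj i x" using no_triangle[of x j i] True \<open>x \<noteq> j\<close> x I j by blast
          then show ?thesis using adj_adj_L[OF I j(1,2) x] True \<open>x \<noteq> j\<close> by (simp add: phase_after)
        qed
        finally show ?thesis by simp
      qed (simp add: phase_after[of _ ?s])
      ultimately show ?thesis by blast
    next
      case False
      then show ?thesis using x by (simp add: phase_after[of _ ?s])
    qed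
    moreover have "x \<in> phase (after ?s j) \<Longrightarrow> x < M" for x by (simp add: phase_after[of _ ?s])
    ultimately show ?thesis unfolding psc by blast
  qed
  have "after ?s j = \<lparr> descents = insert j {d \<in> descents ?s. adj d j}, offset = offset_after ?s j, origin = (type_at ?s ?l + 3 * turn ?s ?l) mod N, orientation = turn ?s ?l, phase = phase (after ?s j) \<rparr>"
    using nl first_of by (simp add: after_def[of ?s j])
  then show ?thesis unfolding D dc w o a corner_state_def .
qed

lemma after_comm:
  assumes I: "Inv \<sigma>" "i < M" "i \<notin> descents \<sigma>" and j: "j < M" "adj i j" "j \<notin> descents \<sigma>"
  shows "after (after \<sigma> i) j = after (after \<sigma> j) i"
proof -
  have "succ (succ i) \<noteq> i" using I(2) M_large by (auto simp: succ_def mod_Suc)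
  then have "(if j = succ i then i else j) = (if i = succ j then j else i)"
    using adj_iff[OF I(2) j(1)] j(2) by auto
  then show ?thesis using after_after[OF I j] after_after[OF I(1) j(1,3) I(2) _ I(3)] j(2) gw.adj_sym by simp
qed

text \<open>The neighbour now lies on the first chamber, so that no change of viewpoint is involved.\<close>

lemma cross_new:
  assumes I: "Inv \<sigma>" "i < M" "i \<notin> descents \<sigma>" and nl: "\<not> long (pos \<sigma> i)" and j: "j < M" "adj i j" and y: "y \<in> Y"
    and r: "r \<in> carrier (A j)"
  shows "cross (after \<sigma> i) j r y = mv (type_at \<sigma> j) (sector (after \<sigma> i) j r) y"
proof -
  obtain c where c: "m dvd pos (after \<sigma> i) j - c" "c = 1 \<or> c = 2 \<or> c = 3 \<or> c = 4"
    using new_pos_nbr[OF I nl j(1)] j(2) by blast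
  have e: "eqt N (type_at (after \<sigma> i) j) (type_at \<sigma> j)" using type_at_after[OF I j(1)] j(2) by blast
  have "mv (type_at (after \<sigma> i) j) (sector (after \<sigma> i) j r) y \<in> Y" using sector_closed[OF j(1) r, of "after \<sigma> i"] y by simp
  then show ?thesis
    using near_first(2,5)[OF c] I mv_cong[OF e] by (simp add: cross_def unview_0)
qed

text \<open>If the sides have a common chamber, the two crossings are moves by commuting letters in this
  chamber. Otherwise they form a reflex corner, and \<open>reflex_square\<close> applies.\<close>

lemma cross_comm_aux:
  assumes I: "Inv \<sigma>" "i < M" "i \<notin> descents \<sigma>" and j: "j < M" "adj i j" "j \<notin> descents \<sigma>"
    and s: "s \<in> carrier (A i)" "s \<noteq> \<one>\<^bsub>A i\<^esub>" and r: "r \<in> carrier (A j)" "r \<noteq> \<one>\<^bsub>A j\<^esub>" and y: "y \<in> Y"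
    and nl: "\<not> long (pos \<sigma> j)" and nLE: "\<nexists>k. isL k (pos \<sigma> i) \<and> isE k (pos \<sigma> j)"
  shows "cross \<sigma> i s (cross (after \<sigma> i) j r y) = cross \<sigma> j r (cross (after \<sigma> j) i s y)"
proof -
  have g: "good \<sigma>" using I by simp
  interpret b: blob N p q "Bs \<sigma>" Y "ms \<sigma>" "hs \<sigma>" "fs \<sigma>" by (rule blob_label[OF g])
  have ji: "adj j i" using j gw.adj_sym by blast
  have pa: "padj (pos \<sigma> i) (pos \<sigma> j)" using pos_adj[OF I(2) j(1), of \<sigma>] j by blast
  have ei: "eqt N (type_at (after \<sigma> j) i) (type_at \<sigma> i)" and ej: "eqt N (type_at (after \<sigma> i) j) (type_at \<sigma> j)"
    using type_at_after[OF I(1) j(1,3) I(2)] type_at_after[OF I j(1)] j(2) ji by blast+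
  have a: "adjt N (T (pos \<sigma> i)) (T (pos \<sigma> j))" using padj_types[OF pa] .
  have K: "cross (after \<sigma> j) i s y = mv (type_at \<sigma> i) (sector (after \<sigma> j) i s) y"
    by (rule cross_new[OF I(1) j(1,3) nl I(2) ji y s(1)])
  have cl: "sector \<sigma> i s \<in> carrier (Bt (label \<sigma> (T (pos \<sigma> i))))" "sector \<sigma> j r \<in> carrier (Bt (label \<sigma> (T (pos \<sigma> j))))"
    using sector_closed[OF I(2) s(1), of \<sigma>] sector_closed[OF j(1) r(1), of \<sigma>] by (simp_all add: type_at_def)
  have c: "mv (type_at \<sigma> i) (sector \<sigma> i s) (mv (type_at \<sigma> j) (sector \<sigma> j r) y) = mv (type_at \<sigma> j) (sector \<sigma> j r) (mv (type_at \<sigma> i) (sector \<sigma> i s) y)"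
    using b.mv_comm[OF a cl y] by (simp add: type_at_def)
  have ki: "On (chamber_of (pos \<sigma> i)) (pos \<sigma> i)" and kj: "On (chamber_of (pos \<sigma> j)) (pos \<sigma> j)" by (rule chamber_of)+
  show ?thesis
  proof (cases "clean (pos \<sigma> i) \<or> clean (pos \<sigma> j)")
    case True
    then have R: "sector (after \<sigma> j) i s = sector \<sigma> i s" "sector (after \<sigma> i) j r = sector \<sigma> j r"
      using sector_eq[OF ei] sector_eq[OF ej] I(2) j ji by (auto simp: phase_after)
    obtain l where l: "On l (pos \<sigma> i)" "On l (pos \<sigma> j)" using common_chamber[OF pa True] by blast
    have lj: "chamber_of (pos \<sigma> j) = l" using not_long[OF nl kj l(2)] .
    have R2: "cross \<sigma> j r (cross (after \<sigma> j) i s y) = unview \<sigma> l (mv (type_at \<sigma> j) (sector \<sigma> j r) (mv (type_at \<sigma> i) (sector \<sigma> i s) y))"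
      unfolding K R unfolding cross_def[of \<sigma> j r] using nl lj by simp
    show ?thesis
    proof (cases "long (pos \<sigma> i)")
      case False
      have li: "chamber_of (pos \<sigma> i) = l" using not_long[OF False ki l(1)] .
      show ?thesis unfolding R2 cross_new[OF I False j(1,2) y r(1)] R using False li c by (simp add: cross_def)
    next
      case True
      let ?z = "mv (type_at \<sigma> j) (sector \<sigma> j r) y"
      have zY: "?z \<in> Y" using sector_closed[OF j(1) r(1), of \<sigma>] y by simp
      have L: "cross (after \<sigma> i) j r y = unview \<sigma> l ?z"
        using True nl lj R(2) by (simp add: cross_def unview_def type_at_def label_after_long pos_after)
      have "cross \<sigma> i s (unview \<sigma> l ?z) = unview \<sigma> l (mv (type_at \<sigma> i) (sector \<sigma> i s) (view \<sigma> l (unview \<sigma> l ?z)))"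
        using b.upt_mv_pt[OF ki l(1), of "unview \<sigma> l ?z" "sector \<sigma> i s"] True cl(1) g zY
        by (simp add: cross_def unview_def view_def type_at_def)
      then show ?thesis unfolding R2 L using c g zY by simp
    qed
  next
    case False
    then obtain k where k: "isE k (pos \<sigma> i)" "isL k (pos \<sigma> j)"
      using unclean_pair[OF pa] nLE by metis
    have nli: "\<not> long (pos \<sigma> i)" using k(1) long_clean E_unclean by blast
    have kk': "chamber_of (pos \<sigma> i) = k" "chamber_of (pos \<sigma> j) = k + 2"
      using isE_unique[OF k(1) ki] isL_unique[OF k(2) kj] by auto
    have wi: "i \<in> phase (after \<sigma> j)" "i \<notin> phase \<sigma>" and wj: "j \<notin> phase (after \<sigma> i)" "j \<in> phase \<sigma>"
      using phase_E[OF I(1,2) k(1)] phase_L[OF I(1) j(1) k(2)] False I(2) j ji by (auto simp: phase_after)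
    let ?b = "sector \<sigma> i s" and ?c = "sector (after \<sigma> i) j r"
    have ri: "sector (after \<sigma> j) i s = inv_t (type_at \<sigma> i) (f (type_at \<sigma> i)) \<otimes>\<^bsub>Bt (type_at \<sigma> i)\<^esub> ?b"
      using sector_flip[OF ei wi s(2)] Bt_cong[OF ei] f_per[OF ei] by simp
    have rj: "sector \<sigma> j r = inv_t (type_at \<sigma> j) (f (type_at \<sigma> j)) \<otimes>\<^bsub>Bt (type_at \<sigma> j)\<^esub> ?c"
      using sector_flip[OF eqt_sym[OF ej] wj(2,1) r(2)] .
    have cc: "?c \<in> carrier (Bt (label \<sigma> (T (pos \<sigma> j))))"
      using sector_closed[OF j(1) r(1), of "after \<sigma> i"] Bt_cong[OF ej] by (simp add: type_at_def)
    have "cross \<sigma> i s (cross (after \<sigma> i) j r y) = unview \<sigma> k (mv (type_at \<sigma> i) ?b (mv (type_at \<sigma> j) ?c y))"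
      unfolding cross_new[OF I nli j(1,2) y r(1)] using nli kk' by (simp add: cross_def)
    also have "\<dots> = unview \<sigma> (k + 2) (mv (type_at \<sigma> j) (sector \<sigma> j r) (mv (type_at \<sigma> i) (sector (after \<sigma> j) i s) y))"
      using b.reflex_square[OF k y cl(1) cc] unfolding ri rj by (simp add: unview_def type_at_def)
    also have "\<dots> = cross \<sigma> j r (cross (after \<sigma> j) i s y)"
      unfolding K using nl kk' by (simp add: cross_def)
    finally show ?thesis .
  qed
qed

lemma cross_comm:
  assumes I: "Inv \<sigma>" "i < M" "i \<notin> descents \<sigma>" and j: "j < M" "adj i j" "j \<notin> descents \<sigma>"
    and s: "s \<in> carrier (A i)" "s \<noteq> \<one>\<^bsub>A i\<^esub>" and r: "r \<in> carrier (A j)" "r \<noteq> \<one>\<^bsub>A j\<^esub>" and y: "y \<in> Y"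
  shows "cross \<sigma> i s (cross (after \<sigma> i) j r y) = cross \<sigma> j r (cross (after \<sigma> j) i s y)"
proof -
  have ji: "adj j i" using j gw.adj_sym by blast
  have pa: "padj (pos \<sigma> i) (pos \<sigma> j)" using pos_adj[OF I(2) j(1), of \<sigma>] j by blast
  show ?thesis
  proof (cases "\<not> long (pos \<sigma> j) \<and> (\<nexists>k. isL k (pos \<sigma> i) \<and> isE k (pos \<sigma> j))")
    case True
    then show ?thesis using cross_comm_aux[OF I j s r y] by blast
  next
    case False
    have "\<not> long (pos \<sigma> i)"
      using False long_nbr[of "pos \<sigma> j" "pos \<sigma> i"] adjt_sym[OF pa] long_clean L_unclean by blast
    moreover have "\<nexists>k. isL k (pos \<sigma> j) \<and> isE k (pos \<sigma> i)"
      using False E_L_aux long_clean L_unclean by blast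
    ultimately show ?thesis using cross_comm_aux[OF I(1) j(1,3) I(2) ji I(3) r s y] by simp
  qed
qed

end

section \<open>The map on words and its image\<close>

context blob_map
begin

text \<open>The syllables of a word are crossed one after the other. The recursion runs from the front of
  the word, hence each crossing is a left multiplication applied to the image of the rest.\<close>

primrec unfold_word :: "(nat \<times> 'a) list \<Rightarrow> state \<Rightarrow> 'y" where
  "unfold_word [] \<sigma> = base"
| "unfold_word (l # u) \<sigma> = cross \<sigma> (fst l) (snd l) (unfold_word u (after \<sigma> (fst l)))"

abbreviation "hea \<equiv> gw.head"
abbreviation "redw \<equiv> gw.red"
abbreviation weq (infix "\<simeq>" 50) where "u \<simeq> u' \<equiv> gw.swap\<^sup>*\<^sup>* u u'"
abbreviation "e1 i \<equiv> \<one>\<^bsub>A i\<^esub>"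

text \<open>Words that may follow in a state: none of the descents can be crossed again.\<close>

definition admissible where "admissible \<sigma> u \<longleftrightarrow> Inv \<sigma> \<and> redw u \<and> (\<forall>d\<in>descents \<sigma>. hea d u = e1 d)"

lemma admissible_Nil [simp]: "admissible \<sigma> [] \<longleftrightarrow> Inv \<sigma>" by (simp add: admissible_def)

lemma admissible_ConsD:
  assumes "admissible \<sigma> ((i, s) # u)"
  shows "Inv \<sigma>" "i < M" "i \<notin> descents \<sigma>" "s \<in> carrier (A i)" "s \<noteq> e1 i" "hea i u = e1 i" "admissible (after \<sigma> i) u"
proof -
  show 1: "Inv \<sigma>" "i < M" "i \<notin> descents \<sigma>" "s \<in> carrier (A i)" "s \<noteq> e1 i" "hea i u = e1 i"
    using assms by (auto simp: admissible_def)
  have "hea d u = e1 d" if "d \<in> descents \<sigma>" "adj d i" for d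
    using assms that gw.adj_sym[of i d] by (auto simp: admissible_def split: if_splits)
  then show "admissible (after \<sigma> i) u" using assms 1 Inv_after[OF 1(1-3)] by (auto simp: admissible_def descents_after)
qed

lemma admissible_ConsI:
  assumes "Inv \<sigma>" "i < M" "i \<notin> descents \<sigma>" "s \<in> carrier (A i)" "s \<noteq> e1 i" "admissible (after \<sigma> i) u"
  shows "admissible \<sigma> ((i, s) # u)"
proof -
  have "hea d u = e1 d" if "d \<in> descents \<sigma>" "adj i d" for d
    using assms(6) that gw.adj_sym[of i d] by (auto simp: admissible_def descents_after)
  then show ?thesis using assms by (auto simp: admissible_def descents_after)
qed

lemma unfold_word_closed [simp]: "admissible \<sigma> u \<Longrightarrow> unfold_word u \<sigma> \<in> Y"
proof (induction u arbitrary: \<sigma>)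
  case (Cons l u)
  obtain i s where l: "l = (i, s)" by force
  show ?case using admissible_ConsD[of \<sigma> i s u] Cons l by simp
qed simp

text \<open>Shuffles of commuting syllables do not change the image, hence the map is defined on group
  elements.\<close>

lemma swap_unfold_word: "gw.swap u u' \<Longrightarrow> admissible \<sigma> u \<Longrightarrow> admissible \<sigma> u' \<and> unfold_word u' \<sigma> = unfold_word u \<sigma>"
proof (induction arbitrary: \<sigma> rule: gw.swap.induct)
  case (1 i j s r ws)
  note a = admissible_ConsD[OF 1(2)]
  note b = admissible_ConsD[OF a(7)]
  have ji: "adj j i" "i \<noteq> j" using 1(1) by auto
  have j: "j \<notin> descents \<sigma>" using b(3) ji by (auto simp: descents_after)
  have ad: "admissible \<sigma> ((j, r) # (i, s) # ws)"
    using 1(2) gw.swap.intros(1)[OF 1(1)] gw.swap_red gw.swap_head unfolding admissible_def by metis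
  have "unfold_word ws (after (after \<sigma> i) j) = unfold_word ws (after (after \<sigma> j) i)"
    using after_comm[OF a(1-3) b(2) 1(1) j] by simp
  then show ?case using cross_comm[OF a(1-3) b(2) 1(1) j a(4,5) b(4,5) unfold_word_closed[OF admissible_ConsD(7)[OF a(7)]]] ad by simp
next
  case (2 ws ws' l)
  obtain i s where l: "l = (i, s)" by force
  note a = admissible_ConsD[OF 2(3)[unfolded l]]
  from 2(2)[OF a(7)] admissible_ConsI[OF a(1-5)] show ?case by (simp add: l)
qed

lemma eqv_unfold_word: "u \<simeq> u' \<Longrightarrow> admissible \<sigma> u \<Longrightarrow> admissible \<sigma> u' \<and> unfold_word u' \<sigma> = unfold_word u \<sigma>"
proof (induction rule: rtranclp_induct)
  case (step u' u'')
  then show ?case using swap_unfold_word[OF step(2), of \<sigma>] by simp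
qed simp

lemma region_at_coord_at: "region_at \<sigma> j b y \<Longrightarrow> good \<sigma> \<Longrightarrow> coord_at \<sigma> j y = b"
proof -
  assume r: "region_at \<sigma> j b y" and g: "good \<sigma>"
  interpret b: blob N p q "Bs \<sigma>" Y "ms \<sigma>" "hs \<sigma>" "fs \<sigma>" by (rule blob_label[OF g])
  show ?thesis using r by (simp add: region_at_def coord_at_def b.region_def)
qed

lemma region_at_clean: "clean (pos \<sigma> j) \<Longrightarrow> good \<sigma> \<Longrightarrow> region_at \<sigma> j b y \<longleftrightarrow> coord_at \<sigma> j y = b"
proof -
  assume c: "clean (pos \<sigma> j)" and g: "good \<sigma>"
  interpret b: blob N p q "Bs \<sigma>" Y "ms \<sigma>" "hs \<sigma>" "fs \<sigma>" by (rule blob_label[OF g])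
  show ?thesis using b.region_clean[OF c] by (simp add: region_at_def coord_at_def)
qed

text \<open>A point in a sector of a reflex side can lie outside the region behind this side only if it came
  around the corner; then it is on the near side of both neighbouring sides. Thus one nontrivial
  neighbouring coordinate suffices, and it does not matter which of the neighbours it belongs to.\<close>

lemma region_at_I:
  assumes I: "Inv \<sigma>" and j: "j < M" and y: "y \<in> Y" and s: "s \<in> carrier (A j)" "s \<noteq> e1 j"
    and c: "coord_at \<sigma> j y = sector \<sigma> j s" and i: "i < M" "adj j i" "coord_at \<sigma> i y \<noteq> one_t (type_at \<sigma> i)"
  shows "region_at \<sigma> j (sector \<sigma> j s) y"
proof -
  have g: "good \<sigma>" using I by simp
  interpret b: blob N p q "Bs \<sigma>" Y "ms \<sigma>" "hs \<sigma>" "fs \<sigma>" by (rule blob_label[OF g])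
  have pa: "padj (pos \<sigma> j) (pos \<sigma> i)" using pos_adj[OF j i(1), of \<sigma>] i(2) by blast
  have ne: "b.coord (pos \<sigma> j) y \<noteq> one_t (label \<sigma> (T (pos \<sigma> j)))"
    using sector_not_one[OF j s, of \<sigma>] c by (simp add: coord_at_def type_at_def)
  have cc: "b.coord (pos \<sigma> i) y \<noteq> one_t (label \<sigma> (T (pos \<sigma> i)))"
    using i(3) by (simp add: coord_at_def type_at_def)
  have E: "b.early k y" if e: "isE k (pos \<sigma> j)" for k
  proof (rule b.early_I[OF e y ne])
    have "j \<notin> phase \<sigma>" using phase_E[OF I j e] .
    then show "b.coord (pos \<sigma> j) y \<noteq> f (label \<sigma> (T (pos \<sigma> j)))"
      using sector_not_f[OF j s(1)] c by (simp add: coord_at_def type_at_def)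
    show "hs \<sigma> (t k) (b.pt k y) \<noteq> fs \<sigma> (t k)"
    proof (cases "isL k (pos \<sigma> i)")
      case True
      have e': "eqt N (T (pos \<sigma> i)) (t k)" using isL_On[OF True] by blast
      show ?thesis using b.corner_coords(2)[OF e True y] cc b.per[OF e'] b.f_per[OF e']
        by (auto simp: b.inv_mult_eq y)
    next
      case False
      then show ?thesis by (rule b.early_nbr[OF e pa _ y cc])
    qed
  qed
  have L: "b.late k y" if l: "isL k (pos \<sigma> j)" for k
  proof (rule b.late_I[OF l y ne])
    have "j \<in> phase \<sigma>" using phase_L[OF I j l] .
    then show "b.coord (pos \<sigma> j) y \<noteq> inv_t (label \<sigma> (T (pos \<sigma> j))) (f (label \<sigma> (T (pos \<sigma> j))))"
      using sector_not_inv_f[OF j s(1)] c by (simp add: coord_at_def type_at_def)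
    show "hs \<sigma> (t (Suc k)) (b.pt (k + 2) y) \<noteq> inv_t (label \<sigma> (t (Suc k))) (fs \<sigma> (t (Suc k)))"
    proof (cases "isE k (pos \<sigma> i)")
      case True
      have e': "eqt N (T (pos \<sigma> i)) (t (Suc k))" using isE_On[OF True] by blast
      interpret B: group "Bt (label \<sigma> (T (pos \<sigma> i)))" by (rule grp)
      have "inv_t (label \<sigma> (T (pos \<sigma> i))) (f (label \<sigma> (T (pos \<sigma> i)))) \<otimes>\<^bsub>Bt (label \<sigma> (T (pos \<sigma> i)))\<^esub> b.coord (pos \<sigma> i) y
          \<noteq> inv_t (label \<sigma> (T (pos \<sigma> i))) (f (label \<sigma> (T (pos \<sigma> i))))"
        using cc y by simp
      then show ?thesis using b.corner_coords(4)[OF True l y] b.per[OF e'] b.f_per[OF e'] by (simp del: add_2_eq_Suc')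
    next
      case False
      then show ?thesis by (rule b.late_nbr[OF l pa _ y cc])
    qed
  qed
  show ?thesis using c E L by (simp add: region_at_def b.region_def coord_at_def)
qed

lemma partner:
  assumes "j < M" "\<not> clean (pos \<sigma> j)"
  obtains i k where "i < M" "adj j i" "isE k (pos \<sigma> j)" "isL k (pos \<sigma> i)"
    | i k where "i < M" "adj j i" "isL k (pos \<sigma> j)" "isE k (pos \<sigma> i)"
proof -
  have a: "adj j (succ j)" "adj j (pred j)" "succ j < M" "pred j < M"
    using adj_cases[of j "succ j"] adj_cases[of j "pred j"] assms(1) by auto
  note c = cong(3,4)[OF pos_succ[OF assms(1), of \<sigma>]] cong(3,4)[OF pos_pred[OF assms(1), of \<sigma>]]
  consider k where "isE k (pos \<sigma> j)" | k where "isL k (pos \<sigma> j)" using assms(2) by (auto simp: clean_def)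
  then show ?thesis
  proof cases
    case 1
    then show ?thesis using isE_partner[OF 1] c a that(1) by metis
  next
    case 2
    then show ?thesis using isL_partner[OF 2] c a that(2) by metis
  qed
qed

lemma base_coord_at:
  assumes g: "good \<sigma>"
  shows "(\<forall>k. \<not> isL k (pos \<sigma> j)) \<Longrightarrow> coord_at \<sigma> j base = one_t (type_at \<sigma> j)"
    and "isL k (pos \<sigma> j) \<Longrightarrow> coord_at \<sigma> j base = inv_t (type_at \<sigma> j) (f (type_at \<sigma> j))"
proof -
  interpret b: blob N p q "Bs \<sigma>" Y "ms \<sigma>" "hs \<sigma>" "fs \<sigma>" by (rule blob_label[OF g])
  show "coord_at \<sigma> j base = one_t (type_at \<sigma> j)" if "\<forall>k. \<not> isL k (pos \<sigma> j)"
  proof (cases "On 0 (pos \<sigma> j)")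
    case True
    then show ?thesis using coord_at_On[OF g base(1) True] g by (simp add: view_0)
  next
    case False
    then show ?thesis using b.trivial_coord(1)[of base "pos \<sigma> j"] that by (simp add: coord_at_def type_at_def)
  qed
  show "coord_at \<sigma> j base = inv_t (type_at \<sigma> j) (f (type_at \<sigma> j))" if l: "isL k (pos \<sigma> j)" for k
    using b.trivial_coord(2)[of base "pos \<sigma> j" k] isL_unique[OF l, of 0] l by (auto simp: coord_at_def type_at_def)
qed

lemma base_image:
  assumes I: "Inv \<sigma>" and j: "j < M" and s: "s \<in> carrier (A j)" "s \<noteq> e1 j"
  shows "coord_at \<sigma> j base \<noteq> sector \<sigma> j s"
proof (cases "\<exists>k. isL k (pos \<sigma> j)")
  case True
  then obtain k where k: "isL k (pos \<sigma> j)" by blast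
  show ?thesis using base_coord_at(2)[OF _ k] sector_not_inv_f[OF j s(1) phase_L[OF I j k]] Inv_good[OF I] by metis
next
  case False
  then show ?thesis using base_coord_at(1)[of \<sigma> j] sector_not_one[OF j s, of \<sigma>] I by simp
qed

text \<open>The image of a word lies behind exactly those sides that its first syllables cross. In the
  induction step the crossed side and its neighbours keep their coordinates up to the shifts above,
  and all other sides are dealt with by the disjointness of regions.\<close>

lemma image_coords:
  assumes "admissible \<sigma> u" "j < M"
  shows "(clean (pos \<sigma> j) \<longrightarrow> coord_at \<sigma> j (unfold_word u \<sigma>) = sector \<sigma> j (hea j u)) \<and>
    (\<forall>s\<in>carrier (A j). s \<noteq> e1 j \<longrightarrow> region_at \<sigma> j (sector \<sigma> j s) (unfold_word u \<sigma>) \<longleftrightarrow> hea j u = s)"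
  using assms
proof (induction u arbitrary: \<sigma> j)
  case Nil
  then have I: "Inv \<sigma>" by simp
  have "\<not> region_at \<sigma> j (sector \<sigma> j s) base" if "s \<in> carrier (A j)" "s \<noteq> e1 j" for s
    using region_at_coord_at base_image[OF I Nil(2) that] I by fastforce
  moreover have "coord_at \<sigma> j base = sector \<sigma> j (e1 j)" if "clean (pos \<sigma> j)"
    using base_coord_at(1)[of \<sigma> j] that I by (simp add: clean_def sector_one)
  ultimately show ?case by auto
next
  case (Cons l u)
  obtain i s where l: "l = (i, s)" by force
  note a = admissible_ConsD[OF Cons(2)[unfolded l]]
  note I = a(1-3)
  let ?s = "after \<sigma> i" and ?y = "unfold_word u (after \<sigma> i)" and ?z = "unfold_word (l # u) \<sigma>"
  have g: "good \<sigma>" "good ?s" using I by auto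
  interpret b: blob N p q "Bs \<sigma>" Y "ms \<sigma>" "hs \<sigma>" "fs \<sigma>" by (rule blob_label[OF g(1)])
  note IH = Cons.IH[OF a(7)]
  have yY: "?y \<in> Y" using a(7) by simp
  have z: "?z = cross \<sigma> i s ?y" by (simp add: l)
  have zY: "?z \<in> Y" using Cons(2) by (rule unfold_word_closed)
  have cl: "coord_at ?s j ?y = sector ?s j (hea j u)" if "j < M" "adj i j \<or> j = i" for j
    using IH[OF that(1)] clean_after[OF I that(1)] that(2) by blast
  have hc: "hea j u \<in> carrier (A j)" if "j < M" for j
    using gw.red_head_closed[of j u] that a(7) by (auto simp: admissible_def)
  have self: "coord_at \<sigma> i ?z = sector \<sigma> i s"
  proof -
    interpret B: group "Bt (type_at \<sigma> i)" by (rule grp)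
    have "coord_at ?s i ?y = one_t (type_at \<sigma> i)"
      using cl[of i] I a(6) Bt_cong[OF type_at_after[OF I I(2)]] by (simp add: sector_one)
    then show ?thesis unfolding z using cross_self[OF I a(4) yY] I a(4) by simp
  qed
  have self_ne: "coord_at \<sigma> i ?z \<noteq> one_t (type_at \<sigma> i)" using self sector_not_one[OF I(2) a(4,5)] by simp
  have part: "coord_at \<sigma> j ?z \<noteq> one_t (type_at \<sigma> j)" if j: "j < M" "adj i j" and nc: "\<not> clean (pos \<sigma> i)" "\<not> clean (pos \<sigma> j)" for j
  proof -
    have pa: "padj (pos \<sigma> i) (pos \<sigma> j)" using pos_adj[OF I(2) j(1), of \<sigma>] j by blast
    have fl: "j \<in> phase ?s \<longleftrightarrow> j \<notin> phase \<sigma>" using nc j by (simp add: phase_after)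
    have e: "eqt N (type_at ?s j) (type_at \<sigma> j)" using type_at_after[OF I j(1)] j(2) by blast
    note cg = Bt_cong[OF e] f_per[OF e]
    have c: "coord_at ?s j ?y \<in> carrier (Bt (type_at \<sigma> j))" using coord_at_closed[OF g(2) yY, of j] cg by simp
    show ?thesis
    proof (cases rule: unclean_pair[OF pa nc])
      case (1 k)
      have "j \<notin> phase ?s" using phase_L[OF I(1) j(1) 1(2)] fl by blast
      then have "coord_at ?s j ?y \<noteq> f (type_at \<sigma> j)" using sector_not_f[OF j(1) hc[OF j(1)], of ?s] cl[OF j(1)] j cg by simp
      then show ?thesis unfolding z using cross_EL[OF I a(4) yY j 1] c by (simp add: inv_mult_eq)
    next
      case (2 k)
      have "j \<in> phase ?s" using phase_E[OF I(1) j(1) 2(2)] fl by blast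
      then have ne: "coord_at ?s j ?y \<noteq> inv_t (type_at \<sigma> j) (f (type_at \<sigma> j))" using sector_not_inv_f[OF j(1) hc[OF j(1)], of ?s] cl[OF j(1)] j cg by simp
      interpret B: group "Bt (type_at \<sigma> j)" by (rule grp)
      show ?thesis unfolding z using cross_LE[OF I a(4) yY j 2] c ne
        by (metis B.inv_equality B.inv_inv f_closed B.inv_comm B.inv_closed)
    qed
  qed
  have rself: "region_at \<sigma> i (sector \<sigma> i s) ?z"
  proof (cases "clean (pos \<sigma> i)")
    case True
    then show ?thesis using region_at_clean[OF True g(1)] self by simp
  next
    case False
    then obtain j where j: "j < M" "adj i j" "\<not> clean (pos \<sigma> j)"
      using partner[OF I(2) False] E_unclean L_unclean by metis
    show ?thesis by (rule region_at_I[OF I(1,2) zY a(4,5) self j(1,2) part[OF j(1,2) False j(3)]])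
  qed
  have rc: "region_at \<sigma> j (sector \<sigma> j h) ?z \<longleftrightarrow> coord_at \<sigma> j ?z = sector \<sigma> j h" if "clean (pos \<sigma> j)" for j h
    using region_at_clean[OF that g(1)] .
  consider "j = i" | "j \<noteq> i" "adj i j" | "j \<noteq> i" "\<not> adj i j" by blast
  then show ?case
  proof cases
    case 1
    have "region_at \<sigma> i (sector \<sigma> i h) ?z \<longleftrightarrow> s = h" if "h \<in> carrier (A i)" for h
      using rself region_at_coord_at[OF _ g(1), of i "sector \<sigma> i h" ?z] self sector_inj[OF I(2) a(4) that, of \<sigma>] by auto
    then show ?thesis using self 1 l by simp
  next
    case 2
    have h: "hea j (l # u) = hea j u" using 2 l by simp
    have 3: "coord_at \<sigma> j ?z = sector \<sigma> j h \<longleftrightarrow> hea j u = h" if "h \<in> carrier (A j)" "h \<noteq> e1 j" for h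
      using cross_sector[OF I a(4) yY Cons(3) 2(2) that] cl[OF Cons(3)] 2 sector_inj[OF Cons(3) hc[OF Cons(3)] that(1), of ?s]
      unfolding z by auto
    have ji: "adj j i" using 2 gw.adj_sym by blast
    have 4: "region_at \<sigma> j (sector \<sigma> j h) ?z \<longleftrightarrow> hea j u = h" if "h \<in> carrier (A j)" "h \<noteq> e1 j" for h
      using 3[OF that] region_at_I[OF I(1) Cons(3) zY that _ I(2) ji self_ne] region_at_coord_at[OF _ g(1), of j "sector \<sigma> j h" ?z] by blast
    have "coord_at \<sigma> j ?z = sector \<sigma> j (hea j u)" if c: "clean (pos \<sigma> j)"
    proof -
      have "j \<in> phase \<sigma> \<longleftrightarrow> j \<in> phase ?s" using c Cons(3) 2 by (simp add: phase_after)
      then have "sector ?s j (hea j u) = sector \<sigma> j (hea j u)" using sector_eq[OF type_at_after[OF I Cons(3)]] 2 by simp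
      then show ?thesis unfolding z using cross_adj[OF I a(4) yY Cons(3) 2(2)] c cl[OF Cons(3)] 2 by simp
    qed
    then show ?thesis using 4 h by simp
  next
    case 3
    have h: "hea j (l # u) = e1 j" using 3 l by simp
    have ne: "\<not> padj (pos \<sigma> i) (pos \<sigma> j)" "\<not> m dvd pos \<sigma> i - pos \<sigma> j"
      using pos_adj[OF I(2) Cons(3), of \<sigma>] pos_eq[OF I(2) Cons(3), of \<sigma>] 3 by auto
    have r: "b.region (pos \<sigma> i) (sector \<sigma> i s) ?z" using rself by (simp add: region_at_def)
    have rn: "sector \<sigma> i s \<noteq> one_t (label \<sigma> (T (pos \<sigma> i)))" using sector_not_one[OF I(2) a(4,5), of \<sigma>] by (simp add: type_at_def)
    have "\<not> region_at \<sigma> j (sector \<sigma> j h) ?z" if "h \<in> carrier (A j)" "h \<noteq> e1 j" for h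
      using b.region_disjoint[OF zY r rn _ _ ne, of "sector \<sigma> j h"] sector_not_one[OF Cons(3) that, of \<sigma>]
      by (auto simp: region_at_def type_at_def)
    moreover have "coord_at \<sigma> j ?z = sector \<sigma> j (e1 j)" if "clean (pos \<sigma> j)"
      using b.region_far_clean[OF zY r rn that ne] by (simp add: coord_at_def sector_one type_at_def)
    ultimately show ?thesis using h by metis
  qed
qed

lemma first_coord_at: "admissible \<sigma> ((i, s) # u) \<Longrightarrow> coord_at \<sigma> i (unfold_word ((i, s) # u) \<sigma>) = sector \<sigma> i s"
  using image_coords[of \<sigma> "(i, s) # u" i] admissible_ConsD[of \<sigma> i s u] region_at_coord_at[of \<sigma> i "sector \<sigma> i s"] by simp

section \<open>Walls between images of words\<close>

text \<open>Changes of viewpoint, which move walls to walls.\<close>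

inductive motion :: "('y \<Rightarrow> 'y) \<Rightarrow> bool" where
  motion_id: "motion (\<lambda>y. y)"
| motion_mv: "motion \<psi> \<Longrightarrow> b \<in> carrier (Bt v) \<Longrightarrow> motion (\<lambda>y. mv v b (\<psi> y))"

lemma motion_comp: "motion \<phi> \<Longrightarrow> motion \<psi> \<Longrightarrow> motion (\<lambda>y. \<phi> (\<psi> y))"
  by (induction rule: motion.induct) (auto intro: motion.intros)

lemma motion_pt: "good \<sigma> \<Longrightarrow> motion (view \<sigma> k)"
proof -
  assume g: "good \<sigma>"
  interpret b: blob N p q "Bs \<sigma>" Y "ms \<sigma>" "hs \<sigma>" "fs \<sigma>" by (rule blob_label[OF g])
  have "motion (\<lambda>y. b.pt k y)"
  proof (induction k)
    case 0
    then show ?case by (simp add: motion_id)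
  next
    case (Suc k)
    then show ?case unfolding b.pt_Suc by (rule motion_mv) simp
  qed
  then show ?thesis by (simp add: view_def)
qed

lemma motion_upt: "good \<sigma> \<Longrightarrow> motion (unview \<sigma> k)"
proof -
  assume g: "good \<sigma>"
  interpret b: blob N p q "Bs \<sigma>" Y "ms \<sigma>" "hs \<sigma>" "fs \<sigma>" by (rule blob_label[OF g])
  have "motion (\<lambda>y. b.upt k y)"
  proof (induction k)
    case 0
    then show ?case by (simp add: motion_id)
  next
    case (Suc k)
    then show ?case unfolding b.upt_Suc
      by (rule motion_comp) (intro motion_mv motion_id f_closed)
  qed
  then show ?thesis by (simp add: unview_def)
qed

lemma motion_cross:
  assumes "good \<sigma>" "i < M" "s \<in> carrier (A i)"
  shows "motion (cross \<sigma> i s)" "motion (uncross \<sigma> i s)"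
proof -
  have r: "sector \<sigma> i s \<in> carrier (Bt (type_at \<sigma> i))" using assms by simp
  have 1: "motion (\<lambda>y. mv (type_at \<sigma> i) (inv_t (type_at \<sigma> i) (sector \<sigma> i s)) (view \<sigma> (chamber_of (pos \<sigma> i)) y))"
    by (rule motion_mv[OF motion_pt[OF assms(1)]]) (simp add: r)
  show "motion (uncross \<sigma> i s)"
  proof (cases "long (pos \<sigma> i)")
    case True
    then show ?thesis using motion_comp[OF motion_upt[OF assms(1)] 1] by (simp add: uncross_def[abs_def])
  next
    case False
    then show ?thesis using 1 by (simp add: uncross_def[abs_def])
  qed
  have 2: "motion (\<lambda>y. mv (type_at \<sigma> i) (sector \<sigma> i s) y)" by (rule motion_mv[OF motion_id r])
  show "motion (cross \<sigma> i s)"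
  proof (cases "long (pos \<sigma> i)")
    case True
    then show ?thesis using motion_comp[OF motion_upt[OF assms(1)] motion_comp[OF 2 motion_pt[OF assms(1)]]]
      by (simp add: cross_def[abs_def])
  next
    case False
    then show ?thesis using motion_comp[OF motion_upt[OF assms(1)] 2] by (simp add: cross_def[abs_def])
  qed
qed

definition wall_of where "wall_of v \<psi> = {(y, z). y \<in> Y \<and> z \<in> Y \<and> hd v (\<psi> y) = hd v (\<psi> z)}"
definition moved_walls where "moved_walls = {wall_of v \<psi> | v \<psi>. motion \<psi>}"
text \<open>A wall of the blob after a crossing, as seen from before the crossing.\<close>

definition pull where "pull \<sigma> i s W = {(y, z). y \<in> Y \<and> z \<in> Y \<and> (uncross \<sigma> i s y, uncross \<sigma> i s z) \<in> W}"
definition own_wall where "own_wall \<sigma> i = {(y, z). y \<in> Y \<and> z \<in> Y \<and> coord_at \<sigma> i y = coord_at \<sigma> i z}"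

lemma moved_walls_sub: "W \<in> moved_walls \<Longrightarrow> W \<subseteq> Y \<times> Y" by (auto simp: moved_walls_def wall_of_def)

lemma moved_walls_sym: "W \<in> moved_walls \<Longrightarrow> (y, z) \<in> W \<Longrightarrow> (z, y) \<in> W" by (auto simp: moved_walls_def wall_of_def)

lemma own_wall_moved_walls: "good \<sigma> \<Longrightarrow> own_wall \<sigma> i \<in> moved_walls"
proof -
  assume g: "good \<sigma>"
  have "own_wall \<sigma> i = wall_of (type_at \<sigma> i) (view \<sigma> (chamber_of (pos \<sigma> i)))"
    using coord_at_On[OF g _ chamber_of] by (auto simp: own_wall_def wall_of_def)
  then show ?thesis using motion_pt[OF g] by (auto simp: moved_walls_def)
qed

context
  fixes \<sigma> i s assumes k: "good \<sigma>" "i < M" "s \<in> carrier (A i)"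
begin

lemma pull_moved_walls: "W \<in> moved_walls \<Longrightarrow> pull \<sigma> i s W \<in> moved_walls"
proof -
  assume "W \<in> moved_walls"
  then obtain v \<psi> where W: "W = wall_of v \<psi>" "motion \<psi>" by (auto simp: moved_walls_def)
  have "pull \<sigma> i s W = wall_of v (\<lambda>y. \<psi> (uncross \<sigma> i s y))"
    using W k by (auto simp: pull_def wall_of_def)
  then show ?thesis using motion_comp[OF W(2) motion_cross(2)[OF k]] by (auto simp: moved_walls_def)
qed

lemma pull_cross: "y \<in> Y \<Longrightarrow> z \<in> Y \<Longrightarrow> (cross \<sigma> i s y, cross \<sigma> i s z) \<in> pull \<sigma> i s W \<longleftrightarrow> (y, z) \<in> W"
  using k by (auto simp: pull_def)

lemma pull_inj: "inj_on (pull \<sigma> i s) moved_walls"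
proof (rule inj_onI)
  fix W W' assume W: "W \<in> moved_walls" "W' \<in> moved_walls" "pull \<sigma> i s W = pull \<sigma> i s W'"
  have "(y, z) \<in> W \<longleftrightarrow> (y, z) \<in> W'" if "y \<in> Y" "z \<in> Y" for y z
    using pull_cross[OF that, of W] pull_cross[OF that, of W'] W(3) by simp
  then show "W = W'" using moved_walls_sub W(1,2) by blast
qed

end

lemma pull_own_wall:
  assumes I: "Inv \<sigma>" "i < M" "i \<notin> descents \<sigma>" and s: "s \<in> carrier (A i)"
  shows "pull \<sigma> i s (own_wall (after \<sigma> i) i) = own_wall \<sigma> i"
proof -
  have g: "good \<sigma>" using I by simp
  have "coord_at (after \<sigma> i) i (uncross \<sigma> i s y) = coord_at (after \<sigma> i) i (uncross \<sigma> i s z) \<longleftrightarrow> coord_at \<sigma> i y = coord_at \<sigma> i z" if yz: "y \<in> Y" "z \<in> Y" for y z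
  proof -
    have *: "coord_at \<sigma> i y = sector \<sigma> i s \<otimes>\<^bsub>Bt (type_at \<sigma> i)\<^esub> coord_at (after \<sigma> i) i (uncross \<sigma> i s y)" if "y \<in> Y" for y
      using cross_self[OF I s, of "uncross \<sigma> i s y"] g I s that by simp
    have "coord_at (after \<sigma> i) i (uncross \<sigma> i s y) \<in> carrier (Bt (type_at \<sigma> i))" if "y \<in> Y" for y
      using coord_at_closed[of "after \<sigma> i" "uncross \<sigma> i s y" i] Bt_cong[OF type_at_after[OF I I(2)]] g I s that by simp
    then show ?thesis unfolding *[OF yz(1)] *[OF yz(2)] using yz s I by (simp add: inv_cancel)
  qed
  then show ?thesis using g I s by (auto simp: pull_def own_wall_def)
qed

text \<open>Walls between \<open>y\<close> and the image of \<open>u\<close>. The walls are required to separate points of the image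
  as well. This distinguishes them from the wall that has just been crossed, in one sector of which all
  these points lie, and prevents that a wall is counted twice.\<close>

definition sepset where
  "sepset \<sigma> y \<S> u \<longleftrightarrow> finite \<S> \<and> \<S> \<subseteq> moved_walls \<and> (\<forall>W\<in>\<S>. (y, unfold_word u \<sigma>) \<notin> W \<and>
     (\<exists>v v'. admissible \<sigma> v \<and> admissible \<sigma> v' \<and> (unfold_word v \<sigma>, unfold_word v' \<sigma>) \<notin> W))"

lemma sepsetD:
  assumes "sepset \<sigma> y \<S> u"
  shows "finite \<S>" "\<S> \<subseteq> moved_walls" "\<forall>W\<in>\<S>. (y, unfold_word u \<sigma>) \<notin> W" "\<forall>W\<in>\<S>. (unfold_word u \<sigma>, y) \<notin> W"
proof -
  show *: "finite \<S>" "\<S> \<subseteq> moved_walls" "\<forall>W\<in>\<S>. (y, unfold_word u \<sigma>) \<notin> W"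
    using assms by (simp_all add: sepset_def)
  then show "\<forall>W\<in>\<S>. (unfold_word u \<sigma>, y) \<notin> W" using moved_walls_sym by blast
qed

lemma pull_sepset:
  assumes a: "admissible \<sigma> ((i, s) # u)" and y: "y \<in> Y" and S: "sepset (after \<sigma> i) y \<S> u"
  shows "sepset \<sigma> (cross \<sigma> i s y) (pull \<sigma> i s ` \<S>) ((i, s) # u)" "card (pull \<sigma> i s ` \<S>) = card \<S>"
    "own_wall \<sigma> i \<notin> pull \<sigma> i s ` \<S>"
proof -
  note b = admissible_ConsD[OF a]
  have k: "good \<sigma>" "i < M" "s \<in> carrier (A i)" using b by auto
  have SW: "\<S> \<subseteq> moved_walls" using S by (simp add: sepset_def)
  show "card (pull \<sigma> i s ` \<S>) = card \<S>"
    using pull_inj[OF k] SW by (intro card_image) (rule inj_on_subset)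
  have im: "\<exists>v v'. admissible \<sigma> v \<and> admissible \<sigma> v' \<and> (unfold_word v \<sigma>, unfold_word v' \<sigma>) \<notin> pull \<sigma> i s W" if W: "W \<in> \<S>" for W
  proof -
    obtain v v' where v: "admissible (after \<sigma> i) v" "admissible (after \<sigma> i) v'" "(unfold_word v (after \<sigma> i), unfold_word v' (after \<sigma> i)) \<notin> W"
      using S W by (auto simp: sepset_def)
    have "(unfold_word ((i, s) # v) \<sigma>, unfold_word ((i, s) # v') \<sigma>) \<notin> pull \<sigma> i s W"
      using v pull_cross[OF k] by simp
    then show ?thesis using admissible_ConsI[OF b(1-5)] v by blast
  qed
  have "(cross \<sigma> i s y, unfold_word ((i, s) # u) \<sigma>) \<notin> pull \<sigma> i s W" if "W \<in> \<S>" for W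
    using pull_cross[OF k y, of "unfold_word u (after \<sigma> i)" W] b(7) S that by (simp add: sepset_def)
  then show "sepset \<sigma> (cross \<sigma> i s y) (pull \<sigma> i s ` \<S>) ((i, s) # u)"
    using S im pull_moved_walls[OF k] unfolding sepset_def by fastforce
  show "own_wall \<sigma> i \<notin> pull \<sigma> i s ` \<S>"
  proof
    assume "own_wall \<sigma> i \<in> pull \<sigma> i s ` \<S>"
    then obtain W where W: "W \<in> \<S>" "pull \<sigma> i s W = pull \<sigma> i s (own_wall (after \<sigma> i) i)"
      using pull_own_wall[OF b(1-4)] by auto
    have "W = own_wall (after \<sigma> i) i"
      by (rule inj_onD[OF pull_inj[OF k] W(2) subsetD[OF SW W(1)] own_wall_moved_walls[OF good_after[OF k(1)]]])
    then obtain v v' where v: "admissible (after \<sigma> i) v" "admissible (after \<sigma> i) v'" "(unfold_word v (after \<sigma> i), unfold_word v' (after \<sigma> i)) \<notin> own_wall (after \<sigma> i) i"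
      using S W(1) by (auto simp: sepset_def)
    have "coord_at (after \<sigma> i) i (unfold_word v (after \<sigma> i)) = sector (after \<sigma> i) i (e1 i)" if "admissible (after \<sigma> i) v" for v
      using image_coords[OF that b(2)] clean_after(2)[OF b(1-3) b(2)] that by (simp add: admissible_def descents_after)
    then show False using v by (simp add: own_wall_def)
  qed
qed

text \<open>The two conditions under which walls between \<open>y\<close> and the image of \<open>u\<close> are counted: \<open>y\<close> is not
  behind the sides crossed by the first syllables of \<open>u\<close>, or more strongly not even in their sectors.\<close>

definition off_regions where
  "off_regions \<sigma> u y \<longleftrightarrow> (\<forall>j<M. hea j u \<noteq> e1 j \<longrightarrow> \<not> region_at \<sigma> j (sector \<sigma> j (hea j u)) y)"

definition off_sectors where
  "off_sectors \<sigma> u y \<longleftrightarrow> (\<forall>j<M. hea j u \<noteq> e1 j \<longrightarrow> coord_at \<sigma> j y \<noteq> sector \<sigma> j (hea j u))"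

text \<open>In the stronger case the wall crossed by the first syllable separates. The rest of the word is
  then in the weaker case: at neighbours the sectors have not changed, and \<open>y\<close> cannot be behind another
  side because it is nontrivial at the crossed one.\<close>

lemma off_sectors_step:
  assumes a: "admissible \<sigma> ((i, s) # u)" and y: "y \<in> Y" and h: "off_sectors \<sigma> ((i, s) # u) (cross \<sigma> i s y)"
  shows "off_regions (after \<sigma> i) u y"
proof -
  note b = admissible_ConsD[OF a]
  note I = b(1-3)
  let ?s = "after \<sigma> i"
  have I': "Inv ?s" by (rule Inv_after[OF I])
  then have g: "good ?s" by simp
  interpret b: blob N p q "Bs ?s" Y "ms ?s" "hs ?s" "fs ?s" by (rule blob_label[OF g])
  interpret B: group "Bt (type_at \<sigma> i)" by (rule grp)
  have "coord_at \<sigma> i (cross \<sigma> i s y) \<noteq> sector \<sigma> i s" using h I b(5) unfolding off_sectors_def by fastforce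
  then have self: "coord_at ?s i y \<noteq> one_t (type_at ?s i)"
    using cross_self[OF I b(4) y] Bt_cong[OF type_at_after[OF I I(2)]] b(2,4) by auto
  show ?thesis unfolding off_regions_def
  proof (intro allI impI notI)
    fix j assume j: "j < M" "hea j u \<noteq> e1 j" and r: "region_at ?s j (sector ?s j (hea j u)) y"
    have hc: "hea j u \<in> carrier (A j)"
      using gw.red_head_closed[of j u] j b(7) by (auto simp: admissible_def)
    have ij: "j \<noteq> i" using j b(6) by auto
    show False
    proof (cases "adj i j")
      case True
      have "coord_at \<sigma> j (cross \<sigma> i s y) \<noteq> sector \<sigma> j (hea j u)"
        using h[unfolded off_sectors_def, rule_format, OF j(1)] j(2) True ij by simp
      then show False
        using cross_sector[OF I b(4) y j(1) True hc j(2)] region_at_coord_at[OF r g] by blast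
    next
      case False
      have ne: "\<not> padj (pos ?s j) (pos ?s i)" "\<not> m dvd pos ?s j - pos ?s i"
        using pos_adj[OF j(1) I(2), of ?s] pos_eq[OF j(1) I(2), of ?s] False ij gw.adj_sym[of i j] by auto
      have "coord_at ?s i y = one_t (type_at ?s i)"
        using b.region_far_clean[OF y _ _ clean_after(2)[OF I I(2)] ne, of "sector ?s j (hea j u)"] r sector_not_one[OF j(1) hc j(2), of ?s]
        by (simp add: region_at_def coord_at_def type_at_def)
      then show False using self by simp
    qed
  qed
qed

lemma label_eqt: "good \<sigma> \<Longrightarrow> eqt N (label \<sigma> v) (label \<sigma> w) \<longleftrightarrow> eqt N v w"
  by (auto simp: good_def label_def eqt_def dvd_diff_commute)

lemma label_surj: "good \<sigma> \<Longrightarrow> \<exists>v. w = label \<sigma> v"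
  by (rule exI[of _ "orientation \<sigma> * (w - origin \<sigma>)"]) (auto simp: good_def label_def)

text \<open>If only the weaker condition holds at a side, the point has come around a reflex corner. As seen
  from the next blob it is behind the other side of the corner only, in a sector there that is not used
  by the map.\<close>

lemma bad_point:
  assumes I: "Inv \<sigma>" "i < M" "i \<notin> descents \<sigma>" and s: "s \<in> carrier (A i)" "s \<noteq> e1 i" and y: "y \<in> Y"
    and c: "coord_at \<sigma> i y = sector \<sigma> i s" and r: "\<not> region_at \<sigma> i (sector \<sigma> i s) y"
  obtains j where "j < M" "adj i j" "\<And>v. \<not> eqt N v (type_at \<sigma> j) \<Longrightarrow> hd v (uncross \<sigma> i s y) = one_t v"
    "\<And>h. h \<in> carrier (A j) \<Longrightarrow> hd (type_at \<sigma> j) (uncross \<sigma> i s y) \<noteq> sector (after \<sigma> i) j h" "\<not> long (pos \<sigma> i)"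
proof -
  have g: "good \<sigma>" using I by simp
  interpret b: blob N p q "Bs \<sigma>" Y "ms \<sigma>" "hs \<sigma>" "fs \<sigma>" by (rule blob_label[OF g])
  have c': "b.coord (pos \<sigma> i) y = sector \<sigma> i s" using c by (simp add: coord_at_def)
  have ne: "b.coord (pos \<sigma> i) y \<noteq> one_t (label \<sigma> (T (pos \<sigma> i)))"
    using sector_not_one[OF I(2) s, of \<sigma>] c by (simp add: coord_at_def type_at_def)
  have nc: "\<not> clean (pos \<sigma> i)" using r region_at_clean[OF _ g] c by blast
  have nl: "\<not> long (pos \<sigma> i)" using nc long_clean by blast
  have fl: "j \<in> phase (after \<sigma> i) \<longleftrightarrow> j \<notin> phase \<sigma>" if "j < M" "adj i j" "\<not> clean (pos \<sigma> j)" for j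
    using nc that by (simp add: phase_after)
  have all: "hd v z = one_t v" if "\<And>v. \<not> eqt N v u \<Longrightarrow> hs \<sigma> v z = one_t (label \<sigma> v)" "eqt N w (label \<sigma> u)" "\<not> eqt N v w" for v w u z
  proof -
    obtain v' where v': "v = label \<sigma> v'" using label_surj[OF g] by blast
    have "\<not> eqt N v' u" using that(2,3) label_eqt[OF g, of v' u] v' eqt_sym eqt_trans by blast
    then show ?thesis using that(1) v' by simp
  qed
  show ?thesis
  proof (cases rule: partner[OF I(2) nc])
    case (1 j k)
    have w: "i \<notin> phase \<sigma>" "j \<in> phase \<sigma>" using phase_E[OF I(1,2) 1(3)] phase_L[OF I(1) 1(1,4)] by auto
    have nf: "b.coord (pos \<sigma> i) y \<noteq> f (label \<sigma> (T (pos \<sigma> i)))"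
      using sector_not_f[OF I(2) s(1) w(1)] c by (simp add: coord_at_def type_at_def)
    have "isE k' (pos \<sigma> i) \<Longrightarrow> k' = k" for k' using isE_unique[OF 1(3)] isE_On by blast
    then have nE: "\<not> b.early k y" using r c E_L_aux[OF 1(3)] by (auto simp: region_at_def b.region_def coord_at_def)
    have kk': "chamber_of (pos \<sigma> i) = k" using isE_unique[OF 1(3) chamber_of] .
    have z: "uncross \<sigma> i s y = mv (label \<sigma> (T (pos \<sigma> i))) (inv_t (label \<sigma> (T (pos \<sigma> i))) (b.coord (pos \<sigma> i) y)) (b.pt k y)"
      using nl kk' c' by (simp add: uncross_def view_def type_at_def)
    note nb = b.not_early[OF 1(3) y ne nf nE z]
    have e: "eqt N (T (pos \<sigma> j)) (t k)" using isL_On[OF 1(4)] by blast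
    have e': "eqt N (type_at \<sigma> j) (label \<sigma> (t k))" using label_eqt[OF g] e by (simp add: type_at_def)
    show ?thesis
    proof (rule that(1)[OF 1(1,2) _ _ nl])
      show "hd v (uncross \<sigma> i s y) = one_t v" if "\<not> eqt N v (type_at \<sigma> j)" for v
        by (rule all[OF nb(2) e' that])
      have "j \<notin> phase (after \<sigma> i)" using fl[OF 1(1,2)] w L_unclean[OF 1(4)] by blast
      then show "hd (type_at \<sigma> j) (uncross \<sigma> i s y) \<noteq> sector (after \<sigma> i) j h" if "h \<in> carrier (A j)" for h
        using sector_not_f[OF 1(1) that, of "after \<sigma> i"] nb(1) hd_cong[OF e'] f_per[OF e'] f_per[OF type_at_after[OF I 1(1)]] 1(2) by metis
    qed
  next
    case (2 j k)
    have w: "i \<in> phase \<sigma>" "j \<notin> phase \<sigma>" using phase_L[OF I(1,2) 2(3)] phase_E[OF I(1) 2(1,4)] by auto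
    have nf: "b.coord (pos \<sigma> i) y \<noteq> inv_t (label \<sigma> (T (pos \<sigma> i))) (f (label \<sigma> (T (pos \<sigma> i))))"
      using sector_not_inv_f[OF I(2) s(1) w(1)] c by (simp add: coord_at_def type_at_def)
    have "isL k' (pos \<sigma> i) \<Longrightarrow> k' = k" for k' using isL_unique[OF 2(3)] isL_On by fastforce
    then have nE: "\<not> b.late k y" using r c E_L_aux[OF _ 2(3)] by (auto simp: region_at_def b.region_def coord_at_def)
    have kk': "chamber_of (pos \<sigma> i) = k + 2" using isL_unique[OF 2(3) chamber_of] .
    have z: "uncross \<sigma> i s y = mv (label \<sigma> (T (pos \<sigma> i))) (inv_t (label \<sigma> (T (pos \<sigma> i))) (b.coord (pos \<sigma> i) y)) (b.pt (k + 2) y)"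
      using nl c' unfolding uncross_def kk' by (simp add: view_def type_at_def del: add_2_eq_Suc')
    note nb = b.not_late[OF 2(3) y ne nf nE z]
    have e: "eqt N (T (pos \<sigma> j)) (t (Suc k))" using isE_On[OF 2(4)] by blast
    have e': "eqt N (type_at \<sigma> j) (label \<sigma> (t (Suc k)))" using label_eqt[OF g] e by (simp add: type_at_def)
    show ?thesis
    proof (rule that(1)[OF 2(1,2) _ _ nl])
      show "hd v (uncross \<sigma> i s y) = one_t v" if "\<not> eqt N v (type_at \<sigma> j)" for v
        by (rule all[OF nb(2) e' that])
      have w': "j \<in> phase (after \<sigma> i)" using fl[OF 2(1,2)] w E_unclean[OF 2(4)] by blast
      show "hd (type_at \<sigma> j) (uncross \<sigma> i s y) \<noteq> sector (after \<sigma> i) j h" if "h \<in> carrier (A j)" for h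
        using sector_not_inv_f[OF 2(1) that w'] nb(1) hd_cong[OF e'] f_per[OF e'] Bt_cong[OF e']
          f_per[OF type_at_after[OF I 2(1)]] Bt_cong[OF type_at_after[OF I 2(1)]] 2(2) by simp
    qed
  qed
qed

text \<open>In the weaker case no wall is gained by crossing the bad side, but the rest of the word is in the
  stronger case: a point with a single wall, in a sector that is not used, is in none of the sectors
  that are used by the next blob.\<close>

lemma bad_step:
  assumes a: "admissible \<sigma> ((i, s) # u)" and y: "y \<in> Y"
    and c: "coord_at \<sigma> i y = sector \<sigma> i s" and r: "\<not> region_at \<sigma> i (sector \<sigma> i s) y"
  shows "off_sectors (after \<sigma> i) u (uncross \<sigma> i s y)"
proof -
  note b = admissible_ConsD[OF a]
  note I = b(1-3)
  let ?s = "after \<sigma> i" and ?y = "uncross \<sigma> i s y"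
  obtain j0 where j0: "j0 < M" "adj i j0" "\<And>v. \<not> eqt N v (type_at \<sigma> j0) \<Longrightarrow> hd v ?y = one_t v"
    "\<And>h. h \<in> carrier (A j0) \<Longrightarrow> hd (type_at \<sigma> j0) ?y \<noteq> sector ?s j0 h" and nl: "\<not> long (pos \<sigma> i)"
    using bad_point[OF I b(4,5) y c r] by metis
  have I': "Inv ?s" by (rule Inv_after[OF I])
  then have g: "good ?s" by simp
  interpret b: blob N p q "Bs ?s" Y "ms ?s" "hs ?s" "fs ?s" by (rule blob_label[OF g])
  have yY: "?y \<in> Y" using I b(4) y by simp
  have e0: "eqt N (type_at ?s j0) (type_at \<sigma> j0)" using type_at_after[OF I j0(1)] j0(2) by blast
  obtain d where d: "m dvd pos ?s j0 - d" "d = 1 \<or> d = 2 \<or> d = 3 \<or> d = 4"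
    using new_pos_nbr[OF I nl j0(1)] j0(2) by blast
  have triv: "hd v ?y = one_t v" if "\<not> eqt N v (type_at ?s j0)" for v
    using j0(3)[of v] that e0 eqt_trans eqt_sym by blast
  have "hs ?s v ?y = one_t (label ?s v)" if v: "v = 0 \<or> v = 1" for v
  proof (rule triv)
    have "\<not> N dvd v + 1 + d" using not_dvd_small(1)[of "v + 1 + d" N] d(2) v N by auto
    moreover have "v - T (pos ?s j0) = v + 1 + d" using near_first(4)[OF d] by simp
    ultimately have "\<not> eqt N v (T (pos ?s j0))" unfolding eqt_def by metis
    then show "\<not> eqt N (label ?s v) (type_at ?s j0)" using label_eqt[OF g] by (simp add: type_at_def)
  qed
  then have t01: "hs ?s (t 0) ?y = one_t (label ?s (t 0))" "hs ?s 1 ?y = one_t (label ?s 1)" by (auto simp: t_0)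
  show ?thesis unfolding off_sectors_def
  proof (intro allI impI)
    fix j assume j: "j < M" "hea j u \<noteq> e1 j"
    have hc: "hea j u \<in> carrier (A j)"
      using gw.red_head_closed[of j u] j b(7) by (auto simp: admissible_def)
    have r1: "sector ?s j (hea j u) \<noteq> one_t (type_at ?s j)" by (rule sector_not_one[OF j(1) hc j(2)])
    show "coord_at ?s j ?y \<noteq> sector ?s j (hea j u)"
    proof (cases "j = j0")
      case True
      then show ?thesis using coord_at_new[OF I nl j(1) _ yY] j0(2,4) hc by simp
    next
      case ne: False
      show ?thesis
      proof (cases "On 0 (pos ?s j)")
        case True
        have "On 0 (pos ?s j0)" using near_first(3)[OF d] by blast
        then have "\<not> eqt N (T (pos ?s j)) (T (pos ?s j0))"
          using type_inj[OF True] pos_eq[OF j(1) j0(1), of ?s] ne by blast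
        then have "hd (type_at ?s j) ?y = one_t (type_at ?s j)"
          using label_eqt[OF g] by (intro triv) (simp add: type_at_def)
        then show ?thesis using coord_at_On[OF g yY True] r1 g yY by (simp add: view_0)
      next
        case False
        show ?thesis
        proof (cases "\<exists>k. isL k (pos ?s j)")
          case True
          then obtain k where k: "isL k (pos ?s j)" by blast
          have "coord_at ?s j ?y = inv_t (type_at ?s j) (f (type_at ?s j))"
            using b.trivial_coord(2)[OF yY t01 False k] by (simp add: coord_at_def type_at_def)
          then show ?thesis using sector_not_inv_f[OF j(1) hc phase_L[OF I' j(1) k]] by simp
        next
          case nL: False
          have "coord_at ?s j ?y = one_t (type_at ?s j)"
            using b.trivial_coord(1)[OF yY t01 False] nL by (simp add: coord_at_def type_at_def)
          then show ?thesis using r1 by simp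
        qed
      qed
    qed
  qed
qed

text \<open>A wall is gained at least with every second syllable, since a crossing without gain leads to the
  stronger case.\<close>

lemma sep_bound:
  assumes "admissible \<sigma> u" "y \<in> Y" "off_regions \<sigma> u y"
  shows "(\<exists>\<S>. sepset \<sigma> y \<S> u \<and> length u \<le> 2 * card \<S> + 1) \<and>
    (off_sectors \<sigma> u y \<longrightarrow> (\<exists>\<S>. sepset \<sigma> y \<S> u \<and> length u \<le> 2 * card \<S>))"
  using assms
proof (induction "length u" arbitrary: \<sigma> u y rule: less_induct)
  case less
  show ?case
  proof (cases "off_sectors \<sigma> u y")
    case True
    show ?thesis
    proof (cases u)
      case Nil
      have "sepset \<sigma> y {} u" by (simp add: sepset_def)
      then show ?thesis using Nil by fastforce
    next
      case (Cons l u')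
      obtain i s where l: "l = (i, s)" by force
      have a: "admissible \<sigma> ((i, s) # u')" using less.prems Cons l by simp
      note b = admissible_ConsD[OF a]
      define y' where "y' = uncross \<sigma> i s y"
      have y': "y' \<in> Y" "cross \<sigma> i s y' = y" using b less.prems(2) by (simp_all add: y'_def)
      have "off_regions (after \<sigma> i) u' y'" using off_sectors_step[OF a y'(1)] y'(2) True Cons l by simp
      then obtain \<S> where S: "sepset (after \<sigma> i) y' \<S> u'" "length u' \<le> 2 * card \<S> + 1"
        using less.hyps[OF _ b(7) y'(1)] Cons by auto
      note P = pull_sepset[OF a y'(1) S(1)]
      let ?S = "insert (own_wall \<sigma> i) (pull \<sigma> i s ` \<S>)"
      have f: "finite (pull \<sigma> i s ` \<S>)" using P(1) by (simp add: sepset_def)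
      have "coord_at \<sigma> i y \<noteq> sector \<sigma> i s" using True Cons l b(2,5) unfolding off_sectors_def by fastforce
      then have 1: "(y, unfold_word u \<sigma>) \<notin> own_wall \<sigma> i" using first_coord_at[OF a] Cons l by (simp add: own_wall_def)
      have "(unfold_word u \<sigma>, unfold_word [] \<sigma>) \<notin> own_wall \<sigma> i"
        using first_coord_at[OF a] base_image[OF b(1,2,4,5)] Cons l by (auto simp: own_wall_def)
      then have "\<exists>v v'. admissible \<sigma> v \<and> admissible \<sigma> v' \<and> (unfold_word v \<sigma>, unfold_word v' \<sigma>) \<notin> own_wall \<sigma> i"
        using less.prems(1) admissible_Nil b(1) by blast
      moreover have "sepset \<sigma> y (pull \<sigma> i s ` \<S>) u" using P(1) y'(2) Cons l by simp
      moreover have "own_wall \<sigma> i \<in> moved_walls" by (rule own_wall_moved_walls[OF Inv_good[OF b(1)]])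
      ultimately have "sepset \<sigma> y ?S u"
        using 1 unfolding sepset_def by simp
      moreover have "length u \<le> 2 * card ?S" using S(2) P(2,3) f Cons by simp
      ultimately show ?thesis by (meson le_add1 order_trans)
    qed
  next
    case False
    then obtain j where j: "j < M" "hea j u \<noteq> e1 j" "coord_at \<sigma> j y = sector \<sigma> j (hea j u)"
      by (auto simp: off_sectors_def)
    let ?h = "hea j u" and ?u = "gw.del j u"
    have eq: "u \<simeq> (j, ?h) # ?u" by (rule gw.head_to_front[OF j(2)])
    have a: "admissible \<sigma> ((j, ?h) # ?u)" and F: "unfold_word ((j, ?h) # ?u) \<sigma> = unfold_word u \<sigma>" using eqv_unfold_word[OF eq less.prems(1)] by auto
    note b = admissible_ConsD[OF a]
    have r: "\<not> region_at \<sigma> j (sector \<sigma> j ?h) y" using less.prems(3) j by (simp add: off_regions_def)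
    define y' where "y' = uncross \<sigma> j ?h y"
    have y': "y' \<in> Y" "cross \<sigma> j ?h y' = y" using b less.prems(2) by (simp_all add: y'_def)
    have H: "off_sectors (after \<sigma> j) ?u y'" unfolding y'_def by (rule bad_step[OF a less.prems(2) j(3) r])
    have len: "length u = Suc (length ?u)" using gw.eqv_length[OF eq] by simp
    have "off_regions (after \<sigma> j) ?u y'" using H region_at_coord_at b(1) good_after Inv_good unfolding off_regions_def off_sectors_def by metis
    then obtain \<S> where S: "sepset (after \<sigma> j) y' \<S> ?u" "length ?u \<le> 2 * card \<S>"
      using less.hyps[OF _ b(7) y'(1)] H len by auto
    note P = pull_sepset[OF a y'(1) S(1)]
    have "sepset \<sigma> y (pull \<sigma> j ?h ` \<S>) u" using P(1) F y'(2) unfolding sepset_def by simp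
    then show ?thesis using False P(2) S(2) len by auto
  qed
qed

text \<open>Common first syllables are removed, as crossings preserve the number of separating walls. When
  there are none left, the image of each of the two words is outside the regions of the other one by
  \<open>image_coords\<close>, and the previous bound applies.\<close>

lemma sep_words:
  assumes "admissible \<sigma> u" "admissible \<sigma> x"
  shows "\<exists>c u1 x1 \<S>. u \<simeq> c @ u1 \<and> x \<simeq> c @ x1 \<and> finite \<S> \<and> \<S> \<subseteq> moved_walls \<and>
    (\<forall>W\<in>\<S>. (unfold_word u \<sigma>, unfold_word x \<sigma>) \<notin> W) \<and> length u1 + length x1 \<le> 4 * card \<S> + 2"
  using assms
proof (induction "length u" arbitrary: \<sigma> u x rule: less_induct)
  case less
  have g: "good \<sigma>" using less.prems by (simp add: admissible_def)
  show ?case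
  proof (cases "\<exists>j<M. hea j u \<noteq> e1 j \<and> hea j u = hea j x")
    case True
    then obtain j where j: "j < M" "hea j u \<noteq> e1 j" "hea j x = hea j u" by auto
    let ?h = "hea j u" and ?u = "gw.del j u" and ?x = "gw.del j x"
    have eq: "u \<simeq> (j, ?h) # ?u" by (rule gw.head_to_front[OF j(2)])
    have eq': "x \<simeq> (j, ?h) # ?x" using gw.head_to_front[of j x] j by simp
    note a = eqv_unfold_word[OF eq less.prems(1)] and a' = eqv_unfold_word[OF eq' less.prems(2)]
    note b = admissible_ConsD[OF conjunct1[OF a]] and b' = admissible_ConsD[OF conjunct1[OF a']]
    have len: "length ?u < length u" using gw.eqv_length[OF eq] by simp
    obtain c u1 x1 \<S> where c: "?u \<simeq> c @ u1" "?x \<simeq> c @ x1" "finite \<S>" "\<S> \<subseteq> moved_walls"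
      "\<forall>W\<in>\<S>. (unfold_word ?u (after \<sigma> j), unfold_word ?x (after \<sigma> j)) \<notin> W" "length u1 + length x1 \<le> 4 * card \<S> + 2"
      using less.hyps[OF len b(7) b'(7)] by blast
    have k: "good \<sigma>" "j < M" "?h \<in> carrier (A j)" using g b by auto
    let ?S = "pull \<sigma> j ?h ` \<S>"
    have "card ?S = card \<S>" using pull_inj[OF k] c(4) by (intro card_image) (rule inj_on_subset)
    moreover have "?S \<subseteq> moved_walls" using pull_moved_walls[OF k] c(4) by blast
    moreover have "(unfold_word u \<sigma>, unfold_word x \<sigma>) \<notin> W" if "W \<in> ?S" for W
      using that pull_cross[OF k unfold_word_closed[OF b(7)] unfold_word_closed[OF b'(7)]] c(5) conjunct2[OF a] conjunct2[OF a'] by auto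
    moreover have "u \<simeq> ((j, ?h) # c) @ u1" "x \<simeq> ((j, ?h) # c) @ x1"
      using rtranclp_trans[OF eq gw.eqv_Cons[OF c(1)]] rtranclp_trans[OF eq' gw.eqv_Cons[OF c(2)]] by simp_all
    ultimately show ?thesis using c(3,6) by (metis finite_imageI)
  next
    case False
    have H: "off_regions \<sigma> u (unfold_word x \<sigma>)" if a: "admissible \<sigma> u" "admissible \<sigma> x" and F: "\<not> (\<exists>j<M. hea j u \<noteq> e1 j \<and> hea j u = hea j x)" for u x
    proof -
      have "hea j u \<in> carrier (A j)" if "j < M" for j
        using gw.red_head_closed[of j u] that a(1) by (auto simp: admissible_def)
      then show ?thesis using image_coords[OF a(2)] F unfolding off_regions_def by fastforce
    qed
    have "\<not> (\<exists>j<M. hea j x \<noteq> e1 j \<and> hea j x = hea j u)" using False by metis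
    then have "off_regions \<sigma> u (unfold_word x \<sigma>)" "off_regions \<sigma> x (unfold_word u \<sigma>)" using H less.prems False by blast+
    then obtain \<S> \<S>' where S: "sepset \<sigma> (unfold_word x \<sigma>) \<S> u" "length u \<le> 2 * card \<S> + 1"
      and S': "sepset \<sigma> (unfold_word u \<sigma>) \<S>' x" "length x \<le> 2 * card \<S>' + 1"
      using sep_bound[OF less.prems(1) unfold_word_closed[OF less.prems(2)]] sep_bound[OF less.prems(2) unfold_word_closed[OF less.prems(1)]] by blast
    have s: "\<forall>W\<in>\<S>. (unfold_word u \<sigma>, unfold_word x \<sigma>) \<notin> W" "\<forall>W\<in>\<S>'. (unfold_word u \<sigma>, unfold_word x \<sigma>) \<notin> W"
      "finite \<S>" "\<S> \<subseteq> moved_walls" "finite \<S>'" "\<S>' \<subseteq> moved_walls"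
      using sepsetD[OF S(1)] sepsetD[OF S'(1)] by auto
    have e: "u \<simeq> [] @ u" "x \<simeq> [] @ x" by simp_all
    have "card \<S>' \<le> card \<S> \<or> card \<S> \<le> card \<S>'" by linarith
    then have "length u + length x \<le> 4 * card \<S> + 2 \<or> length u + length x \<le> 4 * card \<S>' + 2"
      using S(2) S'(2) by linarith
    then show ?thesis
    proof
      assume "length u + length x \<le> 4 * card \<S> + 2"
      then show ?thesis using e s(1,3,4) by blast
    next
      assume "length u + length x \<le> 4 * card \<S>' + 2"
      then show ?thesis using e s(2,5,6) by blast
    qed
  qed
qed

section \<open>The map is coarsely Lipschitz\<close>

text \<open>Words with a common beginning have images that differ by a left multiplication from the images
  of the remaining words, taken in a later state.\<close>

lemma unfold_word_append:
  assumes "c \<in> lists (letters {..<M} A)" "good \<sigma>"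
  shows "\<exists>\<phi> \<tau>. motion \<phi> \<and> good \<tau> \<and> (\<forall>x. unfold_word (c @ x) \<sigma> = \<phi> (unfold_word x \<tau>))"
  using assms
proof (induction c arbitrary: \<sigma> rule: list.induct)
  case Nil
  then show ?case using motion_id by auto
next
  case (Cons l c)
  obtain i s where l: "l = (i, s)" by force
  have i: "i < M" "s \<in> carrier (A i)" "c \<in> lists (letters {..<M} A)" using Cons.prems l by auto
  obtain \<phi> \<tau> where "motion \<phi>" "good \<tau>" "\<forall>x. unfold_word (c @ x) (after \<sigma> i) = \<phi> (unfold_word x \<tau>)"
    using Cons.IH[OF i(3) good_after[OF Cons.prems(2)]] by blast
  then show ?case
    using motion_comp[OF motion_cross(1)[OF Cons.prems(2) i(1,2)]]
    by (intro exI[of _ "\<lambda>y. cross \<sigma> i s (\<phi> y)"] exI[of _ \<tau>]) (simp add: l)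
qed

text \<open>The finitely many letters that occur in crossings, and the points reached from the base point by
  a bounded number of them.\<close>

definition step_letters :: "int \<Rightarrow> 'b set" where
  "step_letters v = {one_t v, f v, inv_t v (f v)} \<union>
     (\<Union>i<M. \<Union>s\<in>carrier (A i). {rho i v s, inv_t v (f v) \<otimes>\<^bsub>Bt v\<^esub> rho i v s})"

inductive steps :: "nat \<Rightarrow> 'y \<Rightarrow> bool" where
  steps_0: "steps 0 base"
| steps_Suc: "steps n y \<Longrightarrow> 0 \<le> v \<Longrightarrow> v < N \<Longrightarrow> b \<in> step_letters v \<Longrightarrow> steps (Suc n) (mv v b y)"

lemma step_letters_per: "eqt N v w \<Longrightarrow> step_letters v = step_letters w"
  using Bt_cong[of v w] f_per[of v w] rho_per[of v w] by (simp add: step_letters_def)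

lemma finite_step_letters: "(\<And>i. i < M \<Longrightarrow> finite (carrier (A i))) \<Longrightarrow> finite (step_letters v)"
  by (auto simp: step_letters_def)

lemma steps_mv: "steps n y \<Longrightarrow> b \<in> step_letters v \<Longrightarrow> steps (Suc n) (mv v b y)"
proof -
  assume a: "steps n y" "b \<in> step_letters v"
  have e: "eqt N v (v mod N)" by (simp add: eqt_iff_mod)
  then have "steps (Suc n) (mv (v mod N) b y)"
    using a step_letters_per[OF e] N by (intro steps_Suc) auto
  then show ?thesis using mv_cong[OF e] by simp
qed

lemma steps_pt: assumes "good \<sigma>" shows "steps n y \<Longrightarrow> steps (n + k) (view \<sigma> k y)"
proof -
  interpret b: blob N p q "Bs \<sigma>" Y "ms \<sigma>" "hs \<sigma>" "fs \<sigma>" by (rule blob_label[OF assms])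
  have "steps n y \<Longrightarrow> steps (n + k) (b.pt k y)"
  proof (induction k)
    case (Suc k)
    then show ?case unfolding b.pt_Suc add_Suc_right by (intro steps_mv) (auto simp: step_letters_def)
  qed simp
  then show "steps n y \<Longrightarrow> ?thesis" by (simp add: view_def)
qed

lemma steps_upt: assumes "good \<sigma>" shows "steps n y \<Longrightarrow> steps (n + k) (unview \<sigma> k y)"
proof -
  interpret b: blob N p q "Bs \<sigma>" Y "ms \<sigma>" "hs \<sigma>" "fs \<sigma>" by (rule blob_label[OF assms])
  have "steps n y \<Longrightarrow> steps (n + k) (b.upt k y)"
  proof (induction k arbitrary: n y)
    case (Suc k)
    have "steps (Suc n) (mv (label \<sigma> (t k)) (fs \<sigma> (t k)) y)"
      using Suc.prems by (rule steps_mv) (simp add: step_letters_def)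
    from Suc.IH[OF this] show ?case unfolding b.upt_Suc by simp
  qed simp
  then show "steps n y \<Longrightarrow> ?thesis" by (simp add: unview_def)
qed

lemma steps_cross:
  assumes g: "good \<sigma>" and i: "i < M" "s \<in> carrier (A i)"
  shows "\<exists>n \<le> 2 * C + 1. steps n (cross \<sigma> i s base)"
proof -
  let ?k = "chamber_of (pos \<sigma> i)"
  have k: "?k \<le> C" using On_range[OF chamber_of] .
  have r: "sector \<sigma> i s \<in> step_letters (type_at \<sigma> i)" using i by (auto simp: sector_def step_letters_def)
  have "steps (0 + ?k) (view \<sigma> ?k base)" by (rule steps_pt[OF g steps_0])
  then have 1: "steps (Suc ?k + ?k) (unview \<sigma> ?k (mv (type_at \<sigma> i) (sector \<sigma> i s) (view \<sigma> ?k base)))"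
    by (intro steps_upt[OF g] steps_mv r) simp
  have 2: "steps (Suc 0 + ?k) (unview \<sigma> ?k (mv (type_at \<sigma> i) (sector \<sigma> i s) base))"
    by (intro steps_upt[OF g] steps_mv r steps_0)
  show ?thesis
  proof (cases "long (pos \<sigma> i)")
    case True
    then show ?thesis using 1 k unfolding cross_def by (intro exI[of _ "Suc ?k + ?k"]) simp
  next
    case False
    then show ?thesis using 2 k unfolding cross_def by (intro exI[of _ "Suc 0 + ?k"]) simp
  qed
qed

end

section \<open>Words and word metrics\<close>

context graph_words
begin

lemma eqv_ev: "x \<simeq> y \<Longrightarrow> x \<in> lists L \<Longrightarrow> y \<in> lists L \<and> ev y = ev x"
proof (induction rule: rtranclp_induct)
  case (step y z)
  have "swap y z \<Longrightarrow> y \<in> lists L \<Longrightarrow> z \<in> lists L \<and> ev z = ev y" for y z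
  proof (induction rule: swap.induct)
    case (1 u v a b ws)
    then have l: "u \<in> V" "v \<in> V" "a \<in> carrier (A u)" "b \<in> carrier (A v)" "ws \<in> lists L" by auto
    have "ev ((u, a) # (v, b) # ws) = ev [(u, a)] \<otimes>\<^bsub>GP\<^esub> ev [(v, b)] \<otimes>\<^bsub>GP\<^esub> ev ws"
      using ev_append[of "[(u, a), (v, b)]" ws] ev_append[of "[(u, a)]" "[(v, b)]"] l by simp
    also have "\<dots> = ev [(v, b)] \<otimes>\<^bsub>GP\<^esub> ev [(u, a)] \<otimes>\<^bsub>GP\<^esub> ev ws"
      using ev_comm[OF l(1,2) 1(1) l(3,4)] by simp
    also have "\<dots> = ev ((v, b) # (u, a) # ws)"
      using ev_append[of "[(v, b), (u, a)]" ws] ev_append[of "[(v, b)]" "[(u, a)]"] l by simp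
    finally show ?case using l by simp
  next
    case (2 ws ws' l)
    then show ?case using ev_append[of "[l]" ws] ev_append[of "[l]" ws'] by (cases l) simp
  qed
  then show ?case using step by simp
qed simp

lemma red_unique: "red x \<Longrightarrow> red y \<Longrightarrow> ev x = ev y \<Longrightarrow> x \<simeq> y"
  using ev_eq_nf[of x y] nf_red[of x] nf_red[of y] eqv_sym[of "nf x" x] red_letters
  by (meson rtranclp_trans)

lemma head_append: "head v (x @ y) = (if \<forall>u\<in>fst ` set x. adj u v then head v y else head v x)"
proof (induction x)
  case (Cons l x)
  obtain i s where l: "l = (i, s)" by force
  show ?case using Cons adj_irrefl[of v] by (cases "i = v") (simp_all add: l)
qed simp

lemma red_append: "red (x @ y) \<Longrightarrow> red x"
proof (induction x)
  case (Cons l x)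
  obtain i s where l: "l = (i, s)" by force
  have "head i x = \<one>\<^bsub>A i\<^esub>" if "\<forall>u\<in>fst ` set x. adj u i"
    using that adj_irrefl[of i] by (intro head_no_type) blast
  then show ?case using Cons l by (auto simp: head_append split: if_splits)
qed simp

lemma move_last: "\<forall>u\<in>fst ` set x. adj u v \<Longrightarrow> (v, b) # x \<simeq> x @ [(v, b)]"
proof (induction x)
  case (Cons l x)
  obtain u c where l: "l = (u, c)" by force
  have "adj v u" using Cons.prems l adj_sym[of u v] by auto
  then have "(v, b) # l # x \<simeq> l # (v, b) # x" using swap.intros(1) l by blast
  also have "\<dots> \<simeq> l # x @ [(v, b)]" using Cons by (intro eqv_Cons) auto
  finally show ?case by simp
qed simp

text \<open>Multiplication by a letter on the right changes only one syllable of a reduced word, which can be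
  moved to the end. Hence the images of the two words differ by at most two crossings.\<close>

lemma right_letter:
  assumes "red u" "j \<in> V" "c \<in> carrier (A j)"
  shows "\<exists>u0 c0 c1. c0 \<in> carrier (A j) \<and> c1 \<in> carrier (A j) \<and> red (u0 @ cons j c0 []) \<and>
    red (u0 @ cons j c1 []) \<and> u \<simeq> u0 @ cons j c0 [] \<and> nf (u @ [(j, c)]) \<simeq> u0 @ cons j c1 []"
  using assms(1)
proof (induction u)
  case Nil
  interpret Aj: group "A j" using grp assms(2) .
  show ?case using assms
    by (intro exI[of _ "[]"] exI[of _ "\<one>\<^bsub>A j\<^esub>"] exI[of _ c]) (auto simp: cons_def act_def)
next
  case (Cons l u)
  interpret Aj: group "A j" using grp assms(2) .
  obtain i s where l: "l = (i, s)" by force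
  have i: "i \<in> V" "s \<in> carrier (A i)" "s \<noteq> \<one>\<^bsub>A i\<^esub>" "head i u = \<one>\<^bsub>A i\<^esub>" "red u" using Cons.prems l by auto
  interpret Ai: group "A i" using grp i(1) .
  obtain u0 c0 c1 where c: "c0 \<in> carrier (A j)" "c1 \<in> carrier (A j)" "red (u0 @ cons j c0 [])"
    "red (u0 @ cons j c1 [])" "u \<simeq> u0 @ cons j c0 []" "nf (u @ [(j, c)]) \<simeq> u0 @ cons j c1 []"
    using Cons.IH[OF i(5)] by blast
  have n: "nf ((l # u) @ [(j, c)]) \<simeq> act i s (u0 @ cons j c1 [])" using eqv_act[OF c(6)] l by simp
  have lu: "l # u \<simeq> l # u0 @ cons j c0 []" by (rule eqv_Cons[OF c(5)])
  have r0: "red (l # u0 @ cons j c0 [])" using eqv_red[OF lu Cons.prems] .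
  show ?case
  proof (cases "head i (u0 @ cons j c1 []) = \<one>\<^bsub>A i\<^esub>")
    case True
    have "act i s (u0 @ cons j c1 []) = l # u0 @ cons j c1 []"
      using del_no_head[OF c(4) True] True i l by (simp add: act_def cons_def)
    then show ?thesis using n lu r0 c(1,2,4) True i l
      by (intro exI[of _ "l # u0"] exI[of _ c0] exI[of _ c1]) simp
  next
    case False
    have h0: "head i (u0 @ cons j c0 []) = \<one>\<^bsub>A i\<^esub>" using r0 l by simp
    have all: "\<forall>u\<in>fst ` set u0. adj u i"
      using False h0 unfolding head_append by (auto split: if_splits)
    then have "head i (cons j c1 []) \<noteq> \<one>\<^bsub>A i\<^esub>" "head i (cons j c0 []) = \<one>\<^bsub>A i\<^esub>"
      using False h0 unfolding head_append by simp_all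
    then have ij: "i = j" "c1 \<noteq> \<one>\<^bsub>A j\<^esub>" "c0 = \<one>\<^bsub>A j\<^esub>" by (auto simp: cons_def split: if_splits)
    have "del i (x @ y) = x @ del i y" if "\<forall>u\<in>fst ` set x. adj u i" for x y
      using that by (induction x) auto
    then have d: "del i (u0 @ cons j c1 []) = u0" using all ij by (simp add: cons_def)
    have h1: "head i (u0 @ cons j c1 []) = c1" using all ij unfolding head_append by (simp add: cons_def)
    have mv: "cons j b u0 \<simeq> u0 @ cons j b []" for b
      using move_last[of u0 j b] all ij by (simp add: cons_def)
    have "l # u \<simeq> cons j s u0" using lu l i ij by (simp add: cons_def)
    then have e0: "l # u \<simeq> u0 @ cons j s []" using mv by (rule rtranclp_trans)
    have e1: "nf ((l # u) @ [(j, c)]) \<simeq> u0 @ cons j (s \<otimes>\<^bsub>A j\<^esub> c1) []"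
      using rtranclp_trans[OF n[unfolded act_def d h1], unfolded ij(1), OF mv] ij(1) by simp
    have "red (nf ((l # u) @ [(j, c)]))" using Cons.prems red_letters assms by (intro red_nf) auto
    then show ?thesis
      using e0 e1 eqv_red[OF e0 Cons.prems] eqv_red[OF e1] c(2) i ij
      by (intro exI[of _ u0] exI[of _ s] exI[of _ "s \<otimes>\<^bsub>A j\<^esub> c1"]) simp
  qed
qed

text \<open>Comparison of the word metric of a finite generating set with the lengths of words in the vertex
  groups.\<close>

lemma letters_bound:
  assumes S: "finite_generating_set GP S"
  shows "\<exists>K::nat. \<forall>g\<in>carrier GP. \<exists>w\<in>lists L. ev w = g \<and> length w \<le> K * word_length GP S g"
proof -
  have S': "finite S" "S \<subseteq> carrier GP" "generate GP S = carrier GP" using S by (auto simp: finite_generating_set_def)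
  let ?S = "S \<union> m_inv GP ` S"
  have Sc: "?S \<subseteq> carrier GP" using S' by auto
  define W where "W s = (SOME w. w \<in> lists L \<and> ev w = s)" for s
  have W: "W s \<in> lists L \<and> ev (W s) = s" if "s \<in> ?S" for s
  proof -
    have "\<exists>w. w \<in> lists L \<and> ev w = s" using ev_surj[of s] Sc that by blast
    then show ?thesis unfolding W_def by (rule someI_ex)
  qed
  obtain K where K: "\<forall>s\<in>?S. length (W s) \<le> K"
    using finite_nat_set_iff_bounded_le[of "(\<lambda>s. length (W s)) ` ?S"] S'(1) by auto
  have *: "\<exists>w\<in>lists L. ev w = foldr (\<otimes>\<^bsub>GP\<^esub>) ws \<one>\<^bsub>GP\<^esub> \<and> length w \<le> K * length ws" if "ws \<in> lists ?S" for ws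
    using that
  proof (induction ws rule: list.induct)
    case Nil
    then show ?case by (intro bexI[of _ "[]"]) (auto simp: ev_Nil)
  next
    case (Cons s ws)
    obtain w where w: "w \<in> lists L" "ev w = foldr (\<otimes>\<^bsub>GP\<^esub>) ws \<one>\<^bsub>GP\<^esub>" "length w \<le> K * length ws"
      using Cons by auto
    then show ?case using W[of s] K Cons.prems ev_append[of "W s" w]
      by (intro bexI[of _ "W s @ w"]) (auto intro: add_mono)
  qed
  show ?thesis
  proof (intro exI[of _ K] ballI)
    fix g assume "g \<in> carrier GP"
    then obtain ws where "ws \<in> lists ?S" "length ws = word_length GP S g" "foldr (\<otimes>\<^bsub>GP\<^esub>) ws \<one>\<^bsub>GP\<^esub> = g"
      using Q.word_length_attained[OF S'(2), of g] S'(3) by auto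
    then show "\<exists>w\<in>lists L. ev w = g \<and> length w \<le> K * word_length GP S g" using *[of ws] by auto
  qed
qed

end

context group
begin

lemma word_dist_left:
  assumes "x \<in> carrier G" "y \<in> carrier G" "z \<in> carrier G"
  shows "word_dist G S (x \<otimes> y) (x \<otimes> z) = word_dist G S y z"
proof -
  have "inv (x \<otimes> y) \<otimes> (x \<otimes> z) = inv y \<otimes> (inv x \<otimes> (x \<otimes> z))"
    using assms by (simp add: inv_mult_group m_assoc)
  also have "inv x \<otimes> (x \<otimes> z) = z" using assms by (simp add: m_assoc[symmetric])
  finally show ?thesis using assms by (simp add: word_dist_def)
qed

lemma word_dist_triangle:
  assumes "finite_generating_set G S" "x \<in> carrier G" "y \<in> carrier G" "z \<in> carrier G"
  shows "word_dist G S x z \<le> word_dist G S x y + word_dist G S y z" "word_dist G S x y = word_dist G S y x"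
  using Metric_space.triangle[OF Metric_space_word_dist, of S x y z] Metric_space.commute[OF Metric_space_word_dist, of S x y] assms
  by (auto simp: finite_generating_set_def)

end

lemma (in graph_words) dist_letters:
  assumes S: "finite_generating_set GP S" and fin: "finite L"
  shows "\<exists>K::real. K \<ge> 0 \<and> (\<forall>u\<in>lists L. \<forall>x\<in>lists L. word_dist GP S (ev u) (ev x) \<le> K * (length u + length x))"
proof -
  obtain K :: real where K: "K \<ge> 0" "\<forall>l\<in>L. word_dist GP S \<one>\<^bsub>GP\<^esub> (ev [l]) \<le> K"
  proof -
    have "finite ((\<lambda>l. word_dist GP S \<one>\<^bsub>GP\<^esub> (ev [l])) ` L)" using fin by simp
    from bdd_above_finite[OF this] obtain K where K: "\<And>l. l \<in> L \<Longrightarrow> word_dist GP S \<one>\<^bsub>GP\<^esub> (ev [l]) \<le> K"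
      by (auto simp: bdd_above_def)
    have "\<forall>l\<in>L. word_dist GP S \<one>\<^bsub>GP\<^esub> (ev [l]) \<le> max 0 K" using K by (simp add: le_max_iff_disj)
    then show ?thesis using that[of "max 0 K"] by simp
  qed
  have *: "word_dist GP S \<one>\<^bsub>GP\<^esub> (ev u) \<le> K * length u" if "u \<in> lists L" for u
    using that
  proof (induction u rule: list.induct)
    case Nil
    have "word_dist GP S \<one>\<^bsub>GP\<^esub> \<one>\<^bsub>GP\<^esub> = 0"
      using Metric_space.zero[OF Q.Metric_space_word_dist, of S "\<one>\<^bsub>GP\<^esub>" "\<one>\<^bsub>GP\<^esub>"] S by (simp add: finite_generating_set_def)
    then show ?case by (simp add: ev_Nil)
  next
    case (Cons l u)
    then have l: "[l] \<in> lists L" "u \<in> lists L" by auto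
    have "word_dist GP S (ev [l]) (ev (l # u)) = word_dist GP S \<one>\<^bsub>GP\<^esub> (ev u)"
      using Q.word_dist_left[of "ev [l]" "\<one>\<^bsub>GP\<^esub>" "ev u" S] ev_append[OF l] l by simp
    moreover have "word_dist GP S \<one>\<^bsub>GP\<^esub> (ev (l # u)) \<le> word_dist GP S \<one>\<^bsub>GP\<^esub> (ev [l]) + word_dist GP S (ev [l]) (ev (l # u))"
      using Cons.prems l by (intro Q.word_dist_triangle[OF S]) (simp_all del: lists.Cons)
    ultimately show ?case using Cons.IH[OF l(2)] K(2) l by (auto simp: algebra_simps intro: order_trans)
  qed
  have "word_dist GP S (ev u) (ev x) \<le> K * (length u + length x)" if "u \<in> lists L" "x \<in> lists L" for u x
    using Q.word_dist_triangle(1)[OF S, of "ev u" "\<one>\<^bsub>GP\<^esub>" "ev x"] Q.word_dist_triangle(2)[OF S, of "ev u" "\<one>\<^bsub>GP\<^esub>" "\<one>\<^bsub>GP\<^esub>"] *[OF that(1)] *[OF that(2)] that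
    by (simp add: algebra_simps)
  then show ?thesis using K(1) by (intro exI[of _ K]) simp
qed

lemma (in graph_words) separating_dist:
  assumes T: "finite_generating_set GP T"
  shows "\<exists>K::real. K \<ge> 0 \<and> (\<forall>x\<in>carrier GP. \<forall>z\<in>carrier GP. \<forall>\<S>. \<S> \<subseteq> walls \<longrightarrow> (\<forall>W\<in>\<S>. (x, z) \<notin> W) \<longrightarrow>
    card \<S> \<le> K * word_dist GP T x z)"
proof -
  obtain K :: nat where K: "\<forall>g\<in>carrier GP. \<exists>w\<in>lists L. ev w = g \<and> length w \<le> K * word_length GP T g"
    using letters_bound[OF T] by blast
  have "card \<S> \<le> real K * word_dist GP T x z"
    if x: "x \<in> carrier GP" "z \<in> carrier GP" and S: "\<S> \<subseteq> walls" "\<forall>W\<in>\<S>. (x, z) \<notin> W" for x z \<S>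
  proof -
    obtain w where w: "w \<in> lists L" "ev w = inv\<^bsub>GP\<^esub> x \<otimes>\<^bsub>GP\<^esub> z" "length w \<le> K * word_length GP T (inv\<^bsub>GP\<^esub> x \<otimes>\<^bsub>GP\<^esub> z)"
      using K x by (meson Q.inv_closed Q.m_closed)
    have z: "x \<otimes>\<^bsub>GP\<^esub> ev w = z" using w(2) x by (simp add: Q.m_assoc[symmetric])
    have "\<S> \<subseteq> separating x z" using S by (auto simp: separating_def)
    then have "card \<S> \<le> length w"
      using separating_word[OF w(1) x(1)] unfolding z by (meson card_mono order_trans)
    then have "real (card \<S>) \<le> real (K * word_length GP T (inv\<^bsub>GP\<^esub> x \<otimes>\<^bsub>GP\<^esub> z))"
      using w(3) by (intro of_nat_mono) simp
    then show ?thesis using x by (simp add: word_dist_def)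
  qed
  then show ?thesis by (intro exI[of _ "real K"]) simp
qed

section \<open>The map between the groups\<close>

text \<open>The graph product \<open>H\<close> over the \<open>n\<close>-cycle as the target, with types read modulo \<open>n\<close>.\<close>

locale graph_product_map = H: graph_words "{..<n}" "cycle_edges n" B +
  blob_map M A "int n" p q "\<lambda>v. B (nat (v mod int n))" "carrier H.GP" "\<lambda>v. H.mv (nat (v mod int n))" "\<lambda>v. H.hd (nat (v mod int n))"
    f rho "\<one>\<^bsub>H.GP\<^esub>"
  for n :: nat and B :: "nat \<Rightarrow> 'b monoid" and M :: nat and A :: "nat \<Rightarrow> 'a monoid" and p q :: nat
    and f :: "int \<Rightarrow> 'b" and rho :: "nat \<Rightarrow> int \<Rightarrow> 'a \<Rightarrow> 'b" +
  assumes fin: "i < M \<Longrightarrow> finite (carrier (A i))"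
begin

definition root :: state where
  "root = \<lparr> descents = {}, offset = 0, origin = 0, orientation = 1, phase = {j. j < M \<and> (\<exists>k. isL k (int j))} \<rparr>"

lemma Inv_root: "Inv root"
  using E_L_aux by (auto simp: Inv_def good_def root_def pos_def)

lemma admissible_root: "redw u \<Longrightarrow> admissible root u"
  using Inv_root by (simp add: admissible_def root_def)

definition embedding where "embedding g = unfold_word (SOME u. redw u \<and> gw.ev u = g) root"

lemma embedding_red: "redw u \<Longrightarrow> embedding (gw.ev u) = unfold_word u root"
proof -
  assume u: "redw u"
  define x where "x = (SOME x. redw x \<and> gw.ev x = gw.ev u)"
  have "redw x \<and> gw.ev x = gw.ev u" unfolding x_def by (rule someI[of _ u]) (simp add: u)
  then have "u \<simeq> x" using gw.red_unique[OF u, of x] by simp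
  then show ?thesis using eqv_unfold_word[of u x root] admissible_root[OF u] by (simp add: embedding_def x_def)
qed

lemma embedding_closed: "g \<in> carrier gw.GP \<Longrightarrow> embedding g \<in> carrier H.GP"
  using gw.red_rep[of g] embedding_red unfold_word_closed admissible_root by metis

lemma type_less: "nat (v mod int n) < n"
  using N by (simp add: nat_less_iff)

lemma motion_left: "motion \<psi> \<Longrightarrow> \<exists>x\<in>carrier H.GP. \<forall>y\<in>carrier H.GP. \<psi> y = x \<otimes>\<^bsub>H.GP\<^esub> y"
proof (induction rule: motion.induct)
  case motion_id
  then show ?case by (intro bexI[of _ "\<one>\<^bsub>H.GP\<^esub>"]) auto
next
  case (motion_mv \<psi> b v)
  then obtain x where x: "x \<in> carrier H.GP" "\<forall>y\<in>carrier H.GP. \<psi> y = x \<otimes>\<^bsub>H.GP\<^esub> y" by blast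
  let ?b = "H.ev [(nat (v mod int n), b)]"
  have b: "?b \<in> carrier H.GP" using motion_mv(2) type_less[of v] by simp
  show ?case using x b by (intro bexI[of _ "?b \<otimes>\<^bsub>H.GP\<^esub> x"]) (auto simp: H.mv_def H.Q.m_assoc)
qed

lemma moved_walls_walls: "moved_walls \<subseteq> H.walls"
proof
  fix W assume "W \<in> moved_walls"
  then obtain v \<psi> where W: "W = wall_of v \<psi>" "motion \<psi>" by (auto simp: moved_walls_def)
  obtain x where x: "x \<in> carrier H.GP" "\<forall>y\<in>carrier H.GP. \<psi> y = x \<otimes>\<^bsub>H.GP\<^esub> y" using motion_left[OF W(2)] by blast
  have "W = H.wall (inv\<^bsub>H.GP\<^esub> x) (nat (v mod int n))"
    using x unfolding W(1) wall_of_def H.wall_def by auto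
  then show "W \<in> H.walls" using x type_less[of v] unfolding H.walls_def by blast
qed

lemma finite_steps: "finite {y. steps n' y}"
proof (induction n')
  case 0
  have "{y. steps 0 y} \<subseteq> {\<one>\<^bsub>H.GP\<^esub>}" by (auto elim: steps.cases)
  then show ?case by (rule finite_subset) simp
next
  case (Suc k)
  have "{y. steps (Suc k) y} \<subseteq> (\<Union>v\<in>{0..<int n}. \<Union>b\<in>step_letters v. (\<lambda>y. H.mv (nat (v mod int n)) b y) ` {y. steps k y})"
  proof
    fix y assume "y \<in> {y. steps (Suc k) y}"
    then have "\<exists>v b y'. y = H.mv (nat (v mod int n)) b y' \<and> steps k y' \<and> v \<in> {0..<int n} \<and> b \<in> step_letters v"
      unfolding mem_Collect_eq
    proof (cases rule: steps.cases)
      case (steps_Suc y' v b)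
      then show ?thesis by (metis Suc_inject atLeastLessThan_iff)
    qed
    then show "y \<in> (\<Union>v\<in>{0..<int n}. \<Union>b\<in>step_letters v. (\<lambda>y. H.mv (nat (v mod int n)) b y) ` {y. steps k y})"
      by blast
  qed
  moreover have "finite (step_letters v)" for v using finite_step_letters fin by blast
  ultimately show ?case using Suc by (meson finite_UN_I finite_atLeastLessThan_int finite_imageI finite_subset)
qed

context
  fixes S T
  assumes S: "finite_generating_set gw.GP S" and T: "finite_generating_set H.GP T"
begin

lemma upper_letter:
  "\<exists>K\<ge>0. \<forall>g\<in>carrier gw.GP. \<forall>l\<in>letters {..<M} A. word_dist H.GP T (embedding g) (embedding (g \<otimes>\<^bsub>gw.GP\<^esub> gw.ev [l])) \<le> K"
proof -
  let ?d = "word_dist H.GP T" and ?o = "\<one>\<^bsub>H.GP\<^esub>"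
  have "finite (\<Union>k\<le>2 * C + 1. ?d ?o ` {y. steps k y})" using finite_steps by simp
  from bdd_above_finite[OF this] obtain K0 where K0: "\<And>k y. k \<le> 2 * C + 1 \<Longrightarrow> steps k y \<Longrightarrow> ?d ?o y \<le> K0"
    by (auto simp: bdd_above_def)
  have K0_pos: "K0 \<ge> 0" using K0[OF _ steps_0] by (simp add: word_dist_def)
  have cross: "?d ?o (cross \<tau> j c ?o) \<le> K0" if "good \<tau>" "j < M" "c \<in> carrier (A j)" for \<tau> j c
    using steps_cross[OF that] K0 by auto
  have one: "?d (unfold_word u0 root) (unfold_word (u0 @ gw.cons j c []) root) \<le> K0"
    if u: "u0 \<in> lists (letters {..<M} A)" "j < M" "c \<in> carrier (A j)" for u0 j c
  proof -
    obtain \<phi> \<tau> where p: "motion \<phi>" "good \<tau>" "\<forall>x. unfold_word (u0 @ x) root = \<phi> (unfold_word x \<tau>)"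
      using unfold_word_append[OF u(1)] Inv_good[OF Inv_root] by blast
    obtain x where x: "x \<in> carrier H.GP" "\<forall>y\<in>carrier H.GP. \<phi> y = x \<otimes>\<^bsub>H.GP\<^esub> y" using motion_left[OF p(1)] by blast
    have k: "cross \<tau> j c ?o \<in> carrier H.GP" using cross_closed[OF p(2) u(2,3), of ?o] by simp
    have e: "unfold_word u0 root = x \<otimes>\<^bsub>H.GP\<^esub> ?o" using p(3)[rule_format, of "[]"] x by simp
    have oo: "?d ?o ?o \<le> K0" using K0[OF _ steps_0] by simp
    show ?thesis
    proof (cases "c = e1 j")
      case True
      then show ?thesis
        using e H.Q.word_dist_left[OF x(1), of ?o ?o T] oo by (simp add: gw.cons_def)
    next
      case False
      have "unfold_word (u0 @ gw.cons j c []) root = x \<otimes>\<^bsub>H.GP\<^esub> cross \<tau> j c ?o"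
        using p(3) x(2) k False by (simp add: gw.cons_def)
      then show ?thesis
        using e H.Q.word_dist_left[OF x(1) _ k, of ?o T] cross[OF p(2) u(2,3)] by simp
    qed
  qed
  have "?d (embedding g) (embedding (g \<otimes>\<^bsub>gw.GP\<^esub> gw.ev [l])) \<le> 2 * K0" if g: "g \<in> carrier gw.GP" and l: "l \<in> letters {..<M} A" for g l
  proof -
    obtain j c where jc: "l = (j, c)" "j < M" "c \<in> carrier (A j)" using l by (cases l) auto
    obtain u where u: "redw u" "gw.ev u = g" using gw.red_rep[OF g] by blast
    have ul: "u \<in> lists (letters {..<M} A)" using gw.red_letters[OF u(1)] .
    obtain u0 c0 c1 where c: "c0 \<in> carrier (A j)" "c1 \<in> carrier (A j)" "redw (u0 @ gw.cons j c0 [])"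
      "redw (u0 @ gw.cons j c1 [])" "u \<simeq> u0 @ gw.cons j c0 []" "gw.nf (u @ [(j, c)]) \<simeq> u0 @ gw.cons j c1 []"
      using gw.right_letter[OF u(1) _ jc(3)] jc(2) by auto
    have u0: "u0 \<in> lists (letters {..<M} A)" using gw.red_letters[OF c(3)] by simp
    have r0: "redw u0" by (rule gw.red_append[OF c(3)])
    have n: "redw (gw.nf (u @ [(j, c)]))" "gw.ev (gw.nf (u @ [(j, c)])) = g \<otimes>\<^bsub>gw.GP\<^esub> gw.ev [l]"
      using gw.red_nf[of "u @ [(j, c)]"] gw.ev_nf[of "u @ [(j, c)]"] gw.ev_append[OF ul, of "[(j, c)]"] ul jc u by auto
    have e0: "embedding g = unfold_word (u0 @ gw.cons j c0 []) root"
      using embedding_red[OF u(1)] u(2) eqv_unfold_word[OF c(5) admissible_root[OF u(1)]] by simp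
    have e1: "embedding (g \<otimes>\<^bsub>gw.GP\<^esub> gw.ev [l]) = unfold_word (u0 @ gw.cons j c1 []) root"
      using embedding_red[OF n(1)] n(2) eqv_unfold_word[OF c(6) admissible_root[OF n(1)]] by simp
    have cl: "unfold_word (u0 @ gw.cons j c0 []) root \<in> carrier H.GP" "unfold_word (u0 @ gw.cons j c1 []) root \<in> carrier H.GP" "unfold_word u0 root \<in> carrier H.GP"
      using unfold_word_closed admissible_root c(3,4) r0 by blast+
    show ?thesis
      unfolding e0 e1
      using H.Q.word_dist_triangle(1)[OF T cl(1,3,2)] H.Q.word_dist_triangle(2)[OF T cl(1,3,2)]
        one[OF u0 jc(2) c(1)] one[OF u0 jc(2) c(2)] by simp
  qed
  then show ?thesis using K0_pos by (intro exI[of _ "2 * K0"]) simp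
qed

lemma upper:
  "\<exists>K\<ge>0. \<forall>g\<in>carrier gw.GP. \<forall>g'\<in>carrier gw.GP. word_dist H.GP T (embedding g) (embedding g') \<le> K * word_dist gw.GP S g g'"
proof -
  let ?d = "word_dist H.GP T" and ?L = "letters {..<M} A"
  obtain K where K: "K \<ge> 0" "\<And>g l. g \<in> carrier gw.GP \<Longrightarrow> l \<in> ?L \<Longrightarrow> ?d (embedding g) (embedding (g \<otimes>\<^bsub>gw.GP\<^esub> gw.ev [l])) \<le> K"
    using upper_letter by blast
  have w: "?d (embedding g) (embedding (g \<otimes>\<^bsub>gw.GP\<^esub> gw.ev w)) \<le> K * length w" if "w \<in> lists ?L" "g \<in> carrier gw.GP" for w g
    using that
  proof (induction w arbitrary: g rule: list.induct)
    case Nil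
    have "?d (embedding g) (embedding g) = 0"
      using Metric_space.zero[OF H.Q.Metric_space_word_dist, of T "embedding g" "embedding g"] T embedding_closed[OF Nil(2)] by (simp add: finite_generating_set_def)
    then show ?case using Nil by (simp add: gw.ev_Nil)
  next
    case (Cons l w)
    then have l: "l \<in> ?L" "[l] \<in> lists ?L" "w \<in> lists ?L" by auto
    let ?g = "g \<otimes>\<^bsub>gw.GP\<^esub> gw.ev [l]"
    have g: "?g \<in> carrier gw.GP" "?g \<otimes>\<^bsub>gw.GP\<^esub> gw.ev w = g \<otimes>\<^bsub>gw.GP\<^esub> gw.ev (l # w)" "g \<otimes>\<^bsub>gw.GP\<^esub> gw.ev (l # w) \<in> carrier gw.GP"
      using gw.ev_append[OF l(2,3)] gw.ev_closed[OF l(2)] gw.ev_closed[OF l(3)] Cons.prems gw.ev_closed[OF Cons.prems(1)]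
      by (simp_all add: gw.Q.m_assoc)
    have "?d (embedding g) (embedding (g \<otimes>\<^bsub>gw.GP\<^esub> gw.ev (l # w))) \<le> ?d (embedding g) (embedding ?g) + ?d (embedding ?g) (embedding (g \<otimes>\<^bsub>gw.GP\<^esub> gw.ev (l # w)))"
      by (intro H.Q.word_dist_triangle[OF T] embedding_closed g Cons.prems)
    then show ?case
      using Cons.IH[OF l(3) g(1)] K(2)[OF Cons.prems(2) l(1)] g(2) by (simp add: algebra_simps)
  qed
  obtain R :: nat where R: "\<forall>g\<in>carrier gw.GP. \<exists>w\<in>lists ?L. gw.ev w = g \<and> length w \<le> R * word_length gw.GP S g"
    using gw.letters_bound[OF S] by blast
  have "?d (embedding g) (embedding g') \<le> (K * R) * word_dist gw.GP S g g'" if g: "g \<in> carrier gw.GP" "g' \<in> carrier gw.GP" for g g'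
  proof -
    let ?h = "inv\<^bsub>gw.GP\<^esub> g \<otimes>\<^bsub>gw.GP\<^esub> g'"
    obtain x where x: "x \<in> lists ?L" "gw.ev x = ?h" "length x \<le> R * word_length gw.GP S ?h"
      using R g by (meson gw.Q.inv_closed gw.Q.m_closed)
    have "g \<otimes>\<^bsub>gw.GP\<^esub> gw.ev x = g'" using x(2) g by (simp add: gw.Q.m_assoc[symmetric])
    then have "?d (embedding g) (embedding g') \<le> K * length x" using w[OF x(1) g(1)] by simp
    also have "\<dots> \<le> K * real (R * word_length gw.GP S ?h)" using x(3) K(1) by (intro mult_left_mono of_nat_mono)
    finally show ?thesis using g by (simp add: word_dist_def)
  qed
  then show ?thesis using K(1) by (intro exI[of _ "K * R"]) simp
qed

lemma lower:
  "\<exists>K\<ge>0. \<exists>K'\<ge>0. \<forall>g\<in>carrier gw.GP. \<forall>g'\<in>carrier gw.GP. word_dist gw.GP S g g' \<le> K * word_dist H.GP T (embedding g) (embedding g') + K'"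
proof -
  have "letters {..<M} A = (\<Union>i<M. Pair i ` carrier (A i))" by (auto simp: letters_def)
  then have fL: "finite (letters {..<M} A)" using fin by simp
  obtain K1 :: real where K1: "K1 \<ge> 0" "\<forall>u\<in>lists (letters {..<M} A). \<forall>x\<in>lists (letters {..<M} A).
      word_dist gw.GP S (gw.ev u) (gw.ev x) \<le> K1 * (length u + length x)"
    using gw.dist_letters[OF S fL] by blast
  obtain K2 :: real where K2: "K2 \<ge> 0" "\<forall>x\<in>carrier H.GP. \<forall>z\<in>carrier H.GP. \<forall>\<S>. \<S> \<subseteq> H.walls \<longrightarrow> (\<forall>W\<in>\<S>. (x, z) \<notin> W) \<longrightarrow>
      card \<S> \<le> K2 * word_dist H.GP T x z"
    using H.separating_dist[OF T] by blast
  have "word_dist gw.GP S g g' \<le> (4 * K1 * K2) * word_dist H.GP T (embedding g) (embedding g') + 2 * K1"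
    if g: "g \<in> carrier gw.GP" "g' \<in> carrier gw.GP" for g g'
  proof -
    obtain u where u: "redw u" "gw.ev u = g" using gw.red_rep[OF g(1)] by blast
    obtain x where x: "redw x" "gw.ev x = g'" using gw.red_rep[OF g(2)] by blast
    obtain c u1 x1 \<S> where c: "u \<simeq> c @ u1" "x \<simeq> c @ x1" "finite \<S>" "\<S> \<subseteq> moved_walls"
      "\<forall>W\<in>\<S>. (unfold_word u root, unfold_word x root) \<notin> W" "length u1 + length x1 \<le> 4 * card \<S> + 2"
      using sep_words[OF admissible_root[OF u(1)] admissible_root[OF x(1)]] by blast
    have l: "c \<in> lists (letters {..<M} A)" "u1 \<in> lists (letters {..<M} A)" "x1 \<in> lists (letters {..<M} A)"
      using gw.red_letters[OF gw.eqv_red[OF c(1) u(1)]] gw.red_letters[OF gw.eqv_red[OF c(2) x(1)]] by auto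
    have e: "g = gw.ev c \<otimes>\<^bsub>gw.GP\<^esub> gw.ev u1" "g' = gw.ev c \<otimes>\<^bsub>gw.GP\<^esub> gw.ev x1"
      using gw.eqv_ev[OF c(1) gw.red_letters[OF u(1)]] gw.eqv_ev[OF c(2) gw.red_letters[OF x(1)]] u x
        gw.ev_append[OF l(1,2)] gw.ev_append[OF l(1,3)] by auto
    have "word_dist gw.GP S g g' = word_dist gw.GP S (gw.ev u1) (gw.ev x1)"
      unfolding e using l by (simp add: gw.Q.word_dist_left)
    also have "\<dots> \<le> K1 * (length u1 + length x1)" using K1(2) l by blast
    also have "\<dots> \<le> K1 * (4 * card \<S> + 2)"
    proof (rule mult_left_mono[OF _ K1(1)])
      show "real (length u1 + length x1) \<le> real (4 * card \<S> + 2)" using c(6) by (simp only: of_nat_le_iff)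
    qed
    finally have 1: "word_dist gw.GP S g g' \<le> K1 * (4 * card \<S> + 2)" .
    have "\<S> \<subseteq> H.walls" using c(4) moved_walls_walls by blast
    moreover have "\<forall>W\<in>\<S>. (embedding g, embedding g') \<notin> W" using c(5) embedding_red[OF u(1)] embedding_red[OF x(1)] u(2) x(2) by simp
    ultimately have "card \<S> \<le> K2 * word_dist H.GP T (embedding g) (embedding g')"
      using K2(2)[rule_format, OF embedding_closed[OF g(1)] embedding_closed[OF g(2)], of \<S>] by blast
    then have "K1 * (4 * card \<S> + 2) \<le> K1 * (4 * (K2 * word_dist H.GP T (embedding g) (embedding g')) + 2)"
      using K1(1) by (intro mult_left_mono) auto
    then show ?thesis using 1 by (simp add: algebra_simps)
  qed
  then show ?thesis using K1(1) K2(1) by (intro exI[of _ "4 * K1 * K2"] exI[of _ "2 * K1"] conjI) auto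
qed

lemma quasi_embedding: "quasiisometric_embedding (word_metric gw.GP S) (word_metric H.GP T) embedding"
proof -
  obtain K0 where K0: "K0 \<ge> 0" "\<forall>g\<in>carrier gw.GP. \<forall>g'\<in>carrier gw.GP. word_dist H.GP T (embedding g) (embedding g') \<le> K0 * word_dist gw.GP S g g'"
    using upper by blast
  obtain K1 K2 where K1: "K1 \<ge> 0" "K2 \<ge> 0" "\<forall>g\<in>carrier gw.GP. \<forall>g'\<in>carrier gw.GP. word_dist gw.GP S g g' \<le> K1 * word_dist H.GP T (embedding g) (embedding g') + K2"
    using lower by blast
  define K where "K = 1 + K0 + K1"
  have K: "K \<ge> 1" using K0 K1 by (simp add: K_def)
  have pos: "word_dist gw.GP S g g' \<ge> 0" "word_dist H.GP T h h' \<ge> 0" for g g' h h' by (simp_all add: word_dist_def)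
  have "(1 / K) * word_dist gw.GP S g g' - K2 \<le> word_dist H.GP T (embedding g) (embedding g') \<and>
      word_dist H.GP T (embedding g) (embedding g') \<le> K * word_dist gw.GP S g g' + K2"
    if g: "g \<in> carrier gw.GP" "g' \<in> carrier gw.GP" for g g'
  proof
    let ?a = "word_dist gw.GP S g g'" and ?b = "word_dist H.GP T (embedding g) (embedding g')"
    have "?b \<le> K0 * ?a" using K0 g by blast
    also have "\<dots> \<le> K * ?a" using pos K1 by (intro mult_right_mono) (auto simp: K_def)
    finally show "?b \<le> K * ?a + K2" using K1(2) by simp
    have "?a \<le> K1 * ?b + K2" using K1 g by blast
    also have "\<dots> \<le> K * ?b + K * K2"
      using pos K0 K1 K mult_right_mono[OF K K1(2)] by (intro add_mono mult_right_mono) (auto simp: K_def)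
    finally show "(1 / K) * ?a - K2 \<le> ?b" using K by (simp add: field_simps)
  qed
  then show ?thesis
    unfolding quasiisometric_embedding_def
    using K K1(2) embedding_closed gw.Q.mspace_word_metric[OF S] H.Q.mspace_word_metric[OF T]
      gw.Q.mdist_word_metric[OF S] H.Q.mdist_word_metric[OF T]
    by (intro conjI exI[of _ K] exI[of _ K2]) auto
qed

end

end

section \<open>Vertex groups\<close>

lemma finite_or_cyclic_countable: "finite_or_cyclic_group G \<Longrightarrow> countable (carrier G)"
proof -
  assume g: "finite_or_cyclic_group G"
  then interpret group G by (simp add: finite_or_cyclic_group_def)
  show ?thesis
  proof (cases "finite (carrier G)")
    case False
    then obtain x where "x \<in> carrier G" "subgroup_generated G {x} = G"
      using g by (auto simp: finite_or_cyclic_group_def cyclic_group_def)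
    then have "carrier G = range (\<lambda>n::int. x [^]\<^bsub>G\<^esub> n)" using carrier_subgroup_generated_by_singleton[of x] by simp
    then show ?thesis by simp
  qed (rule countable_finite)
qed

text \<open>A vertex group of \<open>H\<close> is countable, thus each vertex group of \<open>G\<close> is finite. This gives the finite set of
  letters needed for the upper bound.\<close>

lemma lesspoll_finite: "countable Y \<Longrightarrow> X \<prec> Y \<Longrightarrow> finite X"
proof (rule ccontr)
  assume Y: "countable Y" "X \<prec> Y" and "infinite X"
  have "Y \<lesssim> (UNIV :: nat set)" using Y(1) by (auto simp: countable_def lepoll_def)
  also have "\<dots> \<lesssim> X" using \<open>infinite X\<close> infinite_le_lepoll by blast
  finally show False using Y(2) lepoll_antisym unfolding lesspoll_def by blast
qed

text \<open>There is room for the gluing element \<open>c\<close> because \<open>X\<close> is strictly smaller than \<open>Y\<close>.\<close>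

lemma sector_injection:
  assumes X: "finite X" "X \<prec> Y" "a \<in> X" and Y: "b \<in> Y" "c \<in> Y" "b \<noteq> c"
  shows "\<exists>r. inj_on r X \<and> r ` X \<subseteq> Y - {c} \<and> r a = b"
proof -
  have "\<exists>Z. finite Z \<and> card Z = card (X - {a}) \<and> Z \<subseteq> Y - {b, c}"
  proof (cases "finite Y")
    case True
    have "card X \<le> card Y" "card X \<noteq> card Y"
      using X(2) lepoll_iff_card_le[OF X(1) True] eqpoll_iff_card[OF X(1) True] by (simp_all add: lesspoll_def)
    then have "card X - 1 \<le> card Y - 2" by linarith
    moreover have "card (X - {a}) = card X - 1" "card (Y - {b, c}) = card Y - 2" using X Y by (simp_all add: card_Diff_subset)
    ultimately have "card (X - {a}) \<le> card (Y - {b, c})" by simp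
    then show ?thesis by (rule obtain_subset_with_card_n) blast
  next
    case False
    then have "infinite (Y - {b, c})" by simp
    then show ?thesis by (rule infinite_arbitrarily_large)
  qed
  then obtain Z where Z: "finite Z" "card Z = card (X - {a})" "Z \<subseteq> Y - {b, c}" by blast
  then obtain h where h: "bij_betw h (X - {a}) Z" using finite_same_card_bij[of "X - {a}" Z] X(1) by auto
  let ?r = "h(a := b)"
  have "inj_on ?r X"
    using h Z by (auto simp: bij_betw_def inj_on_def)
  moreover have "?r ` X \<subseteq> Y - {c}" using h Z Y by (auto simp: bij_betw_def)
  ultimately show ?thesis by (intro exI[of _ ?r]) simp
qed

lemma graph_words_cycle:
  fixes k :: nat and A :: "nat \<Rightarrow> 'a monoid"
  assumes "\<forall>i\<in>cycle_vertices k. group (A i)" "k > 2"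
  shows "graph_words {..<k} (cycle_edges k) A"
proof (rule graph_words.intro)
  show "group (A v)" if "v \<in> {..<k}" for v using assms that by (simp add: cycle_vertices_def)
  show "{v} \<notin> cycle_edges k" for v
  proof
    assume "{v} \<in> cycle_edges k"
    then obtain i where i: "{v} = {i, Suc i mod k}" "i < k" by (auto simp: cycle_edges_def)
    then have "Suc i mod k = i" by auto
    then show False using assms(2) i(2) by (cases "Suc i = k") auto
  qed
qed

theorem theorem3:
  fixes m n p q :: nat
    and A :: "nat \<Rightarrow> 'a monoid" and B :: "nat \<Rightarrow> 'b monoid"
    and G :: "(nat \<times> 'a) list set set monoid" and H :: "(nat \<times> 'b) list set set monoid"
    and S :: "(nat \<times> 'a) list set set set" and T :: "(nat \<times> 'b) list set set set"
  assumes "m > 6" and "n > 6" and "p \<ge> 1"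
    and "m = n + p * (n - 4) + q * (n - 2)"
    and "\<forall>i \<in> cycle_vertices m. finite_or_cyclic_group (A i)"
    and "\<forall>j \<in> cycle_vertices n. finite_or_cyclic_group (B j)"
    and "G = graph_product (cycle_vertices m) (cycle_edges m) A"
    and "H = graph_product (cycle_vertices n) (cycle_edges n) B"
    and "\<forall>i \<in> cycle_vertices m. \<forall>j \<in> cycle_vertices n. carrier (A i) \<prec> carrier (B j)"
    and "finite_generating_set G S" and "finite_generating_set H T"
  shows "\<exists>F. quasiisometric_embedding (word_metric G S) (word_metric H T) F"
proof -
  have gA: "group (A i)" if "i < m" for i using assms(5) that by (simp add: cycle_vertices_def finite_or_cyclic_group_def)
  have gB: "group (B j)" if "j < n" for j using assms(6) that by (simp add: cycle_vertices_def finite_or_cyclic_group_def)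
  have less: "carrier (A i) \<prec> carrier (B j)" if "i < m" "j < n" for i j using assms(9) that by (simp add: cycle_vertices_def)
  have fA: "finite (carrier (A i))" if "i < m" for i
    using lesspoll_finite[OF finite_or_cyclic_countable less[OF that, of 0]] assms(2,6) by (simp add: cycle_vertices_def)
  have oneA: "\<one>\<^bsub>A i\<^esub> \<in> carrier (A i)" if "i < m" for i using gA[OF that] by (simp add: group.is_monoid monoid.one_closed)
  have oneB: "\<one>\<^bsub>B j\<^esub> \<in> carrier (B j)" if "j < n" for j using gB[OF that] by (simp add: group.is_monoid monoid.one_closed)
  have "\<exists>c\<in>carrier (B j). c \<noteq> \<one>\<^bsub>B j\<^esub>" if j: "j < n" for j
  proof (rule ccontr)
    assume "\<not> ?thesis"
    then have "inj_on (\<lambda>_. \<one>\<^bsub>A 0\<^esub>) (carrier (B j))" unfolding inj_on_def by metis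
    then have "carrier (B j) \<lesssim> carrier (A 0)"
      using oneA[of 0] assms(1) unfolding lepoll_def by (intro exI[of _ "\<lambda>_. \<one>\<^bsub>A 0\<^esub>"]) auto
    then show False using less[of 0 j] j assms(1) lepoll_antisym by (auto simp: lesspoll_def)
  qed
  then obtain c where c: "\<And>j. j < n \<Longrightarrow> c j \<in> carrier (B j)" "\<And>j. j < n \<Longrightarrow> c j \<noteq> \<one>\<^bsub>B j\<^esub>" by metis
  have "\<exists>r. inj_on r (carrier (A i)) \<and> r ` carrier (A i) \<subseteq> carrier (B j) - {c j} \<and> r \<one>\<^bsub>A i\<^esub> = \<one>\<^bsub>B j\<^esub>"
    if "i < m" "j < n" for i j
    using sector_injection[OF fA[OF that(1)] less[OF that] oneA[OF that(1)] oneB[OF that(2)] c(1)[OF that(2)]] c(2)[OF that(2)] by metis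
  then obtain r where r: "\<And>i j. i < m \<Longrightarrow> j < n \<Longrightarrow> inj_on (r i j) (carrier (A i)) \<and>
      r i j ` carrier (A i) \<subseteq> carrier (B j) - {c j} \<and> r i j \<one>\<^bsub>A i\<^esub> = \<one>\<^bsub>B j\<^esub>" by metis
  interpret gw: graph_words "{..<m}" "cycle_edges m" A
    using gA assms(1) by (intro graph_words_cycle) (auto simp: cycle_vertices_def)
  interpret H: graph_words "{..<n}" "cycle_edges n" B
    using gB assms(2) by (intro graph_words_cycle) (auto simp: cycle_vertices_def)
  let ?t = "\<lambda>v. nat (v mod int n)"
  have t: "?t v < n" for v using assms(2) by (simp add: nat_less_iff)
  have tv: "int (?t v) = v mod int n" for v using assms(2) by simp
  have te: "?t v = ?t w \<longleftrightarrow> eqt (int n) v w" for v w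
    using tv[of v] tv[of w] by (metis eqt_iff_mod)
  have ta: "H.adj (?t v) (?t w) \<longleftrightarrow> adjt (int n) v w" for v w
  proof -
    have "H.adj (?t v) (?t w) \<longleftrightarrow> adjt (int n) (int (?t v)) (int (?t w))"
      unfolding H.adj_def using t assms(2) by (intro cycle_adj) auto
    also have "\<dots> \<longleftrightarrow> adjt (int n) v w" unfolding tv by (intro adjt_cong) (simp_all add: eqt_iff_mod)
    finally show ?thesis .
  qed
  interpret shape "int n" p q using assms(2,3) by unfold_locales auto
  interpret hds: heads "int n" "\<lambda>v. B (?t v)" "carrier H.GP" "\<lambda>v. H.mv (?t v)" "\<lambda>v. H.hd (?t v)"
  proof (rule heads.intro)
    show "int n \<ge> 7" using assms(2) by simp
    show "group (B (?t v))" for v using gB t by simp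
    show "eqt (int n) v w \<Longrightarrow> B (?t v) = B (?t w) \<and> H.mv (?t v) = H.mv (?t w) \<and> H.hd (?t v) = H.hd (?t w)" for v w
      using te by metis
    show "b \<in> carrier (B (?t v)) \<Longrightarrow> y \<in> carrier H.GP \<Longrightarrow> H.mv (?t v) b y \<in> carrier H.GP" for b v y
      using t[of v] by (simp add: H.mv_def)
    show "y \<in> carrier H.GP \<Longrightarrow> H.mv (?t v) \<one>\<^bsub>B (?t v)\<^esub> y = y" for y v
      using t[of v] by (simp add: H.mv_def H.ev_one)
    show "H.mv (?t v) b (H.mv (?t v) c y) = H.mv (?t v) (b \<otimes>\<^bsub>B (?t v)\<^esub> c) y"
      if "b \<in> carrier (B (?t v))" "c \<in> carrier (B (?t v))" "y \<in> carrier H.GP" for b c v y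
      using that t[of v] by (simp add: H.mv_def H.Q.m_assoc[symmetric] H.ev_mult)
    show "H.mv (?t v) b (H.mv (?t w) c y) = H.mv (?t w) c (H.mv (?t v) b y)"
      if "adjt (int n) v w" "b \<in> carrier (B (?t v))" "c \<in> carrier (B (?t w))" "y \<in> carrier H.GP" for b c v w y
      using that t[of v] t[of w] H.ev_comm[of "?t v" "?t w" b c] ta[of v w] by (simp add: H.mv_def H.Q.m_assoc[symmetric])
    show "y \<in> carrier H.GP \<Longrightarrow> H.hd (?t v) y \<in> carrier (B (?t v))" for y v
      using H.hd_closed t by simp
    show "b \<in> carrier (B (?t v)) \<Longrightarrow> y \<in> carrier H.GP \<Longrightarrow> H.hd (?t v) (H.mv (?t v) b y) = b \<otimes>\<^bsub>B (?t v)\<^esub> H.hd (?t v) y" for b v y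
      using H.hd_mv_same t by simp
    show "adjt (int n) v w \<Longrightarrow> b \<in> carrier (B (?t w)) \<Longrightarrow> y \<in> carrier H.GP \<Longrightarrow> H.hd (?t v) (H.mv (?t w) b y) = H.hd (?t v) y" for b v w y
      using H.hd_mv_adj[of "?t v" "?t w" b y] ta[of v w] t[of w] by simp
    show "far (int n) v w \<Longrightarrow> y \<in> carrier H.GP \<Longrightarrow> H.hd (?t w) y \<noteq> \<one>\<^bsub>B (?t w)\<^esub> \<Longrightarrow> H.hd (?t v) y = \<one>\<^bsub>B (?t v)\<^esub>" for v w y
      using H.hd_exclusive[of y "?t w" "?t v"] ta[of v w] te[of v w] by (simp add: far_def)
  qed
  have mm: "int m = shape.m (int n) p q"
    using assms(2,4) m_eq by (simp add: of_nat_diff)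
  interpret graph_product_map n B m A p q "\<lambda>v. c (?t v)" "\<lambda>i v. r i (?t v)"
  proof unfold_locales
    show "int m = shape.m (int n) p q" by (rule mm)
    show "c (?t v) \<in> carrier (B (?t v))" "c (?t v) \<noteq> \<one>\<^bsub>B (?t v)\<^esub>" for v using c t by auto
    show "eqt (int n) v w \<Longrightarrow> c (?t v) = c (?t w)" for v w using te by metis
    show "i < m \<Longrightarrow> s \<in> carrier (A i) \<Longrightarrow> r i (?t v) s \<in> carrier (B (?t v))" for i s v using r[of i "?t v"] t by auto
    show "i < m \<Longrightarrow> s \<in> carrier (A i) \<Longrightarrow> s' \<in> carrier (A i) \<Longrightarrow> r i (?t v) s = r i (?t v) s' \<Longrightarrow> s = s'" for i s s' v
      using r[of i "?t v"] t by (auto dest: inj_onD)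
    show "i < m \<Longrightarrow> r i (?t v) \<one>\<^bsub>A i\<^esub> = \<one>\<^bsub>B (?t v)\<^esub>" for i v using r[of i "?t v"] t by auto
    show "i < m \<Longrightarrow> s \<in> carrier (A i) \<Longrightarrow> r i (?t v) s \<noteq> c (?t v)" for i s v using r[of i "?t v"] t by auto
    show "eqt (int n) v w \<Longrightarrow> r i (?t v) = r i (?t w)" for i v w using te by metis
    show "\<one>\<^bsub>H.GP\<^esub> \<in> carrier H.GP" by simp
    show "H.hd (?t v) \<one>\<^bsub>H.GP\<^esub> = \<one>\<^bsub>B (?t v)\<^esub>" for v by (rule H.hd_one)
    show "i < m \<Longrightarrow> finite (carrier (A i))" for i by (rule fA)
  qed
  have "G = gw.GP" "H = H.GP" using assms(7,8) by (simp_all add: cycle_vertices_def)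
  then show ?thesis using quasi_embedding[of S T] assms(10,11) by blast
qed

end
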